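(* Let $q\in\mathbb{C}^*$ and $k\ge1$. (a) The $q$-rook monoid algebra $R_k(q)$ is semisimple if and only if $[k]!\ne 0$. (b) If $R_k(q)$ is semisimple, then the irreducible representations of $R_k(q)$ are indexed by $\lambda\in\hat A_k$ and are given explicitly as follows: for $\lambda=(\lambda^{(1)},\lambda^{(2)})\in\hat A_k$, the module $H^\lambda$ has basis $\{v_L : L\text{ a standard tableau of shape }\lambda\}$ with action $$X_iv_L=CT(L(i))\,v_L,\qquad T_iv_L=(T_i)_{LL}v_L+(q^{-1}+(T_i)_{LL})\,v_{s_iL},$$ where $CT(b)=0$ if the box $b$ is in $\lambda^{(1)}$ and $CT(b)=q^{2(c-r)}$ if $b$ is in row $r$ and column $c$ of $\lambda^{(2)}$; $(T_i)_{LL}=q$ if $L(i)$ and $L(i+1)$ are in the same row of some $\lambda^{(j)}$; $(T_i)_{LL}=-q^{-1}$ if they are in the same column of some $\lambda^{(j)}$; $(T_i)_{LL}=\dfrac{CT(L(i+1))(q-q^{-1})}{CT(L(i+1))-CT(L(i))}$ otherwise; $s_iL$ is $L$ with $i$ and $i+1$ switched; and $v_{s_iL}=0$ if $s_iL$ is not a standard tableau.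
   Context: All algebras are associative unital $\mathbb{C}$-algebras. $[k]!=[1][2]\cdots[k]$ with $[i]=1+q^2+\cdots+q^{2(i-1)}$. The $q$-rook monoid algebra $R_k(q)$ is the algebra given by generators $P_1,\dots,P_k$ and $T_1,\dots,T_{k-1}$ with relations (A1) $T_i^2=(q-q^{-1})T_i+1$ for $1\le i\le k-1$; (A2) $T_iT_{i+1}T_i=T_{i+1}T_iT_{i+1}$ for $1\le i\le k-2$; (A3) $T_iT_j=T_jT_i$ for $|i-j|>1$; (R1) $P_i^2=P_i$ for $1\le i\le k$; (R2) $P_iP_j=P_jP_i$ for $1\le i,j\le k$; (R3) $P_iT_j=T_jP_i$ for $1\le i<j\le k-1$; (R4) $P_iT_j=T_jP_i=qP_i$ for $1\le j<i\le k$; (R5) $P_{i+1}=qP_iT_i^{-1}P_i=q\bigl(P_iT_iP_i-(q-q^{-1})P_i\bigr)$ for $1\le i\le k-1$. In $R_k(q)$ put $X_i=T_{i-1}\cdots T_1(1-P_1)T_1\cdots T_{i-1}$ for $1\le i\le k$; in particular $X_1=1-P_1$, and $R_k(q)$ is generated by $X_1,T_1,\dots,T_{k-1}$. A partition is identified with its Young diagram (rows numbered from top, columns from left). $\hat A_k$ is the set of pairs of partitions $\lambda=(\lambda^{(1)},\lambda^{(2)})$ with $k$ boxes in total such that $\lambda^{(1)}$ has at most one row. A standard tableau $L$ of shape $\lambda$ is a filling of the boxes of $\lambda$ with $1,\dots,k$ (each once) such that in each $\lambda^{(j)}$ entries increase left to right in rows and top to bottom in columns; $L(i)$ is the box of $L$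 containing $i$. If $q^2=1$ and both boxes $L(i),L(i+1)$ lie in $\lambda^{(2)}$ (not in the same row or column), the quotient defining $(T_i)_{LL}$ is read after cancellation as a rational function of $q$. *)

theory Defs
  imports Complex_Main "HOL-Algebra.QuotRing" "HOL-Algebra.Module" "HOL-Library.Poly_Mapping"
begin

section \<open>Left modules over a noncommutative ring\<close>

text \<open>
  The locale \<open>module\<close> of HOL-Algebra requires a commutative base ring; the following is the same
  list of axioms over an arbitrary ring. A module over a complex unital algebra \<open>A\<close> is a module
  over the underlying ring; its complex structure is \<open>c x = (c 1\<^sub>A) x\<close>, and homomorphisms
  of modules are automatically complex linear.
\<close>

locale left_module = R?: ring R + M?: abelian_group M for R (structure) and M (structure) +
  assumes smult_closed: "\<lbrakk>a \<in> carrier R; x \<in> carrier M\<rbrakk> \<Longrightarrow> a \<odot>\<^bsub>M\<^esub> x \<in> carrier M"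
    and smult_l_distr: "\<lbrakk>a \<in> carrier R; b \<in> carrier R; x \<in> carrier M\<rbrakk> \<Longrightarrow>
      (a \<oplus>\<^bsub>R\<^esub> b) \<odot>\<^bsub>M\<^esub> x = a \<odot>\<^bsub>M\<^esub> x \<oplus>\<^bsub>M\<^esub> b \<odot>\<^bsub>M\<^esub> x"
    and smult_r_distr: "\<lbrakk>a \<in> carrier R; x \<in> carrier M; y \<in> carrier M\<rbrakk> \<Longrightarrow>
      a \<odot>\<^bsub>M\<^esub> (x \<oplus>\<^bsub>M\<^esub> y) = a \<odot>\<^bsub>M\<^esub> x \<oplus>\<^bsub>M\<^esub> a \<odot>\<^bsub>M\<^esub> y"
    and smult_assoc1: "\<lbrakk>a \<in> carrier R; b \<in> carrier R; x \<in> carrier M\<rbrakk> \<Longrightarrow>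
      (a \<otimes>\<^bsub>R\<^esub> b) \<odot>\<^bsub>M\<^esub> x = a \<odot>\<^bsub>M\<^esub> (b \<odot>\<^bsub>M\<^esub> x)"
    and smult_one: "x \<in> carrier M \<Longrightarrow> \<one>\<^bsub>R\<^esub> \<odot>\<^bsub>M\<^esub> x = x"

definition simple_module :: "('a, 'r) ring_scheme \<Rightarrow> ('a, 'b, 'm) module_scheme \<Rightarrow> bool" where
  "simple_module A M \<longleftrightarrow> left_module A M \<and> carrier M \<noteq> {\<zero>\<^bsub>M\<^esub>} \<and>
     (\<forall>N. submodule N A M \<longrightarrow> N = {\<zero>\<^bsub>M\<^esub>} \<or> N = carrier M)"

definition submodule_sum ::
  "('a, 'r) ring_scheme \<Rightarrow> ('a, 'b, 'm) module_scheme \<Rightarrow> 'b set set \<Rightarrow> 'b set" where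
  "submodule_sum A M F = \<Inter>{N. submodule N A M \<and> \<Union>F \<subseteq> N}"

text \<open>A module is semisimple if it is an internal direct sum of simple submodules.\<close>

definition semisimple_module :: "('a, 'r) ring_scheme \<Rightarrow> ('a, 'b, 'm) module_scheme \<Rightarrow> bool" where
  "semisimple_module A M \<longleftrightarrow> left_module A M \<and>
     (\<exists>F. (\<forall>N\<in>F. submodule N A M \<and> simple_module A (M\<lparr>carrier := N\<rparr>)) \<and>
          submodule_sum A M F = carrier M \<and>
          (\<forall>N\<in>F. N \<inter> submodule_sum A M (F - {N}) = {\<zero>\<^bsub>M\<^esub>}))"

definition regular_module :: "('a, 'r) ring_scheme \<Rightarrow> ('a, 'a) module" where
  "regular_module A = \<lparr>carrier = carrier A, mult = mult A, one = \<one>\<^bsub>A\<^esub>,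
     zero = \<zero>\<^bsub>A\<^esub>, add = add A, smult = mult A\<rparr>"

definition semisimple_ring :: "('a, 'r) ring_scheme \<Rightarrow> bool" where
  "semisimple_ring A \<longleftrightarrow> semisimple_module A (regular_module A)"

definition module_isomorphic ::
  "('a, 'r) ring_scheme \<Rightarrow> ('a, 'b, 'm) module_scheme \<Rightarrow> ('a, 'c, 'n) module_scheme \<Rightarrow> bool" where
  "module_isomorphic A M N \<longleftrightarrow>
     (\<exists>f \<in> iso (add_monoid M) (add_monoid N).
        \<forall>a\<in>carrier A. \<forall>x\<in>carrier M. f (a \<odot>\<^bsub>M\<^esub> x) = a \<odot>\<^bsub>N\<^esub> f x)"


section \<open>The q-rook monoid algebra\<close>

datatype rook_gen = GenP nat | GenT nat

datatype rook_word = Word (letters: "rook_gen list")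

text \<open>The free monoid, written additively because \<^typ>\<open>rook_word \<Rightarrow>\<^sub>0 complex\<close> then is its
  monoid algebra, that is, the free algebra on all symbols \<^term>\<open>GenP i\<close>, \<^term>\<open>GenT i\<close>.\<close>

instantiation rook_word :: monoid_add
begin

definition zero_rook_word :: rook_word where
  "0 = Word []"

definition plus_rook_word :: "rook_word \<Rightarrow> rook_word \<Rightarrow> rook_word" where
  "u + v = Word (letters u @ letters v)"

instance
  by standard (auto simp: zero_rook_word_def plus_rook_word_def)

end

type_synonym free_elt = "rook_word \<Rightarrow>\<^sub>0 complex"

definition rook_gens :: "nat \<Rightarrow> rook_gen set" where
  "rook_gens k = GenP ` {1..k} \<union> GenT ` {1..<k}"

definition free_algebra :: "nat \<Rightarrow> free_elt ring" where
  "free_algebra k = \<lparr>carrier = {f. \<forall>w\<in>Poly_Mapping.keys f. set (letters w) \<subseteq> rook_gens k},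
     mult = (*), one = 1, zero = 0, add = (+)\<rparr>"

definition scal :: "complex \<Rightarrow> free_elt" where
  "scal c = Poly_Mapping.single 0 c"

definition genP :: "nat \<Rightarrow> free_elt" where
  "genP i = Poly_Mapping.single (Word [GenP i]) 1"

definition genT :: "nat \<Rightarrow> free_elt" where
  "genT i = Poly_Mapping.single (Word [GenT i]) 1"

text \<open>The relations (A1)--(A3) and (R1)--(R5), each written as left side minus right side. By (A1),
  \<open>T\<^sub>i\<close> is invertible in the quotient with inverse \<open>T\<^sub>i - (q - q\<^sup>-\<^sup>1)\<close>, so
  \<open>q P\<^sub>i T\<^sub>i\<^sup>-\<^sup>1 P\<^sub>i\<close> is given by the second expression in (R5).\<close>

definition rook_relations :: "nat \<Rightarrow> complex \<Rightarrow> free_elt set" where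
  "rook_relations k q =
     {genT i * genT i - (scal (q - inverse q) * genT i + 1) | i. 1 \<le> i \<and> i + 1 \<le> k} \<union>
     {genT i * genT (i+1) * genT i - genT (i+1) * genT i * genT (i+1) | i. 1 \<le> i \<and> i + 2 \<le> k} \<union>
     {genT i * genT j - genT j * genT i | i j.
        1 \<le> i \<and> i + 1 \<le> k \<and> 1 \<le> j \<and> j + 1 \<le> k \<and> \<bar>int i - int j\<bar> > 1} \<union>
     {genP i * genP i - genP i | i. 1 \<le> i \<and> i \<le> k} \<union>
     {genP i * genP j - genP j * genP i | i j. 1 \<le> i \<and> i \<le> k \<and> 1 \<le> j \<and> j \<le> k} \<union>
     {genP i * genT j - genT j * genP i | i j. 1 \<le> i \<and> i < j \<and> j + 1 \<le> k} \<union>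
     {genP i * genT j - genT j * genP i | i j. 1 \<le> j \<and> j < i \<and> i \<le> k} \<union>
     {genT j * genP i - scal q * genP i | i j. 1 \<le> j \<and> j < i \<and> i \<le> k} \<union>
     {genP (i+1) - scal q * (genP i * genT i * genP i - scal (q - inverse q) * genP i) | i.
        1 \<le> i \<and> i + 1 \<le> k}"

definition rook_ideal :: "nat \<Rightarrow> complex \<Rightarrow> free_elt set" where
  "rook_ideal k q = Idl\<^bsub>free_algebra k\<^esub> (rook_relations k q)"

definition rook_class :: "nat \<Rightarrow> complex \<Rightarrow> free_elt \<Rightarrow> free_elt set" where
  "rook_class k q f = rook_ideal k q +>\<^bsub>free_algebra k\<^esub> f"

definition rook_algebra :: "nat \<Rightarrow> complex \<Rightarrow> (complex, free_elt set) module" where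
  "rook_algebra k q = ring.extend (free_algebra k Quot rook_ideal k q)
     (module.fields (\<lambda>c x. mult (free_algebra k Quot rook_ideal k q) (rook_class k q (scal c)) x))"

definition rook_T :: "nat \<Rightarrow> complex \<Rightarrow> nat \<Rightarrow> free_elt set" where
  "rook_T k q i = rook_class k q (genT i)"

definition rook_X :: "nat \<Rightarrow> complex \<Rightarrow> nat \<Rightarrow> free_elt set" where
  "rook_X k q i = rook_class k q
     (prod_list (map genT (rev [1..<i])) * (1 - genP 1) * prod_list (map genT [1..<i]))"

lemma free_algebra_simps [simp]:
  "mult (free_algebra k) = (*)" "one (free_algebra k) = 1"
  "zero (free_algebra k) = 0" "add (free_algebra k) = (+)"
  by (simp_all add: free_algebra_def)

lemma free_algebra_closed:
  assumes "f \<in> carrier (free_algebra k)" "g \<in> carrier (free_algebra k)"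
  shows "f + g \<in> carrier (free_algebra k)" "f * g \<in> carrier (free_algebra k)"
    "- f \<in> carrier (free_algebra k)" "f - g \<in> carrier (free_algebra k)"
proof -
  show "f + g \<in> carrier (free_algebra k)"
    using assms Poly_Mapping.keys_add[of f g] by (auto simp: free_algebra_def)
  show "f - g \<in> carrier (free_algebra k)"
    using assms keys_diff[of f g] by (auto simp: free_algebra_def)
  show "- f \<in> carrier (free_algebra k)"
    using assms by (auto simp: free_algebra_def)
  show "f * g \<in> carrier (free_algebra k)"
    using assms keys_mult[of f g]
    by (fastforce simp: free_algebra_def plus_rook_word_def)
qed

lemma scal_closed: "scal c \<in> carrier (free_algebra k)"
  by (auto simp: free_algebra_def scal_def zero_rook_word_def)

lemma one_closed: "1 \<in> carrier (free_algebra k)"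
  by (auto simp: free_algebra_def zero_rook_word_def)

lemma genP_closed: "1 \<le> i \<Longrightarrow> i \<le> k \<Longrightarrow> genP i \<in> carrier (free_algebra k)"
  by (auto simp: free_algebra_def genP_def rook_gens_def)

lemma genT_closed: "1 \<le> i \<Longrightarrow> i < k \<Longrightarrow> genT i \<in> carrier (free_algebra k)"
  by (auto simp: free_algebra_def genT_def rook_gens_def)

lemma ring_free_algebra: "ring (free_algebra k)"
proof (rule ringI)
  show "abelian_group (free_algebra k)"
  proof (rule abelian_groupI)
    fix f assume "f \<in> carrier (free_algebra k)"
    then show "\<exists>g\<in>carrier (free_algebra k). g \<oplus>\<^bsub>free_algebra k\<^esub> f = \<zero>\<^bsub>free_algebra k\<^esub>"
      by (intro bexI[of _ "- f"]) (auto intro: free_algebra_closed)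
  qed (auto intro: free_algebra_closed simp: add_ac, simp add: free_algebra_def)
  show "monoid (free_algebra k)"
    by (rule monoidI) (auto intro: free_algebra_closed one_closed simp: mult.assoc)
qed (auto simp: algebra_simps)

lemma rook_relations_closed: "rook_relations k q \<subseteq> carrier (free_algebra k)"
  unfolding rook_relations_def
  by (auto intro!: free_algebra_closed scal_closed genP_closed genT_closed one_closed)

lemma ideal_rook_ideal: "ideal (rook_ideal k q) (free_algebra k)"
  unfolding rook_ideal_def
  by (rule ring.genideal_ideal[OF ring_free_algebra rook_relations_closed])

lemma rook_algebra_simps:
  "carrier (rook_algebra k q) = carrier (free_algebra k Quot rook_ideal k q)"
  "mult (rook_algebra k q) = mult (free_algebra k Quot rook_ideal k q)"
  "one (rook_algebra k q) = one (free_algebra k Quot rook_ideal k q)"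
  "zero (rook_algebra k q) = zero (free_algebra k Quot rook_ideal k q)"
  "add (rook_algebra k q) = add (free_algebra k Quot rook_ideal k q)"
  by (simp_all add: rook_algebra_def ring.defs module.defs monoid.defs partial_object.defs)

lemma ring_rook_algebra: "ring (rook_algebra k q)"
proof -
  interpret ring "free_algebra k Quot rook_ideal k q"
    by (rule ideal.quotient_is_ring[OF ideal_rook_ideal])
  show ?thesis
  proof (rule ringI)
    show "abelian_group (rook_algebra k q)"
      by (rule abelian_groupI) (auto simp: rook_algebra_simps a_ac intro: l_neg)
    show "monoid (rook_algebra k q)"
      by (rule monoidI) (auto simp: rook_algebra_simps m_assoc)
  qed (auto simp: rook_algebra_simps l_distr r_distr)
qed

definition q_int :: "complex \<Rightarrow> nat \<Rightarrow> complex" where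
  "q_int q i = (\<Sum>j<i. q ^ (2 * j))"

definition q_fact :: "complex \<Rightarrow> nat \<Rightarrow> complex" where
  "q_fact q k = (\<Prod>i=1..k. q_int q i)"


section \<open>Pairs of partitions and standard tableaux\<close>

definition is_partition :: "nat list \<Rightarrow> bool" where
  "is_partition p \<longleftrightarrow> sorted_wrt (\<ge>) p \<and> 0 \<notin> set p"

definition diagram :: "nat list \<Rightarrow> (nat \<times> nat) set" where
  "diagram p = {(r, c). 1 \<le> r \<and> r \<le> length p \<and> 1 \<le> c \<and> c \<le> p ! (r - 1)}"

type_synonym bipartition = "nat list \<times> nat list"

definition A_hat :: "nat \<Rightarrow> bipartition set" where
  "A_hat k = {(p1, p2). is_partition p1 \<and> is_partition p2 \<and>
     sum_list p1 + sum_list p2 = k \<and> length p1 \<le> 1}"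

text \<open>A box is a triple \<open>(j, r, c)\<close>: row \<open>r\<close> and column \<open>c\<close> of the \<open>j\<close>-th partition,
  \<open>j \<in> {1, 2}\<close>.\<close>

type_synonym box = "nat \<times> nat \<times> nat"

definition boxes :: "bipartition \<Rightarrow> box set" where
  "boxes \<mu> = {1} \<times> diagram (fst \<mu>) \<union> {2} \<times> diagram (snd \<mu>)"

text \<open>A filling is a function on all triples, set to \<open>0\<close> outside the diagram so that equality of
  functions is equality of tableaux.\<close>

type_synonym tableau = "box \<Rightarrow> nat"

definition standard_tableaux :: "bipartition \<Rightarrow> tableau set" where
  "standard_tableaux \<mu> = {L.
     bij_betw L (boxes \<mu>) {1..card (boxes \<mu>)} \<and> (\<forall>b. b \<notin> boxes \<mu> \<longrightarrow> L b = 0) \<and>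
     (\<forall>j r c c'. (j, r, c) \<in> boxes \<mu> \<and> (j, r, c') \<in> boxes \<mu> \<and> c < c' \<longrightarrow> L (j, r, c) < L (j, r, c')) \<and>
     (\<forall>j r r' c. (j, r, c) \<in> boxes \<mu> \<and> (j, r', c) \<in> boxes \<mu> \<and> r < r' \<longrightarrow> L (j, r, c) < L (j, r', c))}"

definition box_of :: "bipartition \<Rightarrow> tableau \<Rightarrow> nat \<Rightarrow> box" where
  "box_of \<mu> L i = (THE b. b \<in> boxes \<mu> \<and> L b = i)"

definition switch :: "nat \<Rightarrow> tableau \<Rightarrow> tableau" where
  "switch i L = (\<lambda>b. if L b = i then i + 1 else if L b = i + 1 then i else L b)"

fun CT :: "complex \<Rightarrow> box \<Rightarrow> complex" where
  "CT q (j, r, c) = (if j = 1 then 0 else q powi (2 * (int c - int r)))"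

definition T_quot :: "box \<Rightarrow> box \<Rightarrow> complex \<Rightarrow> complex" where
  "T_quot b b' z = CT z b' * (z - inverse z) / (CT z b' - CT z b)"

text \<open>For \<open>b = L(i)\<close> and \<open>b' = L(i+1)\<close>. If \<open>q\<^sup>2 = 1\<close> and both boxes lie in the second partition,
  the numerator and the denominator of \<^const>\<open>T_quot\<close> both vanish at \<open>q\<close>; the value after
  cancellation of the rational function of \<open>z\<close> at \<open>z = q\<close> is its limit there.\<close>

fun T_entry :: "complex \<Rightarrow> box \<Rightarrow> box \<Rightarrow> complex" where
  "T_entry q (j, r, c) (j', r', c') =
     (if j = j' \<and> r = r' then q
      else if j = j' \<and> c = c' then - inverse q
      else if q\<^sup>2 = 1 \<and> j = 2 \<and> j' = 2 then Lim (at q) (T_quot (j, r, c) (j', r', c'))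
      else T_quot (j, r, c) (j', r', c') q)"

definition T_diag :: "complex \<Rightarrow> bipartition \<Rightarrow> tableau \<Rightarrow> nat \<Rightarrow> complex" where
  "T_diag q \<mu> L i = T_entry q (box_of \<mu> L i) (box_of \<mu> L (i + 1))"


section \<open>The modules with basis the standard tableaux\<close>

text \<open>The complex vector space with basis \<open>v\<^sub>L\<close>, as coordinate functions on the (finite)
  set of standard tableaux, with a given action \<open>act\<close> of an algebra. The ring fields
  \<open>mult\<close> and \<open>one\<close> inherited by the record type carry no meaning for a module.\<close>

definition tableau_module ::
  "bipartition \<Rightarrow> ('a \<Rightarrow> (tableau \<Rightarrow> complex) \<Rightarrow> (tableau \<Rightarrow> complex))
     \<Rightarrow> ('a, tableau \<Rightarrow> complex) module" where
  "tableau_module \<mu> act = \<lparr>carrier = {f. \<forall>L. L \<notin> standard_tableaux \<mu> \<longrightarrow> f L = 0},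
     mult = undefined, one = undefined, zero = (\<lambda>_. 0), add = (\<lambda>f g L. f L + g L), smult = act\<rparr>"

text \<open>The basis vector \<open>v\<^sub>L\<close>, and \<open>0\<close> if \<open>L\<close> is not a standard tableau of shape \<open>\<mu>\<close>.\<close>

definition tvec :: "bipartition \<Rightarrow> tableau \<Rightarrow> tableau \<Rightarrow> complex" where
  "tvec \<mu> L = (\<lambda>L'. if L' = L \<and> L \<in> standard_tableaux \<mu> then 1 else 0)"

text \<open>The second conjunct says that \<open>c 1\<close> acts as multiplication by \<open>c\<close>, i.e. that the complex
  structure of the module is the one of coordinate functions.\<close>

definition seminormal_action ::
  "nat \<Rightarrow> complex \<Rightarrow> bipartition \<Rightarrow> (free_elt set \<Rightarrow> (tableau \<Rightarrow> complex) \<Rightarrow> (tableau \<Rightarrow> complex)) \<Rightarrow> bool"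
  where
  "seminormal_action k q \<mu> act \<longleftrightarrow>
     left_module (rook_algebra k q) (tableau_module \<mu> act) \<and>
     (\<forall>c. \<forall>f\<in>carrier (tableau_module \<mu> act).
        act (c \<odot>\<^bsub>rook_algebra k q\<^esub> \<one>\<^bsub>rook_algebra k q\<^esub>) f = (\<lambda>L. c * f L)) \<and>
     (\<forall>L\<in>standard_tableaux \<mu>. \<forall>i. 1 \<le> i \<and> i \<le> k \<longrightarrow>
        act (rook_X k q i) (tvec \<mu> L) = (\<lambda>L'. CT q (box_of \<mu> L i) * tvec \<mu> L L')) \<and>
     (\<forall>L\<in>standard_tableaux \<mu>. \<forall>i. 1 \<le> i \<and> i + 1 \<le> k \<longrightarrow>
        act (rook_T k q i) (tvec \<mu> L) =
          (\<lambda>L'. T_diag q \<mu> L i * tvec \<mu> L L'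
                + (inverse q + T_diag q \<mu> L i) * tvec \<mu> (switch i L) L'))"

end

theory Submission
  imports Defs "HOL-Library.Function_Algebras"
begin

text \<open>
  The algebra \<open>R\<^sub>k(q)\<close> is compared with its seminormal representations. A standard tableau
  is encoded as the list of its boxes, the box of the largest entry first, and the operators of all
  shapes act together on functions of such lists (\<open>T_op\<close>, \<open>P_op\<close>). If \<open>[k]! \<noteq> 0\<close>, the
  content differences in the denominators have nonzero q-analogues, and the defining relations
  come down to the addition law \<open>qnum_add\<close> of these q-analogues (\<open>op_relation\<close>). The elements
  \<open>X\<^sub>i\<close> act diagonally, with the eigenvalues \<open>CT\<close> (\<open>op_X_elt\<close>).

  For \<open>[k]! \<noteq> 0\<close> the representations identify \<open>R\<^sub>k(q)\<close> with a product of matrix algebras, one for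
  each shape. They are jointly surjective because the image contains all matrix units
  (\<open>matrix_units_exist\<close>): by induction on the rank, a matrix unit of rank \<open>n\<close> is refined by Lagrange
  interpolation in \<open>T\<^sub>n\<close>, and \<open>T\<^sub>n\<close> connects tableaux whose two last boxes are exchanged. They are
  jointly injective by a count that needs no basis of \<open>R\<^sub>k(q)\<close>. Writing \<open>A\<^sub>n\<close> for the subalgebra of
  rank \<open>n\<close>, one has \<open>A\<^sub>n\<^sub>+\<^sub>1 = A\<^sub>n + A\<^sub>n T\<^sub>n A\<^sub>n + A\<^sub>n X\<^sub>n\<^sub>+\<^sub>1\<close> (\<open>A_Suc_subset\<close>). If \<open>A\<^sub>n\<close> is a product of
  matrix algebras with units \<open>E\<^sub>s\<^sub>s\<^sub>'\<close>, the block \<open>E\<^sub>s\<^sub>s A\<^sub>n\<^sub>+\<^sub>1 E\<^sub>s\<^sub>'\<^sub>s\<^sub>'\<close> is therefore spanned by one element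
  for each common subshape with \<open>n - 1\<close> boxes of the shapes of \<open>s\<close> and \<open>s'\<close> and, if these shapes
  are equal, by \<open>E\<^sub>s\<^sub>s\<^sub>'\<close> and \<open>E\<^sub>s\<^sub>s\<^sub>' X\<^sub>n\<^sub>+\<^sub>1\<close>, the latter being redundant unless the first diagram is empty. The
  image of the block has a basis indexed by the common covers with \<open>n + 1\<close> boxes. As a shape has more addable
  than removable boxes (\<open>card_removable_less_addable\<close>), there are at least as many covers as
  spanning elements, so the block is mapped injectively (\<open>block_separated\<close>). The conclusion is
  \<open>rook_ideal_iff_mat\<close>. Semisimplicity and the classification of the simple modules are then those
  of a product of matrix algebras.

  Conversely let \<open>R\<^sub>k(q)\<close> be semisimple. The character \<open>\<chi>\<close> with \<open>T\<^sub>i \<mapsto> q\<close> and \<open>P\<^sub>i \<mapsto> 0\<close> splits off, which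
  yields \<open>n\<close> with \<open>r n = \<chi>(r) n\<close> for all \<open>r\<close> and \<open>\<chi>(n) = 1\<close>. Let \<open>n\<close> act on functions \<open>v\<close> on the
  permutations of \<open>k\<close> letters, through the Hecke algebra. The functional \<open>\<epsilon>(v) = \<Sum>\<^sub>w q\<^sup>i\<^sup>n\<^sup>v\<^sup>(\<^sup>w\<^sup>) v(w)\<close>
  transforms by \<open>\<chi>\<close>, hence \<open>\<epsilon>(n v) = \<epsilon>(v)\<close>. On the other hand \<open>n v\<close> is an invariant function, hence a
  multiple of \<open>w \<mapsto> q\<^sup>i\<^sup>n\<^sup>v\<^sup>(\<^sup>w\<^sup>)\<close>, and \<open>\<epsilon>(n v)\<close> is a multiple of the Poincare polynomial
  \<open>\<Sum>\<^sub>w q\<^sup>2\<^sup>i\<^sup>n\<^sup>v\<^sup>(\<^sup>w\<^sup>) = [k]!\<close>. Since \<open>\<epsilon> \<noteq> 0\<close>, this forces \<open>[k]! \<noteq> 0\<close> (\<open>semisimple_imp_q_fact\<close>).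
\<close>


section \<open>Modules of the free algebra\<close>

lemma poly_mapping_sum_single:
  "f = (\<Sum>w\<in>Poly_Mapping.keys f. Poly_Mapping.single w (Poly_Mapping.lookup f w))"
  for f :: "'a \<Rightarrow>\<^sub>0 'b::comm_monoid_add"
  by (rule poly_mapping_eqI)
    (simp add: lookup_sum lookup_single when_def in_keys_iff)

lemma free_algebra_induct [consumes 1, case_names single add]:
  assumes f: "f \<in> carrier (free_algebra k)"
    and single: "\<And>w c. set (letters w) \<subseteq> rook_gens k \<Longrightarrow> P (Poly_Mapping.single w c)"
    and add: "\<And>f g. f \<in> carrier (free_algebra k) \<Longrightarrow> g \<in> carrier (free_algebra k) \<Longrightarrow>
      P f \<Longrightarrow> P g \<Longrightarrow> P (f + g)"
  shows "P f"
proof -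
  have "P (\<Sum>w\<in>A. Poly_Mapping.single w (Poly_Mapping.lookup f w)) \<and>
    (\<Sum>w\<in>A. Poly_Mapping.single w (Poly_Mapping.lookup f w)) \<in> carrier (free_algebra k)"
    if "finite A" "A \<subseteq> Poly_Mapping.keys f" for A
    using that
  proof (induction A)
    case empty
    show ?case using single[of 0 0] by (simp add: zero_rook_word_def free_algebra_def)
  next
    case (insert w A)
    have w: "set (letters w) \<subseteq> rook_gens k" using f insert.prems by (auto simp: free_algebra_def)
    have "Poly_Mapping.single w (Poly_Mapping.lookup f w) \<in> carrier (free_algebra k)"
      using w by (auto simp: free_algebra_def)
    with insert w show ?case by (auto intro!: add single free_algebra_closed)
  qed
  from this[of "Poly_Mapping.keys f"] show ?thesis using poly_mapping_sum_single[of f] by simp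
qed

lemma free_elt_induct [case_names single add]:
  assumes single: "\<And>w c. P (Poly_Mapping.single w c)" and add: "\<And>f g. P f \<Longrightarrow> P g \<Longrightarrow> P (f + g)"
  shows "P (f :: free_elt)"
proof -
  have "P (\<Sum>w\<in>A. Poly_Mapping.single w (Poly_Mapping.lookup f w))" if "finite A" for A
    using that by (induction A) (use single[of 0 0] in \<open>auto intro!: add single\<close>)
  from this[of "Poly_Mapping.keys f"] show ?thesis using poly_mapping_sum_single[of f] by simp
qed

lemma free_algebra_zero: "0 \<in> carrier (free_algebra k)"
  by (simp add: free_algebra_def)

lemma free_algebra_sum:
  "(\<And>x. x \<in> A \<Longrightarrow> f x \<in> carrier (free_algebra k)) \<Longrightarrow> (\<Sum>x\<in>A. f x) \<in> carrier (free_algebra k)"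
  by (induction A rule: infinite_finite_induct) (auto intro: free_algebra_closed free_algebra_zero)

lemma free_algebra_mono: "n \<le> k \<Longrightarrow> carrier (free_algebra n) \<subseteq> carrier (free_algebra k)"
proof -
  assume "n \<le> k"
  then have "rook_gens n \<subseteq> rook_gens k" by (auto simp: rook_gens_def)
  then show ?thesis by (fastforce simp: free_algebra_def)
qed

lemma scal_simps:
  "scal 1 = 1" "scal 0 = 0" "scal (a + b) = scal a + scal b" "scal (a * b) = scal a * scal b"
  "scal (- a) = - scal a" "scal (a - b) = scal a - scal b"
  by (simp_all add: scal_def single_add mult_single single_uminus single_diff)

primrec word_act :: "(rook_gen \<Rightarrow> 'v \<Rightarrow> 'v) \<Rightarrow> rook_gen list \<Rightarrow> 'v \<Rightarrow> 'v" where
  "word_act G [] v = v"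
| "word_act G (g # w) v = G g (word_act G w v)"

lemma word_act_append: "word_act G (u @ w) v = word_act G u (word_act G w v)"
  by (induction u) auto

text \<open>A vector space with one linear operator for each generator is a module over the free
  algebra. All representations below arise in this way.\<close>

locale free_action = Modules.module sc for sc :: "complex \<Rightarrow> 'v::ab_group_add \<Rightarrow> 'v" +
  fixes G :: "rook_gen \<Rightarrow> 'v \<Rightarrow> 'v"
  assumes G_add: "G g (v + w) = G g v + G g w"
    and G_scale: "G g (sc c v) = sc c (G g v)"
begin

definition act :: "free_elt \<Rightarrow> 'v \<Rightarrow> 'v" where
  "act f v = (\<Sum>w\<in>Poly_Mapping.keys f. sc (Poly_Mapping.lookup f w) (word_act G (letters w) v))"

lemma act_superset:
  assumes "finite A" "Poly_Mapping.keys f \<subseteq> A"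
  shows "act f v = (\<Sum>w\<in>A. sc (Poly_Mapping.lookup f w) (word_act G (letters w) v))"
  unfolding act_def using assms by (intro sum.mono_neutral_left) (auto simp: in_keys_iff)

lemma act_add_left: "act (f + g) v = act f v + act g v"
proof -
  let ?A = "Poly_Mapping.keys f \<union> Poly_Mapping.keys g"
  have "Poly_Mapping.keys (f + g) \<subseteq> ?A" by (rule Poly_Mapping.keys_add)
  then show ?thesis
    by (simp add: act_superset[of ?A] lookup_add scale_left_distrib sum.distrib)
qed

lemma act_single: "act (Poly_Mapping.single w c) v = sc c (word_act G (letters w) v)"
  by (subst act_superset[of "{w}"]) auto

lemma word_act_add: "word_act G w (u + v) = word_act G w u + word_act G w v"
  by (induction w) (auto simp: G_add)

lemma word_act_scale: "word_act G w (sc c v) = sc c (word_act G w v)"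
  by (induction w) (auto simp: G_scale)

lemma act_add_right: "act f (u + v) = act f u + act f v"
  by (simp add: act_def word_act_add scale_right_distrib sum.distrib)

lemma act_scale: "act f (sc c v) = sc c (act f v)"
  by (simp add: act_def word_act_scale scale_sum_right mult.commute)

lemma act_zero_left [simp]: "act 0 v = 0"
  by (simp add: act_def)

lemma act_zero_right [simp]: "act f 0 = 0"
  using act_add_right[of f 0 0] by simp

lemma act_minus_left: "act (- f) v = - act f v"
  using act_add_left[of f "- f" v] by (simp add: eq_neg_iff_add_eq_0 add.commute)

lemma act_diff_left: "act (f - g) v = act f v - act g v"
  using act_add_left[of f "- g" v] by (simp add: act_minus_left)

lemma act_sum_left: "act (\<Sum>x\<in>A. f x) v = (\<Sum>x\<in>A. act (f x) v)"
  by (induction A rule: infinite_finite_induct) (auto simp: act_add_left)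

lemma act_sum_right: "act f (\<Sum>x\<in>A. v x) = (\<Sum>x\<in>A. act f (v x))"
  by (induction A rule: infinite_finite_induct) (auto simp: act_add_right)

lemma act_scal [simp]: "act (scal c) v = sc c v"
  by (simp add: scal_def act_single zero_rook_word_def)

lemma act_one [simp]: "act 1 v = v"
  using act_scal[of 1 v] by (simp add: scal_simps)

lemma act_genP [simp]: "act (genP i) v = G (GenP i) v"
  by (simp add: genP_def act_single)

lemma act_genT [simp]: "act (genT i) v = G (GenT i) v"
  by (simp add: genT_def act_single)

lemma act_mult: "act (f * g) v = act f (act g v)"
proof (induction f rule: free_elt_induct)
  case (single u c)
  show ?case
  proof (induction g rule: free_elt_induct)
    case (single w d)
    show ?case
      by (simp add: mult_single act_single plus_rook_word_def word_act_append word_act_scale)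
  next
    case (add g g')
    then show ?case by (simp add: distrib_left act_add_left act_add_right)
  qed
next
  case (add f f')
  then show ?case by (simp add: distrib_right act_add_left)
qed

lemmas act_simps = act_add_left act_diff_left act_minus_left act_mult act_scale

lemma act_mem_subspace:
  assumes Z: "subspace Z" and G: "\<And>g v. g \<in> rook_gens k \<Longrightarrow> v \<in> Z \<Longrightarrow> G g v \<in> Z"
    and f: "f \<in> carrier (free_algebra k)" and v: "v \<in> Z"
  shows "act f v \<in> Z"
  using f
proof (induction rule: free_algebra_induct)
  case (single w c)
  then have "word_act G (letters w) v \<in> Z"
  proof (induction "letters w" arbitrary: w)
    case Nil
    then show ?case using v by (metis word_act.simps(1))
  next
    case (Cons g u)
    from Cons(1)[of "Word u"] Cons(2,3) have "word_act G u v \<in> Z" by (metis insert_subset list.simps(15) rook_word.sel)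
    with Cons(2,3) G show ?case by (metis insert_subset list.simps(15) word_act.simps(2))
  qed
  then show ?case by (simp add: act_single subspace_scale[OF Z])
next
  case (add f g)
  then show ?case by (simp add: act_add_left subspace_add[OF Z])
qed

text \<open>The relations need hold only modulo a submodule \<open>Z\<close>: then the free action descends to an
  action of the rook monoid algebra on the quotient by \<open>Z\<close>.\<close>

lemma rook_ideal_act:
  assumes Z: "subspace Z" and G: "\<And>g v. g \<in> rook_gens k \<Longrightarrow> v \<in> Z \<Longrightarrow> G g v \<in> Z"
    and rel: "\<And>r v. r \<in> rook_relations k q \<Longrightarrow> act r v \<in> Z"
    and f: "f \<in> rook_ideal k q"
  shows "act f v \<in> Z"
proof -
  let ?J = "{f \<in> carrier (free_algebra k). \<forall>v. act f v \<in> Z}"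
  interpret F: ring "free_algebra k" by (rule ring_free_algebra)
  have inv: "\<ominus>\<^bsub>free_algebra k\<^esub> f = - f" if "f \<in> carrier (free_algebra k)" for f
    by (rule F.minus_equality) (use that in \<open>auto intro: free_algebra_closed\<close>)
  have "ideal ?J (free_algebra k)"
  proof (rule idealI)
    show "ring (free_algebra k)" by (rule ring_free_algebra)
    have "inv\<^bsub>add_monoid (free_algebra k)\<^esub> f = - f" if "f \<in> carrier (free_algebra k)" for f
      using inv[OF that] by (simp add: a_inv_def)
    then show "subgroup ?J (add_monoid (free_algebra k))"
      by (intro subgroup.intro)
        (auto intro: free_algebra_closed free_algebra_zero
          simp: act_add_left act_minus_left subspace_add[OF Z] subspace_neg[OF Z] subspace_0[OF Z])
    fix a x assume a: "a \<in> ?J" and x: "x \<in> carrier (free_algebra k)"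
    then show "x \<otimes>\<^bsub>free_algebra k\<^esub> a \<in> ?J"
      using act_mem_subspace[OF Z G x] by (auto intro: free_algebra_closed simp: act_mult)
    show "a \<otimes>\<^bsub>free_algebra k\<^esub> x \<in> ?J"
      using a x by (auto intro: free_algebra_closed simp: act_mult)
  qed
  moreover have "rook_relations k q \<subseteq> ?J" using rel rook_relations_closed[of k q] by auto
  ultimately have "rook_ideal k q \<subseteq> ?J" unfolding rook_ideal_def
    by (rule F.genideal_minimal)
  with f show ?thesis by auto
qed

end


section \<open>Quantum integers and contents\<close>

text \<open>The quotient \<open>(1 - q\<^sup>-\<^sup>2\<^sup>d) / (q - q\<^sup>-\<^sup>1)\<close>, read after cancellation if \<open>q\<^sup>2 = 1\<close>.\<close>

definition qnum :: "complex \<Rightarrow> int \<Rightarrow> complex" where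
  "qnum q d = (if q\<^sup>2 = 1 then q * of_int d else (1 - q powi (- 2 * d)) / (q - inverse q))"

lemma qnum_0 [simp]: "qnum q 0 = 0"
  by (simp add: qnum_def)

lemma hecke_param_eq_0_iff: "q \<noteq> 0 \<Longrightarrow> q - inverse q = 0 \<longleftrightarrow> q\<^sup>2 = 1" for q :: complex
  by (auto simp: field_simps power2_eq_square)

lemma inverse_of_square_one: "q\<^sup>2 = 1 \<Longrightarrow> inverse q = q" for q :: complex
  by (metis inverse_unique power2_eq_square)

text \<open>The addition law of the multiplicative formal group. It turns every identity between diagonal
  entries into a polynomial identity in the q-analogues of two content differences.\<close>

lemma qnum_add:
  assumes "q \<noteq> 0"
  shows "qnum q (m + n) = qnum q m + qnum q n - (q - inverse q) * qnum q m * qnum q n"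
proof (cases "q\<^sup>2 = 1")
  case True
  then show ?thesis by (simp add: qnum_def inverse_of_square_one algebra_simps)
next
  case False
  define h where "h = q - inverse q"
  have h: "h \<noteq> 0" using hecke_param_eq_0_iff[OF assms] False by (simp add: h_def)
  have "q powi (- 2 * (m + n)) = q powi (- 2 * m) * q powi (- 2 * n)"
    using assms by (simp flip: power_int_add add: algebra_simps)
  moreover have "(1 - a * b) / h = (1 - a) / h + (1 - b) / h - h * ((1 - a) / h) * ((1 - b) / h)" for a b
    using h by (simp add: field_simps)
  ultimately show ?thesis
    using False unfolding qnum_def h_def[symmetric] by simp
qed

lemma qnum_1: "q \<noteq> 0 \<Longrightarrow> qnum q 1 = inverse q"
proof -
  assume q: "q \<noteq> 0"
  show ?thesis
  proof (cases "q\<^sup>2 = 1")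
    case True
    then show ?thesis by (simp add: qnum_def inverse_of_square_one)
  next
    case False
    then have "q * q \<noteq> 1" by (simp add: power2_eq_square)
    with q False show ?thesis
      by (simp add: qnum_def power_int_minus field_simps power2_eq_square)
  qed
qed

lemma qnum_minus_1: "q \<noteq> 0 \<Longrightarrow> qnum q (- 1) = - q"
proof -
  assume q: "q \<noteq> 0"
  have "0 = qnum q 1 + qnum q (-1) - (q - inverse q) * qnum q 1 * qnum q (-1)"
    using qnum_add[OF q, of 1 "-1"] by simp
  then have "q * (q + qnum q (-1)) = 0" using q by (simp add: qnum_1 field_simps)
  with q show ?thesis by (simp add: eq_neg_iff_add_eq_0 add.commute)
qed

lemma q_int_geometric: "q_int q i * (q\<^sup>2 - 1) = q ^ (2 * i) - 1"
  by (induction i) (auto simp: q_int_def algebra_simps power2_eq_square)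

lemma q_int_nonzero: "q_fact q k \<noteq> 0 \<Longrightarrow> 1 \<le> i \<Longrightarrow> i \<le> k \<Longrightarrow> q_int q i \<noteq> 0"
  by (auto simp: q_fact_def)

text \<open>For \<open>q\<^sup>2 \<noteq> 1\<close> a zero means \<open>q\<^sup>2\<^sup>d = 1\<close>, hence \<open>[\<bar>d\<bar>] = 0\<close>, and \<open>[\<bar>d\<bar>]\<close> is a factor of \<open>[k]!\<close>.\<close>

lemma qnum_nonzero:
  assumes q: "q \<noteq> 0" and k: "q_fact q k \<noteq> 0" and d: "d \<noteq> 0" "\<bar>d\<bar> \<le> int k"
  shows "qnum q d \<noteq> 0"
proof (cases "q\<^sup>2 = 1")
  case True
  with q d show ?thesis by (simp add: qnum_def)
next
  case False
  have "q_int q (nat \<bar>d\<bar>) \<noteq> 0" using d by (intro q_int_nonzero[OF k]) auto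
  with False have "q ^ (2 * nat \<bar>d\<bar>) \<noteq> 1" using q_int_geometric[of q "nat \<bar>d\<bar>"] by auto
  moreover have "q powi (- 2 * d) = q ^ (2 * nat \<bar>d\<bar>)" if "d < 0"
    using that nat_mult_distrib[of 2 "- d"] by (simp add: power_int_def)
  moreover have "q powi (- 2 * d) = inverse (q ^ (2 * nat \<bar>d\<bar>))" if "d > 0"
    using that by (simp add: power_int_def nat_mult_distrib power_inverse)
  ultimately have "q powi (- 2 * d) \<noteq> 1" using d(1) by (cases "d < 0") auto
  with False q show ?thesis using hecke_param_eq_0_iff[OF q] by (simp add: qnum_def)
qed

definition content :: "box \<Rightarrow> int" where
  "content b = int (snd (snd b)) - int (fst (snd b))"

text \<open>The diagonal matrix entry of \<open>T\<^sub>i\<close> as a function of the boxes \<open>x = L(i)\<close> and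
  \<open>y = L(i+1)\<close>. The three cases of the classical formula (same row, same column, otherwise) are
  one formula in terms of the content difference.\<close>

definition diag_entry :: "complex \<Rightarrow> box \<Rightarrow> box \<Rightarrow> complex" where
  "diag_entry q x y = (if fst x = fst y then inverse (qnum q (content y - content x))
     else if fst x = 1 then q - inverse q else 0)"

text \<open>The trace of the block of \<open>T\<^sub>i\<close> on \<open>v\<^sub>L\<close> and \<open>v\<^sub>s\<^sub>i\<^sub>L\<close>.\<close>

lemma diag_entry_sum:
  assumes "q \<noteq> 0" and "fst x \<in> {1, 2}" "fst y \<in> {1, 2}"
    and "fst x = fst y \<Longrightarrow> qnum q (content y - content x) \<noteq> 0"
    and "fst x = fst y \<Longrightarrow> qnum q (content x - content y) \<noteq> 0"
  shows "diag_entry q x y + diag_entry q y x = q - inverse q"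
proof (cases "fst x = fst y")
  case True
  define m where "m = qnum q (content y - content x)"
  define n where "n = qnum q (content x - content y)"
  have "m + n - (q - inverse q) * m * n = 0"
    using qnum_add[OF assms(1), of "content y - content x" "content x - content y"]
    by (simp add: m_def n_def)
  with True assms(4,5) show ?thesis
    by (simp add: diag_entry_def field_simps flip: m_def n_def) algebra
next
  case False
  with assms(2,3) show ?thesis by (auto simp: diag_entry_def)
qed

text \<open>A Yang--Baxter identity: for boxes of one diagram, with the denominators cleared, it is the
  addition law of the q-analogues. It is the core of the braid relation.\<close>

lemma diag_entry_yang_baxter:
  assumes "q \<noteq> 0" and "fst x \<in> {1, 2}" "fst y \<in> {1, 2}" "fst z \<in> {1, 2}"
    and "fst x = fst y \<Longrightarrow> qnum q (content y - content x) \<noteq> 0"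
    and "fst y = fst z \<Longrightarrow> qnum q (content z - content y) \<noteq> 0"
    and "fst x = fst z \<Longrightarrow> qnum q (content z - content x) \<noteq> 0"
  shows "diag_entry q x y * diag_entry q y z + (q - inverse q) * diag_entry q x z =
    diag_entry q x z * (diag_entry q x y + diag_entry q y z)"
proof (cases "fst x = fst y \<and> fst y = fst z")
  case True
  define m where "m = qnum q (content y - content x)"
  define n where "n = qnum q (content z - content y)"
  define l where "l = qnum q (content z - content x)"
  define h where "h = q - inverse q"
  have l: "l = m + n - h * m * n"
    using qnum_add[OF assms(1), of "content y - content x" "content z - content y"]
    by (simp add: m_def n_def l_def h_def)
  have nz: "m \<noteq> 0" "n \<noteq> 0" "l \<noteq> 0" using True assms(5-7) by (auto simp: m_def n_def l_def)
  have "inverse m * inverse n + h * inverse l = inverse l * (inverse m + inverse n)"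
    using nz by (simp add: field_simps) (simp add: l algebra_simps)
  with True show ?thesis by (simp add: diag_entry_def flip: m_def n_def l_def h_def)
next
  case False
  have c: "fst x = 1 \<or> fst x = 2" "fst y = 1 \<or> fst y = 2" "fst z = 1 \<or> fst z = 2"
    using assms(2-4) by auto
  from c(1) show ?thesis
  proof
    assume x: "fst x = 1"
    from c(2) show ?thesis
    proof
      assume "fst y = 1"
      with x c(3) False show ?thesis by (simp add: diag_entry_def) (simp add: algebra_simps)
    next
      assume "fst y = 2"
      from c(3) show ?thesis
        by (elim disjE) (simp_all add: diag_entry_def x \<open>fst y = 2\<close> algebra_simps)
    qed
  next
    assume x: "fst x = 2"
    from c(2) show ?thesis
    proof
      assume y: "fst y = 1"
      from c(3) show ?thesis
        by (elim disjE) (simp_all add: diag_entry_def x y algebra_simps)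
    next
      assume y: "fst y = 2"
      with x c(3) False show ?thesis by (simp add: diag_entry_def)
    qed
  qed
qed


section \<open>Shapes and standard tableaux\<close>

text \<open>The diagrams of the pairs of partitions whose first member has at most one row.\<close>

definition shape :: "box set \<Rightarrow> bool" where
  "shape N \<longleftrightarrow> finite N \<and> (\<forall>j r c. (j, r, c) \<in> N \<longrightarrow>
     (j = 1 \<and> r = 1 \<or> j = 2 \<and> 1 \<le> r) \<and> 1 \<le> c \<and>
     (\<forall>r' c'. 1 \<le> r' \<and> r' \<le> r \<and> 1 \<le> c' \<and> c' \<le> c \<longrightarrow> (j, r', c') \<in> N))"

definition addable :: "box \<Rightarrow> box set \<Rightarrow> bool" where
  "addable b N \<longleftrightarrow> b \<notin> N \<and> shape (insert b N)"

lemma shape_empty [simp]: "shape {}"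
  by (simp add: shape_def)

lemma shape_finite: "shape N \<Longrightarrow> finite N"
  by (simp add: shape_def)

lemma shape_down:
  "shape N \<Longrightarrow> (j, r, c) \<in> N \<Longrightarrow> 1 \<le> r' \<Longrightarrow> r' \<le> r \<Longrightarrow> 1 \<le> c' \<Longrightarrow> c' \<le> c \<Longrightarrow> (j, r', c') \<in> N"
  unfolding shape_def by blast

lemma shape_valid:
  "shape N \<Longrightarrow> (j, r, c) \<in> N \<Longrightarrow> (j = 1 \<and> r = 1 \<or> j = 2 \<and> 1 \<le> r) \<and> 1 \<le> c"
  unfolding shape_def by blast

lemma shape_comp: "shape N \<Longrightarrow> b \<in> N \<Longrightarrow> fst b \<in> {1, 2}"
  using shape_valid[of N "fst b" "fst (snd b)" "snd (snd b)"] by auto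

lemma shape_Un: "shape M \<Longrightarrow> shape N \<Longrightarrow> shape (M \<union> N)"
proof -
  assume M: "shape M" and N: "shape N"
  show ?thesis
    unfolding shape_def[of "M \<union> N"]
  proof (intro conjI allI impI)
    show "finite (M \<union> N)" using M N by (simp add: shape_finite)
    fix j r c assume "(j, r, c) \<in> M \<union> N"
    then show "j = 1 \<and> r = 1 \<or> j = 2 \<and> 1 \<le> r" "1 \<le> c"
      using shape_valid[OF M, of j r c] shape_valid[OF N, of j r c] by auto
    fix r' c' assume "1 \<le> r' \<and> r' \<le> r \<and> 1 \<le> c' \<and> c' \<le> c"
    with \<open>(j, r, c) \<in> M \<union> N\<close> show "(j, r', c') \<in> M \<union> N"
      using shape_down[OF M, of j r c r' c'] shape_down[OF N, of j r c r' c'] by auto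
  qed
qed

lemma shape_Int: "shape M \<Longrightarrow> shape N \<Longrightarrow> shape (M \<inter> N)"
proof -
  assume M: "shape M" and N: "shape N"
  show ?thesis
    unfolding shape_def[of "M \<inter> N"]
  proof (intro conjI allI impI)
    show "finite (M \<inter> N)" using M by (simp add: shape_finite)
    fix j r c assume "(j, r, c) \<in> M \<inter> N"
    then show "j = 1 \<and> r = 1 \<or> j = 2 \<and> 1 \<le> r" "1 \<le> c"
      using shape_valid[OF M, of j r c] by auto
    fix r' c' assume "1 \<le> r' \<and> r' \<le> r \<and> 1 \<le> c' \<and> c' \<le> c"
    with \<open>(j, r, c) \<in> M \<inter> N\<close> show "(j, r', c') \<in> M \<inter> N"
      using shape_down[OF M, of j r c r' c'] shape_down[OF N, of j r c r' c'] by auto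
  qed
qed

lemma addable_both:
  assumes "shape N" "addable x N" "addable y N" "x \<noteq> y"
  shows "addable y (insert x N)"
  using assms shape_Un[of "insert x N" "insert y N"] by (auto simp: addable_def insert_commute)

text \<open>If \<open>y\<close> were on the diagonal of \<open>x\<close>, the two boxes above and to the left of the later one would
  have to be added in between.\<close>

lemma addable_pair_content:
  assumes N: "shape N" and x: "addable x N" and y: "addable y (insert x N)" and j: "fst x = fst y"
  shows "content x \<noteq> content y"
proof
  assume eq: "content x = content y"
  obtain j r c where xe: "x = (j, r, c)" by (cases x)
  obtain r' c' where ye: "y = (j, r', c')" using j xe by (cases y) auto
  have vx: "1 \<le> r" "1 \<le> c" using x shape_valid[of "insert x N" j r c] by (auto simp: addable_def xe)
  have vy: "1 \<le> r'" "1 \<le> c'"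
    using y shape_valid[of "insert y (insert x N)" j r' c'] by (auto simp: addable_def ye)
  have d: "int c - int r = int c' - int r'" using eq by (simp add: content_def xe ye)
  have ne: "x \<noteq> y" using y by (auto simp: addable_def)
  show False
  proof (cases "r \<le> r'")
    case True
    with d ne have lt: "r < r'" "c < c'" by (auto simp: xe ye)
    have "(j, r', c' - 1) \<in> insert y (insert x N)"
      using y vx vy lt shape_down[of "insert y (insert x N)" j r' c' r' "c' - 1"]
      by (auto simp: addable_def ye)
    then have "(j, r', c' - 1) \<in> insert x N" using lt vy by (auto simp: ye)
    then have "(j, r', c' - 1) \<in> N" using lt by (auto simp: xe)
    from shape_down[OF N this, of r c] have "x \<in> N" using lt vx by (auto simp: xe)
    with x show False by (simp add: addable_def)
  next
    case False
    then have "y \<in> insert x N"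
      using d vy shape_down[of "insert x N" j r c r' c'] x by (auto simp: addable_def xe ye)
    with y show False by (simp add: addable_def)
  qed
qed

text \<open>The box that \<open>y\<close> misses in \<open>N\<close> can only be \<open>x\<close>, so \<open>x\<close> is directly above \<open>y\<close> or directly to its left.\<close>

lemma not_addable_adjacent:
  assumes N: "shape N" and x: "addable x N" and y: "addable y (insert x N)" and ny: "\<not> addable y N"
  shows "fst x = fst y \<and> (content y - content x = 1 \<or> content y - content x = - 1)"
proof -
  obtain j r c where xe: "x = (j, r, c)" by (cases x)
  obtain j' r' c' where ye: "y = (j', r', c')" by (cases y)
  have sy: "shape (insert y (insert x N))" using y by (simp add: addable_def)
  have yN: "y \<notin> N" "x \<noteq> y" "x \<notin> N" using x y by (auto simp: addable_def)
  have vx: "1 \<le> r" "1 \<le> c" using x shape_valid[of "insert x N" j r c] by (auto simp: addable_def xe)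
  have vy: "(j' = 1 \<and> r' = 1 \<or> j' = 2 \<and> 1 \<le> r') \<and> 1 \<le> c'"
    using sy shape_valid[of "insert y (insert x N)" j' r' c'] by (auto simp: ye)
  have "\<not> shape (insert y N)" using ny yN by (auto simp: addable_def)
  moreover have "shape (insert y N)"
    if *: "\<And>r'' c''. 1 \<le> r'' \<and> r'' \<le> r' \<and> 1 \<le> c'' \<and> c'' \<le> c' \<Longrightarrow> (j', r'', c'') \<in> insert y N"
    unfolding shape_def
  proof (intro conjI allI impI)
    show "finite (insert y N)" using N by (simp add: shape_finite)
    fix j2 r2 c2 assume m: "(j2, r2, c2) \<in> insert y N"
    then show "j2 = 1 \<and> r2 = 1 \<or> j2 = 2 \<and> 1 \<le> r2" "1 \<le> c2"
      using vy shape_valid[OF N, of j2 r2 c2] by (auto simp: ye)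
    fix r3 c3 assume "1 \<le> r3 \<and> r3 \<le> r2 \<and> 1 \<le> c3 \<and> c3 \<le> c2"
    with m * show "(j2, r3, c3) \<in> insert y N"
      using shape_down[OF N, of j2 r2 c2 r3 c3] by (auto simp: ye)
  qed
  ultimately obtain r'' c'' where rc: "1 \<le> r''" "r'' \<le> r'" "1 \<le> c''" "c'' \<le> c'"
    "(j', r'', c'') \<notin> insert y N" by blast
  then have "(j', r'', c'') \<in> insert y (insert x N)"
    using shape_down[OF sy, of j' r' c' r'' c''] by (auto simp: ye)
  with rc(5) have "(j', r'', c'') = x" by auto
  with rc have le: "j' = j" "r \<le> r'" "c \<le> c'" by (auto simp: xe)
  have mem: "(j, a, b) \<in> insert y (insert x N)" if "1 \<le> a" "a \<le> r'" "1 \<le> b" "b \<le> c'" for a b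
    using shape_down[OF sy, of j' r' c' a b] that le by (auto simp: ye)
  have notN: "(j, a, b) \<notin> N" if "r \<le> a" "c \<le> b" for a b
    using shape_down[OF N, of j a b r c] that vx yN by (auto simp: xe)
  have "r' = r \<or> c' = c"
  proof (rule ccontr)
    assume "\<not> ?thesis"
    then have "(j, r', c' - 1) \<in> insert y (insert x N)" "r < r'" "c < c'"
      using mem[of r' "c' - 1"] le vx by auto
    then show False using notN[of r' "c' - 1"] le vx by (auto simp: xe ye)
  qed
  then show ?thesis
  proof
    assume r: "r' = r"
    have "c < c'" using r le yN by (auto simp: xe ye)
    moreover have "\<not> c + 1 < c'"
      using mem[of r "c + 1"] notN[of r "c + 1"] r le vx by (auto simp: xe ye)
    ultimately show ?thesis using r le by (auto simp: content_def xe ye)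
  next
    assume c: "c' = c"
    have "r < r'" using c le yN by (auto simp: xe ye)
    moreover have "\<not> r + 1 < r'"
      using mem[of "r + 1" c] notN[of "r + 1" c] c le vx by (auto simp: xe ye)
    ultimately show ?thesis using c le by (auto simp: content_def xe ye)
  qed
qed

text \<open>Of two addable boxes neither is to the lower right of the other, so they differ in rows and in
  columns, in opposite directions.\<close>

lemma addable_both_content:
  assumes N: "shape N" and x: "addable x N" and y: "addable y N" and ne: "x \<noteq> y" and j: "fst x = fst y"
  shows "\<bar>content x - content y\<bar> \<ge> 2"
proof -
  obtain j r c where xe: "x = (j, r, c)" by (cases x)
  obtain r' c' where ye: "y = (j, r', c')" using j xe by (cases y) auto
  have vx: "1 \<le> r" "1 \<le> c" using x shape_valid[of "insert x N" j r c] by (auto simp: addable_def xe)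
  have vy: "1 \<le> r'" "1 \<le> c'"
    using y shape_valid[of "insert y N" j r' c'] by (auto simp: addable_def ye)
  have "\<not> (r \<le> r' \<and> c \<le> c')"
    using shape_down[of "insert y N" j r' c' r c] x y ne vx by (auto simp: addable_def xe ye)
  moreover have "\<not> (r' \<le> r \<and> c' \<le> c)"
    using shape_down[of "insert x N" j r c r' c'] x y ne vy by (auto simp: addable_def xe ye)
  ultimately show ?thesis by (auto simp: content_def xe ye)
qed

text \<open>Between two boxes of one diagonal at least two further boxes are added.\<close>

lemma addable_triple_content:
  assumes N: "shape N" and x: "addable x N" and y: "addable y (insert x N)"
    and z: "addable z (insert y (insert x N))" and j: "fst x = fst z"
  shows "content x \<noteq> content z"
proof
  assume eq: "content x = content z"
  obtain j r c where xe: "x = (j, r, c)" by (cases x)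
  obtain r' c' where ze: "z = (j, r', c')" using j xe by (cases z) auto
  have sz: "shape (insert z (insert y (insert x N)))" using z by (simp add: addable_def)
  have vx: "1 \<le> r" "1 \<le> c" using x shape_valid[of "insert x N" j r c] by (auto simp: addable_def xe)
  have vz: "1 \<le> r'" "1 \<le> c'" using shape_valid[OF sz, of j r' c'] by (auto simp: ze)
  have d: "int c - int r = int c' - int r'" using eq by (simp add: content_def xe ze)
  have ne: "x \<noteq> z" "x \<notin> N" using x z by (auto simp: addable_def)
  have notN: "(j, a, b) \<notin> N" if "r \<le> a" "c \<le> b" for a b
    using shape_down[OF N, of j a b r c] that vx ne by (auto simp: xe)
  show False
  proof (cases "r \<le> r'")
    case True
    with d ne have lt: "r < r'" "c < c'" by (auto simp: xe ze)
    have "(j, r', c' - 1) \<in> insert z (insert y (insert x N))"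
      "(j, r' - 1, c') \<in> insert z (insert y (insert x N))"
      using lt vx shape_down[OF sz, of j r' c' r' "c' - 1"] shape_down[OF sz, of j r' c' "r' - 1" c']
      by (auto simp: ze)
    then show False using notN[of r' "c' - 1"] notN[of "r' - 1" c'] lt by (auto simp: xe ze)
  next
    case False
    then have "z \<in> insert x N"
      using d vz shape_down[of "insert x N" j r c r' c'] x by (auto simp: addable_def xe ze)
    with z show False by (simp add: addable_def)
  qed
qed

text \<open>The first row up to column \<open>c\<close> and the first column up to row \<open>r'\<close> share one box only.\<close>

lemma content_bound_aux:
  assumes N: "shape N" and "(j, r, c) \<in> N" "(j, r', c') \<in> N"
  shows "(int c - int r) - (int c' - int r') < int (card N)"
proof -
  have v: "1 \<le> r" "1 \<le> c" "1 \<le> r'" "1 \<le> c'"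
    using shape_valid[OF N assms(2)] shape_valid[OF N assms(3)] by auto
  let ?A = "(\<lambda>b. (j, 1::nat, b)) ` {1..c}" and ?B = "(\<lambda>a. (j, a, 1::nat)) ` {2..r'}"
  have "?A \<union> ?B \<subseteq> N"
    using shape_down[OF N assms(2)] shape_down[OF N assms(3)] v by auto
  then have "card (?A \<union> ?B) \<le> card N" by (rule card_mono[OF shape_finite[OF N]])
  moreover have "card (?A \<union> ?B) = c + (r' - 1)"
    by (subst card_Un_disjoint) (auto simp: card_image inj_on_def)
  ultimately show ?thesis using v by linarith
qed

lemma content_bound:
  assumes N: "shape N" and "x \<in> N" "y \<in> N" "fst x = fst y"
  shows "\<bar>content x - content y\<bar> < int (card N)"
proof -
  obtain j r c where x: "x = (j, r, c)" by (cases x)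
  obtain r' c' where y: "y = (j, r', c')" using assms(4) x by (cases y) auto
  from content_bound_aux[OF N, of j r c r' c'] content_bound_aux[OF N, of j r' c' r c] assms(2,3)
  show ?thesis by (auto simp: content_def x y)
qed

text \<open>A standard tableau is recorded as the list of its boxes in decreasing order of their entries,
  so that the box of the largest entry is the head and removing it is taking the tail.\<close>

fun std :: "box list \<Rightarrow> bool" where
  "std [] \<longleftrightarrow> True"
| "std (b # s) \<longleftrightarrow> std s \<and> addable b (set s)"

lemma std_distinct: "std l \<Longrightarrow> distinct l"
  by (induction l) (auto simp: addable_def)

lemma std_shape: "std l \<Longrightarrow> shape (set l)"
  by (cases l) (auto simp: addable_def)

lemma std_card: "std l \<Longrightarrow> card (set l) = length l"
  using std_distinct distinct_card by blast

lemma std_swap: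
  assumes "std (y # x # s)" and "addable y (set s)"
  shows "std (x # y # s)"
  using assms addable_both[of "set s" y x] std_shape[of s] by (auto simp: addable_def)

lemma std_swap_iff: "std (y # x # s) \<Longrightarrow> std (x # y # s) \<longleftrightarrow> addable y (set s)"
  using std_swap[of y x s] by auto


section \<open>The seminormal representations\<close>

text \<open>The operators \<open>T\<^sub>i\<close> and \<open>P\<^sub>i\<close> on functions of standard tableaux, for all shapes at once.
  In the coordinates of a function the coefficient \<open>q\<^sup>-\<^sup>1 + (T\<^sub>i)\<^sub>L\<^sub>'\<^sub>L\<^sub>'\<close> with
  \<open>L' = s\<^sub>iL\<close> is \<open>q - (T\<^sub>i)\<^sub>L\<^sub>L\<close>. The head of a list of length \<open>n\<close> is the box of \<open>n\<close>, so \<open>T\<^sub>i\<close> concerns the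
  two first boxes if \<open>i + 1\<close> is the length, and otherwise leaves the head alone. On lists
  of length at most \<open>i\<close> the default value is \<open>0\<close>.\<close>

fun T_op :: "complex \<Rightarrow> nat \<Rightarrow> (box list \<Rightarrow> complex) \<Rightarrow> box list \<Rightarrow> complex" where
  "T_op q i f (y # x # s) =
     (if i = Suc (length s)
      then diag_entry q x y * f (y # x # s)
        + (if addable y (set s) then (q - diag_entry q x y) * f (x # y # s) else 0)
      else T_op q i (\<lambda>l. f (y # l)) (x # s))"
| "T_op q i f [y] = 0"
| "T_op q i f [] = 0"

text \<open>The last \<open>i\<close> boxes of a list are those of the entries \<open>1, ..., i\<close>.\<close>

definition P_op :: "nat \<Rightarrow> (box list \<Rightarrow> complex) \<Rightarrow> box list \<Rightarrow> complex" where
  "P_op i f l = (if \<forall>b\<in>set (drop (length l - i) l). fst b = 1 then f l else 0)"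

lemma T_op_add: "T_op q i (\<lambda>l. f l + g l) l = T_op q i f l + T_op q i g l"
proof (induction q i f l arbitrary: g rule: T_op.induct)
  case (1 q i f y x s)
  then show ?case
    using "1.IH"[of "\<lambda>l. g (y # l)"] by (simp add: distrib_left)
qed auto

lemma T_op_scale: "T_op q i (\<lambda>l. c * f l) l = c * T_op q i f l"
  by (induction q i f l rule: T_op.induct) (auto simp: algebra_simps)

lemma T_op_cong:
  assumes "std l" and "\<And>l'. std l' \<Longrightarrow> length l' = length l \<Longrightarrow> set l' = set l \<Longrightarrow> f l' = g l'"
  shows "T_op q i f l = T_op q i g l"
  using assms
proof (induction q i f l arbitrary: g rule: T_op.induct)
  case (1 q i f y x s)
  show ?case
  proof (cases "i = Suc (length s)")
    case True
    have "f (y # x # s) = g (y # x # s)" using 1 by blast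
    moreover have "f (x # y # s) = g (x # y # s)" if "addable y (set s)"
      using 1(3)[OF std_swap[OF 1(2) that]] by (simp add: insert_commute)
    ultimately show ?thesis using True by simp
  next
    case False
    have "T_op q i (\<lambda>l. f (y # l)) (x # s) = T_op q i (\<lambda>l. g (y # l)) (x # s)"
    proof (rule 1(1)[OF False])
      show "std (x # s)" using 1(2) by simp
      fix l' assume "std l'" "length l' = length (x # s)" "set l' = set (x # s)"
      then show "f (y # l') = g (y # l')" using 1(2) by (intro 1(3)) auto
    qed
    with False show ?thesis by simp
  qed
qed auto

lemma T_op_Cons: "i < length s \<Longrightarrow> T_op q i f (y # s) = T_op q i (\<lambda>l. f (y # l)) s"
  by (cases s) auto

text \<open>The operators do not mix shapes, so a condition on the shape can be pulled out.\<close>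

lemma T_op_set:
  assumes "std l"
  shows "T_op q i (\<lambda>l. if C (set l) then f l else 0) l = (if C (set l) then T_op q i f l else 0)"
proof -
  have "T_op q i (\<lambda>l'. if C (set l') then f l' else 0) l =
    T_op q i (\<lambda>l'. (if C (set l) then 1 else 0) * f l') l"
    by (rule T_op_cong[OF assms]) auto
  then show ?thesis by (simp add: T_op_scale)
qed

lemma P_op_Cons: "i \<le> length s \<Longrightarrow> P_op i f (b # s) = P_op i (\<lambda>l. f (b # l)) s"
  by (simp add: P_op_def Suc_diff_le)

lemma P_op_length: "length l = i \<Longrightarrow> P_op i f l = (if \<forall>b\<in>set l. fst b = 1 then f l else 0)"
  by (simp add: P_op_def)

lemma addable_meet:
  assumes "addable y (insert x N)" "addable y (insert z N)" "x \<noteq> z"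
  shows "addable y N"
proof -
  have "insert y N = insert y (insert x N) \<inter> insert y (insert z N)"
    using assms by (auto simp: addable_def)
  moreover have "shape (insert y (insert x N) \<inter> insert y (insert z N))"
    using assms by (intro shape_Int) (auto simp: addable_def)
  ultimately show ?thesis using assms by (simp add: addable_def)
qed

text \<open>Proves an equation by exhibiting the difference of its sides as a combination of two quantities
  known to vanish.\<close>

lemma eq_by_cofactors:
  fixes l :: complex
  assumes "y = 0" "z = 0" "l - r = y * t + z * u"
  shows "l = r"
  using assms by simp

locale seminormal =
  fixes k :: nat and q :: complex
  assumes q_nonzero: "q \<noteq> 0" and q_fact_nonzero: "q_fact q k \<noteq> 0"
begin

abbreviation h where "h \<equiv> q - inverse q"

lemma qnum_content_nonzero:
  assumes "std l" "length l \<le> k" "x \<in> set l" "y \<in> set l" "fst x = fst y" "content x \<noteq> content y"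
  shows "qnum q (content y - content x) \<noteq> 0"
  using content_bound[OF std_shape[OF assms(1)] assms(3-5)] assms(2,6) std_card[OF assms(1)]
  by (intro qnum_nonzero[OF q_nonzero q_fact_nonzero]) auto

lemma std_comp: "std l \<Longrightarrow> b \<in> set l \<Longrightarrow> fst b \<in> {1, 2}"
  using std_shape shape_comp by blast

lemma std_pair_content: "std (y # x # s) \<Longrightarrow> fst x = fst y \<Longrightarrow> content x \<noteq> content y"
  using addable_pair_content[of "set s" x y] std_shape[of s] by auto

lemma std_triple_content: "std (z # y # x # s) \<Longrightarrow> fst x = fst z \<Longrightarrow> content x \<noteq> content z"
  using addable_triple_content[of "set s" x y z] std_shape[of s] by auto

lemma diag_entry_swap:
  assumes "std (y # x # s)" "length (y # x # s) \<le> k"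
  shows "diag_entry q y x = h - diag_entry q x y"
proof -
  have "diag_entry q x y + diag_entry q y x = h"
  proof (rule diag_entry_sum[OF q_nonzero])
    show "fst x \<in> {1, 2}" "fst y \<in> {1, 2}" using std_comp[OF assms(1)] by auto
    show "qnum q (content y - content x) \<noteq> 0" if "fst x = fst y"
      using qnum_content_nonzero[OF assms, of x y] std_pair_content[OF assms(1)] that by simp
    show "qnum q (content x - content y) \<noteq> 0" if "fst x = fst y"
      using qnum_content_nonzero[OF assms, of y x] std_pair_content[OF assms(1)] that by simp
  qed
  then show ?thesis by (simp add: eq_diff_eq add.commute)
qed

text \<open>If \<open>i\<close> and \<open>i + 1\<close> are neighbours then \<open>T\<^sub>i\<close> acts by a root \<open>q\<close> or \<open>-q\<^sup>-\<^sup>1\<close> of the quadratic relation.\<close>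

lemma diag_entry_not_addable:
  assumes "std (y # x # s)" "\<not> addable y (set s)"
  shows "diag_entry q x y * diag_entry q x y = h * diag_entry q x y + 1"
proof -
  have "fst x = fst y \<and> (content y - content x = 1 \<or> content y - content x = - 1)"
    using assms not_addable_adjacent[of "set s" x y] std_shape[of s] by auto
  then have "diag_entry q x y = q \<or> diag_entry q x y = - inverse q"
    using q_nonzero qnum_1[OF q_nonzero] qnum_minus_1[OF q_nonzero] by (auto simp: diag_entry_def)
  then show ?thesis using q_nonzero by (auto simp: algebra_simps)
qed

lemma diag_entry_braid:
  assumes "std (z # y # x # s)" "length (z # y # x # s) \<le> k"
  shows "diag_entry q x y * diag_entry q y z + h * diag_entry q x z =
    diag_entry q x z * (diag_entry q x y + diag_entry q y z)"
proof (rule diag_entry_yang_baxter[OF q_nonzero])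
  show "fst x \<in> {1, 2}" "fst y \<in> {1, 2}" "fst z \<in> {1, 2}" using std_comp[OF assms(1)] by auto
  show "qnum q (content y - content x) \<noteq> 0" if "fst x = fst y"
    using qnum_content_nonzero[OF assms, of x y] std_pair_content[of y x s] assms that by simp
  show "qnum q (content z - content y) \<noteq> 0" if "fst y = fst z"
    using qnum_content_nonzero[OF assms, of y z] std_pair_content[of z y "x # s"] assms that by simp
  show "qnum q (content z - content x) \<noteq> 0" if "fst x = fst z"
    using qnum_content_nonzero[OF assms, of x z] std_triple_content[of z y x s] assms that by simp
qed

text \<open>Only the two first boxes matter. If they can be exchanged, the block of \<open>T\<^sub>i\<close> has trace \<open>h\<close> and
  determinant \<open>-1\<close>; otherwise it is a single root of the quadratic relation.\<close>

lemma T_quadratic: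
  assumes "std l" "length l \<le> k" "1 \<le> i" "i < length l"
  shows "T_op q i (T_op q i f) l = h * T_op q i f l + f l"
  using assms
proof (induction l arbitrary: f)
  case (Cons y s)
  show ?case
  proof (cases "i < length s")
    case True
    have "T_op q i (T_op q i f) (y # s) = T_op q i (\<lambda>l. T_op q i f (y # l)) s"
      using True by (simp add: T_op_Cons)
    also have "\<dots> = T_op q i (T_op q i (\<lambda>l. f (y # l))) s"
      using Cons(2) True by (intro T_op_cong) (auto simp: T_op_Cons)
    also have "\<dots> = h * T_op q i (\<lambda>l. f (y # l)) s + f (y # s)"
      using Cons True by simp
    finally show ?thesis using True by (simp add: T_op_Cons)
  next
    case False
    with Cons.prems obtain x s' where s: "s = x # s'" "i = Suc (length s')" by (cases s) auto
    note st = Cons.prems(1)[unfolded s]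
    have sw: "diag_entry q y x = h - diag_entry q x y"
      using diag_entry_swap[OF st] Cons.prems(2) s by simp
    have x: "addable x (set s')" using st by simp
    define a where "a = diag_entry q x y"
    define iq where "iq = inverse q"
    define u where "u = f (y # x # s')"
    define v where "v = f (x # y # s')"
    note defs = a_def[symmetric] iq_def[symmetric] u_def[symmetric] v_def[symmetric]
    have qi: "q * iq = 1" using q_nonzero by (simp add: iq_def)
    show ?thesis
    proof (cases "addable y (set s')")
      case True
      show ?thesis unfolding s
        by (simp add: True x sw defs) (rule eq_by_cofactors[where y = "q * iq - 1" and t = u and z = 0],
            use qi in \<open>simp_all add: algebra_simps\<close>)
    next
      case False
      have "a * a = (q - iq) * a + 1"
        using diag_entry_not_addable[OF st False] by (simp add: defs)
      then show ?thesis unfolding s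
        by (simp add: False x defs)
          (metis distrib_right mult.assoc mult_1)
    qed
  qed
qed auto

text \<open>Only the three first boxes matter, in their at most six orders. Which orders are standard
  depends on which boxes are addable. In each case the difference of the two sides is a combination
  of the Yang--Baxter identity and, where an exchange is impossible, of the quadratic relation.\<close>

lemma T_braid:
  assumes "std l" "length l \<le> k" "1 \<le> i" "Suc i < length l"
  shows "T_op q i (T_op q (Suc i) (T_op q i f)) l = T_op q (Suc i) (T_op q i (T_op q (Suc i) f)) l"
  using assms
proof (induction l arbitrary: f)
  case (Cons z s)
  show ?case
  proof (cases "Suc i < length s")
    case True
    have *: "T_op q a (T_op q b (T_op q c f)) (z # s) =
      T_op q a (T_op q b (T_op q c (\<lambda>l. f (z # l)))) s" if "{a, b, c} \<subseteq> {i, Suc i}" for a b c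
    proof -
      have lt: "a < length s" "b < length s" "c < length s" using that True by auto
      have "T_op q a (T_op q b (T_op q c f)) (z # s) =
        T_op q a (\<lambda>l. T_op q b (T_op q c f) (z # l)) s"
        using lt by (simp add: T_op_Cons)
      also have "\<dots> = T_op q a (\<lambda>l. T_op q b (\<lambda>l. T_op q c f (z # l)) l) s"
        using Cons(2) lt by (intro T_op_cong) (auto simp: T_op_Cons)
      also have "\<dots> = T_op q a (\<lambda>l. T_op q b (T_op q c (\<lambda>l. f (z # l))) l) s"
        using Cons(2) lt by (intro T_op_cong) (auto simp: T_op_Cons)
      finally show ?thesis by simp
    qed
    have "T_op q i (T_op q (Suc i) (T_op q i (\<lambda>l. f (z # l)))) s =
      T_op q (Suc i) (T_op q i (T_op q (Suc i) (\<lambda>l. f (z # l)))) s"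
      using Cons.prems True by (intro Cons.IH) auto
    then show ?thesis using *[of i "Suc i" i] *[of "Suc i" i "Suc i"] by simp
  next
    case False
    with Cons.prems obtain y x s' where s: "s = y # x # s'" "i = Suc (length s')"
      by (cases s; cases "tl s") auto
    note st = Cons.prems(1)[unfolded s]
    let ?N = "set s'"
    have len: "length (z # y # x # s') \<le> k" using Cons.prems(2) s by simp
    have x: "addable x ?N" and y: "addable y (insert x ?N)" and z: "addable z (insert y (insert x ?N))"
      using st by auto
    have N: "shape ?N" using st std_shape[of s'] by simp
    have ne: "x \<noteq> y" "x \<noteq> z" "y \<noteq> z" using std_distinct[OF st] by auto
    have z_x: "addable z (insert x ?N)" if "addable z ?N"
      using addable_both[OF N x that] ne by simp
    have z_y: "addable z (insert y ?N)" "addable y (insert z ?N)" if "addable z ?N" "addable y ?N"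
      using addable_both[OF N that(2,1)] addable_both[OF N that] ne by auto
    have y_z: "addable y ?N" if "addable y (insert z ?N)"
      using addable_meet[OF y that] ne by simp
    have z_n: "addable z ?N" if "addable z (insert x ?N)" "addable z (insert y ?N)"
      using addable_meet[OF that] ne by simp
    define a where "a = diag_entry q x y"
    define b where "b = diag_entry q y z"
    define c where "c = diag_entry q x z"
    define iq where "iq = inverse q"
    have qi: "q * iq = 1" using q_nonzero by (simp add: iq_def)
    have yx: "diag_entry q y x = q - iq - a"
      using diag_entry_swap[of y x s'] st len by (simp add: a_def iq_def)
    have zy: "diag_entry q z y = q - iq - b"
      using diag_entry_swap[OF st len] by (simp add: b_def iq_def)
    have yb: "a * b + (q - iq) * c - c * (a + b) = 0"
      using diag_entry_braid[OF st len] by (simp add: a_def b_def c_def iq_def)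
    have na: "(q - a) * (iq + a) = 0" if "\<not> addable y ?N"
    proof -
      have "a * a = (q - iq) * a + 1"
        using diag_entry_not_addable[of y x s'] st that by (simp add: a_def iq_def)
      with qi show ?thesis by (simp add: algebra_simps)
    qed
    have nb: "(q - b) * (iq + b) = 0" if "\<not> addable z (insert x ?N)"
    proof -
      have "b * b = (q - iq) * b + 1"
        using diag_entry_not_addable[OF st] that by (simp add: b_def iq_def)
      with qi show ?thesis by (simp add: algebra_simps)
    qed
    define f1 where "f1 = f (z # y # x # s')"
    define f2 where "f2 = f (z # x # y # s')"
    define f3 where "f3 = f (y # z # x # s')"
    define f4 where "f4 = f (y # x # z # s')"
    define f5 where "f5 = f (x # z # y # s')"
    define f6 where "f6 = f (x # y # z # s')"
    note defs = a_def[symmetric] b_def[symmetric] c_def[symmetric] iq_def[symmetric]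
      f1_def[symmetric] f2_def[symmetric] f3_def[symmetric] f4_def[symmetric] f5_def[symmetric]
      f6_def[symmetric]
    show ?thesis
    proof (cases "addable y ?N"; cases "addable z (insert x ?N)")
      assume A: "addable y ?N" and B: "addable z (insert x ?N)"
      show ?thesis
      proof (cases "addable z ?N")
        case True
        show ?thesis unfolding s
          by (simp add: A B x y z_y[OF True A] True yx zy defs insert_commute) (rule eq_by_cofactors[OF yb, where t = "(a - b) * f1 + (q - a) * f2 - (q - b) * f3"
              and z = 0], simp_all add: algebra_simps)
      next
        case False
        have "\<not> addable z (insert y ?N)" using False B z_n by blast
        then show ?thesis unfolding s
          by (simp add: A B x y False yx zy defs insert_commute) (rule eq_by_cofactors[OF yb, where t = "(a - b) * f1 + (q - a) * f2 - (q - b) * f3"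
              and z = 0], simp_all add: algebra_simps)
      qed
    next
      assume A: "addable y ?N" and B: "\<not> addable z (insert x ?N)"
      have "\<not> addable z ?N" using z_x B by blast
      then show ?thesis unfolding s
        by (cases "addable z (insert y ?N)")
          (simp add: A B x y yx zy defs insert_commute; rule eq_by_cofactors[OF yb nb[OF B], where t = "(a - b) * f1 + (q - a) * f2"
            and u = "c * f1"]; simp add: algebra_simps)+
    next
      assume A: "\<not> addable y ?N" and B: "addable z (insert x ?N)"
      have "\<not> addable y (insert z ?N)" using y_z A by blast
      then show ?thesis unfolding s
        by (cases "addable z ?N")
          (simp add: A B x y yx zy defs insert_commute; rule eq_by_cofactors[OF yb na[OF A], where t = "(a - b) * f1 - (q - b) * f3"
            and u = "- c * f1"]; simp add: algebra_simps)+
    next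
      assume A: "\<not> addable y ?N" and B: "\<not> addable z (insert x ?N)"
      \<comment> \<open>The three boxes lie in one row or in one column: different roots would contradict \<open>yb\<close>.\<close>
      have "a = q \<or> a = - iq" "b = q \<or> b = - iq"
        using na[OF A] nb[OF B] by (auto simp: eq_neg_iff_add_eq_0 add.commute)
      moreover have False if "a * b = - 1" "a + b = q - iq"
        using yb by (simp add: that)
      moreover have "q * - iq = - 1" "- iq * q = - 1" using qi by (simp_all add: mult.commute)
      ultimately have eq: "a = b" by (metis add.commute add_uminus_conv_diff)
      show ?thesis unfolding s
        by (simp add: A B x y yx zy defs insert_commute)
          (simp add: eq)
    qed
  qed
qed auto

lemma T_far_commute:
  assumes "std l" "1 \<le> j" "Suc j < i" "i < length l"
  shows "T_op q i (T_op q j f) l = T_op q j (T_op q i f) l"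
  using assms
proof (induction l arbitrary: f)
  case (Cons y s)
  have j: "j < length s" using Cons.prems by simp
  show ?case
  proof (cases "i < length s")
    case True
    have "T_op q i (T_op q j f) (y # s) = T_op q i (T_op q j (\<lambda>l. f (y # l))) s"
      using True j Cons.prems(1) by (auto simp: T_op_Cons intro!: T_op_cong)
    also have "\<dots> = T_op q j (T_op q i (\<lambda>l. f (y # l))) s"
      using Cons True by simp
    also have "\<dots> = T_op q j (T_op q i f) (y # s)"
      using True j Cons.prems(1) by (auto simp: T_op_Cons intro!: T_op_cong)
    finally show ?thesis .
  next
    case False
    with Cons.prems obtain x s' where s: "s = x # s'" "i = Suc (length s')" by (cases s) auto
    note st = Cons.prems(1)[unfolded s]
    have j': "j < length s'" using Cons.prems s by simp
    have "T_op q j (T_op q i f) (y # x # s') = T_op q j (\<lambda>l. T_op q i f (y # x # l)) s'"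
      using j' by (simp add: T_op_Cons)
    also have "\<dots> = T_op q j (\<lambda>l. diag_entry q x y * f (y # x # l)
        + (if addable y (set l) then (q - diag_entry q x y) * f (x # y # l) else 0)) s'"
      using st s by (intro T_op_cong) auto
    also have "\<dots> = diag_entry q x y * T_op q j (\<lambda>l. f (y # x # l)) s'
        + (if addable y (set s') then (q - diag_entry q x y) * T_op q j (\<lambda>l. f (x # y # l)) s' else 0)"
      using st by (simp add: T_op_add T_op_scale T_op_set[where C = "addable y"])
    also have "\<dots> = T_op q i (T_op q j f) (y # x # s')"
      using s j' by (simp add: T_op_Cons)
    finally show ?thesis using s by simp
  qed
qed simp

lemma P_T_commute:
  assumes "std l" "i < j" "j < length l"
  shows "P_op i (T_op q j f) l = T_op q j (P_op i f) l"
  using assms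
proof (induction l arbitrary: f)
  case (Cons y s)
  have i: "i \<le> length s" using Cons.prems by simp
  show ?case
  proof (cases "j < length s")
    case True
    have "P_op i (T_op q j f) (y # s) = P_op i (\<lambda>l. T_op q j f (y # l)) s"
      using i by (simp add: P_op_Cons)
    also have "\<dots> = P_op i (T_op q j (\<lambda>l. f (y # l))) s"
      using True by (simp add: P_op_def T_op_Cons)
    also have "\<dots> = T_op q j (P_op i (\<lambda>l. f (y # l))) s"
      using Cons True by simp
    also have "\<dots> = T_op q j (P_op i f) (y # s)"
      using True i Cons.prems(1) by (auto simp: T_op_Cons P_op_Cons intro!: T_op_cong)
    finally show ?thesis .
  next
    case False
    with Cons.prems obtain x s' where s: "s = x # s'" "j = Suc (length s')" by (cases s) auto
    then have "i \<le> length s'" using Cons.prems by simp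
    with s show ?thesis by (simp add: P_op_def Suc_diff_le)
  qed
qed simp

text \<open>A shape contained in the first diagram is a row.\<close>

lemma shape_row_content:
  assumes "shape N" "addable b N" "\<forall>x\<in>insert b N. fst x = 1"
  shows "b = (1, 1, Suc (card N))"
proof -
  obtain r c where b: "b = (1, r, c)" using assms(3) by (cases b) auto
  have sh: "shape (insert b N)" using assms(2) by (simp add: addable_def)
  have row: "r = 1" "1 \<le> c" using shape_valid[OF sh, of 1 r c] by (auto simp: b)
  have "insert b N = (\<lambda>c. (1, 1, c)) ` {1..c}"
  proof
    have "(1, 1, c') \<in> insert b N" if "1 \<le> c'" "c' \<le> c" for c'
      using shape_down[OF sh, of 1 r c 1 c'] row that by (simp add: b)
    then show "(\<lambda>c. (1, 1, c)) ` {1..c} \<subseteq> insert b N"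
      by (intro image_subsetI) (metis atLeastAtMost_iff)
    show "insert b N \<subseteq> (\<lambda>c. (1, 1, c)) ` {1..c}"
    proof
      fix x assume x: "x \<in> insert b N"
      obtain r' c' where xe: "x = (1, r', c')" using assms(3) x by (cases x) auto
      have r': "r' = 1" "1 \<le> c'" using shape_valid[OF sh, of 1 r' c'] x by (auto simp: xe)
      have "c' \<le> c"
      proof (rule ccontr)
        assume "\<not> c' \<le> c"
        then have "x \<in> N" using x by (auto simp: xe b)
        then have "b \<in> N" using shape_down[OF assms(1), of 1 r' c' 1 c] \<open>\<not> c' \<le> c\<close> row r' by (auto simp: xe b)
        with assms(2) show False by (simp add: addable_def)
      qed
      with r' xe show "x \<in> (\<lambda>c. (1, 1, c)) ` {1..c}" by auto
    qed
  qed
  then have "card (insert b N) = c" by (simp add: card_image inj_on_def)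
  moreover have "card (insert b N) = Suc (card N)"
    using assms by (simp add: addable_def shape_finite)
  ultimately show ?thesis using b row by simp
qed

lemma T_row:
  assumes "std l" "\<forall>b\<in>set l. fst b = 1" "1 \<le> j" "j < length l"
  shows "T_op q j f l = q * f l"
  using assms
proof (induction l arbitrary: f)
  case (Cons y s)
  show ?case
  proof (cases "j < length s")
    case True
    with Cons show ?thesis by (simp add: T_op_Cons)
  next
    case False
    with Cons.prems obtain x s' where s: "s = x # s'" "j = Suc (length s')" by (cases s) auto
    have st: "std (y # x # s')" using Cons.prems(1) s by simp
    have x: "x = (1, 1, Suc (card (set s')))"
      using st Cons.prems(2) s by (intro shape_row_content[OF std_shape[of s']]) auto
    have y: "y = (1, 1, Suc (card (set (x # s'))))"
      using st Cons.prems(2) s by (intro shape_row_content[OF std_shape[of "x # s'"]]) auto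
    have c: "card (set (x # s')) = Suc (card (set s'))" using st std_card[of "x # s'"] std_card[of s'] by simp
    have "\<not> addable y (set s')"
    proof
      assume a: "addable y (set s')"
      have "y = (1, 1, Suc (card (set s')))"
        using st Cons.prems(2) s by (intro shape_row_content[OF std_shape[of s'] a]) auto
      with y c show False by simp
    qed
    moreover have "diag_entry q x y = q"
      unfolding y c using qnum_1[OF q_nonzero] by (simp add: diag_entry_def x content_def)
    ultimately show ?thesis using s by simp
  qed
qed simp

text \<open>On the image of \<open>P\<^sub>i\<close> the first \<open>i\<close> entries form a row, where \<open>T\<^sub>j\<close> is multiplication by \<open>q\<close>.\<close>

lemma P_absorb:
  assumes "std l" "1 \<le> j" "j < i" "i \<le> length l"
  shows "P_op i (T_op q j f) l = q * P_op i f l \<and> T_op q j (P_op i f) l = q * P_op i f l"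
  using assms
proof (induction l arbitrary: f)
  case (Cons y s)
  show ?case
  proof (cases "i \<le> length s")
    case True
    have j: "j < length s" using True Cons.prems by simp
    have "P_op i (T_op q j f) (y # s) = P_op i (T_op q j (\<lambda>l. f (y # l))) s"
      using True j by (simp add: P_op_Cons) (simp add: P_op_def T_op_Cons)
    moreover have "T_op q j (P_op i f) (y # s) = T_op q j (P_op i (\<lambda>l. f (y # l))) s"
      using True j Cons.prems(1) by (auto simp: T_op_Cons P_op_Cons intro!: T_op_cong)
    ultimately show ?thesis using Cons True by (simp add: P_op_Cons)
  next
    case False
    with Cons.prems have i: "i = length (y # s)" by simp
    let ?C = "\<lambda>N. \<forall>b\<in>N. fst (b :: box) = 1"
    have "T_op q j (P_op i f) (y # s) = T_op q j (\<lambda>l. if ?C (set l) then f l else 0) (y # s)"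
      using i by (intro T_op_cong Cons.prems(1)) (simp add: P_op_length)
    also have "\<dots> = (if ?C (set (y # s)) then T_op q j f (y # s) else 0)"
      by (rule T_op_set[OF Cons.prems(1)])
    finally show ?thesis
      using T_row[OF Cons.prems(1), of j f] Cons.prems i by (simp add: P_op_length)
  qed
qed simp

text \<open>If the first \<open>i\<close> entries form a row, the diagonal entry of \<open>T\<^sub>i\<close> is \<open>q\<close> or \<open>h\<close> according to whether
  \<open>i + 1\<close> continues the row or starts the second diagram.\<close>

lemma P_Suc:
  assumes "std l" "1 \<le> i" "i < length l"
  shows "P_op (Suc i) f l = q * (P_op i (T_op q i (P_op i f)) l - h * P_op i f l)"
  using assms
proof (induction l arbitrary: f)
  case (Cons y s)
  show ?case
  proof (cases "i < length s")
    case True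
    have "P_op i (T_op q i (P_op i f)) (y # s) = P_op i (T_op q i (P_op i (\<lambda>l. f (y # l)))) s"
    proof -
      have "T_op q i (P_op i f) (y # s) = T_op q i (P_op i (\<lambda>l. f (y # l))) s"
        using True Cons.prems(1) by (auto simp: T_op_Cons P_op_Cons intro!: T_op_cong)
      then show ?thesis using True by (simp add: P_op_def Suc_diff_le)
    qed
    then show ?thesis using Cons True by (simp add: P_op_Cons)
  next
    case False
    with Cons.prems obtain x s' where s: "s = x # s'" "i = Suc (length s')" by (cases s) auto
    have st: "std (y # x # s')" using Cons.prems(1) s by simp
    have iq: "inverse q * q = 1" using q_nonzero by simp
    show ?thesis
    proof (cases "\<forall>b\<in>set (x # s'). fst b = 1")
      case False
      then have "\<not> (\<forall>b\<in>set s. fst b = 1)" "\<not> (\<forall>b\<in>set (y # s). fst b = 1)" using s by auto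
      then show ?thesis using s by (auto simp: P_op_def)
    next
      case True
      show ?thesis
      proof (cases "fst y = 1")
        case y: True
        have all: "\<forall>b\<in>set (y # x # s'). fst b = 1" using True y by simp
        have "T_op q i (P_op i f) (y # x # s') = q * P_op i f (y # x # s')"
          using s by (intro T_row[OF st all]) auto
        moreover have "P_op i g (y # s) = g (y # s)" for g
          using True s by (simp add: P_op_def)
        moreover have "P_op (Suc i) f (y # s) = f (y # s)"
          using all s by (simp add: P_op_def)
        moreover have "q * (q * c - h * c) = c" for c
          using q_nonzero by (simp add: algebra_simps)
        ultimately show ?thesis using s by simp
      next
        case y: False
        then have "fst y = 2" using std_comp[OF st, of y] by auto
        then show ?thesis using s True by (auto simp: P_op_def diag_entry_def)
      qed
    qed
  qed
qed simp

text \<open>The formula for \<open>(T\<^sub>i)\<^sub>L\<^sub>L\<close> with the denominator cleared, so that it also holds for \<open>q\<^sup>2 = 1\<close>.\<close>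

lemma diag_entry_CT:
  assumes "std (y # x # s)" "length (y # x # s) \<le> k"
  shows "diag_entry q x y * (CT q y - CT q x) = h * CT q y"
proof -
  obtain j r c where x: "x = (j, r, c)" by (cases x)
  obtain j' r' c' where y: "y = (j', r', c')" by (cases y)
  have comp: "j \<in> {1, 2}" "j' \<in> {1, 2}"
    using std_comp[OF assms(1), of x] std_comp[OF assms(1), of y] by (auto simp: x y)
  show ?thesis
  proof (cases "j = 2 \<and> j' = 2")
    case True
    define d where "d = content y - content x"
    have nz: "qnum q d \<noteq> 0"
      using qnum_content_nonzero[OF assms, of x y] std_pair_content[OF assms(1)] True
      by (simp add: x y d_def)
    have "q powi (2 * content y) * q powi (- 2 * d) = q powi (2 * content x)"
      using q_nonzero by (simp flip: power_int_add add: d_def algebra_simps)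
    then have "CT q x = CT q y * q powi (- 2 * d)" using True by (simp add: x y content_def)
    moreover have "h * qnum q d = 1 - q powi (- 2 * d)"
    proof (cases "q\<^sup>2 = 1")
      case True
      then have "q powi (2 * n) = 1" for n using q_nonzero by (simp add: power_int_mult)
      from this[of "- d"] True show ?thesis by (simp add: inverse_of_square_one)
    next
      case False
      then show ?thesis using hecke_param_eq_0_iff[OF q_nonzero] by (simp add: qnum_def)
    qed
    moreover have "CT q y - CT q y * p = CT q y * (1 - p)" for p by (simp add: algebra_simps)
    ultimately have "CT q y - CT q x = CT q y * (h * qnum q d)" by simp
    moreover have "diag_entry q x y = inverse (qnum q d)" using True by (simp add: diag_entry_def x y d_def)
    ultimately show ?thesis using nz by simp
  next
    case False
    with comp show ?thesis by (auto simp: x y diag_entry_def)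
  qed
qed

text \<open>The recursion \<open>X\<^sub>i\<^sub>+\<^sub>1 = T\<^sub>i X\<^sub>i T\<^sub>i\<close> on the level of eigenvalues.\<close>

lemma T_CT_T:
  assumes "std l" "length l \<le> k" "1 \<le> i" "i < length l"
  shows "T_op q i (\<lambda>l. CT q (l ! (length l - i)) * T_op q i f l) l =
    CT q (l ! (length l - Suc i)) * f l"
  using assms
proof (induction l arbitrary: f)
  case (Cons y s)
  show ?case
  proof (cases "i < length s")
    case True
    have "T_op q i (\<lambda>l. CT q (l ! (length l - i)) * T_op q i f l) (y # s) =
      T_op q i (\<lambda>l. CT q (l ! (length l - i)) * T_op q i (\<lambda>l. f (y # l)) l) s"
      using True Cons.prems(1) by (auto simp: T_op_Cons Suc_diff_le intro!: T_op_cong)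
    also have "\<dots> = CT q (s ! (length s - Suc i)) * f (y # s)"
      using Cons True by simp
    finally show ?thesis using True by (simp add: Suc_diff_Suc)
  next
    case False
    with Cons.prems obtain x s' where s: "s = x # s'" "i = Suc (length s')" by (cases s) auto
    note st = Cons.prems(1)[unfolded s]
    have len: "length (y # x # s') \<le> k" using Cons.prems(2) s by simp
    have sw: "diag_entry q y x = h - diag_entry q x y"
      using diag_entry_swap[OF st] Cons.prems(2) s by simp
    have x: "addable x (set s')" using st by simp
    define a where "a = diag_entry q x y"
    define iq where "iq = inverse q"
    define u where "u = f (y # x # s')"
    define v where "v = f (x # y # s')"
    define cx where "cx = CT q x"
    define cy where "cy = CT q y"
    note defs = a_def[symmetric] iq_def[symmetric] u_def[symmetric] v_def[symmetric]
      cx_def[symmetric] cy_def[symmetric]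
    have qi: "q * iq - 1 = 0" using q_nonzero by (simp add: iq_def)
    have ct: "a * (cy - cx) - (q - iq) * cy = 0"
      using diag_entry_CT[OF st len] by (simp add: defs)
    show ?thesis
    proof (cases "addable y (set s')")
      case True
      show ?thesis unfolding s
        by (simp add: True x sw defs)
          (rule eq_by_cofactors[OF qi ct, where t = "cy * u" and u = "- a * u - (q - a) * v"],
            simp add: algebra_simps)
    next
      case False
      have "a * a - ((q - iq) * a + 1) = 0"
        using diag_entry_not_addable[OF st False] by (simp add: defs)
      from eq_by_cofactors[OF this ct, where l = "a * a * cx" and r = cy and t = cy and u = "- a"]
      have "a * a * cx = cy" by (simp add: algebra_simps)
      then show ?thesis unfolding s
        by (simp add: False x defs) (metis mult.assoc mult.commute)
    qed
  qed
qed simp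

lemma P_1_CT:
  assumes "std l" "l \<noteq> []"
  shows "f l - P_op 1 f l = CT q (l ! (length l - 1)) * f l"
  using assms
proof (induction l arbitrary: f)
  case (Cons y s)
  show ?case
  proof (cases "s = []")
    case False
    then show ?thesis using Cons by (simp add: P_op_Cons Suc_leI)
  next
    case True
    obtain j r c where y: "y = (j, r, c)" by (cases y)
    have sh: "shape {y}" using Cons.prems True by (simp add: addable_def)
    from shape_valid[OF sh, of j r c] have v: "j = 1 \<or> j = 2" "1 \<le> r" "1 \<le> c" by (auto simp: y)
    from shape_down[OF sh, of j r c 1 1] v have "r = 1" "c = 1" by (auto simp: y)
    with v True show ?thesis by (auto simp: y P_op_def)
  qed
qed simp

end


section \<open>Matrices of the elements of the free algebra\<close>

definition fscale :: "complex \<Rightarrow> ('x \<Rightarrow> complex) \<Rightarrow> 'x \<Rightarrow> complex" where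
  "fscale c f = (\<lambda>x. c * f x)"

lemma fscale_apply: "fscale c f x = c * f x"
  by (simp add: fscale_def)

lemma sum_fun_apply: "(\<Sum>i\<in>A. f i) x = (\<Sum>i\<in>A. f i x)"
  for f :: "'i \<Rightarrow> 'x \<Rightarrow> 'y::comm_monoid_add"
  by (induction A rule: infinite_finite_induct) auto

lemma vector_space_fscale: "vector_space fscale"
  by standard (auto simp: fun_eq_iff fscale_apply algebra_simps)

lemma module_fscale: "Modules.module fscale"
  by standard (auto simp: fun_eq_iff fscale_apply algebra_simps)

definition gen_op :: "complex \<Rightarrow> rook_gen \<Rightarrow> (box list \<Rightarrow> complex) \<Rightarrow> box list \<Rightarrow> complex" where
  "gen_op q g = (case g of GenP i \<Rightarrow> P_op i | GenT i \<Rightarrow> T_op q i)"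

lemma gen_op_simps [simp]: "gen_op q (GenP i) = P_op i" "gen_op q (GenT i) = T_op q i"
  by (simp_all add: gen_op_def)

lemma free_action_gen_op: "free_action fscale (gen_op q)"
proof (intro free_action.intro module_fscale free_action_axioms.intro ext)
  fix g v w l c
  show "gen_op q g (v + w) l = (gen_op q g v + gen_op q g w) l"
    by (cases g) (auto simp: P_op_def T_op_add plus_fun_def)
  show "gen_op q g (fscale c v) l = fscale c (gen_op q g v) l"
    by (cases g) (auto simp: P_op_def T_op_scale fscale_def)
qed

definition St :: "nat \<Rightarrow> box list set" where
  "St n = {l. std l \<and> length l = n}"

lemma St_0 [simp]: "St 0 = {[]}"
  by (auto simp: St_def)

lemma Cons_in_St: "b # s \<in> St (Suc n) \<longleftrightarrow> s \<in> St n \<and> addable b (set s)"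
  by (auto simp: St_def)

lemma St_SucE:
  assumes "l \<in> St (Suc n)"
  obtains b s where "l = b # s" "s \<in> St n" "addable b (set s)"
  using assms by (cases l) (auto simp: St_def)

lemma addable_cases:
  assumes "shape N" "addable b N"
  shows "b \<in> {(1, 1, 1), (2, 1, 1)} \<union> (\<lambda>(j, r, c). (j, r, Suc c)) ` N \<union> (\<lambda>(j, r, c). (j, Suc r, c)) ` N"
proof -
  obtain j r c where b: "b = (j, r, c)" by (cases b)
  have sh: "shape (insert b N)" using assms by (simp add: addable_def)
  have v: "j = 1 \<and> r = 1 \<or> j = 2 \<and> 1 \<le> r" "1 \<le> c" using shape_valid[OF sh, of j r c] by (auto simp: b)
  show ?thesis
  proof (cases "c = 1")
    case False
    then have "(j, r, c - 1) \<in> insert b N" "(j, r, c - 1) \<noteq> b"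
      using shape_down[OF sh, of j r c r "c - 1"] v by (auto simp: b)
    then have "(j, r, c - 1) \<in> N" by simp
    then have "b \<in> (\<lambda>(j, r, c). (j, r, Suc c)) ` N"
      using v False by (intro image_eqI[of _ _ "(j, r, c - 1)"]) (auto simp: b)
    then show ?thesis by simp
  next
    case c: True
    show ?thesis
    proof (cases "r = 1")
      case False
      then have "(j, r - 1, c) \<in> insert b N" "(j, r - 1, c) \<noteq> b"
        using shape_down[OF sh, of j r c "r - 1" c] v by (auto simp: b)
      then have "(j, r - 1, c) \<in> N" by simp
      then have "b \<in> (\<lambda>(j, r, c). (j, Suc r, c)) ` N"
        using v False by (intro image_eqI[of _ _ "(j, r - 1, c)"]) (auto simp: b)
      then show ?thesis by simp
    qed (use c v b in auto)
  qed
qed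

lemma finite_addable: "shape N \<Longrightarrow> finite {b. addable b N}"
  by (rule finite_subset[OF subsetI[OF addable_cases]]) (auto simp: shape_finite)

lemma finite_St: "finite (St n)"
proof (induction n)
  case (Suc n)
  have "St (Suc n) \<subseteq> (\<Union>s\<in>St n. (\<lambda>b. b # s) ` {b. addable b (set s)})"
    by (auto elim!: St_SucE)
  moreover have "finite (\<Union>s\<in>St n. (\<lambda>b. b # s) ` {b. addable b (set s)})"
    using Suc finite_addable std_shape by (auto simp: St_def)
  ultimately show ?case by (rule finite_subset)
qed simp

text \<open>The element \<open>X\<^sub>i\<^sub>+\<^sub>1\<close>; with this index it commutes with the generators of rank \<open>i\<close>.\<close>

primrec X_elt :: "nat \<Rightarrow> free_elt" where
  "X_elt 0 = 1 - genP 1"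
| "X_elt (Suc i) = genT (Suc i) * X_elt i * genT (Suc i)"

lemma X_elt_prod_list:
  "prod_list (map genT (rev [1..<Suc i])) * (1 - genP 1) * prod_list (map genT [1..<Suc i]) = X_elt i"
proof (induction i)
  case (Suc i)
  have "[1..<Suc (Suc i)] = [1..<Suc i] @ [Suc i]" by simp
  then show ?case by (simp only: rev_append map_append prod_list.append X_elt.simps flip: Suc)
      (simp add: mult.assoc)
qed simp

lemma X_elt_closed: "i < n \<Longrightarrow> X_elt i \<in> carrier (free_algebra n)"
  by (induction i) (auto intro!: free_algebra_closed one_closed genP_closed genT_closed)

definition unit_fun :: "'x \<Rightarrow> 'x \<Rightarrow> complex" where
  "unit_fun l = (\<lambda>m. if m = l then 1 else 0)"

context seminormal
begin

sublocale op: free_action fscale "gen_op q"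
  by (rule free_action_gen_op)

abbreviation op where "op \<equiv> op.act"

lemma op_cong:
  assumes "std l" and "\<And>l'. std l' \<Longrightarrow> length l' = length l \<Longrightarrow> set l' = set l \<Longrightarrow> g l' = g' l'"
  shows "op f g l = op f g' l"
proof -
  have "word_act (gen_op q) w g l = word_act (gen_op q) w g' l"
    if "std l" "\<And>l'. std l' \<Longrightarrow> length l' = length l \<Longrightarrow> set l' = set l \<Longrightarrow> g l' = g' l'" for w l
    using that
  proof (induction w arbitrary: l)
    case (Cons x w)
    show ?case
    proof (cases x)
      case (GenP i)
      then show ?thesis using Cons by (simp add: P_op_def)
    next
      case (GenT i)
      then show ?thesis using Cons by (auto intro!: T_op_cong)
    qed
  qed simp
  with assms show ?thesis by (simp add: op.act_def fscale_apply sum_fun_apply)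
qed

lemma op_Cons:
  assumes f: "f \<in> carrier (free_algebra n)" and s: "std (y # s)" "length s = n"
  shows "op f g (y # s) = op f (\<lambda>l. g (y # l)) s"
  using f
proof (induction rule: free_algebra_induct)
  case (single w c)
  have "word_act (gen_op q) u g (y # s) = word_act (gen_op q) u (\<lambda>l. g (y # l)) s"
    if "set u \<subseteq> rook_gens n" "std (y # s)" "length s = n" for u s
    using that
  proof (induction u arbitrary: s)
    case (Cons x u)
    show ?case
    proof (cases x)
      case (GenP i)
      with Cons(2,4) have "i \<le> length s" by (auto simp: rook_gens_def)
      with GenP Cons show ?thesis by (simp add: P_op_Cons) (simp add: P_op_def)
    next
      case (GenT i)
      with Cons(2,4) have "i < length s" by (auto simp: rook_gens_def)
      with GenT Cons show ?thesis by (auto simp: T_op_Cons intro!: T_op_cong)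
    qed
  qed simp
  from this[OF single s] show ?case by (simp add: op.act_single) (simp add: fscale_apply)
next
  case (add f f')
  then show ?case by (simp add: op.act_add_left)
qed

lemma op_apply_simps:
  "op (f + f') g l = op f g l + op f' g l" "op (f - f') g l = op f g l - op f' g l"
  "op (f * f') g l = op f (op f' g) l" "op (scal c) g l = c * g l"
  by (simp_all add: op.act_add_left op.act_diff_left op.act_mult fscale_apply)

lemma op_sum: "op (\<Sum>x\<in>A. f x) g l = (\<Sum>x\<in>A. op (f x) g l)"
  by (simp add: op.act_sum_left sum_fun_apply)

text \<open>The relations hold on tableaux with at most \<open>k\<close> boxes, where all denominators are nonzero.\<close>

lemma op_relation:
  assumes r: "r \<in> rook_relations n q" and l: "l \<in> St n" and n: "n \<le> k"
  shows "op r g l = 0"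
proof -
  have l': "std l" "length l = n" using l by (auto simp: St_def)
  have one: "op 1 g l = g l" for g by simp
  note simps = op_apply_simps one op.act_genT op.act_genP gen_op_simps
  show ?thesis
    using r unfolding rook_relations_def
  proof (elim UnE CollectE exE conjE)
    fix i assume r: "r = genT i * genT i - (scal (q - inverse q) * genT i + 1)" "1 \<le> i" "i + 1 \<le> n"
    show ?thesis using T_quadratic[of l i g] l' n r(2,3)
      by (simp add: r(1) simps del: op.act_scal)
  next
    fix i assume r: "r = genT i * genT (i+1) * genT i - genT (i+1) * genT i * genT (i+1)"
      "1 \<le> i" "i + 2 \<le> n"
    show ?thesis using T_braid[of l i g] l' n r(2,3)
      by (simp add: r(1) simps del: op.act_scal)
  next
    fix i j assume r: "r = genT i * genT j - genT j * genT i" "1 \<le> i" "i + 1 \<le> n" "1 \<le> j"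
      "j + 1 \<le> n" "1 < \<bar>int i - int j\<bar>"
    show ?thesis
    proof (cases "i < j")
      case True
      then show ?thesis using T_far_commute[of l i j g] l' n r(2-) by (simp add: r(1) simps del: op.act_scal)
    next
      case False
      then show ?thesis using T_far_commute[of l j i g] l' n r(2-) by (simp add: r(1) simps del: op.act_scal)
    qed
  next
    fix i assume r: "r = genP i * genP i - genP i"
    show ?thesis by (simp add: r simps P_op_def)
  next
    fix i j assume r: "r = genP i * genP j - genP j * genP i"
    show ?thesis by (simp add: r simps P_op_def)
  next
    fix i j assume r: "r = genP i * genT j - genT j * genP i" "1 \<le> i" "i < j" "j + 1 \<le> n"
    show ?thesis using P_T_commute[of l i j g] l' n r(2-) by (simp add: r(1) simps del: op.act_scal)
  next
    fix i j assume r: "r = genP i * genT j - genT j * genP i" "1 \<le> j" "j < i" "i \<le> n"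
    show ?thesis using P_absorb[of l j i g] l' n r(2-) by (simp add: r(1) simps del: op.act_scal)
  next
    fix i j assume r: "r = genT j * genP i - scal q * genP i" "1 \<le> j" "j < i" "i \<le> n"
    show ?thesis using P_absorb[of l j i g] l' n r(2-) by (simp add: r(1) simps del: op.act_scal)
  next
    fix i assume r: "r = genP (i+1) - scal q * (genP i * genT i * genP i - scal (q - inverse q) * genP i)"
      "1 \<le> i" "i + 1 \<le> n"
    show ?thesis using P_Suc[of l i g] l' n r(2-) by (simp add: r(1) simps del: op.act_scal)
  qed
qed

lemma op_X_elt:
  assumes "std l" "length l \<le> k" "i < length l"
  shows "op (X_elt i) g l = CT q (l ! (length l - Suc i)) * g l"
  using assms
proof (induction i arbitrary: l g)
  case 0
  then show ?case using P_1_CT[of l g] by (auto simp: op_apply_simps)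
next
  case (Suc i)
  have "op (X_elt (Suc i)) g l = T_op q (Suc i) (op (X_elt i) (T_op q (Suc i) g)) l"
    by (simp add: op.act_mult)
  also have "\<dots> = T_op q (Suc i) (\<lambda>l. CT q (l ! (length l - Suc i)) * T_op q (Suc i) g l) l"
    using Suc by (intro T_op_cong) auto
  also have "\<dots> = CT q (l ! (length l - Suc (Suc i))) * g l"
    using T_CT_T[of l "Suc i" g] Suc.prems by simp
  finally show ?case .
qed

definition mat :: "free_elt \<Rightarrow> box list \<Rightarrow> box list \<Rightarrow> complex" where
  "mat f l m = op f (unit_fun m) l"

lemma mat_eq_0: "std l \<Longrightarrow> set m \<noteq> set l \<Longrightarrow> mat f l m = 0"
proof -
  assume "std l" "set m \<noteq> set l"
  then have "op f (unit_fun m) l = op f 0 l"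
    by (intro op_cong) (auto simp: unit_fun_def)
  then show ?thesis by (simp add: mat_def)
qed

lemma op_eq_mat:
  assumes l: "l \<in> St n"
  shows "op f g l = (\<Sum>m\<in>St n. mat f l m * g m)"
proof -
  have "op f g l = op f (\<Sum>m\<in>St n. fscale (g m) (unit_fun m)) l"
  proof (rule op_cong)
    show "std l" using l by (simp add: St_def)
    fix l' assume "std l'" "length l' = length l"
    then have "l' \<in> St n" using l by (simp add: St_def)
    then show "g l' = (\<Sum>m\<in>St n. fscale (g m) (unit_fun m)) l'"
      by (simp add: sum_fun_apply fscale_apply unit_fun_def finite_St if_distrib cong: if_cong)
  qed
  then show ?thesis
    by (simp add: op.act_sum_right op.act_scale sum_fun_apply mat_def)
      (simp add: fscale_apply mult.commute)
qed

lemma mat_simps: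
  "mat (f + f') l m = mat f l m + mat f' l m" "mat (f - f') l m = mat f l m - mat f' l m"
  "mat (scal c * f) l m = c * mat f l m" "mat 1 l m = (if l = m then 1 else 0)"
  "mat 0 l m = 0"
  by (simp_all add: mat_def op_apply_simps unit_fun_def del: op.act_scal)

lemma mat_sum: "mat (\<Sum>x\<in>A. f x) l m = (\<Sum>x\<in>A. mat (f x) l m)"
  by (simp add: mat_def op_sum)

lemma mat_mult: "l \<in> St n \<Longrightarrow> mat (f * g) l m = (\<Sum>p\<in>St n. mat f l p * mat g p m)"
  using op_eq_mat[of l n f "op g (unit_fun m)"] by (simp add: mat_def op_apply_simps)

text \<open>Elements of rank \<open>n\<close> do not touch the box of \<open>n + 1\<close>.\<close>

lemma mat_Cons:
  assumes "f \<in> carrier (free_algebra n)" "y # s \<in> St (Suc n)"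
  shows "mat f (y # s) (z # m) = (if y = z then mat f s m else 0)"
proof -
  have "mat f (y # s) (z # m) = op f (\<lambda>l. unit_fun (z # m) (y # l)) s"
    unfolding mat_def using assms by (intro op_Cons) (auto simp: St_def)
  also have "(\<lambda>l. unit_fun (z # m) (y # l)) = (if y = z then unit_fun m else 0)"
    by (auto simp: unit_fun_def)
  also have "op f (if y = z then unit_fun m else 0) s = (if y = z then mat f s m else 0)"
    by (cases "y = z") (simp_all add: mat_def zero_fun_def[symmetric] del: zero_fun_def)
  finally show ?thesis .
qed

end


section \<open>All matrix units lie in the image\<close>

lemma addable_row_unique:
  assumes "addable b N" "addable b' N" "fst b = 1" "fst b' = 1"
  shows "b = b'"
proof -
  have *: "c = c'" if a: "addable (1, r, c) N" "addable (1, r', c') N" and "c \<le> c'" for r c r' c'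
  proof (rule ccontr)
    assume "c \<noteq> c'"
    have v: "r = 1" "1 \<le> c" "r' = 1"
      using shape_valid[of "insert (1, r, c) N" 1 r c] shape_valid[of "insert (1, r', c') N" 1 r' c'] a
      by (auto simp: addable_def)
    have "(1, r, c) \<in> insert (1, r', c') N"
      using shape_down[of "insert (1, r', c') N" 1 r' c' r c] a v \<open>c \<le> c'\<close> by (auto simp: addable_def)
    with \<open>c \<noteq> c'\<close> a show False by (auto simp: addable_def)
  qed
  obtain r c r' c' where b: "b = (1, r, c)" "b' = (1, r', c')" using assms(3,4) by (cases b; cases b') auto
  have "r = 1" "r' = 1"
    using shape_valid[of "insert b N" 1 r c] shape_valid[of "insert b' N" 1 r' c'] assms
    by (auto simp: addable_def b)
  moreover have "c = c'" using *[of r c r' c'] *[of r' c' r c] assms b by (cases "c \<le> c'") auto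
  ultimately show ?thesis using b by simp
qed

lemma addable_first:
  assumes "addable b N" "\<forall>x\<in>N. fst x \<noteq> fst b"
  shows "b = (fst b, 1, 1)"
proof -
  obtain j r c where b: "b = (j, r, c)" by (cases b)
  have sh: "shape (insert b N)" using assms by (simp add: addable_def)
  have "1 \<le> r" "1 \<le> c" using shape_valid[OF sh, of j r c] by (auto simp: b)
  then have "(j, 1, 1) \<in> insert b N" using shape_down[OF sh, of j r c 1 1] by (auto simp: b)
  with assms(2) show ?thesis by (auto simp: b)
qed

text \<open>Take a box of the given diagram with maximal sum of row and column.\<close>

lemma removable_exists:
  assumes N: "shape N" and x: "x \<in> N"
  shows "\<exists>b\<in>N. fst b = fst x \<and> shape (N - {b})"
proof -
  let ?m = "\<lambda>b::box. fst (snd b) + snd (snd b)"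
  let ?A = "{b \<in> N. fst b = fst x}"
  have "x \<in> ?A" using x by simp
  then have fin: "finite ?A" "?A \<noteq> {}" using shape_finite[OF N] by (simp, blast)
  have "Max (?m ` ?A) \<in> ?m ` ?A" using fin by (intro Max_in) auto
  then obtain b where b1: "b \<in> ?A" "Max (?m ` ?A) = ?m b" by (elim imageE)
  have b: "b \<in> ?A" "?m b' \<le> ?m b" if "b' \<in> ?A" for b'
    using b1 that fin(1) Max_ge[of "?m ` ?A" "?m b'"] by (simp_all only: finite_imageI image_eqI)
  have "shape (N - {b})"
    unfolding shape_def
  proof (intro conjI allI impI)
    show "finite (N - {b})" using shape_finite[OF N] by simp
    fix j r c assume m: "(j, r, c) \<in> N - {b}"
    then show "j = 1 \<and> r = 1 \<or> j = 2 \<and> 1 \<le> r" "1 \<le> c" using shape_valid[OF N, of j r c] by auto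
    fix r' c' assume le: "1 \<le> r' \<and> r' \<le> r \<and> 1 \<le> c' \<and> c' \<le> c"
    with m have "(j, r', c') \<in> N" using shape_down[OF N, of j r c r' c'] by auto
    moreover have "(j, r', c') \<noteq> b"
    proof
      assume eq: "(j, r', c') = b"
      with b1 m have "?m (j, r, c) \<le> ?m b" by (intro b(2)) auto
      with eq le have "(j, r, c) = b" by auto
      with m show False by simp
    qed
    ultimately show "(j, r', c') \<in> N - {b}" by simp
  qed
  with b1(1) show ?thesis by auto
qed

lemma std_exists: "shape N \<Longrightarrow> \<exists>l. std l \<and> set l = N"
proof (induction "card N" arbitrary: N)
  case 0
  then have "std [] \<and> set [] = N" using shape_finite[of N] by simp
  then show ?case by blast
next
  case (Suc n)
  then have "N \<noteq> {}" by auto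
  then obtain x where "x \<in> N" by blast
  then obtain b where b: "b \<in> N" "shape (N - {b})" using removable_exists Suc by blast
  have "n = card (N - {b})" using Suc(2) b(1) shape_finite[OF Suc(3)] by simp
  then obtain l where "std l" "set l = N - {b}" using Suc(1) b(2) by blast
  then have "std (b # l) \<and> set (b # l) = N" using b Suc(3) by (auto simp: addable_def insert_absorb)
  then show ?case by blast
qed

lemma St_exists: "shape N \<Longrightarrow> card N = n \<Longrightarrow> \<exists>l\<in>St n. set l = N"
  using std_exists[of N] std_card by (fastforce simp: St_def)

context seminormal
begin

definition matrix_unit :: "nat \<Rightarrow> box list \<Rightarrow> box list \<Rightarrow> free_elt \<Rightarrow> bool" where
  "matrix_unit n l l' f \<longleftrightarrow> f \<in> carrier (free_algebra n) \<and>
     (\<forall>m\<in>St n. \<forall>p\<in>St n. mat f m p = (if m = l \<and> p = l' then 1 else 0))"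

lemma matrix_unitD:
  assumes "matrix_unit n l l' f"
  shows "f \<in> carrier (free_algebra n)"
    "m \<in> St n \<Longrightarrow> p \<in> St n \<Longrightarrow> mat f m p = (if m = l \<and> p = l' then 1 else 0)"
  using assms by (auto simp: matrix_unit_def)

lemma matrix_unit_op:
  assumes e: "matrix_unit n l l' e" and m: "m \<in> St n" and l: "l' \<in> St n"
  shows "op e g m = (if m = l then g l' else 0)"
proof -
  have "op e g m = (\<Sum>p\<in>St n. if p = l' then (if m = l then g p else 0) else 0)"
    unfolding op_eq_mat[OF m] by (intro sum.cong) (auto simp: matrix_unitD(2)[OF e m])
  then show ?thesis using l by (simp add: finite_St)
qed

lemma mat_unit_mult_left:
  assumes e: "matrix_unit n s p e" and a: "y # a \<in> St (Suc n)" and p: "p \<in> St n"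
  shows "mat (e * f) (y # a) c = (if a = s then mat f (y # p) c else 0)"
proof -
  have a': "a \<in> St n" "std (y # a)" "length a = n" using a by (auto simp: St_def)
  have "mat (e * f) (y # a) c = op e (\<lambda>l. op f (unit_fun c) (y # l)) a"
    using op_Cons[OF matrix_unitD(1)[OF e] a'(2,3)] by (simp add: mat_def op_apply_simps)
  also have "\<dots> = (if a = s then op f (unit_fun c) (y # p) else 0)"
    by (rule matrix_unit_op[OF e a'(1) p])
  finally show ?thesis by (simp add: mat_def)
qed

lemma mat_unit_mult_right:
  assumes e: "matrix_unit n p s e" and a: "a \<in> St (Suc n)" and b: "z # b \<in> St (Suc n)"
    and p: "p \<in> St n" "set p = set s"
  shows "mat (f * e) a (z # b) = (if b = s then mat f a (z # p) else 0)"
proof -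
  have b': "b \<in> St n" using b by (simp add: Cons_in_St)
  have "mat (f * e) a (z # b) = (\<Sum>m\<in>St (Suc n). mat f a m * mat e m (z # b))"
    by (rule mat_mult[OF a])
  also have "\<dots> = (\<Sum>m\<in>St (Suc n). if m = z # p then (if b = s then mat f a m else 0) else 0)"
  proof (rule sum.cong[OF refl])
    fix m assume m: "m \<in> St (Suc n)"
    then obtain y m' where m': "m = y # m'" "m' \<in> St n" by (auto elim: St_SucE)
    have "mat e m (z # b) = (if y = z then mat e m' b else 0)"
      using mat_Cons[OF matrix_unitD(1)[OF e], of y m' z b] m m' by simp
    moreover have "mat e m' b = (if m' = p \<and> b = s then 1 else 0)"
      by (rule matrix_unitD(2)[OF e m'(2) b'])
    ultimately show "mat f a m * mat e m (z # b) = (if m = z # p then (if b = s then mat f a m else 0) else 0)"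
      using m' by auto
  qed
  also have "\<dots> = (if b = s then mat f a (z # p) else 0)"
    using b p by (auto simp: finite_St Cons_in_St)
  finally show ?thesis .
qed

lemma mat_genT_top:
  "mat (genT (Suc (length s))) (y # x # s) c = diag_entry q x y * unit_fun c (y # x # s)
     + (if addable y (set s) then (q - diag_entry q x y) * unit_fun c (x # y # s) else 0)"
  by (simp add: mat_def)

text \<open>The last box \<open>b0\<close> of \<open>Q\<close> is taken in the second diagram if there is one. Then the diagonal entry of
  \<open>T\<^sub>n\<close> is \<open>0\<close> at the addable box of the first diagram, and it is the inverse of a q-analogue at the
  addable boxes of the second, which have distinct contents. Otherwise the shape is a row with two
  addable boxes, and the entries there are \<open>q\<close> and \<open>q - q\<^sup>-\<^sup>1\<close>.\<close>

lemma separating_tableau: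
  assumes N: "shape N" "card N = n" and n: "1 \<le> n" "n < k"
  shows "\<exists>Q\<in>St n. set Q = N \<and> inj_on (\<lambda>b. diag_entry q (hd Q) b) {b. addable b N}"
proof -
  obtain x where x: "x \<in> N" "(\<exists>b\<in>N. fst b = 2) \<Longrightarrow> fst x = 2"
    using N n by (metis card.empty ex_in_conv not_one_le_zero)
  obtain b0 where b0: "b0 \<in> N" "fst b0 = fst x" "shape (N - {b0})"
    using removable_exists[OF N(1) x(1)] by blast
  have card: "Suc (card (N - {b0})) = n" using N b0 shape_finite[of N] by (metis card_Suc_Diff1)
  obtain r where r: "r \<in> St (n - 1)" "set r = N - {b0}" using St_exists[OF b0(3)] card by force
  have ab0: "addable b0 (N - {b0})" using b0 N by (simp add: addable_def insert_absorb)
  have Q: "b0 # r \<in> St n" "set (b0 # r) = N"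
    using r b0 n ab0 Cons_in_St[of b0 r "n - 1"] by auto
  have entry_nz: "diag_entry q b0 b \<noteq> 0" if "addable b N" "fst b = 2" "fst b0 = 2" for b
  proof -
    have st: "b # b0 # r \<in> St (Suc n)" using that Q Cons_in_St[of b "b0 # r" n] by simp
    then have "qnum q (content b - content b0) \<noteq> 0"
      using that n std_pair_content[of b b0 r]
      by (intro qnum_content_nonzero[of "b # b0 # r"]) (auto simp: St_def)
    then show ?thesis using that by (simp add: diag_entry_def)
  qed
  have entry_ne: "diag_entry q b0 b \<noteq> diag_entry q b0 b'"
    if b: "addable b N" "addable b' N" "b \<noteq> b'" and j: "fst b = 2" "fst b' = 2" "fst b0 = 2" for b b'
  proof
    assume "diag_entry q b0 b = diag_entry q b0 b'"
    with j have "qnum q (content b - content b0) = qnum q (content b' - content b0)"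
      by (simp add: diag_entry_def)
    then have "qnum q ((content b - content b0) + - (content b' - content b0)) =
      qnum q ((content b' - content b0) + - (content b' - content b0))"
      by (simp only: qnum_add[OF q_nonzero])
    then have "qnum q (content b - content b') = 0" by simp
    moreover have "shape (insert b (insert b' N))"
      using addable_both[OF N(1) b(2,1)] b by (auto simp: addable_def)
    from content_bound[OF this, of b b'] have "\<bar>content b - content b'\<bar> \<le> int k"
      using b j N n shape_finite[OF N(1)] by (auto simp: addable_def)
    moreover have "content b - content b' \<noteq> 0"
      using addable_both_content[OF N(1) b] j by auto
    ultimately show False using qnum_nonzero[OF q_nonzero q_fact_nonzero] by blast
  qed
  have comp: "fst b \<in> {1, 2}" if "addable b N" for b
    using shape_comp[of "insert b N" b] that by (auto simp: addable_def)
  have "inj_on (\<lambda>b. diag_entry q b0 b) {b. addable b N}"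
  proof (rule inj_onI)
    fix b b' assume b: "b \<in> {b. addable b N}" "b' \<in> {b. addable b N}"
      and eq: "diag_entry q b0 b = diag_entry q b0 b'"
    show "b = b'"
    proof (cases "fst b0 = 2")
      case True
      have z: "diag_entry q b0 c = 0" if "fst c = 1" for c using True that by (simp add: diag_entry_def)
      show ?thesis
        using comp[of b] comp[of b'] b eq z[of b] z[of b'] entry_nz[of b] entry_nz[of b']
          entry_ne[of b b'] True addable_row_unique[of b N b'] by auto
    next
      case False
      then have no2: "\<forall>x\<in>N. fst x \<noteq> 2" using b0(2) x(2) by auto
      then have all1: "\<forall>x\<in>N. fst x = 1" using shape_comp[OF N(1)] by blast
      have b01: "fst b0 = 1" using all1 b0 by simp
      have two: "c = (2, 1, 1) \<and> diag_entry q b0 c = h" if "addable c N" "fst c = 2" for c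
        using addable_first[of c N] that no2 b01 by (auto simp: diag_entry_def)
      have one: "diag_entry q b0 c = q" if c: "addable c N" "fst c = 1" for c
      proof -
        have "b0 = (1, 1, Suc (card (N - {b0})))"
          using all1 b0 by (intro shape_row_content[OF b0(3) ab0]) auto
        moreover have "c = (1, 1, Suc (card N))"
          using all1 c by (intro shape_row_content[OF N(1)]) auto
        ultimately have "content c - content b0 = 1" using card N(2) by (auto simp: content_def)
        then show ?thesis using c b01 qnum_1[OF q_nonzero] by (simp add: diag_entry_def)
      qed
      have "q \<noteq> h" using q_nonzero by simp
      then show ?thesis
        using comp[of b] comp[of b'] b eq two[of b] two[of b'] one[of b] one[of b']
          addable_row_unique[of b N b'] by auto
    qed
  qed
  with Q show ?thesis by (intro bexI[of _ "b0 # r"]) auto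
qed

text \<open>The element \<open>E\<^sub>Q\<^sub>Q T\<^sub>n E\<^sub>Q\<^sub>Q\<close> is diagonal, with distinct entries at the tableaux \<open>b # Q\<close>; Lagrange
  interpolation in it isolates one of them.\<close>

lemma diagonal_unit_exists:
  assumes Q: "Q \<in> St n" and e: "matrix_unit n Q Q e" and n: "1 \<le> n" "n < k"
    and inj: "inj_on (\<lambda>b. diag_entry q (hd Q) b) {b. addable b (set Q)}"
    and b: "addable b (set Q)"
  shows "\<exists>f. matrix_unit (Suc n) (b # Q) (b # Q) f"
proof -
  \<comment> \<open>\<open>D f \<phi>\<close>: the matrix of \<open>f\<close> is diagonal, with entry \<open>\<phi> y\<close> at \<open>y # Q\<close> and \<open>0\<close> elsewhere.\<close>
  define D where "D f \<phi> \<longleftrightarrow> f \<in> carrier (free_algebra (Suc n)) \<and>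
    (\<forall>y a z c. y # a \<in> St (Suc n) \<longrightarrow> z # c \<in> St (Suc n) \<longrightarrow>
      mat f (y # a) (z # c) = (if y = z \<and> a = Q \<and> c = Q then \<phi> y else 0))"
    for f :: free_elt and \<phi> :: "box \<Rightarrow> complex"
  have De: "D e (\<lambda>_. 1)"
    unfolding D_def
  proof (intro conjI allI impI)
    show "e \<in> carrier (free_algebra (Suc n))"
      using matrix_unitD(1)[OF e] free_algebra_mono[of n "Suc n"] by auto
    fix y a z c assume m: "y # a \<in> St (Suc n)" "z # c \<in> St (Suc n)"
    have "mat e (y # a) (z # c) = (if y = z then mat e a c else 0)"
      by (rule mat_Cons[OF matrix_unitD(1)[OF e] m(1)])
    then show "mat e (y # a) (z # c) = (if y = z \<and> a = Q \<and> c = Q then 1 else 0)"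
      using m matrix_unitD(2)[OF e, of a c] by (auto simp: Cons_in_St)
  qed
  have D_mult: "D (f * g) (\<lambda>y. \<phi> y * \<psi> y)" if "D f \<phi>" "D g \<psi>" for f g \<phi> \<psi>
    unfolding D_def
  proof (intro conjI allI impI)
    show "f * g \<in> carrier (free_algebra (Suc n))" using that by (auto simp: D_def intro: free_algebra_closed)
    fix y a z c assume m: "y # a \<in> St (Suc n)" "z # c \<in> St (Suc n)"
    have "mat (f * g) (y # a) (z # c) = (\<Sum>p\<in>St (Suc n). mat f (y # a) p * mat g p (z # c))"
      by (rule mat_mult[OF m(1)])
    also have "\<dots> = (\<Sum>p\<in>St (Suc n). if p = y # a then (if y = z \<and> a = Q \<and> c = Q then \<phi> y * \<psi> y else 0) else 0)"
    proof (rule sum.cong[OF refl])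
      fix p assume p: "p \<in> St (Suc n)"
      then obtain w d where p': "p = w # d" by (auto elim: St_SucE)
      have fg: "mat f (y # a) (w # d) = (if y = w \<and> a = Q \<and> d = Q then \<phi> y else 0)"
        "mat g (w # d) (z # c) = (if w = z \<and> d = Q \<and> c = Q then \<psi> w else 0)"
        using that m p p' unfolding D_def by blast+
      show "mat f (y # a) p * mat g p (z # c) =
        (if p = y # a then (if y = z \<and> a = Q \<and> c = Q then \<phi> y * \<psi> y else 0) else 0)"
        unfolding p' fg list.inject
        by (cases "w = y"; cases "d = a"; cases "a = Q"; cases "w = z") simp_all
    qed
    also have "\<dots> = (if y = z \<and> a = Q \<and> c = Q then \<phi> y * \<psi> y else 0)" using m by (simp add: finite_St)
    finally show "mat (f * g) (y # a) (z # c) = (if y = z \<and> a = Q \<and> c = Q then \<phi> y * \<psi> y else 0)" .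
  qed
  obtain b0 r where Qr: "Q = b0 # r" "n = Suc (length r)" using Q n by (cases Q) (auto simp: St_def)
  have Dx: "D (e * genT n * e) (\<lambda>y. diag_entry q b0 y)"
    unfolding D_def
  proof (intro conjI allI impI)
    show "e * genT n * e \<in> carrier (free_algebra (Suc n))"
      using matrix_unitD(1)[OF e] free_algebra_mono[of n "Suc n"] n
      by (auto intro!: free_algebra_closed genT_closed)
    fix y a z c assume m: "y # a \<in> St (Suc n)" "z # c \<in> St (Suc n)"
    have "mat (e * genT n * e) (y # a) (z # c) = (if c = Q then mat (e * genT n) (y # a) (z # Q) else 0)"
      by (rule mat_unit_mult_right[OF e m Q refl])
    moreover have "mat (e * genT n) (y # a) (z # Q) = (if a = Q then mat (genT n) (y # Q) (z # Q) else 0)"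
      by (rule mat_unit_mult_left[OF e m(1) Q])
    moreover have "mat (genT n) (y # Q) (z # Q) = (if y = z then diag_entry q b0 y else 0)" if "a = Q"
    proof -
      have "y \<noteq> b0" using m(1) that Qr by (auto simp: Cons_in_St addable_def)
      then show ?thesis unfolding Qr mat_genT_top by (cases "y = z") (simp_all add: unit_fun_def)
    qed
    ultimately show "mat (e * genT n * e) (y # a) (z # c) =
      (if y = z \<and> a = Q \<and> c = Q then diag_entry q b0 y else 0)" by (cases "a = Q"; cases "c = Q"; cases "y = z") simp_all
  qed
  have D_lin: "D (scal \<alpha> * f + scal \<beta> * g) (\<lambda>y. \<alpha> * \<phi> y + \<beta> * \<psi> y)" if "D f \<phi>" "D g \<psi>" for f g \<phi> \<psi> \<alpha> \<beta>
    using that by (auto simp: D_def mat_simps intro!: free_algebra_closed scal_closed)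
  have ex: "\<exists>f \<phi>. D f \<phi> \<and> \<phi> b = 1 \<and> (\<forall>c\<in>B. \<phi> c = 0)" if "finite B" "B \<subseteq> {c. addable c (set Q)} - {b}" for B
    using that
  proof (induction B)
    case empty
    then show ?case using De by (intro exI[of _ e] exI[of _ "\<lambda>_. 1"]) simp
  next
    case (insert c B)
    then obtain f \<phi> where f: "D f \<phi>" "\<phi> b = 1" "\<forall>c\<in>B. \<phi> c = 0" by auto
    let ?a = "\<lambda>b. diag_entry q b0 b"
    have ne: "?a b \<noteq> ?a c" using inj b insert.prems Qr by (auto dest: inj_onD)
    \<comment> \<open>The interpolation factor \<open>(x - a c) / (a b - a c)\<close>, for \<open>x\<close> the element of \<open>Dx\<close>.\<close>
    have "D (f * (scal (1 / (?a b - ?a c)) * (e * genT n * e) + scal (- ?a c / (?a b - ?a c)) * e))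
      (\<lambda>y. \<phi> y * (1 / (?a b - ?a c) * ?a y + - ?a c / (?a b - ?a c) * 1))"
      by (intro D_mult f D_lin Dx De)
    moreover have "1 / (?a b - ?a c) * ?a b + - ?a c / (?a b - ?a c) * 1 = 1"
      using ne by (simp add: diff_divide_distrib[symmetric])
    ultimately show ?case using f
      by (intro exI[of _ "f * (scal (1 / (?a b - ?a c)) * (e * genT n * e) + scal (- ?a c / (?a b - ?a c)) * e)"]
          exI[of _ "\<lambda>y. \<phi> y * (1 / (?a b - ?a c) * ?a y + - ?a c / (?a b - ?a c) * 1)"]) auto
  qed
  have fin: "finite ({c. addable c (set Q)} - {b})"
    using Q finite_addable[OF std_shape] by (auto simp: St_def)
  from ex[OF fin order.refl] obtain f \<phi>
    where f: "D f \<phi>" "\<phi> b = 1" "\<forall>c\<in>{c. addable c (set Q)} - {b}. \<phi> c = 0"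
    by (elim exE conjE)
  have "matrix_unit (Suc n) (b # Q) (b # Q) f"
    unfolding matrix_unit_def
  proof (intro conjI ballI)
    show "f \<in> carrier (free_algebra (Suc n))" using f(1) by (simp add: D_def)
    fix m p assume mp: "m \<in> St (Suc n)" "p \<in> St (Suc n)"
    then obtain y a z c where yz: "m = y # a" "p = z # c" by (metis St_SucE)
    have "mat f m p = (if y = z \<and> a = Q \<and> c = Q then \<phi> y else 0)"
      using f(1) mp unfolding D_def yz by blast
    moreover have "\<phi> y = (if y = b then 1 else 0)" if "a = Q"
      using f(2,3) mp(1) that unfolding yz by (cases "y = b") (simp_all add: Cons_in_St)
    ultimately show "mat f m p = (if m = b # Q \<and> p = b # Q then 1 else 0)"
      unfolding yz by (cases "a = Q"; cases "y = b"; cases "y = z") simp_all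
  qed
  then show ?thesis by blast
qed

text \<open>By induction on the rank. Two tableaux with the same last box \<open>b\<close> are connected through \<open>b # Q\<close>
  for a separating tableau \<open>Q\<close>, by matrix units of lower rank. If the last boxes \<open>b\<close> and \<open>b'\<close> differ,
  both can be removed, and \<open>T\<^sub>n\<close> connects \<open>b # b' # r\<close> to \<open>b' # b # r\<close>.\<close>

theorem matrix_units_exist:
  assumes "n \<le> k" "l \<in> St n" "l' \<in> St n" "set l = set l'"
  shows "\<exists>f. matrix_unit n l l' f"
  using assms
proof (induction n arbitrary: l l')
  case 0
  have "matrix_unit 0 [] [] 1" by (auto simp: matrix_unit_def mat_simps one_closed)
  with 0 show ?case by auto
next
  case (Suc n)
  have unit: "\<exists>f. matrix_unit n l l' f" if "l \<in> St n" "l' \<in> St n" "set l = set l'" for l l'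
    using Suc that by simp
  have lift: "matrix_unit (Suc n) (b # s) (b # s') (e * f * e')"
    if "matrix_unit n s Q e" "matrix_unit n Q s' e'" "matrix_unit (Suc n) (b # Q) (b # Q) f"
      "Q \<in> St n" "b # Q \<in> St (Suc n)" "set s = set Q" "set s' = set Q" for b s s' Q e f e'
    unfolding matrix_unit_def
  proof (intro conjI ballI)
    show "e * f * e' \<in> carrier (free_algebra (Suc n))"
      using that free_algebra_mono[of n "Suc n"]
      by (auto simp: matrix_unit_def intro!: free_algebra_closed)
    fix a c assume ac: "a \<in> St (Suc n)" "c \<in> St (Suc n)"
    then obtain y a' z c' where ac': "a = y # a'" "c = z # c'" by (metis St_SucE)
    have "mat (e * f * e') (y # a') (z # c') = (if c' = s' then mat (e * f) (y # a') (z # Q) else 0)"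
      using ac ac' that by (intro mat_unit_mult_right) auto
    moreover have "mat (e * f) (y # a') (z # Q) = (if a' = s then mat f (y # Q) (z # Q) else 0)"
      using ac ac' that by (intro mat_unit_mult_left) auto
    moreover have "mat f (y # Q) (z # Q) = (if y = b \<and> z = b then 1 else 0)" if "c' = s'" "a' = s"
    proof -
      have "y # Q \<in> St (Suc n)" "z # Q \<in> St (Suc n)"
        using ac ac' that \<open>set s = set Q\<close> \<open>set s' = set Q\<close> \<open>Q \<in> St n\<close> by (auto simp: Cons_in_St)
      then show ?thesis
        using matrix_unitD(2)[OF \<open>matrix_unit (Suc n) (b # Q) (b # Q) f\<close>, of "y # Q" "z # Q"] by simp
    qed
    ultimately show "mat (e * f * e') a c = (if a = b # s \<and> c = b # s' then 1 else 0)"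
      using ac' by (cases "a' = s"; cases "c' = s'"; cases "y = b"; cases "z = b") simp_all
  qed
  have same: "\<exists>f. matrix_unit (Suc n) (b # s) (b # s') f"
    if m: "b # s \<in> St (Suc n)" "b # s' \<in> St (Suc n)" "set s = set s'" for b s s'
  proof (cases "n = 0")
    case True
    then have s: "s = []" "s' = []" using m by (auto simp: St_def)
    have b: "addable b {}" using m s by (auto simp: Cons_in_St)
    have uniq: "y = b" if "[y] \<in> St (Suc 0)" "fst y = fst b" for y
    proof -
      have "y = (fst y, 1, 1)" by (rule addable_first) (use that in \<open>auto simp: Cons_in_St\<close>)
      moreover have "b = (fst b, 1, 1)" by (rule addable_first[OF b]) simp
      ultimately show ?thesis using that by metis
    qed
    have comp: "fst y = 1 \<or> fst y = 2" if "[y] \<in> St (Suc 0)" for y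
      using that std_comp[of "[y]" y] by (auto simp: St_def)
    have P: "mat (genP 1) [y] [z] = (if fst y = 1 \<and> y = z then 1 else 0)" for y z
      by (cases "y = z") (simp_all add: mat_def P_op_def unit_fun_def)
    have sing: "\<exists>y. m = [y]" if "m \<in> St (Suc 0)" for m
      using that by (auto elim: St_SucE)
    \<comment> \<open>In rank one \<open>P\<^sub>1\<close> separates the two tableaux.\<close>
    define f where "f = (if fst b = 1 then genP 1 else 1 - genP 1)"
    have "matrix_unit (Suc 0) [b] [b] f"
      unfolding matrix_unit_def
    proof (intro conjI ballI)
      show "f \<in> carrier (free_algebra (Suc 0))"
        by (auto simp: f_def intro!: genP_closed free_algebra_closed one_closed)
      fix m p assume mp: "m \<in> St (Suc 0)" "p \<in> St (Suc 0)"
      then obtain y z where yz: "m = [y]" "p = [z]" using sing by blast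
      have "y = b \<longleftrightarrow> fst y = fst b" "fst y = 1 \<or> fst y = 2" "fst b = 1 \<or> fst b = 2"
        using uniq[of y] comp[of y] comp[of b] mp yz m s \<open>n = 0\<close> by auto
      then show "mat f m p = (if m = [b] \<and> p = [b] then 1 else 0)"
        by (cases "y = z") (auto simp: yz f_def P mat_simps simp del: One_nat_def)
    qed
    then show ?thesis using s True by auto
  next
    case False
    have s: "s \<in> St n" "s' \<in> St n" "addable b (set s)" using m by (auto simp: Cons_in_St)
    obtain Q where Q: "Q \<in> St n" "set Q = set s" "inj_on (\<lambda>b. diag_entry q (hd Q) b) {b. addable b (set Q)}"
      using separating_tableau[of "set s" n] s False Suc.prems(1) std_shape std_card
      by (fastforce simp: St_def)
    obtain e0 where e0: "matrix_unit n Q Q e0" using unit Q by blast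
    obtain f where f: "matrix_unit (Suc n) (b # Q) (b # Q) f"
    proof -
      have "1 \<le> n" "n < k" "addable b (set Q)" using False Suc.prems(1) s Q by simp_all
      from diagonal_unit_exists[OF Q(1) e0 this(1,2) Q(3) this(3)] that show ?thesis by blast
    qed
    obtain e where e: "matrix_unit n s Q e" using unit[OF s(1) Q(1)] Q(2) by auto
    obtain e' where e': "matrix_unit n Q s' e'" using unit[OF Q(1) s(2)] Q(2) m(3) by auto
    have "matrix_unit (Suc n) (b # s) (b # s') (e * f * e')"
      using Q s m by (intro lift[OF e e' f Q(1)]) (simp_all add: Cons_in_St)
    then show ?thesis by blast
  qed
  obtain b s where l: "l = b # s" "s \<in> St n" "addable b (set s)" using Suc.prems(2) by (rule St_SucE)
  obtain b' s' where l': "l' = b' # s'" "s' \<in> St n" "addable b' (set s')" using Suc.prems(3) by (rule St_SucE)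
  show ?case
  proof (cases "b = b'")
    case True
    have "set s = set s'" using Suc.prems(4) l l' True by (auto simp: addable_def)
    then show ?thesis using same[of b s s'] Suc.prems l l' True by auto
  next
    case False
    have N: "shape (set s)" "shape (set s')" using l l' std_shape by (auto simp: St_def)
    have b: "b \<in> set s'" "b' \<in> set s" using Suc.prems(4) l l' False by auto
    define R where "R = set s \<inter> set s'"
    have R: "shape R" unfolding R_def by (rule shape_Int[OF N])
    have sR: "set s = insert b' R" "set s' = insert b R" "b \<notin> R" "b' \<notin> R"
      using Suc.prems(4) l l' False by (auto simp: R_def addable_def)
    have cardR: "card R = n - 1" "1 \<le> n"
      using sR std_card[of s] l(2) shape_finite[OF R] by (auto simp: St_def)
    obtain r where r: "r \<in> St (n - 1)" "set r = R" using St_exists[OF R cardR(1)] by blast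
    have aR: "addable b R" "addable b' R" using sR N by (auto simp: addable_def)
    have Q: "b' # r \<in> St n" "b # r \<in> St n"
      using r aR cardR(2) Cons_in_St[of b' r "n - 1"] Cons_in_St[of b r "n - 1"] by auto
    have bQ: "b # b' # r \<in> St (Suc n)" "b' # b # r \<in> St (Suc n)"
      using Q r sR l l' by (auto simp: Cons_in_St)
    have n: "n = Suc (length r)" using Q by (simp add: St_def)
    obtain e where e: "matrix_unit (Suc n) (b # s) (b # b' # r) e"
      using same[of b s "b' # r"] Suc.prems(2) l bQ r sR by auto
    obtain e' where e': "matrix_unit (Suc n) (b' # b # r) (b' # s') e'"
      using same[of b' "b # r" s'] Suc.prems(3) l' bQ r sR by auto
    \<comment> \<open>If \<open>c\<close> vanished, the contents would differ by \<open>1\<close>, which is too close for two boxes addable to \<open>R\<close>.\<close>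
    define c where "c = q - diag_entry q b' b"
    have c: "c \<noteq> 0"
    proof (cases "fst b = fst b'")
      case True
      have "qnum q (content b - content b') = qnum q 1" if "diag_entry q b' b = q"
      proof -
        have "inverse (qnum q (content b - content b')) = q"
          using that True by (simp add: diag_entry_def)
        then have "inverse (inverse (qnum q (content b - content b'))) = inverse q" by simp
        then show ?thesis using qnum_1[OF q_nonzero] by simp
      qed
      moreover have "qnum q (content b - content b') \<noteq> qnum q 1"
      proof
        assume "qnum q (content b - content b') = qnum q 1"
        then have "qnum q ((content b - content b') + - 1) = qnum q (1 + - 1)"
          by (simp only: qnum_add[OF q_nonzero])
        then have "qnum q (content b - content b' - 1) = 0" by simp
        moreover have "content b - content b' - 1 \<noteq> 0"
          using addable_both_content[OF R aR False True] by auto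
        moreover have "\<bar>content b - content b' - 1\<bar> \<le> int k"
          using content_bound[of "set (b # b' # r)" b b'] std_shape[of "b # b' # r"]
            std_card[of "b # b' # r"] bQ Suc.prems(1) True by (auto simp: St_def)
        ultimately show False
          using qnum_nonzero[OF q_nonzero q_fact_nonzero] by blast
      qed
      ultimately show ?thesis by (auto simp: c_def)
    next
      case False
      then show ?thesis using q_nonzero by (auto simp: c_def diag_entry_def)
    qed
    have "matrix_unit (Suc n) (b # s) (b' # s') (scal (inverse c) * (e * genT n * e'))"
      unfolding matrix_unit_def
    proof (intro conjI ballI)
      show "scal (inverse c) * (e * genT n * e') \<in> carrier (free_algebra (Suc n))"
        using e e' cardR by (auto simp: matrix_unit_def intro!: free_algebra_closed scal_closed genT_closed)
      fix x z assume xz: "x \<in> St (Suc n)" "z \<in> St (Suc n)"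
      let ?g = "op e' (unit_fun z)"
      have g: "?g m = (if m = b' # b # r then unit_fun z (b' # s') else 0)" if "m \<in> St (Suc n)" for m
        by (rule matrix_unit_op[OF e' that]) (use Suc.prems(3) l' in auto)
      have "mat (e * genT n * e') x z = op e (T_op q n ?g) x"
        by (simp add: mat_def op.act_mult)
      also have "\<dots> = (if x = b # s then T_op q n ?g (b # b' # r) else 0)"
        by (rule matrix_unit_op[OF e xz(1) bQ(1)])
      also have "T_op q n ?g (b # b' # r) = c * unit_fun z (b' # s')"
        using n aR r g[OF bQ(1)] g[OF bQ(2)] False by (simp add: c_def)
      finally show "mat (scal (inverse c) * (e * genT n * e')) x z =
          (if x = b # s \<and> z = b' # s' then 1 else 0)"
        using c by (simp add: mat_simps unit_fun_def)
    qed
    then show ?thesis using l l' by blast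
  qed
qed

text \<open>The value \<open>0\<close> for tableaux of different shapes lets sums run over all pairs of tableaux.\<close>

definition mu :: "nat \<Rightarrow> box list \<Rightarrow> box list \<Rightarrow> free_elt" where
  "mu n s s' = (if set s = set s' then SOME f. matrix_unit n s s' f else 0)"

lemma matrix_unit_mu:
  "n \<le> k \<Longrightarrow> s \<in> St n \<Longrightarrow> s' \<in> St n \<Longrightarrow> set s = set s' \<Longrightarrow> matrix_unit n s s' (mu n s s')"
  unfolding mu_def using matrix_units_exist by (simp add: someI_ex)

lemma mu_closed: "n \<le> k \<Longrightarrow> s \<in> St n \<Longrightarrow> s' \<in> St n \<Longrightarrow> mu n s s' \<in> carrier (free_algebra n)"
  using matrix_unitD(1)[OF matrix_unit_mu] by (cases "set s = set s'") (auto simp: mu_def free_algebra_zero)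

lemma mat_mu:
  "n \<le> k \<Longrightarrow> s \<in> St n \<Longrightarrow> s' \<in> St n \<Longrightarrow> set s = set s' \<Longrightarrow> l \<in> St n \<Longrightarrow> m \<in> St n \<Longrightarrow>
    mat (mu n s s') l m = (if l = s \<and> m = s' then 1 else 0)"
  using matrix_unitD(2)[OF matrix_unit_mu] .

lemma mat_mu_left:
  assumes "n \<le> k" "s \<in> St n" "u \<in> St n" "set s = set u" "a \<in> St n"
  shows "mat (mu n s u * f) a c = (if a = s then mat f u c else 0)"
  using matrix_unit_op[OF matrix_unit_mu[OF assms(1-4)] assms(5,3), of "op f (unit_fun c)"]
  by (simp add: mat_def op_apply_simps)

lemma mat_mu_right:
  assumes "n \<le> k" "u \<in> St n" "s \<in> St n" "set u = set s" "a \<in> St n" "c \<in> St n"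
  shows "mat (f * mu n u s) a c = (if c = s then mat f a u else 0)"
proof -
  have "mat (f * mu n u s) a c = (\<Sum>m\<in>St n. if m = u then (if c = s then mat f a m else 0) else 0)"
    unfolding mat_mult[OF assms(5)] by (intro sum.cong) (auto simp: mat_mu assms)
  then show ?thesis using assms by (simp add: finite_St)
qed

end


section \<open>A spanning set for the rook monoid algebra\<close>

text \<open>An algebra with elements satisfying the defining relations. The value \<open>t 0 = 0\<close> lets the
  spanning sets below start at rank zero.\<close>

locale rook_model = seminormal k q + vector_space cs
  for k :: nat and q :: complex and cs :: "complex \<Rightarrow> 'a::ring_1 \<Rightarrow> 'a" +
  fixes t p :: "nat \<Rightarrow> 'a"
  assumes cs_left: "cs c x * y = cs c (x * y)" and cs_right: "x * cs c y = cs c (x * y)"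
    and t_0: "t 0 = 0"
    and t_quadratic: "1 \<le> i \<Longrightarrow> i < k \<Longrightarrow> t i * t i = cs (q - inverse q) (t i) + 1"
    and t_braid: "1 \<le> i \<Longrightarrow> Suc i < k \<Longrightarrow> t i * t (Suc i) * t i = t (Suc i) * t i * t (Suc i)"
    and t_far: "1 \<le> i \<Longrightarrow> Suc i < j \<Longrightarrow> j < k \<Longrightarrow> t i * t j = t j * t i"
    and p_idem: "1 \<le> i \<Longrightarrow> i \<le> k \<Longrightarrow> p i * p i = p i"
    and p_t_commute: "1 \<le> i \<Longrightarrow> i < j \<Longrightarrow> j < k \<Longrightarrow> p i * t j = t j * p i"
    and t_p_absorb: "1 \<le> j \<Longrightarrow> j < i \<Longrightarrow> i \<le> k \<Longrightarrow> t j * p i = cs q (p i)"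
    and p_t_absorb: "1 \<le> j \<Longrightarrow> j < i \<Longrightarrow> i \<le> k \<Longrightarrow> p i * t j = cs q (p i)"
    and p_Suc: "1 \<le> i \<Longrightarrow> i < k \<Longrightarrow> p (Suc i) = cs q (p i * t i * p i - cs (q - inverse q) (p i))"
begin

definition gen_el :: "rook_gen \<Rightarrow> 'a" where
  "gen_el g = (case g of GenP i \<Rightarrow> p i | GenT i \<Rightarrow> t i)"

lemma gen_el_simps [simp]: "gen_el (GenP i) = p i" "gen_el (GenT i) = t i"
  by (simp_all add: gen_el_def)

sublocale reg: free_action cs "\<lambda>g x. gen_el g * x"
  by unfold_locales (simp_all add: distrib_left cs_right)

definition ev :: "free_elt \<Rightarrow> 'a" where
  "ev f = reg.act f 1"

lemma reg_act: "reg.act f x = ev f * x"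
proof -
  have *: "word_act (\<lambda>g x. gen_el g * x) w 1 * x = word_act (\<lambda>g x. gen_el g * x) w x" for w x
    by (induction w) (simp_all add: mult.assoc)
  show ?thesis
    by (simp add: ev_def reg.act_def sum_distrib_right cs_left *)
qed

lemma ev_simps:
  "ev 1 = 1" "ev 0 = 0" "ev (f + g) = ev f + ev g" "ev (f - g) = ev f - ev g" "ev (f * g) = ev f * ev g"
  "ev (genT i) = t i" "ev (genP i) = p i" "ev (scal c) = cs c 1" "ev (scal c * f) = cs c (ev f)"
  using reg_act[of f "ev g"] by (simp_all add: ev_def reg.act_simps)

lemma ev_sum: "ev (\<Sum>x\<in>A. f x) = (\<Sum>x\<in>A. ev (f x))"
  by (simp add: ev_def reg.act_sum_left)

definition A :: "nat \<Rightarrow> 'a set" where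
  "A n = ev ` carrier (free_algebra n)"

lemma A_mult: "x \<in> A n \<Longrightarrow> y \<in> A n \<Longrightarrow> x * y \<in> A n"
  unfolding A_def by (auto simp flip: ev_simps(5) intro!: imageI free_algebra_closed)

lemma A_mono: "n \<le> m \<Longrightarrow> A n \<subseteq> A m"
  unfolding A_def using free_algebra_mono by blast

lemma A_1: "1 \<in> A n"
  unfolding A_def by (rule image_eqI[of _ _ 1]) (simp_all add: ev_simps one_closed)

lemma A_t: "1 \<le> i \<Longrightarrow> i < n \<Longrightarrow> t i \<in> A n"
  unfolding A_def by (rule image_eqI[of _ _ "genT i"]) (simp_all add: ev_simps genT_closed)

lemma A_p: "1 \<le> i \<Longrightarrow> i \<le> n \<Longrightarrow> p i \<in> A n"
  unfolding A_def by (rule image_eqI[of _ _ "genP i"]) (simp_all add: ev_simps genP_closed)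

lemma A_subset:
  assumes W: "subspace W" "1 \<in> W" and t: "\<And>i x. 1 \<le> i \<Longrightarrow> i < n \<Longrightarrow> x \<in> W \<Longrightarrow> t i * x \<in> W"
    and p: "\<And>i x. 1 \<le> i \<Longrightarrow> i \<le> n \<Longrightarrow> x \<in> W \<Longrightarrow> p i * x \<in> W"
  shows "A n \<subseteq> W"
proof
  fix x assume "x \<in> A n"
  then obtain f where f: "f \<in> carrier (free_algebra n)" "x = ev f" by (auto simp: A_def)
  have "gen_el g * v \<in> W" if "g \<in> rook_gens n" "v \<in> W" for g v
    using that t p by (auto simp: rook_gens_def)
  from reg.act_mem_subspace[OF W(1) this f(1) W(2)] f(2) show "x \<in> W" by (simp add: ev_def)
qed

text \<open>An element commuting with the generators of \<open>A n\<close> commutes with \<open>A n\<close>; of the \<open>p\<close> it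
  suffices to consider \<open>p 1\<close>, by the recursion for the \<open>p i\<close>.\<close>

lemma commute_A:
  assumes n: "n \<le> k" and t: "\<And>i. 1 \<le> i \<Longrightarrow> i < n \<Longrightarrow> z * t i = t i * z"
    and p: "1 \<le> n \<Longrightarrow> z * p 1 = p 1 * z" and x: "x \<in> A n"
  shows "z * x = x * z"
proof -
  have pi: "z * p i = p i * z" if "1 \<le> i" "i \<le> n" for i
    using that
  proof (induction i rule: nat_induct_at_least)
    case base
    then show ?case using p by simp
  next
    case (Suc i)
    then have z: "z * p i = p i * z" "z * t i = t i * z" using t by auto
    have "z * (p i * t i * p i) = (p i * t i * p i) * z"
      using z by (metis mult.assoc)
    then show ?case
      using Suc n z by (simp add: p_Suc cs_left cs_right left_diff_distrib right_diff_distrib)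
  qed
  have "A n \<subseteq> {x. z * x = x * z}"
  proof (rule A_subset)
    show "subspace {x. z * x = x * z}"
      by (rule subspaceI) (auto simp: distrib_left distrib_right cs_left cs_right)
    fix i x assume x: "x \<in> {x. z * x = x * z}"
    show "t i * x \<in> {x. z * x = x * z}" if "1 \<le> i" "i < n"
      using x t[OF that] by (simp add: mult.assoc) (metis mult.assoc)
    show "p i * x \<in> {x. z * x = x * z}" if "1 \<le> i" "i \<le> n"
      using x pi[OF that] by (simp add: mult.assoc) (metis mult.assoc)
  qed simp
  with x show ?thesis by auto
qed

lemma t_commutes_A: "n < i \<Longrightarrow> i < k \<Longrightarrow> x \<in> A n \<Longrightarrow> t i * x = x * t i"
  by (rule commute_A[of n]) (auto intro: t_far[symmetric] p_t_commute[symmetric])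

text \<open>The image of \<open>X\<^sub>i\<^sub>+\<^sub>1\<close> in the model.\<close>

primrec xe :: "nat \<Rightarrow> 'a" where
  "xe 0 = 1 - p 1"
| "xe (Suc i) = t (Suc i) * xe i * t (Suc i)"

lemma ev_X_elt: "ev (X_elt i) = xe i"
  by (induction i) (simp_all add: ev_simps)

lemma xe_A: "i < n \<Longrightarrow> xe i \<in> A n"
  unfolding A_def by (metis X_elt_closed ev_X_elt imageI)

text \<open>By the recursion for \<open>p 2\<close>, the product \<open>p 1 * t 1 * p 1\<close> is a combination of \<open>p 1\<close> and \<open>p 2\<close>.\<close>

lemma x_1_p_1:
  assumes "1 < k"
  shows "xe 1 * p 1 = p 1 - p 2" "p 1 * xe 1 = p 1 - p 2"
proof -
  have p2: "p 2 = cs q (p 1 * t 1 * p 1 - cs h (p 1))" using p_Suc[of 1] assms by (simp add: numeral_2_eq_2)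
  have "cs (inverse q) (p 2) = p 1 * t 1 * p 1 - cs h (p 1)"
    using p2 q_nonzero by simp
  then have ptp: "p 1 * t 1 * p 1 = cs (inverse q) (p 2) + cs h (p 1)" by simp
  have tp2: "t 1 * p 2 = cs q (p 2)" "p 2 * t 1 = cs q (p 2)"
    using t_p_absorb[of 1 2] p_t_absorb[of 1 2] assms by auto
  have tt: "t 1 * t 1 = cs h (t 1) + 1" using t_quadratic[of 1] assms by simp
  have "t 1 * t 1 * p 1 = cs h (t 1 * p 1) + p 1" by (simp only: tt distrib_right cs_left mult_1_left)
  moreover have "t 1 * (p 1 * t 1 * p 1) = p 2 + cs h (t 1 * p 1)"
  proof -
    have "t 1 * (p 1 * t 1 * p 1) = cs (inverse q) (cs q (p 2)) + cs h (t 1 * p 1)"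
      by (simp only: ptp distrib_left cs_right tp2)
    then show ?thesis using q_nonzero by simp
  qed
  ultimately show "xe 1 * p 1 = p 1 - p 2"
    by (simp add: left_diff_distrib right_diff_distrib mult.assoc)
  have "p 1 * t 1 * t 1 = cs h (p 1 * t 1) + p 1" by (simp only: mult.assoc tt distrib_left cs_right mult_1_right)
  moreover have "(p 1 * t 1 * p 1) * t 1 = p 2 + cs h (p 1 * t 1)"
  proof -
    have "(p 1 * t 1 * p 1) * t 1 = cs (inverse q) (cs q (p 2)) + cs h (p 1 * t 1)"
      by (simp only: ptp distrib_right cs_left tp2)
    then show ?thesis using q_nonzero by simp
  qed
  ultimately show "p 1 * xe 1 = p 1 - p 2"
    by (simp add: left_diff_distrib right_diff_distrib mult.assoc)
qed

lemma commute_triple: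
  "a * z = z * a \<Longrightarrow> b * z = z * b \<Longrightarrow> (a * b * a) * z = z * (a * b * a)" for a b z :: 'a
  by (metis mult.assoc)

text \<open>For \<open>i = n - 1\<close> the braid relation is used on both sides of the factor \<open>xe (n - 2)\<close>; for smaller
  \<open>i\<close> all factors of \<open>xe n\<close> commute with \<open>t i\<close>.\<close>

lemma xe_commutes_t: "1 \<le> i \<Longrightarrow> i < n \<Longrightarrow> n < k \<Longrightarrow> xe n * t i = t i * xe n"
proof (induction n)
  case (Suc n)
  show ?case
  proof (cases "i = n")
    case False
    then have "xe n * t i = t i * xe n" "t (Suc n) * t i = t i * t (Suc n)"
      using Suc t_far[of i "Suc n"] by auto
    then show ?thesis using commute_triple by simp
  next
    case True
    with Suc.prems obtain m where m: "n = Suc m" by (cases n) auto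
    let ?a = "t (Suc m)" and ?b = "t (Suc (Suc m))" and ?x = "xe m"
    have br: "?a * ?b * ?a = ?b * ?a * ?b" using t_braid[of "Suc m"] m Suc.prems by simp
    have bx: "?b * ?x = ?x * ?b"
      using m Suc.prems xe_A[of m "Suc m"] by (intro t_commutes_A) auto
    have "?a * (?b * ?a * ?x * ?a * ?b) = (?a * ?b * ?a) * ?x * ?a * ?b" by (simp add: mult.assoc)
    also have "\<dots> = (?b * ?a * ?b) * ?x * ?a * ?b" by (simp only: br)
    also have "\<dots> = ?b * ?a * (?b * ?x) * ?a * ?b" by (simp only: mult.assoc)
    also have "\<dots> = ?b * ?a * (?x * ?b) * ?a * ?b" by (simp only: bx)
    also have "\<dots> = ?b * ?a * ?x * (?b * ?a * ?b)" by (simp only: mult.assoc)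
    also have "\<dots> = ?b * ?a * ?x * (?a * ?b * ?a)" by (simp only: br)
    finally show ?thesis using True m by (simp add: mult.assoc)
  qed
qed simp

lemma xe_commutes_p_1: "1 \<le> n \<Longrightarrow> n < k \<Longrightarrow> xe n * p 1 = p 1 * xe n"
proof (induction n rule: nat_induct_at_least)
  case base
  then show ?case using x_1_p_1 by simp
next
  case (Suc n)
  then have "xe n * p 1 = p 1 * xe n" "t (Suc n) * p 1 = p 1 * t (Suc n)"
    using p_t_commute[of 1 "Suc n"] by auto
  then show ?case by (simp only: xe.simps commute_triple)
qed

lemma xe_commutes_A: "n < k \<Longrightarrow> x \<in> A n \<Longrightarrow> xe n * x = x * xe n"
  by (rule commute_A[of n]) (auto intro: xe_commutes_t xe_commutes_p_1[simplified])

definition ATA :: "nat \<Rightarrow> 'a set" where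
  "ATA n = span (A n \<union> {a * t n * b | a b. a \<in> A n \<and> b \<in> A n})"

definition ATAX :: "nat \<Rightarrow> 'a set" where
  "ATAX n = span (A n \<union> {a * t n * b | a b. a \<in> A n \<and> b \<in> A n} \<union> {a * xe n | a. a \<in> A n})"

lemma ATA_base: "a \<in> A n \<Longrightarrow> a \<in> ATA n" "a \<in> A n \<Longrightarrow> b \<in> A n \<Longrightarrow> a * t n * b \<in> ATA n"
  unfolding ATA_def by (auto intro!: span_base)

lemma ATA_subspace: "subspace (ATA n)"
  unfolding ATA_def by (rule subspace_span)

lemma ATA_ATAX: "ATA n \<subseteq> ATAX n"
  unfolding ATA_def ATAX_def by (rule span_mono) auto

lemma ATAX_subspace: "subspace (ATAX n)"
  unfolding ATAX_def by (rule subspace_span)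

lemma ATAX_base: "a \<in> A n \<Longrightarrow> a * xe n \<in> ATAX n"
  unfolding ATAX_def by (auto intro!: span_base)

lemma ATA_subsetI:
  assumes "subspace W" "\<And>a. a \<in> A n \<Longrightarrow> a \<in> W" "\<And>a b. a \<in> A n \<Longrightarrow> b \<in> A n \<Longrightarrow> a * t n * b \<in> W"
  shows "ATA n \<subseteq> W"
  unfolding ATA_def using assms by (intro span_minimal) auto

lemma ATAX_subsetI:
  assumes "subspace W" "\<And>a. a \<in> A n \<Longrightarrow> a \<in> W" "\<And>a b. a \<in> A n \<Longrightarrow> b \<in> A n \<Longrightarrow> a * t n * b \<in> W"
    "\<And>a. a \<in> A n \<Longrightarrow> a * xe n \<in> W"
  shows "ATAX n \<subseteq> W"
  unfolding ATAX_def using assms by (intro span_minimal) auto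

lemma subspace_preimage:
  assumes "subspace W"
  shows "subspace {x. a * x * b \<in> W}"
  using assms by (intro subspaceI)
    (auto simp: distrib_left distrib_right cs_left cs_right
      intro: subspace_0 subspace_add subspace_scale)

lemma ATA_bimodule: "a \<in> A n \<Longrightarrow> b \<in> A n \<Longrightarrow> x \<in> ATA n \<Longrightarrow> a * x * b \<in> ATA n"
proof -
  assume ab: "a \<in> A n" "b \<in> A n" and x: "x \<in> ATA n"
  have "ATA n \<subseteq> {x. a * x * b \<in> ATA n}"
  proof (rule ATA_subsetI[OF subspace_preimage[OF ATA_subspace]]; intro CollectI)
    fix c assume "c \<in> A n"
    with ab show "a * c * b \<in> ATA n" by (intro ATA_base A_mult)
    fix d assume d: "d \<in> A n"
    have "(a * c) * t n * (d * b) \<in> ATA n" using ab d \<open>c \<in> A n\<close> by (intro ATA_base A_mult)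
    then show "a * (c * t n * d) * b \<in> ATA n" by (simp add: mult.assoc)
  qed
  with x show ?thesis by auto
qed

text \<open>Conjugation by \<open>t (n + 1)\<close> maps the spanning sets of rank \<open>n\<close> into those of rank \<open>n + 1\<close>: it is
  harmless on \<open>A n\<close> by the quadratic relation and on \<open>A n * t n * A n\<close> by the braid relation.\<close>

lemma t_A_t:
  assumes n: "Suc n < k" and a: "a \<in> A n"
  shows "t (Suc n) * a * t (Suc n) \<in> ATA (Suc n)"
proof -
  have a': "a \<in> A (Suc n)" using a A_mono[of n "Suc n"] by auto
  have "t (Suc n) * a * t (Suc n) = a * (t (Suc n) * t (Suc n))"
    using t_commutes_A[of n "Suc n" a] n a by (simp add: mult.assoc)
  also have "\<dots> = cs h (a * t (Suc n) * 1) + a"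
    using n by (simp add: t_quadratic distrib_left cs_right)
  also have "\<dots> \<in> ATA (Suc n)"
    using a' A_1 by (intro subspace_add[OF ATA_subspace] subspace_scale[OF ATA_subspace] ATA_base)
  finally show ?thesis .
qed

lemma t_AtA_t:
  assumes n: "Suc n < k" and a: "a \<in> A n" "b \<in> A n"
  shows "t (Suc n) * (a * t n * b) * t (Suc n) \<in> ATA (Suc n)"
proof (cases "n = 0")
  case True
  then show ?thesis using subspace_0[OF ATA_subspace] by (simp add: t_0)
next
  case False
  have a': "a \<in> A (Suc n)" "b \<in> A (Suc n)" "t n \<in> A (Suc n)"
    using a A_mono[of n "Suc n"] A_t[of n "Suc n"] False by auto
  have c: "t (Suc n) * a = a * t (Suc n)" "t (Suc n) * b = b * t (Suc n)"
    using t_commutes_A[of n "Suc n"] n a by auto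
  have "t (Suc n) * (a * t n * b) * t (Suc n) = (t (Suc n) * a) * t n * (b * t (Suc n))"
    by (simp add: mult.assoc)
  also have "\<dots> = a * (t (Suc n) * t n * t (Suc n)) * b"
    by (simp only: c(1) c(2)[symmetric] mult.assoc)
  also have "\<dots> = (a * t n) * t (Suc n) * (t n * b)"
  proof -
    have "t (Suc n) * t n * t (Suc n) = t n * t (Suc n) * t n" using t_braid[of n] False n by simp
    then show ?thesis by (simp only: mult.assoc)
  qed
  also have "\<dots> \<in> ATA (Suc n)" using a' by (intro ATA_base A_mult)
  finally show ?thesis .
qed

lemma t_ATA_t:
  assumes n: "Suc n < k" and x: "x \<in> ATA n"
  shows "t (Suc n) * x * t (Suc n) \<in> ATA (Suc n)"
proof -
  have "ATA n \<subseteq> {x. t (Suc n) * x * t (Suc n) \<in> ATA (Suc n)}"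
    using t_A_t[OF n] t_AtA_t[OF n]
    by (intro ATA_subsetI subspace_preimage ATA_subspace) auto
  with x show ?thesis by auto
qed

text \<open>Modulo \<open>ATA n\<close> the element \<open>X\<^sub>n\<^sub>+\<^sub>1\<close> is annihilated by \<open>p 1\<close>. For \<open>n = 1\<close> the product is \<open>p 1 - p 2\<close>, and
  conjugation raises the rank.\<close>

lemma xe_p_1: "1 \<le> n \<Longrightarrow> n < k \<Longrightarrow> xe n * p 1 \<in> ATA n"
proof (induction n rule: nat_induct_at_least)
  case base
  have "p 2 = cs q (p 1 * t 1 * p 1 - cs h (p 1))" using p_Suc[of 1] base by (simp add: numeral_2_eq_2)
  moreover have p1: "p 1 \<in> ATA 1" "p 1 * t 1 * p 1 \<in> ATA 1"
    using A_p[of 1 1] ATA_base by auto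
  ultimately have "p 2 \<in> ATA 1"
    by (simp only: subspace_diff[OF ATA_subspace] subspace_scale[OF ATA_subspace])
  with p1 show ?case using x_1_p_1(1) base subspace_diff[OF ATA_subspace] by simp
next
  case (Suc n)
  have "xe (Suc n) * p 1 = t (Suc n) * (xe n * p 1) * t (Suc n)"
    using p_t_commute[of 1 "Suc n"] Suc by (simp add: mult.assoc)
  then show ?case using t_ATA_t[of n "xe n * p 1"] Suc by simp
qed

text \<open>The analogue of \<open>H\<^sub>n\<^sub>+\<^sub>1 = H\<^sub>n + H\<^sub>n T\<^sub>n H\<^sub>n\<close> for the Hecke algebras. The right side is stable under left
  multiplication by the generators. Those outside \<open>A n\<close> are \<open>t n\<close> and \<open>p (n + 1)\<close>, and the latter is
  expressed by \<open>t n\<close> and \<open>p n\<close>. The products to control are \<open>t n * a * t n\<close> with \<open>a\<close> in \<open>A n\<close>, hence by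
  induction in the span of rank \<open>n - 1\<close>, and \<open>t n * xe n\<close>.\<close>

theorem A_Suc_subset: "n < k \<Longrightarrow> A (Suc n) \<subseteq> ATAX n"
proof (induction n)
  case 0
  show ?case
  proof (rule A_subset)
    show "subspace (ATAX 0)" by (rule ATAX_subspace)
    have A0: "a \<in> ATAX 0" if "a \<in> A 0" for a using ATA_base(1)[OF that] ATA_ATAX by auto
    then show "1 \<in> ATAX 0" using A_1 by simp
    fix i x assume i: "1 \<le> i" "i \<le> Suc 0" and x: "x \<in> ATAX 0"
    have "ATAX 0 \<subseteq> {x. p 1 * x * 1 \<in> ATAX 0}"
    proof (rule ATAX_subsetI[OF subspace_preimage[OF ATAX_subspace]]; intro CollectI)
      fix a assume a: "a \<in> A 0"
      have c: "z * a = a * z" for z by (rule commute_A[OF _ _ _ a]) auto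
      have "p 1 * a = a - a * xe 0" using c[of "p 1"] by (simp add: right_diff_distrib)
      then show "p 1 * a * 1 \<in> ATAX 0"
        using subspace_diff[OF ATAX_subspace A0[OF a] ATAX_base[OF a]] by simp
      have "p 1 * (a * xe 0) = a * (p 1 * xe 0)" by (simp only: c[of "p 1"] mult.assoc[symmetric])
      also have "p 1 * xe 0 = 0" using p_idem[of 1] 0 by (simp add: right_diff_distrib)
      finally show "p 1 * (a * xe 0) * 1 \<in> ATAX 0" using subspace_0[OF ATAX_subspace] by simp
      fix b show "p 1 * (a * t 0 * b) * 1 \<in> ATAX 0"
        using subspace_0[OF ATAX_subspace] by (simp add: t_0)
    qed
    with x i show "p i * x \<in> ATAX 0" by (auto simp: le_Suc_eq)
  qed auto
next
  case (Suc n)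
  let ?t = "t (Suc n)"
  have sub: "A n \<subseteq> A (Suc n)" by (rule A_mono) simp
  have ATA: "ATA (Suc n) \<subseteq> ATAX (Suc n)" by (rule ATA_ATAX)
  have left: "a * x \<in> ATAX (Suc n)" if a: "a \<in> A (Suc n)" and x: "x \<in> ATAX (Suc n)" for a x
  proof -
    have "ATAX (Suc n) \<subseteq> {x. a * x * 1 \<in> ATAX (Suc n)}"
    proof (rule ATAX_subsetI[OF subspace_preimage[OF ATAX_subspace]]; intro CollectI)
      fix c assume c: "c \<in> A (Suc n)"
      show "a * c * 1 \<in> ATAX (Suc n)" using ATA_base(1)[OF A_mult[OF a c]] ATA by auto
      have "(a * c) * xe (Suc n) \<in> ATAX (Suc n)" using a c by (intro ATAX_base A_mult)
      then show "a * (c * xe (Suc n)) * 1 \<in> ATAX (Suc n)" by (simp only: mult.assoc mult_1_right)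
      fix d assume d: "d \<in> A (Suc n)"
      have "(a * c) * ?t * d \<in> ATAX (Suc n)" using a c d ATA by (blast intro: ATA_base A_mult)
      then show "a * (c * ?t * d) * 1 \<in> ATAX (Suc n)" by (simp add: mult.assoc)
    qed
    with x show ?thesis by auto
  qed
  have right: "x * b \<in> ATAX (Suc n)" if b: "b \<in> A (Suc n)" and x: "x \<in> ATAX (Suc n)" for b x
  proof -
    have "ATAX (Suc n) \<subseteq> {x. 1 * x * b \<in> ATAX (Suc n)}"
    proof (rule ATAX_subsetI[OF subspace_preimage[OF ATAX_subspace]]; intro CollectI)
      fix c assume c: "c \<in> A (Suc n)"
      show "1 * c * b \<in> ATAX (Suc n)" using ATA_base(1)[OF A_mult[OF c b]] ATA by auto
      have "(c * b) * xe (Suc n) \<in> ATAX (Suc n)" using b c by (intro ATAX_base A_mult)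
      then show "1 * (c * xe (Suc n)) * b \<in> ATAX (Suc n)"
        using xe_commutes_A[OF Suc.prems b] by (simp only: mult.assoc mult_1_left)
      fix d assume d: "d \<in> A (Suc n)"
      have "c * ?t * (d * b) \<in> ATAX (Suc n)" using b c d ATA by (blast intro: ATA_base A_mult)
      then show "1 * (c * ?t * d) * b \<in> ATAX (Suc n)" by (simp add: mult.assoc)
    qed
    with x show ?thesis by auto
  qed
  have tat: "?t * a * ?t \<in> ATAX (Suc n)" if a: "a \<in> A (Suc n)" for a
  proof -
    have "ATAX n \<subseteq> {x. ?t * x * ?t \<in> ATAX (Suc n)}"
    proof (rule ATAX_subsetI[OF subspace_preimage[OF ATAX_subspace]]; intro CollectI)
      fix c assume c: "c \<in> A n"
      show "?t * c * ?t \<in> ATAX (Suc n)" using t_A_t[OF Suc.prems c] ATA by auto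
      have "?t * (c * xe n) * ?t = c * xe (Suc n)"
        using t_commutes_A[of n "Suc n" c] Suc.prems c by (simp add: mult.assoc) (metis mult.assoc)
      then show "?t * (c * xe n) * ?t \<in> ATAX (Suc n)" using ATAX_base[of c "Suc n"] sub c by auto
      fix d assume "d \<in> A n"
      then show "?t * (c * t n * d) * ?t \<in> ATAX (Suc n)" using t_AtA_t[OF Suc.prems c] ATA by auto
    qed
    then show ?thesis using a Suc by auto
  qed
  have t: "?t * x \<in> ATAX (Suc n)" if x: "x \<in> ATAX (Suc n)" for x
  proof -
    have "ATAX (Suc n) \<subseteq> {x. ?t * x * 1 \<in> ATAX (Suc n)}"
    proof (rule ATAX_subsetI[OF subspace_preimage[OF ATAX_subspace]]; intro CollectI)
      fix c assume c: "c \<in> A (Suc n)"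
      have "1 * ?t * c \<in> ATA (Suc n)" using c A_1 by (intro ATA_base)
      then show tc: "?t * c * 1 \<in> ATAX (Suc n)" using ATA by auto
      have "?t * (c * xe (Suc n)) = ?t * ?t * xe n * ?t * c"
        using xe_commutes_A[OF Suc.prems c] by (simp add: mult.assoc)
      also have "\<dots> = cs h (c * xe (Suc n)) + xe n * (?t * c)"
        using t_quadratic[of "Suc n"] Suc.prems xe_commutes_A[OF Suc.prems c]
        by (simp add: distrib_right cs_left cs_right mult.assoc)
      also have "\<dots> \<in> ATAX (Suc n)"
      proof (rule subspace_add[OF ATAX_subspace subspace_scale[OF ATAX_subspace ATAX_base[OF c]]])
        have "?t * c \<in> ATAX (Suc n)" using tc by simp
        then show "xe n * (?t * c) \<in> ATAX (Suc n)" by (rule left[rotated]) (simp add: xe_A)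
      qed
      finally show "?t * (c * xe (Suc n)) * 1 \<in> ATAX (Suc n)" by simp
      fix d assume d: "d \<in> A (Suc n)"
      show "?t * (c * ?t * d) * 1 \<in> ATAX (Suc n)"
        using right[OF d tat[OF c]] by (simp add: mult.assoc)
    qed
    with x show ?thesis by auto
  qed
  show ?case
  proof (rule A_subset)
    show "subspace (ATAX (Suc n))" by (rule ATAX_subspace)
    show "1 \<in> ATAX (Suc n)" using ATA_base(1)[OF A_1] ATA by auto
    show "t i * x \<in> ATAX (Suc n)" if "1 \<le> i" "i < Suc (Suc n)" "x \<in> ATAX (Suc n)" for i x
      using that t[of x] left[of "t i" x] A_t[of i "Suc n"] by (cases "i = Suc n") auto
    show "p i * x \<in> ATAX (Suc n)" if i: "1 \<le> i" "i \<le> Suc (Suc n)" and x: "x \<in> ATAX (Suc n)" for i x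
    proof (cases "i = Suc (Suc n)")
      case False
      then show ?thesis using i x left[of "p i" x] A_p[of i "Suc n"] by auto
    next
      case True
      let ?p = "p (Suc n)"
      have px: "?p * y \<in> ATAX (Suc n)" if "y \<in> ATAX (Suc n)" for y
        using left[OF _ that] A_p[of "Suc n" "Suc n"] by simp
      have "p i * x = cs q (?p * (?t * (?p * x)) - cs h (?p * x))"
        using p_Suc[of "Suc n"] True Suc.prems by (simp add: cs_left left_diff_distrib mult.assoc)
      then show ?thesis using px t x
        by (auto intro!: subspace_diff[OF ATAX_subspace] subspace_scale[OF ATAX_subspace])
    qed
  qed
qed

end


section \<open>Adding and removing boxes\<close>

definition next_col :: "box set \<Rightarrow> nat \<Rightarrow> nat \<Rightarrow> nat" where
  "next_col N j r = (LEAST c. 1 \<le> c \<and> (j, r, c) \<notin> N)"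

lemma next_col:
  assumes "finite N"
  shows "1 \<le> next_col N j r" "(j, r, next_col N j r) \<notin> N"
    "1 \<le> c \<Longrightarrow> c < next_col N j r \<Longrightarrow> (j, r, c) \<in> N"
    "1 \<le> c \<Longrightarrow> (j, r, c) \<notin> N \<Longrightarrow> next_col N j r \<le> c"
proof -
  have "finite ((\<lambda>x. snd (snd x)) ` N)" using assms by simp
  then obtain m where "\<forall>c\<in>(\<lambda>x. snd (snd x)) ` N. c < m" using finite_nat_set_iff_bounded by blast
  then have "(j, r, Suc m) \<notin> N" by force
  then have "1 \<le> Suc m \<and> (j, r, Suc m) \<notin> N" by simp
  from LeastI[of "\<lambda>c. 1 \<le> c \<and> (j, r, c) \<notin> N", OF this]
  show "1 \<le> next_col N j r" "(j, r, next_col N j r) \<notin> N" by (simp_all add: next_col_def)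
  show "1 \<le> c \<Longrightarrow> c < next_col N j r \<Longrightarrow> (j, r, c) \<in> N"
    using not_less_Least[of c "\<lambda>c. 1 \<le> c \<and> (j, r, c) \<notin> N"] by (auto simp: next_col_def)
  show "1 \<le> c \<Longrightarrow> (j, r, c) \<notin> N \<Longrightarrow> next_col N j r \<le> c"
    using Least_le[of "\<lambda>c. 1 \<le> c \<and> (j, r, c) \<notin> N" c] by (auto simp: next_col_def)
qed

lemma addable_next_col:
  assumes N: "shape N" and j: "j = 1 \<and> r = 1 \<or> j = 2 \<and> 1 \<le> r"
    and above: "r = 1 \<or> (j, r - 1, next_col N j r) \<in> N"
  shows "addable (j, r, next_col N j r) N"
proof -
  note nc = next_col[OF shape_finite[OF N], where j = j and r = r]
  have "shape (insert (j, r, next_col N j r) N)"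
    unfolding shape_def
  proof (intro conjI allI impI)
    show "finite (insert (j, r, next_col N j r) N)" using shape_finite[OF N] by simp
    fix j' r' c' assume m: "(j', r', c') \<in> insert (j, r, next_col N j r) N"
    then show "j' = 1 \<and> r' = 1 \<or> j' = 2 \<and> 1 \<le> r'" "1 \<le> c'"
      using j nc(1) shape_valid[OF N, of j' r' c'] by auto
    fix r2 c2 assume le: "1 \<le> r2 \<and> r2 \<le> r' \<and> 1 \<le> c2 \<and> c2 \<le> c'"
    show "(j', r2, c2) \<in> insert (j, r, next_col N j r) N"
    proof (cases "(j', r', c') \<in> N")
      case True
      then show ?thesis using shape_down[OF N True, of r2 c2] le by simp
    next
      case False
      then have eq: "j' = j" "r' = r" "c' = next_col N j r" using m by auto
      show ?thesis
      proof (cases "r2 = r")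
        case True
        then show ?thesis using nc(3)[of c2] le eq by (cases "c2 = c'") auto
      next
        case False
        then have "(j, r - 1, next_col N j r) \<in> N" using above le eq by auto
        from shape_down[OF N this, of r2 c2] show ?thesis using le eq False by auto
      qed
    qed
  qed
  with nc(2) show ?thesis by (simp add: addable_def)
qed

lemma addable_exists: "shape N \<Longrightarrow> \<exists>b. addable b N"
  using addable_next_col[of N 1 1] by auto

text \<open>A removable box in a row of the second diagram makes the next row extendable, and the first row is
  always extendable. The row of the first diagram is extendable, and it ends in a removable box unless
  it is empty.\<close>

lemma card_removable_less_addable:
  assumes N: "shape N"
  shows "card {b \<in> N. shape (N - {b})} + 1 + (if \<forall>x\<in>N. fst x \<noteq> 1 then 1 else 0) \<le> card {b. addable b N}"
proof -
  let ?R = "{b \<in> N. shape (N - {b})}"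
  let ?n = "\<lambda>j r. (j, r, next_col N j r)"
  \<comment> \<open>A removable box is sent to the next box of its row in the first diagram, and to the next box of the row below in the second one.\<close>
  define \<psi> :: "box \<Rightarrow> box" where "\<psi> b = (if fst b = 1 then ?n 1 1 else ?n 2 (Suc (fst (snd b))))" for b
  define X where "X = insert (?n 2 1) (if \<forall>x\<in>N. fst x \<noteq> 1 then {?n 1 1} else {})"
  have fin: "finite ?R" "finite X" using shape_finite[OF N] by (simp_all add: X_def)
  have same_row: "c = c'" if b: "(j, r, c) \<in> ?R" "(j, r, c') \<in> ?R" for j r c c'
  proof -
    have "\<not> a < a'" if a: "(j, r, a) \<in> ?R" "(j, r, a') \<in> ?R" for a a'
    proof
      assume "a < a'"
      then have "(j, r, a') \<in> N - {(j, r, a)}" using a by simp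
      from shape_down[OF _ this, of r a] show False
        using a \<open>a < a'\<close> shape_valid[OF N, of j r a] by auto
    qed
    from this[OF b] this[OF b(2,1)] show ?thesis by simp
  qed
  have comp: "fst b = 1 \<and> fst (snd b) = 1 \<or> fst b = 2 \<and> 1 \<le> fst (snd b)" if "b \<in> N" for b
    using shape_valid[OF N, of "fst b" "fst (snd b)" "snd (snd b)"] that by auto
  have "inj_on \<psi> ?R"
  proof (rule inj_onI)
    fix b b' assume b: "b \<in> ?R" "b' \<in> ?R" and eq: "\<psi> b = \<psi> b'"
    then have "fst b = fst b' \<and> fst (snd b) = fst (snd b')"
      using comp[of b] comp[of b'] by (auto simp: \<psi>_def split: if_splits)
    moreover obtain j r c where bj: "b = (j, r, c)" by (cases b)
    moreover obtain j' r' c' where "b' = (j', r', c')" by (cases b')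
    ultimately show "b = b'" using b same_row[of j r c c'] by simp
  qed
  moreover have "\<psi> b \<notin> X" if "b \<in> ?R" for b
    using comp[of b] that by (auto simp: \<psi>_def X_def split: if_splits)
  then have "\<psi> ` ?R \<inter> X = {}" by blast
  ultimately have "card (\<psi> ` ?R \<union> X) = card ?R + card X"
    using fin by (subst card_Un_disjoint) (auto simp: card_image)
  moreover have "card X = 1 + (if \<forall>x\<in>N. fst x \<noteq> 1 then 1 else 0)" by (simp add: X_def)
  moreover have "\<psi> ` ?R \<union> X \<subseteq> {b. addable b N}"
  proof -
    have "addable (\<psi> b) N" if b: "b \<in> ?R" for b
    proof (cases "fst b = 1")
      case True
      then show ?thesis using addable_next_col[OF N, of 1 1] by (simp add: \<psi>_def)
    next
      case False
      obtain r c where bb: "b = (2, r, c)" "1 \<le> r" "1 \<le> c"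
        using comp[of b] b False shape_valid[OF N, of "fst b" "fst (snd b)" "snd (snd b)"] by (cases b) auto
      have "(2, Suc r, c) \<notin> N"
      proof
        assume "(2, Suc r, c) \<in> N"
        then have "(2, Suc r, c) \<in> N - {b}" by (simp add: bb)
        from shape_down[OF _ this, of r c] show False using b bb by auto
      qed
      then have "next_col N 2 (Suc r) \<le> c" using next_col(4)[OF shape_finite[OF N]] bb by blast
      then have "(2, r, next_col N 2 (Suc r)) \<in> N"
        using shape_down[OF N, of 2 r c r "next_col N 2 (Suc r)"] b bb next_col(1)[OF shape_finite[OF N]] by auto
      then show ?thesis using addable_next_col[OF N, of 2 "Suc r"] bb by (simp add: \<psi>_def)
    qed
    then show ?thesis using addable_next_col[OF N, of 2 1] addable_next_col[OF N, of 1 1]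
      by (auto simp: X_def split: if_splits)
  qed
  then have "card (\<psi> ` ?R \<union> X) \<le> card {b. addable b N}" by (intro card_mono finite_addable N)
  ultimately show ?thesis by simp
qed

text \<open>Such tableaux are those on which \<open>P\<^sub>1\<close> acts by \<open>1\<close>.\<close>

lemma std_starting_in_row:
  "shape N \<Longrightarrow> \<exists>x\<in>N. fst x = 1 \<Longrightarrow> \<exists>l. std l \<and> set l = N \<and> fst (last l) = 1"
proof (induction "card N" arbitrary: N)
  case 0
  then show ?case using shape_finite[of N] by auto
next
  case (Suc n)
  show ?case
  proof (cases "\<exists>x\<in>N. fst x \<noteq> 1")
    case True
    then obtain b where b: "b \<in> N" "fst b \<noteq> 1" "shape (N - {b})"
      using removable_exists[OF Suc(3)] by metis
    have n: "n = card (N - {b})" using Suc(2) b(1) shape_finite[OF Suc(3)] by simp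
    have "\<exists>x\<in>N - {b}. fst x = 1" using Suc(4) b(2) by (metis DiffI singletonD)
    from Suc(1)[OF n b(3) this] obtain l where l: "std l" "set l = N - {b}" "fst (last l) = 1" by (elim exE conjE)
    have "l \<noteq> []" using l(2) \<open>\<exists>x\<in>N - {b}. fst x = 1\<close> by fastforce
    then have "std (b # l) \<and> set (b # l) = N \<and> fst (last (b # l)) = 1"
      using l b Suc(3) by (auto simp: addable_def insert_absorb)
    then show ?thesis by blast
  next
    case False
    obtain l where l: "std l" "set l = N" using std_exists[OF Suc(3)] by blast
    have "l \<noteq> []" using l(2) Suc(2) by auto
    then show ?thesis using l False last_in_set by blast
  qed
qed


section \<open>Linear algebra\<close>

context vector_space
begin

lemma span_image_sum:
  assumes "finite Z" "x \<in> span (g ` Z)"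
  shows "\<exists>d. x = (\<Sum>z\<in>Z. d z *s g z)"
proof -
  have "span (g ` Z) \<subseteq> {x. \<exists>d. x = (\<Sum>z\<in>Z. d z *s g z)}"
  proof (rule span_minimal)
    show "subspace {x. \<exists>d. x = (\<Sum>z\<in>Z. d z *s g z)}"
    proof (rule subspaceI; (elim CollectE exE)?; intro CollectI)
      show "\<exists>d. 0 = (\<Sum>z\<in>Z. d z *s g z)" by (rule exI[of _ "\<lambda>_. 0"]) simp
      fix x y d d' assume "x = (\<Sum>z\<in>Z. d z *s g z)" "y = (\<Sum>z\<in>Z. d' z *s g z)"
      then show "\<exists>d. x + y = (\<Sum>z\<in>Z. d z *s g z)"
        by (intro exI[of _ "\<lambda>z. d z + d' z"]) (simp add: scale_left_distrib sum.distrib)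
    next
      fix c x d assume "x = (\<Sum>z\<in>Z. d z *s g z)"
      then show "\<exists>d. c *s x = (\<Sum>z\<in>Z. d z *s g z)"
        by (intro exI[of _ "\<lambda>z. c * d z"]) (simp add: scale_sum_right)
    qed
    show "g ` Z \<subseteq> {x. \<exists>d. x = (\<Sum>z\<in>Z. d z *s g z)}"
    proof (intro subsetI CollectI; elim imageE)
      fix x z assume "x = g z" "z \<in> Z"
      then show "\<exists>d. x = (\<Sum>z\<in>Z. d z *s g z)"
        using assms(1) by (intro exI[of _ "\<lambda>z'. if z' = z then 1 else 0"])
          (simp add: if_distrib[where f = "\<lambda>c. c *s y" for y] cong: if_cong)
    qed
  qed
  with assms(2) show ?thesis by blast
qed

text \<open>Otherwise one member could be dropped, and fewer than \<open>card S\<close> vectors would span the independent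
  set \<open>S\<close>.\<close>

lemma spanning_family_independent:
  assumes Z: "finite Z" and S: "independent S" "S \<subseteq> span (g ` Z)" "card Z \<le> card S" "finite S"
    and zero: "(\<Sum>z\<in>Z. d z *s g z) = 0" and z: "z \<in> Z"
  shows "d z = 0"
proof (rule ccontr)
  assume d: "d z \<noteq> 0"
  have "d z *s g z + (\<Sum>y\<in>Z - {z}. d y *s g y) = 0"
    using zero sum.remove[OF Z z, of "\<lambda>z. d z *s g z"] by simp
  then have "d z *s g z = - (\<Sum>y\<in>Z - {z}. d y *s g y)" by (simp add: eq_neg_iff_add_eq_0)
  then have "inverse (d z) *s (d z *s g z) = - (inverse (d z) *s (\<Sum>y\<in>Z - {z}. d y *s g y))" by simp
  moreover have "inverse (d z) *s (d z *s g z) = g z" using d by simp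
  moreover have "- (inverse (d z) *s (\<Sum>y\<in>Z - {z}. d y *s g y)) \<in> span (g ` (Z - {z}))"
    by (intro span_neg span_scale span_sum span_base) auto
  ultimately have "g z \<in> span (g ` (Z - {z}))" by simp
  then have "g ` Z \<subseteq> span (g ` (Z - {z}))"
    by (auto intro: span_base)
  then have "S \<subseteq> span (g ` (Z - {z}))" using S(2) span_minimal[OF _ subspace_span] by blast
  then have "card S \<le> card (g ` (Z - {z}))"
    using independent_span_bound[OF _ S(1)] Z by simp
  also have "\<dots> \<le> card (Z - {z})" using Z by (intro card_image_le) simp
  also have "\<dots> < card Z" using Z z by (intro psubset_card_mono) auto
  finally show False using S(3) by simp
qed

end

lemma independent_unit_fun:
  assumes "finite L"
  shows "\<not> module.dependent fscale (unit_fun ` L)" "card (unit_fun ` L) = card L"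
proof -
  interpret F: vector_space fscale by (rule vector_space_fscale)
  have inj: "inj_on (unit_fun :: 'a \<Rightarrow> _) L"
    by (rule inj_onI) (metis unit_fun_def zero_neq_one)
  then show "card (unit_fun ` L) = card L" by (rule card_image)
  show "F.independent (unit_fun ` L)"
  proof
    assume "F.dependent (unit_fun ` L)"
    then obtain u v where u: "v \<in> unit_fun ` L" "u v \<noteq> 0" "(\<Sum>v\<in>unit_fun ` L. fscale (u v) v) = 0"
      using F.dependent_finite[of "unit_fun ` L"] assms by auto
    obtain l where l: "l \<in> L" "v = unit_fun l" using u(1) by blast
    have "(\<Sum>m\<in>L. fscale (u (unit_fun m)) (unit_fun m)) l = 0"
      using u(3) by (simp add: sum.reindex[OF inj])
    moreover have "(\<Sum>m\<in>L. fscale (u (unit_fun m)) (unit_fun m)) l = u v"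
    proof -
      have uf: "unit_fun m l = (if m = l then 1 else 0)" for m by (auto simp: unit_fun_def)
      show ?thesis
        using assms l by (simp add: sum_fun_apply fscale_apply uf if_distrib cong: if_cong)
    qed
    ultimately show False using u(2) by simp
  qed
qed


section \<open>The seminormal representations separate points\<close>

text \<open>A model through which the seminormal representations of rank \<open>k\<close> factor, and hence those of
  smaller rank, since every tableau extends to one with \<open>k\<close> boxes.\<close>

locale faithful_rook_model = rook_model +
  assumes op_of_ev_eq_0: "f \<in> carrier (free_algebra k) \<Longrightarrow> ev f = 0 \<Longrightarrow> l \<in> St k \<Longrightarrow> op f g l = 0"
begin

lemma op_ev_eq_0:
  assumes "n \<le> k" "f \<in> carrier (free_algebra n)" "ev f = 0" "l \<in> St n"
  shows "op f g l = 0"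
  using assms
proof (induction "k - n" arbitrary: n l g)
  case 0
  then show ?case using op_of_ev_eq_0 by simp
next
  case (Suc m)
  obtain b where b: "addable b (set l)"
    using addable_exists[OF std_shape[of l]] Suc.prems(4) unfolding St_def by blast
  then have bl: "b # l \<in> St (Suc n)" using Suc.prems by (simp add: Cons_in_St)
  have "op f (\<lambda>l. g (tl l)) (b # l) = 0"
    using Suc.prems Suc.hyps(2) free_algebra_mono[of n "Suc n"] bl by (intro Suc.hyps(1)[of "Suc n"]) auto
  moreover have "op f (\<lambda>l. g (tl l)) (b # l) = op f g l"
    using op_Cons[OF Suc.prems(2), of b l "\<lambda>l. g (tl l)"] bl by (simp add: St_def)
  ultimately show ?case by simp
qed

lemma mat_ev_cong:
  assumes "n \<le> k" "f \<in> carrier (free_algebra n)" "g \<in> carrier (free_algebra n)" "ev f = ev g" "l \<in> St n"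
  shows "mat f l m = mat g l m"
  using op_ev_eq_0[of n "f - g" l "unit_fun m"] assms
  by (simp add: mat_def op_apply_simps free_algebra_closed ev_simps)

text \<open>Joint injectivity of the seminormal representations on \<open>A n\<close>.\<close>

definition separated :: "nat \<Rightarrow> bool" where
  "separated n \<longleftrightarrow> (\<forall>f\<in>carrier (free_algebra n). (\<forall>l\<in>St n. \<forall>m\<in>St n. mat f l m = 0) \<longrightarrow> ev f = 0)"

lemma separatedD:
  assumes "separated n" "f \<in> carrier (free_algebra n)" "g \<in> carrier (free_algebra n)"
    "\<And>l m. l \<in> St n \<Longrightarrow> m \<in> St n \<Longrightarrow> mat f l m = mat g l m"
  shows "ev f = ev g"
proof -
  have "ev (f - g) = 0"
    using assms free_algebra_closed(4)[of f n g] by (simp add: separated_def mat_simps)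
  then show ?thesis by (simp add: ev_simps)
qed

end

text \<open>The inductive step: rank \<open>n\<close> is separated, and two tableaux \<open>s\<close>, \<open>s'\<close> with \<open>n\<close> boxes cut out a
  block of \<open>A (n + 1)\<close>.\<close>

locale block = faithful_rook_model +
  fixes n :: nat and s s' :: "box list"
  assumes n: "n < k" and sep: "separated n" and s: "s \<in> St n" "s' \<in> St n"
begin

abbreviation E where "E l m \<equiv> ev (mu n l m)"

lemma n_le: "n \<le> k" using n by simp

lemmas mu_in = mu_closed[OF n_le]

lemma in_A_Suc: "f \<in> carrier (free_algebra n) \<Longrightarrow> f \<in> carrier (free_algebra (Suc n))"
  using free_algebra_mono[of n "Suc n"] by auto

lemma E_expand_left:
  assumes l: "l \<in> St n" and f: "f \<in> carrier (free_algebra n)"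
  shows "E l l * ev f = (\<Sum>m\<in>St n. cs (mat f l m) (E l m))"
proof -
  have "ev (mu n l l * f) = ev (\<Sum>m\<in>St n. scal (mat f l m) * mu n l m)"
  proof (rule separatedD[OF sep])
    show "mu n l l * f \<in> carrier (free_algebra n)"
      "(\<Sum>m\<in>St n. scal (mat f l m) * mu n l m) \<in> carrier (free_algebra n)"
      using l f by (auto intro!: free_algebra_closed free_algebra_sum scal_closed mu_in)
    fix a c assume a: "a \<in> St n" and c: "c \<in> St n"
    have "mat (\<Sum>m\<in>St n. scal (mat f l m) * mu n l m) a c =
      (\<Sum>m\<in>St n. if m = c then (if a = l then mat f l m else 0) else 0)"
      unfolding mat_sum
    proof (rule sum.cong[OF refl])
      fix m assume m: "m \<in> St n"
      show "mat (scal (mat f l m) * mu n l m) a c = (if m = c then (if a = l then mat f l m else 0) else 0)"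
      proof (cases "set l = set m")
        case True
        then show ?thesis using mat_mu[OF n_le l m True a c] by (auto simp: mat_simps)
      next
        case False
        then have "mat f l m = 0" using l by (intro mat_eq_0) (auto simp: St_def)
        then show ?thesis by (cases "m = c") (auto simp: mat_simps)
      qed
    qed
    also have "\<dots> = (if a = l then mat f l c else 0)" using c by (simp add: finite_St)
    finally show "mat (mu n l l * f) a c = mat (\<Sum>m\<in>St n. scal (mat f l m) * mu n l m) a c"
      using mat_mu_left[OF n_le l l refl a] by simp
  qed
  then show ?thesis by (simp add: ev_simps ev_sum cs_left)
qed

lemma E_expand_right:
  assumes l: "l \<in> St n" and f: "f \<in> carrier (free_algebra n)"
  shows "ev f * E l l = (\<Sum>m\<in>St n. cs (mat f m l) (E m l))"
proof -
  have "ev (f * mu n l l) = ev (\<Sum>m\<in>St n. scal (mat f m l) * mu n m l)"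
  proof (rule separatedD[OF sep])
    show "f * mu n l l \<in> carrier (free_algebra n)"
      "(\<Sum>m\<in>St n. scal (mat f m l) * mu n m l) \<in> carrier (free_algebra n)"
      using l f by (auto intro!: free_algebra_closed free_algebra_sum scal_closed mu_in)
    fix a c assume a: "a \<in> St n" and c: "c \<in> St n"
    have "mat (\<Sum>m\<in>St n. scal (mat f m l) * mu n m l) a c =
      (\<Sum>m\<in>St n. if m = a then (if c = l then mat f m l else 0) else 0)"
      unfolding mat_sum
    proof (rule sum.cong[OF refl])
      fix m assume m: "m \<in> St n"
      show "mat (scal (mat f m l) * mu n m l) a c = (if m = a then (if c = l then mat f m l else 0) else 0)"
      proof (cases "set m = set l")
        case True
        then show ?thesis using mat_mu[OF n_le m l True a c] by (auto simp: mat_simps)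
      next
        case False
        then have "mat f m l = 0" using m by (intro mat_eq_0) (auto simp: St_def)
        then show ?thesis by (cases "m = a") (auto simp: mat_simps)
      qed
    qed
    also have "\<dots> = (if c = l then mat f a l else 0)" using a by (simp add: finite_St)
    finally show "mat (f * mu n l l) a c = mat (\<Sum>m\<in>St n. scal (mat f m l) * mu n m l) a c"
      using mat_mu_right[OF n_le l l refl a c] by simp
  qed
  then show ?thesis by (simp add: ev_simps ev_sum cs_left)
qed

lemma E_compress:
  assumes f: "f \<in> carrier (free_algebra n)"
  shows "E s s * ev f * E s' s' = cs (mat f s s') (E s s')"
proof (cases "set s = set s'")
  case True
  have "ev (mu n s s * f * mu n s' s') = ev (scal (mat f s s') * mu n s s')"
  proof (rule separatedD[OF sep])
    fix a c assume a: "a \<in> St n" and c: "c \<in> St n"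
    show "mat (mu n s s * f * mu n s' s') a c = mat (scal (mat f s s') * mu n s s') a c"
      using mat_mu_right[OF n_le s(2) s(2) refl a c, of "mu n s s * f"]
        mat_mu_left[OF n_le s(1) s(1) refl a, of f] mat_mu[OF n_le s True a c]
      by (auto simp: mat_simps)
  qed (use s f in \<open>auto intro!: free_algebra_closed scal_closed mu_in\<close>)
  then show ?thesis by (simp add: ev_simps cs_left)
next
  case False
  have "ev (mu n s s * f * mu n s' s') = ev 0"
  proof (rule separatedD[OF sep])
    fix a c assume a: "a \<in> St n" and c: "c \<in> St n"
    have "mat f s s' = 0" using s False by (intro mat_eq_0) (auto simp: St_def)
    then show "mat (mu n s s * f * mu n s' s') a c = mat 0 a c"
      using mat_mu_right[OF n_le s(2) s(2) refl a c, of "mu n s s * f"]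
        mat_mu_left[OF n_le s(1) s(1) refl a, of f]
      by (auto simp: mat_simps)
  qed (use s f in \<open>auto intro!: free_algebra_closed free_algebra_zero mu_in\<close>)
  then show ?thesis using False by (simp add: ev_simps mu_def)
qed

lemma E_mult:
  assumes "l \<in> St n" "m \<in> St n" "m' \<in> St n" "set l = set m" "set m = set m'"
  shows "E l m * E m m' = E l m'"
proof -
  have "ev (mu n l m * mu n m m') = ev (mu n l m')"
  proof (rule separatedD[OF sep])
    fix a c assume a: "a \<in> St n" and c: "c \<in> St n"
    show "mat (mu n l m * mu n m m') a c = mat (mu n l m') a c"
      using mat_mu_left[OF n_le assms(1,2,4) a, of "mu n m m'"] assms a c by (simp add: mat_mu n_le)
  qed (use assms in \<open>auto intro!: free_algebra_closed mu_in\<close>)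
  then show ?thesis by (simp add: ev_simps)
qed

lemma E_A: "l \<in> St n \<Longrightarrow> m \<in> St n \<Longrightarrow> E l m \<in> A n"
  unfolding A_def by (auto intro!: imageI mu_in)

text \<open>A matrix unit of rank \<open>n - 1\<close> acts on those of rank \<open>n\<close> by restriction of tableaux.\<close>

lemma E_mult_lower:
  assumes r: "r \<in> St (n - 1)" "u \<in> St (n - 1)" "set r = set u" and l: "l \<in> St n"
    and b: "b # r \<in> St n" "set l = set (b # r)" and f: "matrix_unit (n - 1) r u f"
  shows "E l (b # r) * ev f = E l (b # u)"
proof -
  have pos: "Suc (n - 1) = n" using b by (auto simp: St_def)
  have bu: "b # u \<in> St n" using b r pos Cons_in_St[of b r "n - 1"] Cons_in_St[of b u "n - 1"] by simp
  have "ev (mu n l (b # r) * f) = ev (mu n l (b # u))"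
  proof (rule separatedD[OF sep])
    show "mu n l (b # r) * f \<in> carrier (free_algebra n)" "mu n l (b # u) \<in> carrier (free_algebra n)"
      using l b bu matrix_unitD(1)[OF f] free_algebra_mono[of "n - 1" n]
      by (auto intro!: free_algebra_closed mu_in)
    fix a c assume a: "a \<in> St n" and c: "c \<in> St n"
    then obtain y c' where c': "c = y # c'" "c' \<in> St (n - 1)" by (metis St_SucE pos)
    have "mat f (b # r) (y # c') = (if b = y then mat f r c' else 0)"
      using b pos by (intro mat_Cons[OF matrix_unitD(1)[OF f]]) simp
    also have "mat f r c' = (if c' = u then 1 else 0)"
      using matrix_unitD(2)[OF f r(1) c'(2)] by simp
    finally have "mat f (b # r) c = (if c = b # u then 1 else 0)" using c' by auto
    then show "mat (mu n l (b # r) * f) a c = mat (mu n l (b # u)) a c"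
      using mat_mu_left[OF n_le l b(1,2) a, of f] mat_mu[OF n_le l bu _ a c] b r
      by (cases "c = b # u") simp_all
  qed
  then show ?thesis by (simp add: ev_simps)
qed

lemma lower_mult_E:
  assumes r: "r \<in> St (n - 1)" "u \<in> St (n - 1)" "w \<in> St (n - 1)" "set r = set u" and l: "l \<in> St n"
    and b: "b # w \<in> St n" "set (b # w) = set l" and f: "matrix_unit (n - 1) r u f"
  shows "ev f * E (b # w) l = (if u = w then E (b # r) l else 0)"
proof -
  have pos: "Suc (n - 1) = n" using b by (auto simp: St_def)
  have f_in: "f \<in> carrier (free_algebra n)"
    using matrix_unitD(1)[OF f] free_algebra_mono[of "n - 1" n] by auto
  have mf: "mat (f * mu n (b # w) l) a c = (if c = l \<and> u = w \<and> a = b # r then 1 else 0)"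
    if a: "a \<in> St n" and c: "c \<in> St n" for a c
  proof -
    obtain y a' where a': "a = y # a'" "a' \<in> St (n - 1)" by (metis St_SucE pos a)
    have "mat f (y # a') (b # w) = (if y = b then mat f a' w else 0)"
      using a a' pos by (intro mat_Cons[OF matrix_unitD(1)[OF f]]) simp
    moreover have "mat f a' w = (if a' = r \<and> w = u then 1 else 0)"
      by (rule matrix_unitD(2)[OF f a'(2) r(3)])
    ultimately show ?thesis using mat_mu_right[OF n_le b(1) l b(2) a c, of f] a' by auto
  qed
  show ?thesis
  proof (cases "u = w")
    case True
    have br: "b # r \<in> St n" using b r True pos Cons_in_St[of b r "n - 1"] Cons_in_St[of b w "n - 1"] by simp
    have "ev (f * mu n (b # w) l) = ev (mu n (b # r) l)"
    proof (rule separatedD[OF sep])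
      fix a c assume a: "a \<in> St n" and c: "c \<in> St n"
      show "mat (f * mu n (b # w) l) a c = mat (mu n (b # r) l) a c"
        using mf[OF a c] mat_mu[OF n_le br l _ a c] b r True by simp
    qed (use br b l f_in in \<open>auto intro!: free_algebra_closed mu_in\<close>)
    then show ?thesis using True by (simp add: ev_simps)
  next
    case False
    have "ev (f * mu n (b # w) l) = ev 0"
    proof (rule separatedD[OF sep])
      fix a c assume a: "a \<in> St n" and c: "c \<in> St n"
      show "mat (f * mu n (b # w) l) a c = mat 0 a c"
        using mf[OF a c] False by (simp add: mat_simps)
    qed (use b l f_in in \<open>auto intro!: free_algebra_closed free_algebra_zero mu_in\<close>)
    then show ?thesis using False by (simp add: ev_simps)
  qed
qed

text \<open>Matrix units of rank \<open>n - 1\<close> commute with \<open>t n\<close>, so they can be moved from the left factor to the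
  right one.\<close>

lemma E_t_E:
  assumes m: "b # r \<in> St n" "b' # u \<in> St n" "set s = set (b # r)" "set (b' # u) = set s'"
  shows "r \<noteq> u \<Longrightarrow> E s (b # r) * t n * E (b' # u) s' = 0"
    "u = r \<Longrightarrow> w \<in> St (n - 1) \<Longrightarrow> set w = set r \<Longrightarrow>
      E s (b # r) * t n * E (b' # u) s' = E s (b # w) * t n * E (b' # w) s'"
proof -
  have pos: "Suc (n - 1) = n" using m by (auto simp: St_def)
  have r: "r \<in> St (n - 1)" "u \<in> St (n - 1)"
    using m pos Cons_in_St[of b r "n - 1"] Cons_in_St[of b' u "n - 1"] by auto
  have le: "n - 1 \<le> k" using n by simp
  have comm: "x * t n = t n * x" if "x \<in> A (n - 1)" for x
    using t_commutes_A[of "n - 1" n x] that pos n by simp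
  have move: "E s (b # w) * ev f * t n * z = E s (b # w) * t n * (ev f * z)"
    if "matrix_unit (n - 1) v w' f" for w v w' f z
  proof -
    have "ev f \<in> A (n - 1)" using matrix_unitD(1)[OF that] by (simp add: A_def)
    from comm[OF this] show ?thesis by (simp add: mult.assoc[symmetric]) (simp add: mult.assoc)
  qed
  {
    assume ne: "r \<noteq> u"
    obtain f where f: "matrix_unit (n - 1) r r f" using matrix_units_exist[OF le r(1) r(1) refl] by blast
    have "E s (b # r) * t n * E (b' # u) s' = E s (b # r) * ev f * t n * E (b' # u) s'"
      using E_mult_lower[OF r(1) r(1) refl s(1) m(1,3) f] by simp
    also have "\<dots> = E s (b # r) * t n * (ev f * E (b' # u) s')" by (rule move[OF f])
    also have "ev f * E (b' # u) s' = 0"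
      using lower_mult_E[OF r(1) r(1) r(2) refl s(2) m(2,4) f] ne by simp
    finally show "E s (b # r) * t n * E (b' # u) s' = 0" by simp
  }
  assume u: "u = r" and w: "w \<in> St (n - 1)" "set w = set r"
  obtain f where f: "matrix_unit (n - 1) w r f" using matrix_units_exist[OF le w(1) r(1) w(2)] by blast
  have bw: "b # w \<in> St n" using m(1) w pos Cons_in_St[of b r "n - 1"] Cons_in_St[of b w "n - 1"] by simp
  have "E s (b # r) * t n * E (b' # u) s' = E s (b # w) * ev f * t n * E (b' # u) s'"
    using E_mult_lower[OF w(1) r(1) w(2) s(1) bw _ f] m(3) w by simp
  also have "\<dots> = E s (b # w) * t n * (ev f * E (b' # u) s')" by (rule move[OF f])
  also have "ev f * E (b' # u) s' = E (b' # w) s'"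
    using lower_mult_E[OF w(1) r(1) r(2) w(2) s(2) m(2,4) f] u by simp
  finally show "E s (b # r) * t n * E (b' # u) s' = E s (b # w) * t n * E (b' # w) s'" .
qed

text \<open>The common subshapes index the products \<open>E s m * t n * E m' s'\<close> that need not vanish, and the
  common covers index the coordinates of its image.\<close>

definition common_subshapes :: "box set set" where
  "common_subshapes = {R. shape R \<and> (\<exists>b b'. addable b R \<and> addable b' R \<and> insert b R = set s \<and> insert b' R = set s')}"

definition common_covers :: "(box \<times> box) set" where
  "common_covers = {(b, b'). addable b (set s) \<and> addable b' (set s') \<and> insert b (set s) = insert b' (set s')}"

text \<open>By \<open>E_t_E\<close> the value under \<open>ev\<close> is the same for all choices.\<close>

definition T_elt :: "box set \<Rightarrow> free_elt" where
  "T_elt R = (SOME y. \<exists>b b' r. b # r \<in> St n \<and> b' # r \<in> St n \<and> set s = set (b # r) \<and>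
     set (b' # r) = set s' \<and> set r = R \<and> y = mu n s (b # r) * genT n * mu n (b' # r) s')"

lemma T_elt:
  assumes "b # r \<in> St n" "b' # r \<in> St n" "set s = set (b # r)" "set (b' # r) = set s'"
  shows "ev (T_elt (set r)) = E s (b # r) * t n * E (b' # r) s'" "set r \<in> common_subshapes"
proof -
  have "\<exists>y c c' w. c # w \<in> St n \<and> c' # w \<in> St n \<and> set s = set (c # w) \<and>
     set (c' # w) = set s' \<and> set w = set r \<and> y = mu n s (c # w) * genT n * mu n (c' # w) s'"
    using assms by blast
  from someI_ex[OF this] obtain c c' w where w: "c # w \<in> St n" "c' # w \<in> St n" "set s = set (c # w)"
    "set (c' # w) = set s'" "set w = set r" "T_elt (set r) = mu n s (c # w) * genT n * mu n (c' # w) s'"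
    unfolding T_elt_def[symmetric] by blast
  have pos: "Suc (n - 1) = n" using assms by (auto simp: St_def)
  have ad: "r \<in> St (n - 1)" "w \<in> St (n - 1)" "addable b (set r)" "addable b' (set r)"
    "addable c (set r)" "addable c' (set r)"
    using assms w pos Cons_in_St[of _ r "n - 1"] Cons_in_St[of _ w "n - 1"] by auto
  have "c = b" "c' = b'" using w assms ad by (auto simp: addable_def)
  then show "ev (T_elt (set r)) = E s (b # r) * t n * E (b' # r) s'"
    using w E_t_E(2)[OF assms(1,2,3,4) refl ad(2) w(5)] by (simp add: ev_simps)
  show "set r \<in> common_subshapes"
    unfolding common_subshapes_def
    by (intro CollectI conjI exI[of _ b] exI[of _ b'])
      (use assms ad std_shape[of r] in \<open>simp_all add: St_def\<close>)
qed

lemma T_elt_closed: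
  assumes "R \<in> common_subshapes"
  shows "T_elt R \<in> carrier (free_algebra (Suc n))"
proof -
  obtain b b' where R: "shape R" "addable b R" "addable b' R" "insert b R = set s" "insert b' R = set s'"
    using assms by (auto simp: common_subshapes_def)
  have "card (set s) = n" using s std_card by (auto simp: St_def)
  then have "Suc (card R) = n" using R shape_finite[OF R(1)] by (auto simp: addable_def dest!: arg_cong[of _ _ card])
  then have pos: "Suc (n - 1) = n" "card R = n - 1" by auto
  obtain r where r: "r \<in> St (n - 1)" "set r = R" using St_exists[OF R(1) pos(2)] by blast
  have "b # r \<in> St n" "b' # r \<in> St n"
    using R r pos Cons_in_St[of _ r "n - 1"] by auto
  then have "\<exists>y c c' w. c # w \<in> St n \<and> c' # w \<in> St n \<and> set s = set (c # w) \<and>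
     set (c' # w) = set s' \<and> set w = R \<and> y = mu n s (c # w) * genT n * mu n (c' # w) s'"
    using R r by (metis list.simps(15))
  from someI_ex[OF this] obtain c c' w where w: "c # w \<in> St n" "c' # w \<in> St n"
    "T_elt R = mu n s (c # w) * genT n * mu n (c' # w) s'"
    unfolding T_elt_def[symmetric] by blast
  moreover have "1 \<le> n" using pos by linarith
  ultimately show ?thesis using s
    by (simp only:) (intro free_algebra_closed(2) genT_closed in_A_Suc mu_in; simp)
qed

text \<open>Together these span the block: the summands \<open>A n * t n * A n\<close>, \<open>A n\<close> and \<open>A n * xe n\<close> contribute in this
  order.\<close>

definition spanning_elts :: "free_elt set" where
  "spanning_elts = T_elt ` common_subshapes \<union> (if set s = set s' then insert (mu n s s')
     (if \<forall>x\<in>set s. fst x \<noteq> 1 then {mu n s s' * X_elt n} else {}) else {})"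

lemma spanning_elts_closed: "z \<in> spanning_elts \<Longrightarrow> z \<in> carrier (free_algebra (Suc n))"
proof -
  assume "z \<in> spanning_elts"
  then consider R where "R \<in> common_subshapes" "z = T_elt R" | "z = mu n s s'" | "z = mu n s s' * X_elt n"
    by (auto simp: spanning_elts_def split: if_splits)
  then show ?thesis
    by cases (use s in \<open>simp_all add: T_elt_closed free_algebra_closed in_A_Suc mu_in X_elt_closed\<close>)
qed

lemma cs_E_span: "cs c (E s s') \<in> span (ev ` spanning_elts)"
proof (cases "set s = set s'")
  case True
  then have "mu n s s' \<in> spanning_elts" by (simp add: spanning_elts_def)
  then show ?thesis by (intro span_scale span_base imageI)
qed (simp add: mu_def ev_simps span_zero)

lemma E_t_E_span:
  assumes m: "m \<in> St n" "m' \<in> St n"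
  shows "E s m * t n * E m' s' \<in> span (ev ` spanning_elts)"
proof (cases "n = 0 \<or> set s \<noteq> set m \<or> set m' \<noteq> set s'")
  case True
  then have "E s m * t n * E m' s' = 0" by (auto simp: t_0 mu_def ev_simps)
  then show ?thesis by (simp add: span_zero)
next
  case False
  then obtain b r b' u where e: "m = b # r" "m' = b' # u" using m by (cases m; cases m') (auto simp: St_def)
  note a = m[unfolded e]
  show ?thesis
  proof (cases "u = r")
    case False2: False
    then show ?thesis using E_t_E(1)[OF a] False e by (simp add: span_zero)
  next
    case True
    then have "ev (T_elt (set r)) = E s m * t n * E m' s'" "set r \<in> common_subshapes"
      using T_elt[of b r b'] a False e by auto
    moreover from this(2) have "T_elt (set r) \<in> spanning_elts" by (simp add: spanning_elts_def)
    then have "ev (T_elt (set r)) \<in> span (ev ` spanning_elts)" by (intro span_base imageI)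
    ultimately show ?thesis by simp
  qed
qed

lemma ATA_span:
  assumes "x \<in> ATA n"
  shows "E s s * x * E s' s' \<in> span (ev ` spanning_elts)"
proof -
  have "ATA n \<subseteq> {x. E s s * x * E s' s' \<in> span (ev ` spanning_elts)}"
  proof (rule ATA_subsetI[OF subspace_preimage[OF subspace_span]]; intro CollectI)
    fix a assume "a \<in> A n"
    then show "E s s * a * E s' s' \<in> span (ev ` spanning_elts)"
      using E_compress cs_E_span by (auto simp: A_def)
    fix b assume "b \<in> A n"
    with \<open>a \<in> A n\<close> obtain f g where f: "f \<in> carrier (free_algebra n)" "a = ev f"
      and g: "g \<in> carrier (free_algebra n)" "b = ev g" by (auto simp: A_def)
    have "E s s * (a * t n * b) * E s' s' = (E s s * ev f) * t n * (ev g * E s' s')"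
      by (simp add: f g mult.assoc)
    also have "\<dots> = (\<Sum>m'\<in>St n. cs (mat g m' s') (\<Sum>m\<in>St n. cs (mat f s m) (E s m * t n * E m' s')))"
      unfolding E_expand_left[OF s(1) f(1)] E_expand_right[OF s(2) g(1)]
      by (simp add: sum_distrib_left sum_distrib_right cs_left cs_right)
    also have "\<dots> \<in> span (ev ` spanning_elts)"
      by (intro span_sum span_scale E_t_E_span)
    finally show "E s s * (a * t n * b) * E s' s' \<in> span (ev ` spanning_elts)" .
  qed
  with assms show ?thesis by blast
qed

text \<open>If the shape has a row in the first diagram, let \<open>l\<close> be a tableau with entry \<open>1\<close> there. Then
  \<open>E l s'\<close> absorbs \<open>p 1\<close>, and \<open>xe n * p 1\<close> lies in \<open>ATA n\<close>.\<close>

lemma E_X_span: "E s s' * xe n \<in> span (ev ` spanning_elts)"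
proof (cases "set s = set s' \<and> (\<exists>x\<in>set s. fst x = 1)")
  case False
  then show ?thesis
  proof (cases "set s = set s'")
    case True
    with False have "mu n s s' * X_elt n \<in> spanning_elts" by (auto simp: spanning_elts_def)
    then have "ev (mu n s s' * X_elt n) \<in> span (ev ` spanning_elts)" by (intro span_base imageI)
    then show ?thesis by (simp add: ev_simps ev_X_elt)
  qed (simp add: mu_def ev_simps span_zero)
next
  case True
  then have N: "set s = set s'" by simp
  obtain l where l: "std l" "set l = set s" "fst (last l) = 1"
    using std_starting_in_row[of "set s"] True std_shape s by (auto simp: St_def)
  have lS: "l \<in> St n" using std_card[OF l(1)] l(1,2) s(1) std_card[of s] by (simp add: St_def)
  have n1: "1 \<le> n" using True s by (cases s) (auto simp: St_def)
  have P: "p 1 * E l s' = E l s'"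
  proof -
    have "ev (genP 1 * mu n l s') = ev (mu n l s')"
    proof (rule separatedD[OF sep])
      show "genP 1 * mu n l s' \<in> carrier (free_algebra n)" "mu n l s' \<in> carrier (free_algebra n)"
        using lS s n1 by (auto intro!: free_algebra_closed mu_in genP_closed)
      fix a c assume a: "a \<in> St n" and c: "c \<in> St n"
      have "mat (genP 1 * mu n l s') a c = (if \<forall>b\<in>set (drop (length a - 1) a). fst b = 1 then mat (mu n l s') a c else 0)"
        by (simp add: mat_def op_apply_simps P_op_def)
      moreover have "drop (length a - 1) a = [last a]"
        using a n1 by (cases a rule: rev_cases) (auto simp: St_def)
      ultimately show "mat (genP 1 * mu n l s') a c = mat (mu n l s') a c"
        using mat_mu[OF n_le lS s(2) _ a c] l N by (cases "a = l"; cases "c = s'") simp_all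
    qed
    then show ?thesis by (simp add: ev_simps)
  qed
  have "E s s' * xe n = E s l * (E l s' * xe n)"
    using E_mult[OF s(1) lS s(2)] l N by (simp add: mult.assoc[symmetric])
  also have "E l s' * xe n = xe n * E l s'"
    using xe_commutes_A[OF n E_A[OF lS s(2)]] by simp
  also have "\<dots> = xe n * p 1 * E l s'" by (simp only: mult.assoc P)
  finally have eq: "E s s' * xe n = E s l * (xe n * p 1) * E l s'" by (simp add: mult.assoc)
  have "E s l * (xe n * p 1) * E l s' \<in> ATA n"
    using xe_p_1[OF n1 n] E_A lS s by (intro ATA_bimodule) auto
  from ATA_span[OF this]
  have "E s s * E s l * (xe n * p 1) * (E l s' * E s' s') \<in> span (ev ` spanning_elts)"
    by (simp add: mult.assoc)
  then show ?thesis using eq E_mult[OF s(1) s(1) lS refl] E_mult[OF lS s(2) s(2) _ refl] l N by simp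
qed

lemma block_span:
  assumes "x \<in> A (Suc n)"
  shows "E s s * x * E s' s' \<in> span (ev ` spanning_elts)"
proof -
  have "ATAX n \<subseteq> {x. E s s * x * E s' s' \<in> span (ev ` spanning_elts)}"
  proof (rule ATAX_subsetI[OF subspace_preimage[OF subspace_span]]; intro CollectI)
    fix a assume a: "a \<in> A n"
    show "E s s * a * E s' s' \<in> span (ev ` spanning_elts)" using ATA_span[OF ATA_base(1)[OF a]] .
    show "E s s * (a * t n * b) * E s' s' \<in> span (ev ` spanning_elts)" if "b \<in> A n" for b
      using ATA_span[OF ATA_base(2)[OF a that]] .
    obtain f where f: "f \<in> carrier (free_algebra n)" "a = ev f" using a by (auto simp: A_def)
    have "E s s * (a * xe n) * E s' s' = (E s s * a * E s' s') * xe n"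
      using xe_commutes_A[OF n E_A[OF s(2) s(2)]] by (simp add: mult.assoc)
    also have "\<dots> = cs (mat f s s') (E s s' * xe n)" by (simp add: f(2) E_compress[OF f(1)] cs_left)
    finally show "E s s * (a * xe n) * E s' s' \<in> span (ev ` spanning_elts)"
      using E_X_span by (simp add: span_scale)
  qed
  with assms A_Suc_subset[OF n] show ?thesis by blast
qed

lemma finite_common: "finite common_subshapes" "finite common_covers"
proof -
  have N: "shape (set s)" "shape (set s')" using s std_shape by (auto simp: St_def)
  have "common_subshapes \<subseteq> (\<lambda>b. set s - {b}) ` set s"
    by (auto simp: common_subshapes_def addable_def image_iff)
  then show "finite common_subshapes" by (rule finite_subset) simp
  have "common_covers \<subseteq> {b. addable b (set s)} \<times> {b. addable b (set s')}"
    by (auto simp: common_covers_def)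
  then show "finite common_covers" using finite_addable[OF N(1)] finite_addable[OF N(2)] by (auto intro: finite_subset)
qed

text \<open>For equal shapes the subshapes correspond to removable boxes and the covers to addable ones. Two
  different shapes have at most one common subshape, their intersection, and then their union is a
  common cover.\<close>

lemma card_spanning_elts: "finite spanning_elts" "card spanning_elts \<le> card common_covers"
proof -
  show "finite spanning_elts" using finite_common by (simp add: spanning_elts_def)
  have N: "shape (set s)" "shape (set s')" using s std_shape by (auto simp: St_def)
  show "card spanning_elts \<le> card common_covers"
  proof (cases "set s = set s'")
    case True
    let ?R = "{b \<in> set s. shape (set s - {b})}"
    have "common_subshapes \<subseteq> (\<lambda>b. set s - {b}) ` ?R"
    proof
      fix R assume "R \<in> common_subshapes"
      then obtain b where b: "shape R" "addable b R" "insert b R = set s" by (auto simp: common_subshapes_def)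
      then have "R = set s - {b}" by (auto simp: addable_def)
      with b show "R \<in> (\<lambda>b. set s - {b}) ` ?R" by blast
    qed
    then have "card common_subshapes \<le> card ((\<lambda>b. set s - {b}) ` ?R)" by (intro card_mono) auto
    also have "\<dots> \<le> card ?R" by (rule card_image_le) simp
    finally have 1: "card common_subshapes \<le> card ?R" .
    have "common_covers = (\<lambda>b. (b, b)) ` {b. addable b (set s)}"
      using True by (auto simp: common_covers_def addable_def)
    then have 2: "card common_covers = card {b. addable b (set s)}" by (simp add: card_image inj_on_def)
    let ?rest = "insert (mu n s s') (if \<forall>x\<in>set s. fst x \<noteq> 1 then {mu n s s' * X_elt n} else {})"
    have "spanning_elts = T_elt ` common_subshapes \<union> ?rest"
      unfolding spanning_elts_def if_P[OF True] by (rule refl)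
    then have "card spanning_elts \<le> card (T_elt ` common_subshapes) + card ?rest"
      by (simp only: card_Un_le)
    also have "\<dots> \<le> card common_subshapes + (1 + (if \<forall>x\<in>set s. fst x \<noteq> 1 then 1 else 0))"
      using finite_common by (intro add_mono card_image_le) (auto simp: card_insert_if)
    finally show ?thesis using 1 2 card_removable_less_addable[OF N(1)] by (auto split: if_splits)
  next
    case False
    have sub: "R = set s \<inter> set s'" if "R \<in> common_subshapes" for R
    proof -
      obtain b b' where b: "addable b R" "addable b' R" "insert b R = set s" "insert b' R = set s'"
        using \<open>R \<in> common_subshapes\<close> unfolding common_subshapes_def by blast
      have "b \<noteq> b'" using b False by auto
      then show ?thesis using b(1,2) unfolding b(3,4)[symmetric] by (auto simp: addable_def)
    qed
    show ?thesis
    proof (cases "common_subshapes = {}")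
      case True
      then show ?thesis using False by (simp add: spanning_elts_def)
    next
      case ne: False
      then obtain R b b' where R: "shape R" "addable b R" "addable b' R" "insert b R = set s" "insert b' R = set s'"
        by (auto simp: common_subshapes_def)
      have "b \<noteq> b'" using R False by auto
      then have "(b', b) \<in> common_covers"
        using addable_both[OF R(1,2,3)] addable_both[OF R(1,3,2)] R by (auto simp: common_covers_def)
      then have "1 \<le> card common_covers" using finite_common card_gt_0_iff by (metis One_nat_def Suc_leI empty_iff)
      moreover have "spanning_elts \<subseteq> {T_elt (set s \<inter> set s')}" using False sub by (auto simp: spanning_elts_def)
      then have "card spanning_elts \<le> 1" using card_mono[of "{T_elt (set s \<inter> set s')}" spanning_elts] by simp
      ultimately show ?thesis by simp
    qed
  qed
qed

text \<open>The image of the block contains all unit vectors indexed by \<open>common_covers\<close>, and the block is spanned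
  by at most that many elements. So the images of the spanning elements are independent.\<close>

lemma block_separated:
  assumes f: "f \<in> carrier (free_algebra (Suc n))"
    and zero: "\<And>l m. l \<in> St (Suc n) \<Longrightarrow> m \<in> St (Suc n) \<Longrightarrow> mat f l m = 0"
  shows "E s s * ev f * E s' s' = 0"
proof -
  \<comment> \<open>The coordinates of the block.\<close>
  define \<theta> :: "free_elt \<Rightarrow> box \<times> box \<Rightarrow> complex" where
    "\<theta> g = (\<lambda>(b, b'). if (b, b') \<in> common_covers then mat g (b # s) (b' # s') else 0)" for g
  interpret L: vector_space "fscale :: complex \<Rightarrow> (box \<times> box \<Rightarrow> complex) \<Rightarrow> _"
    by (rule vector_space_fscale)
  have St: "b # s \<in> St (Suc n)" "b' # s' \<in> St (Suc n)" if "(b, b') \<in> common_covers" for b b'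
    using that s by (auto simp: common_covers_def Cons_in_St)
  have \<theta>_lin: "\<theta> (\<Sum>z\<in>Z. scal (d z) * z) = (\<Sum>z\<in>Z. fscale (d z) (\<theta> z))" for d Z
    by (rule ext) (auto simp: \<theta>_def mat_sum mat_simps sum_fun_apply fscale_apply)
  have block: "\<theta> (mu n s s * g * mu n s' s') = \<theta> g" for g
  proof (rule ext, clarify)
    fix b b'
    show "\<theta> (mu n s s * g * mu n s' s') (b, b') = \<theta> g (b, b')"
      using mat_unit_mult_right[OF matrix_unit_mu[OF n_le s(2) s(2) refl], of "b # s" b' s' "mu n s s * g"]
        mat_unit_mult_left[OF matrix_unit_mu[OF n_le s(1) s(1) refl], of b s g "b' # s'"] St[of b b'] s
      by (auto simp: \<theta>_def)
  qed
  have expand: "\<exists>d. E s s * ev g * E s' s' = (\<Sum>z\<in>spanning_elts. cs (d z) (ev z)) \<and>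
      \<theta> g = (\<Sum>z\<in>spanning_elts. fscale (d z) (\<theta> z))" if g: "g \<in> carrier (free_algebra (Suc n))" for g
  proof -
    have "ev g \<in> A (Suc n)" using g by (simp add: A_def)
    from span_image_sum[OF card_spanning_elts(1) block_span[OF this]]
    obtain d where d: "E s s * ev g * E s' s' = (\<Sum>z\<in>spanning_elts. cs (d z) (ev z))" by blast
    let ?g = "mu n s s * g * mu n s' s'" and ?h = "\<Sum>z\<in>spanning_elts. scal (d z) * z"
    have cl: "?g \<in> carrier (free_algebra (Suc n))" "?h \<in> carrier (free_algebra (Suc n))"
      using g s by (simp add: free_algebra_closed in_A_Suc mu_in)
        (intro free_algebra_sum free_algebra_closed(2) scal_closed spanning_elts_closed)
    have "ev ?g = ev ?h" using d by (simp add: ev_simps ev_sum cs_left)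
    then have "mat ?g l m = mat ?h l m" if "l \<in> St (Suc n)" for l m
      using mat_ev_cong[of "Suc n" ?g ?h l m] cl that n by simp
    then have "\<theta> ?g = \<theta> ?h" using St by (auto simp: \<theta>_def)
    then show ?thesis using d \<theta>_lin block by auto
  qed
  obtain d where d: "E s s * ev f * E s' s' = (\<Sum>z\<in>spanning_elts. cs (d z) (ev z))"
    "\<theta> f = (\<Sum>z\<in>spanning_elts. fscale (d z) (\<theta> z))"
    using expand[OF f] by blast
  have "\<theta> f = 0" using zero St by (auto simp: \<theta>_def fun_eq_iff)
  then have zero_comb: "(\<Sum>z\<in>spanning_elts. fscale (d z) (\<theta> z)) = 0" using d by simp
  have units: "unit_fun ` common_covers \<subseteq> L.span (\<theta> ` spanning_elts)"
  proof (intro subsetI; elim imageE)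
    fix x and bb :: "box \<times> box" assume x: "x = unit_fun bb" and bb: "bb \<in> common_covers"
    obtain b b' where b: "bb = (b, b')" by (cases bb)
    have bs: "b # s \<in> St (Suc n)" "b' # s' \<in> St (Suc n)" "set (b # s) = set (b' # s')"
      using bb St[of b b'] by (auto simp: b common_covers_def)
    obtain g where g: "matrix_unit (Suc n) (b # s) (b' # s') g"
      using matrix_units_exist[OF _ bs] n by auto
    have x_eq: "\<theta> g = x"
    proof (rule ext, clarify)
      fix c c'
      show "\<theta> g (c, c') = x (c, c')"
        using matrix_unitD(2)[OF g, of "c # s" "c' # s'"] St[of c c'] bb
        by (auto simp: \<theta>_def x b unit_fun_def)
    qed
    obtain d where d: "\<theta> g = (\<Sum>z\<in>spanning_elts. fscale (d z) (\<theta> z))"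
      using expand[OF matrix_unitD(1)[OF g]] by blast
    have "(\<Sum>z\<in>spanning_elts. fscale (d z) (\<theta> z)) \<in> L.span (\<theta> ` spanning_elts)"
      by (intro L.span_sum L.span_scale L.span_base imageI)
    then show "x \<in> L.span (\<theta> ` spanning_elts)" by (simp only: d[symmetric] x_eq)
  qed
  have "d z = 0" if "z \<in> spanning_elts" for z
    using L.spanning_family_independent[OF card_spanning_elts(1) independent_unit_fun(1)[OF finite_common(2)]
        units _ _ zero_comb that] card_spanning_elts(2) independent_unit_fun(2)[OF finite_common(2)] finite_common(2)
    by simp
  then show ?thesis using d(1) by simp
qed

end

context faithful_rook_model
begin

text \<open>The identity is the sum of the diagonal matrix units of rank \<open>n\<close>, which cut \<open>A (n + 1)\<close> into blocks.\<close>

theorem all_separated: "n \<le> k \<Longrightarrow> separated n"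
proof (induction n)
  case 0
  show ?case
    unfolding separated_def
  proof (intro ballI impI)
    fix f assume f: "f \<in> carrier (free_algebra 0)" and z: "\<forall>l\<in>St 0. \<forall>m\<in>St 0. mat f l m = 0"
    have w: "w = 0" if "set (letters w) \<subseteq> rook_gens 0" for w
      using that by (cases w) (auto simp: rook_gens_def zero_rook_word_def)
    have "f = scal (Poly_Mapping.lookup f 0)"
    proof (rule poly_mapping_eqI)
      fix w
      have "w \<noteq> 0 \<Longrightarrow> w \<notin> Poly_Mapping.keys f" using f w[of w] by (auto simp: free_algebra_def)
      then show "Poly_Mapping.lookup f w = Poly_Mapping.lookup (scal (Poly_Mapping.lookup f 0)) w"
        by (auto simp: scal_def lookup_single when_def in_keys_iff)
    qed
    moreover from this have "mat f [] [] = Poly_Mapping.lookup f 0"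
      by (metis mat_simps(3,4) mult.right_neutral)
    ultimately show "ev f = 0" using z by (metis St_0 ev_simps(2) insertI1 scal_simps(2))
  qed
next
  case (Suc n)
  then have n: "n < k" and sep: "separated n" by auto
  show ?case
    unfolding separated_def
  proof (intro ballI impI)
    fix f assume f: "f \<in> carrier (free_algebra (Suc n))"
      and z: "\<forall>l\<in>St (Suc n). \<forall>m\<in>St (Suc n). mat f l m = 0"
    have one: "(\<Sum>s\<in>St n. ev (mu n s s)) = 1"
    proof -
      have "ev (\<Sum>s\<in>St n. mu n s s) = ev 1"
      proof (rule separatedD[OF sep])
        fix a c assume ac: "a \<in> St n" "c \<in> St n"
        have "mat (\<Sum>s\<in>St n. mu n s s) a c = (\<Sum>s\<in>St n. if s = a then (if c = a then 1 else 0) else 0)"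
          unfolding mat_sum using n ac by (intro sum.cong) (auto simp: mat_mu)
        also have "\<dots> = mat 1 a c" using ac by (simp add: finite_St mat_simps eq_commute)
        finally show "mat (\<Sum>s\<in>St n. mu n s s) a c = mat 1 a c" .
      qed (use n in \<open>auto intro!: free_algebra_sum mu_closed one_closed\<close>)
      then show ?thesis by (simp add: ev_sum ev_simps)
    qed
    have blocks: "ev (mu n s s) * ev f * ev (mu n s' s') = 0" if "s \<in> St n" "s' \<in> St n" for s s'
    proof -
      interpret block k q cs t p n s s'
        using n sep that by unfold_locales
      show ?thesis using block_separated[OF f] z by blast
    qed
    have "ev f = (\<Sum>s\<in>St n. ev (mu n s s)) * ev f * (\<Sum>s\<in>St n. ev (mu n s s))" by (simp add: one)
    also have "\<dots> = 0" by (simp add: sum_distrib_left sum_distrib_right blocks)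
    finally show "ev f = 0" .
  qed
qed

end


section \<open>The kernel of the seminormal representations\<close>

lemma rook_class_hom:
  assumes "f \<in> carrier (free_algebra k)" "g \<in> carrier (free_algebra k)"
  shows "rook_class k q f \<otimes>\<^bsub>rook_algebra k q\<^esub> rook_class k q g = rook_class k q (f * g)"
    "rook_class k q f \<oplus>\<^bsub>rook_algebra k q\<^esub> rook_class k q g = rook_class k q (f + g)"
proof -
  interpret ideal "rook_ideal k q" "free_algebra k" by (rule ideal_rook_ideal)
  from ring_hom_mult[OF rcos_ring_hom assms] ring_hom_add[OF rcos_ring_hom assms]
  show "rook_class k q f \<otimes>\<^bsub>rook_algebra k q\<^esub> rook_class k q g = rook_class k q (f * g)"
    "rook_class k q f \<oplus>\<^bsub>rook_algebra k q\<^esub> rook_class k q g = rook_class k q (f + g)"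
    by (simp_all add: rook_algebra_simps rook_class_def)
qed

lemma rook_class_closed: "f \<in> carrier (free_algebra k) \<Longrightarrow> rook_class k q f \<in> carrier (rook_algebra k q)"
  using ring_hom_closed[OF ideal.rcos_ring_hom[OF ideal_rook_ideal]]
  by (simp add: rook_algebra_simps rook_class_def)

lemma rook_class_one: "\<one>\<^bsub>rook_algebra k q\<^esub> = rook_class k q 1"
  using ring_hom_one[OF ideal.rcos_ring_hom[OF ideal_rook_ideal]]
  by (simp add: rook_algebra_simps rook_class_def)

lemma rook_class_zero: "\<zero>\<^bsub>rook_algebra k q\<^esub> = rook_class k q 0"
proof -
  interpret ring "rook_algebra k q" by (rule ring_rook_algebra)
  have "rook_class k q 0 \<oplus>\<^bsub>rook_algebra k q\<^esub> rook_class k q 0 = rook_class k q 0"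
    using rook_class_hom(2)[OF free_algebra_zero free_algebra_zero] by simp
  then show ?thesis using rook_class_closed[OF free_algebra_zero] by (metis l_zero add.right_cancel zero_closed)
qed

lemma rook_class_surj:
  assumes "x \<in> carrier (rook_algebra k q)"
  shows "\<exists>f\<in>carrier (free_algebra k). x = rook_class k q f"
  using assms by (auto simp: rook_algebra_simps rook_class_def FactRing_def A_RCOSETS_defs a_r_coset_def r_coset_def)

lemma rook_class_eq_zero_iff:
  assumes "f \<in> carrier (free_algebra k)"
  shows "rook_class k q f = \<zero>\<^bsub>rook_algebra k q\<^esub> \<longleftrightarrow> f \<in> rook_ideal k q"
proof -
  interpret ideal "rook_ideal k q" "free_algebra k" by (rule ideal_rook_ideal)
  have "\<zero>\<^bsub>rook_algebra k q\<^esub> = rook_ideal k q" by (simp add: rook_algebra_simps FactRing_def)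
  then show ?thesis using a_rcos_self[OF assms] a_rcos_const[of f] by (auto simp: rook_class_def)
qed

lemma rook_class_minus:
  assumes "f \<in> carrier (free_algebra k)"
  shows "\<ominus>\<^bsub>rook_algebra k q\<^esub> rook_class k q f = rook_class k q (- f)"
proof -
  interpret ring "rook_algebra k q" by (rule ring_rook_algebra)
  show ?thesis
    by (rule minus_equality)
      (use rook_class_hom(2)[of "- f" k f q] assms in
        \<open>auto simp: rook_class_zero intro: rook_class_closed free_algebra_closed\<close>)
qed

lemma rook_class_eq_iff:
  assumes "f \<in> carrier (free_algebra k)" "g \<in> carrier (free_algebra k)"
  shows "rook_class k q f = rook_class k q g \<longleftrightarrow> f - g \<in> rook_ideal k q"
proof -
  interpret ring "rook_algebra k q" by (rule ring_rook_algebra)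
  have "rook_class k q (f - g) = rook_class k q f \<ominus>\<^bsub>rook_algebra k q\<^esub> rook_class k q g"
    using assms rook_class_hom(2)[of f k "- g" q] by (simp add: a_minus_def rook_class_minus free_algebra_closed)
  then have "f - g \<in> rook_ideal k q \<longleftrightarrow>
    rook_class k q f \<ominus>\<^bsub>rook_algebra k q\<^esub> rook_class k q g = \<zero>\<^bsub>rook_algebra k q\<^esub>"
    using assms by (simp add: rook_class_eq_zero_iff[symmetric] free_algebra_closed)
  then show ?thesis using assms rook_class_closed[of f k q] rook_class_closed[of g k q]
    by (metis minus_equality minus_minus a_minus_def a_inv_closed r_neg)
qed

lemma rook_algebra_smult:
  assumes "f \<in> carrier (free_algebra k)"
  shows "c \<odot>\<^bsub>rook_algebra k q\<^esub> rook_class k q f = rook_class k q (scal c * f)"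
proof -
  have "c \<odot>\<^bsub>rook_algebra k q\<^esub> x = rook_class k q (scal c) \<otimes>\<^bsub>rook_algebra k q\<^esub> x" for x
    by (simp add: rook_algebra_def ring.defs module.defs monoid.defs partial_object.defs)
  then show ?thesis using rook_class_hom(1)[OF scal_closed assms] by simp
qed

lemma (in seminormal) rook_ideal_op:
  assumes "n \<le> k" "f \<in> rook_ideal n q" "l \<in> St n"
  shows "op f g l = 0"
proof -
  let ?Z = "{v. \<forall>l\<in>St n. v l = 0}"
  have "op f g \<in> ?Z"
  proof (rule op.rook_ideal_act[OF _ _ _ assms(2)])
    show "op.subspace ?Z"
      by (rule op.subspaceI) (auto simp: fscale_apply)
    show "gen_op q x v \<in> ?Z" if "v \<in> ?Z" for x v
    proof (clarify)
      fix l assume l: "l \<in> St n"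
      then have z: "v l' = 0" if "std l'" "length l' = length l" for l'
        using \<open>v \<in> ?Z\<close> that by (auto simp: St_def)
      have eq: "T_op q i v l = T_op q i (\<lambda>l. 0 * v l) l" for i
      proof (rule T_op_cong)
        show "std l" using l by (simp add: St_def)
        show "v l' = 0 * v l'" if "std l'" "length l' = length l" for l' using z[OF that] by simp
      qed
      have T: "T_op q i v l = 0" for i
        using trans[OF eq[of i] T_op_scale[of q i 0 v l]] by simp
      have "v l = 0" using z[of l] l by (simp add: St_def)
      with T show "gen_op q x v l = 0" by (cases x) (simp_all add: P_op_def)
    qed
    show "op r v \<in> ?Z" if "r \<in> rook_relations n q" for r v
      using op_relation[OF that _ assms(1)] by simp
  qed
  with assms(3) show ?thesis by blast
qed

text \<open>The algebra \<open>R\<^sub>k(q)\<close> depends on the parameters \<open>k\<close> and \<open>q\<close> and so is not a type. The product over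
  all parameters is a type of class \<^class>\<open>ring_1\<close>, in which \<open>R\<^sub>k(q)\<close> is one of the factors.\<close>

abbreviation rook_fiber :: "nat \<times> complex \<Rightarrow> (complex, free_elt set) module" where
  "rook_fiber \<kappa> \<equiv> rook_algebra (fst \<kappa>) (snd \<kappa>)"

typedef rook_product = "{F. \<forall>\<kappa>. F \<kappa> \<in> carrier (rook_fiber \<kappa>)}"
  by (rule exI[of _ "\<lambda>\<kappa>. \<zero>\<^bsub>rook_fiber \<kappa>\<^esub>"])
    (simp add: rook_class_zero rook_class_closed free_algebra_zero)

definition prod_class :: "(nat \<times> complex \<Rightarrow> free_elt) \<Rightarrow> rook_product" where
  "prod_class F = Abs_rook_product (\<lambda>\<kappa>. rook_class (fst \<kappa>) (snd \<kappa>) (F \<kappa>))"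

text \<open>A choice of representatives in all factors.\<close>

definition family :: "(nat \<times> complex \<Rightarrow> free_elt) \<Rightarrow> bool" where
  "family F \<longleftrightarrow> (\<forall>\<kappa>. F \<kappa> \<in> carrier (free_algebra (fst \<kappa>)))"

lemma familyD: "family F \<Longrightarrow> F \<kappa> \<in> carrier (free_algebra (fst \<kappa>))"
  unfolding family_def by blast

lemma Rep_prod_class: "family F \<Longrightarrow> Rep_rook_product (prod_class F) \<kappa> = rook_class (fst \<kappa>) (snd \<kappa>) (F \<kappa>)"
  unfolding prod_class_def
  by (subst Abs_rook_product_inverse) (simp_all add: familyD rook_class_closed del: split_paired_All)

lemma prod_class_surj: "\<exists>F. family F \<and> x = prod_class F"
proof -
  have "\<exists>f\<in>carrier (free_algebra (fst \<kappa>)). Rep_rook_product x \<kappa> = rook_class (fst \<kappa>) (snd \<kappa>) f" for \<kappa>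
    using Rep_rook_product[of x] by (intro rook_class_surj) blast
  then obtain F where F: "\<And>\<kappa>. F \<kappa> \<in> carrier (free_algebra (fst \<kappa>))"
    "\<And>\<kappa>. Rep_rook_product x \<kappa> = rook_class (fst \<kappa>) (snd \<kappa>) (F \<kappa>)" by metis
  then have "Rep_rook_product x = Rep_rook_product (prod_class F)"
    by (simp add: fun_eq_iff Rep_prod_class family_def del: split_paired_All)
  with F(1) show ?thesis unfolding family_def Rep_rook_product_inject by blast
qed

lemma prod_class_eq_iff:
  assumes "family F" "family G"
  shows "prod_class F = prod_class G \<longleftrightarrow> (\<forall>\<kappa>. F \<kappa> - G \<kappa> \<in> rook_ideal (fst \<kappa>) (snd \<kappa>))"
  using assms by (simp add: Rep_rook_product_inject[symmetric] fun_eq_iff Rep_prod_class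
      rook_class_eq_iff familyD del: split_paired_All)

lemma family_closed:
  "family F \<Longrightarrow> family G \<Longrightarrow> family (\<lambda>\<kappa>. F \<kappa> + G \<kappa>)" "family F \<Longrightarrow> family (\<lambda>\<kappa>. - F \<kappa>)"
  "family F \<Longrightarrow> family G \<Longrightarrow> family (\<lambda>\<kappa>. F \<kappa> - G \<kappa>)"
  "family F \<Longrightarrow> family G \<Longrightarrow> family (\<lambda>\<kappa>. F \<kappa> * G \<kappa>)" "family (\<lambda>\<kappa>. 0)" "family (\<lambda>\<kappa>. 1)"
  "family (\<lambda>\<kappa>. scal c)"
  using free_algebra_closed(3)[OF familyD familyD, of F F]
  by (simp_all add: family_def free_algebra_closed free_algebra_zero one_closed scal_closed del: split_paired_All)

instantiation rook_product :: ring_1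
begin

definition "0 = prod_class (\<lambda>\<kappa>. 0)"
definition "1 = prod_class (\<lambda>\<kappa>. 1)"
definition "x + y = Abs_rook_product (\<lambda>\<kappa>. Rep_rook_product x \<kappa> \<oplus>\<^bsub>rook_fiber \<kappa>\<^esub> Rep_rook_product y \<kappa>)"
definition "x * y = Abs_rook_product (\<lambda>\<kappa>. Rep_rook_product x \<kappa> \<otimes>\<^bsub>rook_fiber \<kappa>\<^esub> Rep_rook_product y \<kappa>)"
definition "- x = Abs_rook_product (\<lambda>\<kappa>. \<ominus>\<^bsub>rook_fiber \<kappa>\<^esub> Rep_rook_product x \<kappa>)"
definition "x - y = x + - (y :: rook_product)"

lemma prod_class_uminus: "family F \<Longrightarrow> - prod_class F = prod_class (\<lambda>\<kappa>. - F \<kappa>)"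
  unfolding uminus_rook_product_def prod_class_def[of "\<lambda>\<kappa>. - F \<kappa>"]
  by (simp add: Rep_prod_class rook_class_minus familyD)

lemma prod_class_hom:
  assumes "family F" "family G"
  shows "prod_class F + prod_class G = prod_class (\<lambda>\<kappa>. F \<kappa> + G \<kappa>)"
    "prod_class F * prod_class G = prod_class (\<lambda>\<kappa>. F \<kappa> * G \<kappa>)"
    "prod_class F - prod_class G = prod_class (\<lambda>\<kappa>. F \<kappa> - G \<kappa>)"
proof -
  show "prod_class F + prod_class G = prod_class (\<lambda>\<kappa>. F \<kappa> + G \<kappa>)"
    using assms unfolding plus_rook_product_def prod_class_def[of "\<lambda>\<kappa>. F \<kappa> + G \<kappa>"]
    by (simp add: Rep_prod_class rook_class_hom familyD)
  show "prod_class F * prod_class G = prod_class (\<lambda>\<kappa>. F \<kappa> * G \<kappa>)"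
    using assms unfolding times_rook_product_def prod_class_def[of "\<lambda>\<kappa>. F \<kappa> * G \<kappa>"]
    by (simp add: Rep_prod_class rook_class_hom familyD)
  have "prod_class F + prod_class (\<lambda>\<kappa>. - G \<kappa>) = prod_class (\<lambda>\<kappa>. F \<kappa> + - G \<kappa>)"
    using assms family_closed(2)[of G] familyD[OF family_closed(2)[OF assms(2)]]
    unfolding plus_rook_product_def prod_class_def[of "\<lambda>\<kappa>. F \<kappa> + - G \<kappa>"]
    by (simp add: Rep_prod_class rook_class_hom familyD del: add_uminus_conv_diff)
  then show "prod_class F - prod_class G = prod_class (\<lambda>\<kappa>. F \<kappa> - G \<kappa>)"
    using assms by (simp add: minus_rook_product_def prod_class_uminus)
qed

instance
proof
  fix a b c :: rook_product
  obtain F G H where abc: "a = prod_class F" "b = prod_class G" "c = prod_class H"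
    and fam: "family F" "family G" "family H" using prod_class_surj by metis
  note simps = abc fam prod_class_hom prod_class_uminus family_closed zero_rook_product_def one_rook_product_def
  show "a * b * c = a * (b * c)" "a + b + c = a + (b + c)" "a + b = b + a" "0 + a = a"
    "- a + a = 0" "a - b = a + - b" "1 * a = a" "a * 1 = a"
    "(a + b) * c = a * c + b * c" "a * (b + c) = a * b + a * c"
    by (simp_all add: simps ring_distribs mult.assoc add.assoc) (simp_all add: add.commute)
  show "(0 :: rook_product) \<noteq> 1"
  proof
    \<comment> \<open>The factor of rank \<open>0\<close> acts nontrivially on the empty tableau.\<close>
    assume "(0 :: rook_product) = 1"
    then have "\<forall>\<kappa>. (0 - 1 :: free_elt) \<in> rook_ideal (fst \<kappa>) (snd \<kappa>)"
      unfolding zero_rook_product_def one_rook_product_def prod_class_eq_iff[OF family_closed(5,6)] .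
    then have I: "0 - 1 \<in> rook_ideal 0 1" using spec[where x = "(0, 1)"] by fastforce
    interpret seminormal 0 1 by unfold_locales (simp_all add: q_fact_def)
    have "op (0 - 1) (unit_fun []) [] = 0" by (rule rook_ideal_op[OF _ I]) auto
    then show False
      by (simp only: op_apply_simps(2) op.act_one op.act_zero_left) (simp add: unit_fun_def)
  qed
qed

end

definition prod_scale :: "complex \<Rightarrow> rook_product \<Rightarrow> rook_product" where
  "prod_scale c x = prod_class (\<lambda>\<kappa>. scal c) * x"

lemma scal_commutes: "scal c * f = f * scal c"
proof (induction f rule: free_elt_induct)
  case (single w d)
  then show ?case by (simp add: scal_def mult_single mult.commute)
next
  case (add f g)
  then show ?case by (simp add: distrib_left distrib_right)
qed

lemma prod_scale_class: "family F \<Longrightarrow> prod_scale c (prod_class F) = prod_class (\<lambda>\<kappa>. scal c * F \<kappa>)"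
  by (simp add: prod_scale_def prod_class_hom family_closed)

text \<open>The generators of the factor \<open>(k, q)\<close>. In every other factor they are the scalars \<open>q\<close> and \<open>0\<close>,
  which satisfy the same relations.\<close>

definition fiber_T :: "nat \<Rightarrow> complex \<Rightarrow> nat \<Rightarrow> nat \<times> complex \<Rightarrow> free_elt" where
  "fiber_T k q i \<kappa> = (if i = 0 \<or> k \<le> i then 0 else if \<kappa> = (k, q) then genT i else scal q)"

definition fiber_P :: "nat \<Rightarrow> complex \<Rightarrow> nat \<Rightarrow> nat \<times> complex \<Rightarrow> free_elt" where
  "fiber_P k q i \<kappa> = (if 1 \<le> i \<and> i \<le> k \<and> \<kappa> = (k, q) then genP i else 0)"

lemma family_fiber: "family (fiber_T k q i)" "family (fiber_P k q i)"
  by (simp_all add: family_def fiber_T_def fiber_P_def free_algebra_zero scal_closed genT_closed genP_closed del: split_paired_All)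

lemma rook_relations_mem:
  "1 \<le> i \<and> i < k \<Longrightarrow> genT i * genT i - (scal (q - inverse q) * genT i + 1) \<in> rook_relations k q"
  "1 \<le> i \<and> Suc i < k \<Longrightarrow> genT i * genT (Suc i) * genT i - genT (Suc i) * genT i * genT (Suc i) \<in> rook_relations k q"
  "1 \<le> i \<and> Suc i < j \<and> j < k \<Longrightarrow> genT i * genT j - genT j * genT i \<in> rook_relations k q"
  "1 \<le> i \<and> i \<le> k \<Longrightarrow> genP i * genP i - genP i \<in> rook_relations k q"
  "1 \<le> i \<and> i < j \<and> j < k \<Longrightarrow> genP i * genT j - genT j * genP i \<in> rook_relations k q"
  "1 \<le> j \<and> j < i \<and> i \<le> k \<Longrightarrow> genP i * genT j - genT j * genP i \<in> rook_relations k q"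
  "1 \<le> j \<and> j < i \<and> i \<le> k \<Longrightarrow> genT j * genP i - scal q * genP i \<in> rook_relations k q"
  "1 \<le> i \<and> i < k \<Longrightarrow> genP (Suc i) - scal q * (genP i * genT i * genP i - scal (q - inverse q) * genP i) \<in> rook_relations k q"
proof -
  have "genT i * genT i - (scal (q - inverse q) * genT i + 1) \<in> {genT i * genT i - (scal (q - inverse q) * genT i + 1) | i. 1 \<le> i \<and> i + 1 \<le> k}" if "1 \<le> i \<and> i < k"
    using that by (intro CollectI exI[of _ i]) auto
  then show "1 \<le> i \<and> i < k \<Longrightarrow> genT i * genT i - (scal (q - inverse q) * genT i + 1) \<in> rook_relations k q"
    unfolding rook_relations_def by (simp only: Un_iff simp_thms)
  have "genT i * genT (Suc i) * genT i - genT (Suc i) * genT i * genT (Suc i) \<in> {genT i * genT (i+1) * genT i - genT (i+1) * genT i * genT (i+1) | i. 1 \<le> i \<and> i + 2 \<le> k}" if "1 \<le> i \<and> Suc i < k"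
    using that by (intro CollectI exI[of _ i]) auto
  then show "1 \<le> i \<and> Suc i < k \<Longrightarrow> genT i * genT (Suc i) * genT i - genT (Suc i) * genT i * genT (Suc i) \<in> rook_relations k q"
    unfolding rook_relations_def by (simp only: Un_iff simp_thms)
  have "genT i * genT j - genT j * genT i \<in> {genT i * genT j - genT j * genT i | i j. 1 \<le> i \<and> i + 1 \<le> k \<and> 1 \<le> j \<and> j + 1 \<le> k \<and> \<bar>int i - int j\<bar> > 1}" if "1 \<le> i \<and> Suc i < j \<and> j < k"
    using that by (intro CollectI exI[of _ i] exI[of _ j]) auto
  then show "1 \<le> i \<and> Suc i < j \<and> j < k \<Longrightarrow> genT i * genT j - genT j * genT i \<in> rook_relations k q"
    unfolding rook_relations_def by (simp only: Un_iff simp_thms)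
  have "genP i * genP i - genP i \<in> {genP i * genP i - genP i | i. 1 \<le> i \<and> i \<le> k}" if "1 \<le> i \<and> i \<le> k"
    using that by (intro CollectI exI[of _ i]) auto
  then show "1 \<le> i \<and> i \<le> k \<Longrightarrow> genP i * genP i - genP i \<in> rook_relations k q"
    unfolding rook_relations_def by (simp only: Un_iff simp_thms)
  have "genP i * genT j - genT j * genP i \<in> {genP i * genT j - genT j * genP i | i j. 1 \<le> i \<and> i < j \<and> j + 1 \<le> k}" if "1 \<le> i \<and> i < j \<and> j < k"
    using that by (intro CollectI exI[of _ i] exI[of _ j]) auto
  then show "1 \<le> i \<and> i < j \<and> j < k \<Longrightarrow> genP i * genT j - genT j * genP i \<in> rook_relations k q"
    unfolding rook_relations_def by (simp only: Un_iff simp_thms)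
  have "genP i * genT j - genT j * genP i \<in> {genP i * genT j - genT j * genP i | i j. 1 \<le> j \<and> j < i \<and> i \<le> k}" if "1 \<le> j \<and> j < i \<and> i \<le> k"
    using that by (intro CollectI exI[of _ i] exI[of _ j]) auto
  then show "1 \<le> j \<and> j < i \<and> i \<le> k \<Longrightarrow> genP i * genT j - genT j * genP i \<in> rook_relations k q"
    unfolding rook_relations_def by (simp only: Un_iff simp_thms)
  have "genT j * genP i - scal q * genP i \<in> {genT j * genP i - scal q * genP i | i j. 1 \<le> j \<and> j < i \<and> i \<le> k}" if "1 \<le> j \<and> j < i \<and> i \<le> k"
    using that by (intro CollectI exI[of _ i] exI[of _ j]) auto
  then show "1 \<le> j \<and> j < i \<and> i \<le> k \<Longrightarrow> genT j * genP i - scal q * genP i \<in> rook_relations k q"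
    unfolding rook_relations_def by (simp only: Un_iff simp_thms)
  have "genP (Suc i) - scal q * (genP i * genT i * genP i - scal (q - inverse q) * genP i) \<in> {genP (i+1) - scal q * (genP i * genT i * genP i - scal (q - inverse q) * genP i) | i. 1 \<le> i \<and> i + 1 \<le> k}" if "1 \<le> i \<and> i < k"
    using that by (intro CollectI exI[of _ i]) auto
  then show "1 \<le> i \<and> i < k \<Longrightarrow> genP (Suc i) - scal q * (genP i * genT i * genP i - scal (q - inverse q) * genP i) \<in> rook_relations k q"
    unfolding rook_relations_def by (simp only: Un_iff simp_thms)
qed

lemma (in seminormal) rook_model_product:
  "rook_model k q prod_scale (\<lambda>i. prod_class (fiber_T k q i)) (\<lambda>i. prod_class (fiber_P k q i))"
proof -
  have "vector_space prod_scale"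
  proof
    fix a b :: complex and x y :: rook_product
    obtain F G where xy: "x = prod_class F" "y = prod_class G" "family F" "family G"
      using prod_class_surj by metis
    show "prod_scale a (x + y) = prod_scale a x + prod_scale a y"
      by (simp add: prod_scale_def distrib_left)
    show "prod_scale (a + b) x = prod_scale a x + prod_scale b x"
      "prod_scale a (prod_scale b x) = prod_scale (a * b) x" "prod_scale 1 x = x"
      using xy by (simp_all add: prod_scale_class prod_class_hom family_closed scal_simps distrib_right mult.assoc)
  qed
  have sum0: "0 \<in> rook_ideal n r" for n r
    using additive_subgroup.zero_closed[OF ideal.axioms(1)[OF ideal_rook_ideal[of n r]]] by simp
  have rel: "x \<in> rook_ideal k q" if "x \<in> rook_relations k q" for x
    using ring.genideal_self[OF ring_free_algebra rook_relations_closed] that by (auto simp: rook_ideal_def)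
  have eqI: "prod_class F = prod_class G"
    if "family F" "family G" "F (k, q) - G (k, q) \<in> rook_relations k q \<or> F (k, q) = G (k, q)"
      "\<And>\<kappa>. \<kappa> \<noteq> (k, q) \<Longrightarrow> F \<kappa> = G \<kappa>" for F G
    unfolding prod_class_eq_iff[OF that(1,2)]
  proof
    fix \<kappa>
    show "F \<kappa> - G \<kappa> \<in> rook_ideal (fst \<kappa>) (snd \<kappa>)"
      using that(3) that(4)[of \<kappa>] rel sum0 by (cases "\<kappa> = (k, q)") auto
  qed
  note hom = prod_class_hom prod_scale_class family_closed family_fiber one_rook_product_def
  have qq: "scal q * scal q = scal (q - inverse q) * scal q + 1"
  proof -
    have "q * q = (q - inverse q) * q + 1" using q_nonzero by (simp add: algebra_simps)
    then show ?thesis by (metis scal_simps(1,3,4))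
  qed
  show ?thesis
  proof (intro rook_model.intro rook_model_axioms.intro seminormal_axioms)
    show "vector_space prod_scale" by fact
    fix c x y
    show "prod_scale c x * y = prod_scale c (x * y)" by (simp add: prod_scale_def mult.assoc)
    obtain F G where xy: "x = prod_class F" "y = prod_class G" "family F" "family G"
      using prod_class_surj by metis
    then show "x * prod_scale c y = prod_scale c (x * y)"
      by (simp add: hom) (metis (no_types, lifting) mult.assoc scal_commutes)
  next
    show "prod_class (fiber_T k q 0) = 0"
      unfolding zero_rook_product_def by (rule arg_cong[of _ _ prod_class]) (simp add: fiber_T_def fun_eq_iff)
  next
    fix i assume "1 \<le> i" "i < k"
    then show "prod_class (fiber_T k q i) * prod_class (fiber_T k q i) =
      prod_scale (q - inverse q) (prod_class (fiber_T k q i)) + 1"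
      by (simp only: hom, intro eqI; simp only: hom)
        (simp_all add: fiber_T_def qq rook_relations_mem)
  next
    fix i assume "1 \<le> i" "Suc i < k"
    then show "prod_class (fiber_T k q i) * prod_class (fiber_T k q (Suc i)) * prod_class (fiber_T k q i) =
      prod_class (fiber_T k q (Suc i)) * prod_class (fiber_T k q i) * prod_class (fiber_T k q (Suc i))"
      by (simp only: hom, intro eqI; simp only: hom)
        (simp_all add: fiber_T_def rook_relations_mem)
  next
    fix i j assume "1 \<le> i" "Suc i < j" "j < k"
    then show "prod_class (fiber_T k q i) * prod_class (fiber_T k q j) =
      prod_class (fiber_T k q j) * prod_class (fiber_T k q i)"
      by (simp only: hom, intro eqI; simp only: hom)
        (simp_all add: fiber_T_def rook_relations_mem)
  next
    fix i assume "1 \<le> i" "i \<le> k"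
    then show "prod_class (fiber_P k q i) * prod_class (fiber_P k q i) = prod_class (fiber_P k q i)"
      by (simp only: hom, intro eqI; simp only: hom)
        (simp_all add: fiber_P_def rook_relations_mem)
  next
    fix i j assume "1 \<le> i" "i < j" "j < k"
    then show "prod_class (fiber_P k q i) * prod_class (fiber_T k q j) =
      prod_class (fiber_T k q j) * prod_class (fiber_P k q i)"
      by (simp only: hom, intro eqI; simp only: hom)
        (simp_all add: fiber_P_def fiber_T_def rook_relations_mem)
  next
    fix j i assume ij: "1 \<le> j" "j < i" "i \<le> k"
    then show tp: "prod_class (fiber_T k q j) * prod_class (fiber_P k q i) = prod_scale q (prod_class (fiber_P k q i))"
      by (simp only: hom, intro eqI; simp only: hom)
        (simp_all add: fiber_P_def fiber_T_def rook_relations_mem)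
    from ij have "prod_class (fiber_P k q i) * prod_class (fiber_T k q j) =
      prod_class (fiber_T k q j) * prod_class (fiber_P k q i)"
      by (simp only: hom, intro eqI; simp only: hom)
        (simp_all add: fiber_P_def fiber_T_def rook_relations_mem)
    with tp show "prod_class (fiber_P k q i) * prod_class (fiber_T k q j) = prod_scale q (prod_class (fiber_P k q i))"
      by simp
  next
    fix i assume "1 \<le> i" "i < k"
    then show "prod_class (fiber_P k q (Suc i)) = prod_scale q
      (prod_class (fiber_P k q i) * prod_class (fiber_T k q i) * prod_class (fiber_P k q i) -
        prod_scale (q - inverse q) (prod_class (fiber_P k q i)))"
      by (simp only: hom, intro eqI; simp only: hom)
        (simp_all add: fiber_P_def fiber_T_def rook_relations_mem)
  qed
qed

text \<open>In the factor \<open>(k, q)\<close>, evaluation at these elements is the residue class map.\<close>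

lemma (in seminormal) ev_product:
  assumes "f \<in> carrier (free_algebra k)"
  shows "\<exists>F. family F \<and> F (k, q) = f \<and> rook_model.ev prod_scale (\<lambda>i. prod_class (fiber_T k q i))
    (\<lambda>i. prod_class (fiber_P k q i)) f = prod_class F"
proof -
  interpret M: rook_model k q prod_scale "\<lambda>i. prod_class (fiber_T k q i)" "\<lambda>i. prod_class (fiber_P k q i)"
    by (rule rook_model_product)
  note hom = prod_class_hom prod_scale_class family_closed family_fiber one_rook_product_def
  show ?thesis
    using assms
  proof (induction rule: free_algebra_induct)
    case (single w c)
    have "\<exists>F. family F \<and> F (k, q) = Poly_Mapping.single (Word u) 1 \<and> M.ev (Poly_Mapping.single (Word u) 1) = prod_class F"
      if "set u \<subseteq> rook_gens k" for u
      using that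
    proof (induction u)
      case Nil
      show ?case
      proof -
        have "Poly_Mapping.single (Word []) (1 :: complex) = 1" by (metis single_one zero_rook_word_def)
        then show ?thesis
          using M.ev_simps(1) by (intro exI[of _ "\<lambda>_. 1"]) (simp add: family_closed one_rook_product_def)
      qed
    next
      case (Cons g u)
      then obtain F where F: "family F" "F (k, q) = Poly_Mapping.single (Word u) 1"
        "M.ev (Poly_Mapping.single (Word u) 1) = prod_class F" by auto
      have cons: "Poly_Mapping.single (Word (g # u)) 1 = Poly_Mapping.single (Word [g]) 1 * Poly_Mapping.single (Word u) (1 :: complex)"
        by (simp add: mult_single plus_rook_word_def)
      define G where "G = (case g of GenP i \<Rightarrow> fiber_P k q i | GenT i \<Rightarrow> fiber_T k q i)"
      have G: "family G" "G (k, q) = Poly_Mapping.single (Word [g]) 1" "M.ev (Poly_Mapping.single (Word [g]) 1) = prod_class G"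
        using Cons.prems family_fiber M.ev_simps(6,7)
        by (auto simp: G_def rook_gens_def fiber_T_def fiber_P_def genT_def genP_def)
      show ?case
        using F G by (intro exI[of _ "\<lambda>\<kappa>. G \<kappa> * F \<kappa>"]) (simp add: cons M.ev_simps hom)
    qed
    from this[OF single] obtain F where F: "family F" "F (k, q) = Poly_Mapping.single w 1"
      "M.ev (Poly_Mapping.single w 1) = prod_class F" by auto
    have "Poly_Mapping.single w c = scal c * Poly_Mapping.single w 1" by (simp add: scal_def mult_single)
    then show ?case
      using F by (intro exI[of _ "\<lambda>\<kappa>. scal c * F \<kappa>"]) (simp add: M.ev_simps(9) hom)
  next
    case (add f g)
    then obtain F G where "family F" "F (k, q) = f" "M.ev f = prod_class F"
      "family G" "G (k, q) = g" "M.ev g = prod_class G" by blast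
    then show ?case
      by (intro exI[of _ "\<lambda>\<kappa>. F \<kappa> + G \<kappa>"]) (simp add: M.ev_simps hom)
  qed
qed

text \<open>The product ring is a model in which an element of the free algebra vanishes only if it lies in
  the ideal. So it is a faithful model, and joint injectivity applies.\<close>

theorem (in seminormal) rook_ideal_iff_mat:
  assumes f: "f \<in> carrier (free_algebra k)"
  shows "f \<in> rook_ideal k q \<longleftrightarrow> (\<forall>l\<in>St k. \<forall>m\<in>St k. mat f l m = 0)"
proof
  assume "f \<in> rook_ideal k q"
  then show "\<forall>l\<in>St k. \<forall>m\<in>St k. mat f l m = 0"
    using rook_ideal_op[OF order.refl] by (simp add: mat_def)
next
  assume zero: "\<forall>l\<in>St k. \<forall>m\<in>St k. mat f l m = 0"
  interpret M: rook_model k q prod_scale "\<lambda>i. prod_class (fiber_T k q i)" "\<lambda>i. prod_class (fiber_P k q i)"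
    by (rule rook_model_product)
  have ker: "g \<in> rook_ideal k q" if g: "g \<in> carrier (free_algebra k)" "M.ev g = 0" for g
  proof -
    obtain F where F: "family F" "F (k, q) = g" "M.ev g = prod_class F" using ev_product[OF g(1)] by blast
    then have "prod_class F = prod_class (\<lambda>_. 0)" using g(2) by (simp add: zero_rook_product_def)
    then have "F (k, q) - 0 \<in> rook_ideal (fst (k, q)) (snd (k, q))"
      using prod_class_eq_iff[OF F(1) family_closed(5)] by blast
    with F(2) show ?thesis by simp
  qed
  interpret M: faithful_rook_model k q prod_scale "\<lambda>i. prod_class (fiber_T k q i)" "\<lambda>i. prod_class (fiber_P k q i)"
    by unfold_locales (rule rook_ideal_op[OF order.refl ker])
  have "M.ev f = 0" using M.all_separated[OF order.refl] f zero by (simp add: M.separated_def)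
  with ker f show "f \<in> rook_ideal k q" by blast
qed


section \<open>Modules over a noncommutative ring\<close>

context left_module
begin

lemma zero_smult: "x \<in> carrier M \<Longrightarrow> \<zero>\<^bsub>R\<^esub> \<odot>\<^bsub>M\<^esub> x = \<zero>\<^bsub>M\<^esub>"
proof -
  assume x: "x \<in> carrier M"
  have "\<zero>\<^bsub>R\<^esub> \<odot>\<^bsub>M\<^esub> x \<oplus>\<^bsub>M\<^esub> \<zero>\<^bsub>R\<^esub> \<odot>\<^bsub>M\<^esub> x = \<zero>\<^bsub>R\<^esub> \<odot>\<^bsub>M\<^esub> x"
    using smult_l_distr[of "\<zero>\<^bsub>R\<^esub>" "\<zero>\<^bsub>R\<^esub>" x] x by simp
  then show ?thesis using x by (simp add: smult_closed M.add.r_cancel_one)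
qed

lemma smult_zero: "a \<in> carrier R \<Longrightarrow> a \<odot>\<^bsub>M\<^esub> \<zero>\<^bsub>M\<^esub> = \<zero>\<^bsub>M\<^esub>"
proof -
  assume a: "a \<in> carrier R"
  have "a \<odot>\<^bsub>M\<^esub> \<zero>\<^bsub>M\<^esub> \<oplus>\<^bsub>M\<^esub> a \<odot>\<^bsub>M\<^esub> \<zero>\<^bsub>M\<^esub> = a \<odot>\<^bsub>M\<^esub> \<zero>\<^bsub>M\<^esub>"
    using smult_r_distr[of a "\<zero>\<^bsub>M\<^esub>" "\<zero>\<^bsub>M\<^esub>"] a by simp
  then show ?thesis using a by (simp add: smult_closed M.add.r_cancel_one)
qed

lemma minus_smult: "a \<in> carrier R \<Longrightarrow> x \<in> carrier M \<Longrightarrow> (\<ominus>\<^bsub>R\<^esub> a) \<odot>\<^bsub>M\<^esub> x = \<ominus>\<^bsub>M\<^esub> (a \<odot>\<^bsub>M\<^esub> x)"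
proof -
  assume a: "a \<in> carrier R" and x: "x \<in> carrier M"
  have "(\<ominus>\<^bsub>R\<^esub> a) \<odot>\<^bsub>M\<^esub> x \<oplus>\<^bsub>M\<^esub> a \<odot>\<^bsub>M\<^esub> x = \<zero>\<^bsub>M\<^esub>"
    using smult_l_distr[of "\<ominus>\<^bsub>R\<^esub> a" a x] a x by (simp add: R.l_neg zero_smult)
  then show ?thesis using a x M.minus_equality[of "(\<ominus>\<^bsub>R\<^esub> a) \<odot>\<^bsub>M\<^esub> x" "a \<odot>\<^bsub>M\<^esub> x"]
    by (simp add: smult_closed)
qed

lemma submoduleI:
  assumes "H \<subseteq> carrier M" "\<zero>\<^bsub>M\<^esub> \<in> H" "\<And>x y. x \<in> H \<Longrightarrow> y \<in> H \<Longrightarrow> x \<oplus>\<^bsub>M\<^esub> y \<in> H"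
    and smult: "\<And>a x. a \<in> carrier R \<Longrightarrow> x \<in> H \<Longrightarrow> a \<odot>\<^bsub>M\<^esub> x \<in> H"
  shows "submodule H R M"
proof (intro submodule.intro subgroup.intro submodule_axioms.intro)
  fix x assume x: "x \<in> H"
  then have "(\<ominus>\<^bsub>R\<^esub> \<one>\<^bsub>R\<^esub>) \<odot>\<^bsub>M\<^esub> x = \<ominus>\<^bsub>M\<^esub> x" using assms(1) by (subst minus_smult) (auto simp: smult_one)
  with smult[OF _ x, of "\<ominus>\<^bsub>R\<^esub> \<one>\<^bsub>R\<^esub>"] show "inv\<^bsub>add_monoid M\<^esub> x \<in> H" by (simp add: a_inv_def)
qed (use assms in auto)

lemma cyclic_submodule:
  assumes m: "m \<in> carrier M"
  shows "submodule {a \<odot>\<^bsub>M\<^esub> m | a. a \<in> carrier R} R M"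
proof (rule submoduleI)
  show "{a \<odot>\<^bsub>M\<^esub> m | a. a \<in> carrier R} \<subseteq> carrier M" using m by (auto simp: smult_closed)
  show "\<zero>\<^bsub>M\<^esub> \<in> {a \<odot>\<^bsub>M\<^esub> m | a. a \<in> carrier R}" using zero_smult[OF m] by force
  fix x y assume "x \<in> {a \<odot>\<^bsub>M\<^esub> m | a. a \<in> carrier R}"
  then obtain a where a: "a \<in> carrier R" "x = a \<odot>\<^bsub>M\<^esub> m" by blast
  show "x \<oplus>\<^bsub>M\<^esub> y \<in> {a \<odot>\<^bsub>M\<^esub> m | a. a \<in> carrier R}" if "y \<in> {a \<odot>\<^bsub>M\<^esub> m | a. a \<in> carrier R}"
  proof -
    obtain b where "b \<in> carrier R" "y = b \<odot>\<^bsub>M\<^esub> m" using \<open>y \<in> _\<close> by blast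
    with a m show ?thesis by (intro CollectI exI[of _ "a \<oplus>\<^bsub>R\<^esub> b"]) (simp add: smult_l_distr)
  qed
  fix b assume "b \<in> carrier R"
  with a m show "b \<odot>\<^bsub>M\<^esub> x \<in> {a \<odot>\<^bsub>M\<^esub> m | a. a \<in> carrier R}"
    by (intro CollectI exI[of _ "b \<otimes>\<^bsub>R\<^esub> a"]) (simp add: smult_assoc1)
qed

end

lemma submoduleD:
  assumes "submodule N A M"
  shows "N \<subseteq> carrier M" "\<zero>\<^bsub>M\<^esub> \<in> N" "\<And>x y. x \<in> N \<Longrightarrow> y \<in> N \<Longrightarrow> x \<oplus>\<^bsub>M\<^esub> y \<in> N"
    "\<And>a x. a \<in> carrier A \<Longrightarrow> x \<in> N \<Longrightarrow> a \<odot>\<^bsub>M\<^esub> x \<in> N"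
  using subgroup.subset[OF submodule.axioms(1)[OF assms]] subgroup.one_closed[OF submodule.axioms(1)[OF assms]]
    subgroup.m_closed[OF submodule.axioms(1)[OF assms]] submodule.smult_closed[OF assms] by auto

lemma left_module_restrict:
  assumes M: "left_module A M" and N: "submodule N A M"
  shows "left_module A (M\<lparr>carrier := N\<rparr>)"
proof -
  interpret left_module A M by (rule M)
  have sub: "x \<in> N \<Longrightarrow> x \<in> carrier M" for x using submoduleD(1)[OF N] by blast
  show ?thesis
  proof (intro left_module.intro left_module_axioms.intro)
    show "ring A" by (rule R.ring_axioms)
    show "abelian_group (M\<lparr>carrier := N\<rparr>)"
    proof (rule abelian_groupI)
      fix x assume "x \<in> carrier (M\<lparr>carrier := N\<rparr>)"
      then have x: "x \<in> N" by simp
      have "(\<ominus>\<^bsub>A\<^esub> \<one>\<^bsub>A\<^esub>) \<odot>\<^bsub>M\<^esub> x \<in> N" using submoduleD(4)[OF N _ x] by simp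
      moreover have "(\<ominus>\<^bsub>A\<^esub> \<one>\<^bsub>A\<^esub>) \<odot>\<^bsub>M\<^esub> x = \<ominus>\<^bsub>M\<^esub> x" using sub[OF x] by (subst minus_smult) (auto simp: smult_one)
      ultimately show "\<exists>y\<in>carrier (M\<lparr>carrier := N\<rparr>). y \<oplus>\<^bsub>M\<lparr>carrier := N\<rparr>\<^esub> x = \<zero>\<^bsub>M\<lparr>carrier := N\<rparr>\<^esub>"
        using sub[OF x] by (intro bexI[of _ "\<ominus>\<^bsub>M\<^esub> x"]) (auto simp: M.l_neg)
    qed (use submoduleD[OF N] sub in \<open>auto simp: M.a_ac\<close>)
  qed (use submoduleD[OF N] sub in \<open>auto simp: smult_l_distr smult_r_distr smult_assoc1 smult_one\<close>)
qed

lemma regular_module_simps [simp]: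
  "carrier (regular_module A) = carrier A" "\<zero>\<^bsub>regular_module A\<^esub> = \<zero>\<^bsub>A\<^esub>"
  "x \<oplus>\<^bsub>regular_module A\<^esub> y = x \<oplus>\<^bsub>A\<^esub> y" "x \<odot>\<^bsub>regular_module A\<^esub> y = x \<otimes>\<^bsub>A\<^esub> y"
  by (simp_all add: regular_module_def)

lemma left_module_regular: "ring A \<Longrightarrow> left_module A (regular_module A)"
proof -
  assume "ring A"
  then interpret ring A .
  show ?thesis
  proof (intro left_module.intro left_module_axioms.intro)
    show "ring A" by fact
    show "abelian_group (regular_module A)"
      by (rule abelian_groupI) (auto simp: a_ac intro: l_neg)
  qed (auto simp: l_distr r_distr m_assoc)
qed

text \<open>The submodule generated by \<open>m\<close> is nonzero.\<close>

lemma simple_cyclic: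
  assumes M: "simple_module A M" and m: "m \<in> carrier M" "m \<noteq> \<zero>\<^bsub>M\<^esub>"
  shows "{a \<odot>\<^bsub>M\<^esub> m | a. a \<in> carrier A} = carrier M"
proof -
  interpret left_module A M using M by (simp add: simple_module_def)
  have "m = \<one>\<^bsub>A\<^esub> \<odot>\<^bsub>M\<^esub> m" using m(1) by (simp add: smult_one)
  then have "m \<in> {a \<odot>\<^bsub>M\<^esub> m | a. a \<in> carrier A}" by blast
  with m cyclic_submodule[OF m(1)] M show ?thesis unfolding simple_module_def by blast
qed

text \<open>The annihilator of a nonzero vector is a maximal left ideal, hence one inclusion between
  annihilators is an equality, and it determines a simple module up to isomorphism.\<close>

lemma simple_modules_isomorphic:
  assumes M: "simple_module A M" and H: "simple_module A H"
    and m: "m \<in> carrier M" "m \<noteq> \<zero>\<^bsub>M\<^esub>" and v: "v \<in> carrier H" "v \<noteq> \<zero>\<^bsub>H\<^esub>"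
    and ann: "\<And>a. a \<in> carrier A \<Longrightarrow> a \<odot>\<^bsub>H\<^esub> v = \<zero>\<^bsub>H\<^esub> \<Longrightarrow> a \<odot>\<^bsub>M\<^esub> m = \<zero>\<^bsub>M\<^esub>"
  shows "module_isomorphic A M H"
proof -
  interpret M: left_module A M using M by (simp add: simple_module_def)
  interpret H: left_module A H using H by (simp add: simple_module_def)
  have ann': "a \<odot>\<^bsub>H\<^esub> v = \<zero>\<^bsub>H\<^esub>" if a: "a \<in> carrier A" "a \<odot>\<^bsub>M\<^esub> m = \<zero>\<^bsub>M\<^esub>" for a
  proof (rule ccontr)
    assume "a \<odot>\<^bsub>H\<^esub> v \<noteq> \<zero>\<^bsub>H\<^esub>"
    with simple_cyclic[OF H, of "a \<odot>\<^bsub>H\<^esub> v"] v a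
    obtain b where b: "b \<in> carrier A" "v = b \<odot>\<^bsub>H\<^esub> (a \<odot>\<^bsub>H\<^esub> v)" using H.smult_closed[OF a(1) v(1)] by blast
    let ?c = "\<one>\<^bsub>A\<^esub> \<oplus>\<^bsub>A\<^esub> \<ominus>\<^bsub>A\<^esub> (b \<otimes>\<^bsub>A\<^esub> a)"
    have "?c \<odot>\<^bsub>H\<^esub> v = v \<oplus>\<^bsub>H\<^esub> \<ominus>\<^bsub>H\<^esub> (b \<odot>\<^bsub>H\<^esub> (a \<odot>\<^bsub>H\<^esub> v))"
      using a b(1) v by (simp add: H.smult_l_distr H.minus_smult H.smult_one H.smult_assoc1)
    then have "?c \<odot>\<^bsub>H\<^esub> v = \<zero>\<^bsub>H\<^esub>" using b(2) v by (metis H.M.r_neg)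
    then have "?c \<odot>\<^bsub>M\<^esub> m = \<zero>\<^bsub>M\<^esub>" using a b by (intro ann) auto
    moreover have "?c \<odot>\<^bsub>M\<^esub> m = m \<oplus>\<^bsub>M\<^esub> \<ominus>\<^bsub>M\<^esub> (b \<odot>\<^bsub>M\<^esub> (a \<odot>\<^bsub>M\<^esub> m))"
      using a b(1) m by (simp add: M.smult_l_distr M.minus_smult M.smult_one M.smult_assoc1)
    moreover have "\<ominus>\<^bsub>M\<^esub> \<zero>\<^bsub>M\<^esub> = \<zero>\<^bsub>M\<^esub>" using M.M.r_neg[of "\<zero>\<^bsub>M\<^esub>"] by simp
    ultimately show False using a b(1) m by (simp add: M.smult_zero)
  qed
  have diff: "a \<odot>\<^bsub>M\<^esub> m = b \<odot>\<^bsub>M\<^esub> m \<longleftrightarrow> a \<odot>\<^bsub>H\<^esub> v = b \<odot>\<^bsub>H\<^esub> v" if ab: "a \<in> carrier A" "b \<in> carrier A" for a b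
  proof -
    have *: "x = y \<longleftrightarrow> x \<oplus>\<^bsub>K\<^esub> \<ominus>\<^bsub>K\<^esub> y = \<zero>\<^bsub>K\<^esub>"
      if "abelian_group K" "x \<in> carrier K" "y \<in> carrier K" for K :: "('z, 'w) ring_scheme" and x y
    proof -
      interpret abelian_group K by fact
      show ?thesis using that by (metis minus_equality minus_minus a_inv_closed r_neg)
    qed
    let ?c = "a \<oplus>\<^bsub>A\<^esub> \<ominus>\<^bsub>A\<^esub> b"
    have "?c \<odot>\<^bsub>M\<^esub> m = a \<odot>\<^bsub>M\<^esub> m \<oplus>\<^bsub>M\<^esub> \<ominus>\<^bsub>M\<^esub> (b \<odot>\<^bsub>M\<^esub> m)"
      using ab m by (simp add: M.smult_l_distr M.minus_smult)
    moreover have "?c \<odot>\<^bsub>H\<^esub> v = a \<odot>\<^bsub>H\<^esub> v \<oplus>\<^bsub>H\<^esub> \<ominus>\<^bsub>H\<^esub> (b \<odot>\<^bsub>H\<^esub> v)"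
      using ab v by (simp add: H.smult_l_distr H.minus_smult)
    moreover have "?c \<odot>\<^bsub>M\<^esub> m = \<zero>\<^bsub>M\<^esub> \<longleftrightarrow> ?c \<odot>\<^bsub>H\<^esub> v = \<zero>\<^bsub>H\<^esub>" using ann ann' ab by auto
    ultimately show ?thesis
      using *[OF M.M.abelian_group_axioms, of "a \<odot>\<^bsub>M\<^esub> m" "b \<odot>\<^bsub>M\<^esub> m"]
        *[OF H.M.abelian_group_axioms, of "a \<odot>\<^bsub>H\<^esub> v" "b \<odot>\<^bsub>H\<^esub> v"] ab m v
      by (simp add: M.smult_closed H.smult_closed)
  qed
  \<comment> \<open>The map \<open>a m \<mapsto> a v\<close>.\<close>
  define f where "f x = (SOME a. a \<in> carrier A \<and> x = a \<odot>\<^bsub>M\<^esub> m) \<odot>\<^bsub>H\<^esub> v" for x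
  have f: "f (a \<odot>\<^bsub>M\<^esub> m) = a \<odot>\<^bsub>H\<^esub> v" if a: "a \<in> carrier A" for a
  proof -
    have "\<exists>b. b \<in> carrier A \<and> a \<odot>\<^bsub>M\<^esub> m = b \<odot>\<^bsub>M\<^esub> m" using a by blast
    from someI_ex[OF this] show ?thesis unfolding f_def using diff[OF a] by metis
  qed
  have rep: "\<exists>a\<in>carrier A. x = a \<odot>\<^bsub>M\<^esub> m" if "x \<in> carrier M" for x
    using simple_cyclic[OF M m] that by blast
  have hom: "f \<in> hom (add_monoid M) (add_monoid H)"
  proof (rule homI)
    fix x assume "x \<in> carrier (add_monoid M)"
    then obtain a where a: "a \<in> carrier A" "x = a \<odot>\<^bsub>M\<^esub> m" using rep by auto
    then show "f x \<in> carrier (add_monoid H)" using f v by (simp add: H.smult_closed)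
    fix y assume "y \<in> carrier (add_monoid M)"
    then obtain b where b: "b \<in> carrier A" "y = b \<odot>\<^bsub>M\<^esub> m" using rep by auto
    have "x \<oplus>\<^bsub>M\<^esub> y = (a \<oplus>\<^bsub>A\<^esub> b) \<odot>\<^bsub>M\<^esub> m" using a b m by (simp add: M.smult_l_distr)
    then show "f (x \<otimes>\<^bsub>add_monoid M\<^esub> y) = f x \<otimes>\<^bsub>add_monoid H\<^esub> f y"
      using a b v f[of "a \<oplus>\<^bsub>A\<^esub> b"] by (simp add: f H.smult_l_distr)
  qed
  have "bij_betw f (carrier M) (carrier H)"
  proof (rule bij_betw_imageI)
    show "inj_on f (carrier M)"
    proof (rule inj_onI)
      fix x y assume "x \<in> carrier M" "y \<in> carrier M" "f x = f y"
      then show "x = y" using rep[of x] rep[of y] f diff by auto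
    qed
    show "f ` carrier M = carrier H"
    proof
      show "f ` carrier M \<subseteq> carrier H" using hom by (auto simp: hom_def)
      show "carrier H \<subseteq> f ` carrier M"
        unfolding simple_cyclic[OF H v, symmetric]
        using m by (auto simp: f[symmetric] M.smult_closed)
    qed
  qed
  moreover have "f (a \<odot>\<^bsub>M\<^esub> x) = a \<odot>\<^bsub>H\<^esub> f x" if "a \<in> carrier A" "x \<in> carrier M" for a x
  proof -
    obtain b where b: "b \<in> carrier A" "x = b \<odot>\<^bsub>M\<^esub> m" using rep \<open>x \<in> _\<close> by blast
    then have "a \<odot>\<^bsub>M\<^esub> x = (a \<otimes>\<^bsub>A\<^esub> b) \<odot>\<^bsub>M\<^esub> m" using that m by (simp add: M.smult_assoc1)
    then show ?thesis using b that v f[of "a \<otimes>\<^bsub>A\<^esub> b"] by (simp add: f H.smult_assoc1)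
  qed
  ultimately show ?thesis using hom unfolding module_isomorphic_def iso_def by auto
qed


section \<open>Lists of boxes and tableaux\<close>

text \<open>The filling encoded by a list, with the largest entry at the head.\<close>

fun tab :: "box list \<Rightarrow> tableau" where
  "tab [] = (\<lambda>_. 0)"
| "tab (b # s) = (tab s)(b := Suc (length s))"

lemma tab_eq_0_iff: "tab l b = 0 \<longleftrightarrow> b \<notin> set l"
  by (induction l) auto

lemma tab_le: "tab l b \<le> length l"
  by (induction l) (auto intro: le_SucI)

lemma tab_nth: "distinct l \<Longrightarrow> i < length l \<Longrightarrow> tab l (l ! i) = length l - i"
  by (induction l arbitrary: i) (auto simp: nth_Cons split: nat.splits dest: nth_mem)

lemma tab_bij: "distinct l \<Longrightarrow> bij_betw (tab l) (set l) {1..length l}"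
proof (rule bij_betw_imageI)
  assume d: "distinct l"
  show "inj_on (tab l) (set l)"
    by (rule inj_onI) (metis d in_set_conv_nth tab_nth diff_diff_cancel less_imp_le_nat)
  show "tab l ` set l = {1..length l}"
  proof
    show "tab l ` set l \<subseteq> {1..length l}"
      using tab_le[of l] tab_eq_0_iff[of l] by (force simp: Suc_le_eq)
    show "{1..length l} \<subseteq> tab l ` set l"
    proof
      fix i assume "i \<in> {1..length l}"
      then have "length l - i < length l" "i = tab l (l ! (length l - i))" using tab_nth[OF d, of "length l - i"] by auto
      then show "i \<in> tab l ` set l" by (metis image_eqI nth_mem)
    qed
  qed
qed

lemma tab_inj:
  assumes "distinct l" "distinct l'" "tab l = tab l'"
  shows "l = l'"
proof -
  have set: "set l = set l'" using tab_eq_0_iff[of l] tab_eq_0_iff[of l'] assms(3) by auto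
  then have len: "length l = length l'" using assms(1,2) distinct_card by metis
  show ?thesis
  proof (rule nth_equalityI[OF len])
    fix i assume i: "i < length l"
    have "tab l (l' ! i) = tab l' (l' ! i)" by (simp only: assms(3))
    also have "\<dots> = tab l (l ! i)" using i len tab_nth[OF assms(1)] tab_nth[OF assms(2)] by simp
    finally have "tab l (l' ! i) = tab l (l ! i)" .
    moreover have "l ! i \<in> set l" "l' ! i \<in> set l" using i len by (simp, simp add: set)
    ultimately show "l ! i = l' ! i"
      using inj_onD[OF bij_betw_imp_inj_on[OF tab_bij[OF assms(1)]], of "l ! i" "l' ! i"] by simp
  qed
qed

text \<open>The conditions on a standard tableau, for an arbitrary set of boxes in place of a pair of
  partitions; this allows for induction on the number of boxes.\<close>

definition standard_filling :: "box set \<Rightarrow> tableau \<Rightarrow> bool" where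
  "standard_filling D L \<longleftrightarrow> bij_betw L D {1..card D} \<and> (\<forall>b. b \<notin> D \<longrightarrow> L b = 0) \<and>
     (\<forall>j r c c'. (j, r, c) \<in> D \<and> (j, r, c') \<in> D \<and> c < c' \<longrightarrow> L (j, r, c) < L (j, r, c')) \<and>
     (\<forall>j r r' c. (j, r, c) \<in> D \<and> (j, r', c) \<in> D \<and> r < r' \<longrightarrow> L (j, r, c) < L (j, r', c))"

lemma standard_tableaux_filling: "standard_tableaux \<mu> = {L. standard_filling (boxes \<mu>) L}"
  by (simp add: standard_tableaux_def standard_filling_def)

lemma tab_standard: "std l \<Longrightarrow> standard_filling (set l) (tab l)"
proof (induction l)
  case Nil
  then show ?case by (simp add: standard_filling_def bij_betw_def)
next
  case (Cons b s)
  have d: "distinct (b # s)" using Cons.prems by (rule std_distinct)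
  have sh: "shape (set s)" "shape (insert b (set s))" using Cons.prems std_shape by (auto simp: addable_def)
  have IH: "standard_filling (set s) (tab s)" using Cons by simp
  have lt: "tab (b # s) x < tab (b # s) b" if "x \<in> set s" for x
    using tab_le[of s x] that d by auto
  have old: "tab (b # s) x = tab s x" if "x \<in> set s" for x using that d by auto
  show ?case
    unfolding standard_filling_def
  proof (intro conjI allI impI; (elim conjE)?)
    show "bij_betw (tab (b # s)) (set (b # s)) {1..card (set (b # s))}"
      using tab_bij[OF d] distinct_card[OF d] by simp
    fix x assume "x \<notin> set (b # s)"
    then show "tab (b # s) x = 0" using tab_eq_0_iff by blast
  next
    fix j r c c' assume c: "(j, r, c) \<in> set (b # s)" "(j, r, c') \<in> set (b # s)" "c < c'"
    have "(j, r, c) \<in> set s"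
    proof (rule ccontr)
      assume "(j, r, c) \<notin> set s"
      then have "b = (j, r, c)" "(j, r, c') \<in> set s" using c by auto
      then show False using shape_down[OF sh(1), of j r c' r c] shape_valid[OF sh(2), of j r c] c d by auto
    qed
    then show "tab (b # s) (j, r, c) < tab (b # s) (j, r, c')"
      using IH c lt[of "(j, r, c)"] old unfolding standard_filling_def
      by (cases "(j, r, c') \<in> set s") auto
  next
    fix j r r' c assume c: "(j, r, c) \<in> set (b # s)" "(j, r', c) \<in> set (b # s)" "r < r'"
    have "(j, r, c) \<in> set s"
    proof (rule ccontr)
      assume "(j, r, c) \<notin> set s"
      then have "b = (j, r, c)" "(j, r', c) \<in> set s" using c by auto
      then show False using shape_down[OF sh(1), of j r' c r c] shape_valid[OF sh(2), of j r c] c d by auto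
    qed
    then show "tab (b # s) (j, r, c) < tab (b # s) (j, r', c)"
      using IH c lt[of "(j, r, c)"] old unfolding standard_filling_def
      by (cases "(j, r', c) \<in> set s") auto
  qed
qed

text \<open>The box of the largest entry is removed.\<close>

lemma standard_tab:
  "shape D \<Longrightarrow> standard_filling D L \<Longrightarrow> \<exists>l. std l \<and> set l = D \<and> tab l = L"
proof (induction "card D" arbitrary: D L)
  case 0
  then have "D = {}" using shape_finite by auto
  with 0 have "L = tab []" by (auto simp: standard_filling_def)
  with \<open>D = {}\<close> show ?case by (intro exI[of _ "[]"]) simp
next
  case (Suc n)
  note D = Suc.prems(1) and L = Suc.prems(2)[unfolded standard_filling_def]
  have fin: "finite D" by (rule shape_finite[OF D])
  have bij: "bij_betw L D {1..Suc n}" using L Suc.hyps(2) by simp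
  then have "Suc n \<in> L ` D" by (simp add: bij_betw_def)
  then obtain b where b: "b \<in> D" "L b = Suc n" by auto
  have le: "L x \<le> Suc n" if "x \<in> D" for x using bij_betwE[OF bij] that by auto
  have mono: "L (j, r', c') < L (j, r, c)"
    if "(j, r, c) \<in> D" "1 \<le> r'" "r' \<le> r" "1 \<le> c'" "c' \<le> c" "(r', c') \<noteq> (r, c)" for j r c r' c'
  proof -
    have m: "(j, r', c') \<in> D" "(j, r', c) \<in> D"
      using shape_down[OF D that(1)] that shape_valid[OF D that(1)] by auto
    have "L (j, r', c') < L (j, r', c) \<or> c' = c" using L m that by (cases "c' = c") auto
    moreover have "L (j, r', c) < L (j, r, c) \<or> r' = r" using L m that by (cases "r' = r") auto
    ultimately show ?thesis using that(6) by auto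
  qed
  have sh: "shape (D - {b})"
    unfolding shape_def
  proof (intro conjI allI impI)
    show "finite (D - {b})" using fin by simp
    fix j r c assume m: "(j, r, c) \<in> D - {b}"
    then show "j = 1 \<and> r = 1 \<or> j = 2 \<and> 1 \<le> r" "1 \<le> c" using shape_valid[OF D, of j r c] by auto
    fix r' c' assume rc: "1 \<le> r' \<and> r' \<le> r \<and> 1 \<le> c' \<and> c' \<le> c"
    have "(j, r', c') \<in> D" using shape_down[OF D, of j r c r' c'] m rc by auto
    moreover have "(j, r', c') \<noteq> b"
      using mono[of j r c r' c'] m rc le[of "(j, r, c)"] b by (cases "(r', c') = (r, c)") auto
    ultimately show "(j, r', c') \<in> D - {b}" by simp
  qed
  have card: "n = card (D - {b})" using Suc.hyps(2) b fin by simp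
  have inj: "inj_on L D" by (rule bij_betw_imp_inj_on[OF bij])
  have "L ` (D - {b}) = L ` D - L ` {b}" using inj b(1) by (intro inj_on_image_set_diff) auto
  also have "\<dots> = {1..n}" using bij b(2) by (auto simp: bij_betw_def)
  finally have "bij_betw L (D - {b}) {1..n}" using inj by (auto simp: bij_betw_def intro: inj_on_subset)
  then have "bij_betw (L(b := 0)) (D - {b}) {1..n}"
    by (subst bij_betw_cong[of _ _ L]) auto
  then have "standard_filling (D - {b}) (L(b := 0))"
    using L card unfolding standard_filling_def by auto
  from Suc.hyps(1)[OF card sh this]
  obtain l where l: "std l" "set l = D - {b}" "tab l = L(b := 0)" by blast
  have len: "length l = n" using std_card[OF l(1)] l(2) card by simp
  have "std (b # l)" using l b D by (simp add: addable_def insert_absorb)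
  moreover have "set (b # l) = D" using l b by auto
  moreover have "tab (b # l) = L" using l(3) len b(2) by (auto simp: fun_eq_iff)
  ultimately show ?case by blast
qed

text \<open>Exchanges the boxes of the entries \<open>i\<close> and \<open>i + 1\<close>.\<close>

fun swap_at :: "nat \<Rightarrow> box list \<Rightarrow> box list" where
  "swap_at i (y # x # s) = (if i = Suc (length s) then x # y # s else y # swap_at i (x # s))"
| "swap_at i s = s"

lemma swap_at_simps: "length (swap_at i l) = length l" "set (swap_at i l) = set l"
  by (induction i l rule: swap_at.induct) auto

text \<open>The recursion along the list solved: with \<open>n = length l\<close>, the box of the entry \<open>i\<close> is \<open>l ! (n - i)\<close>.\<close>

lemma T_op_formula:
  assumes "std l" "1 \<le> i" "i < length l"
  shows "T_op q i f l = diag_entry q (l ! (length l - i)) (l ! (length l - Suc i)) * f l +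
    (if std (swap_at i l) then (q - diag_entry q (l ! (length l - i)) (l ! (length l - Suc i))) * f (swap_at i l) else 0)"
  using assms
proof (induction l arbitrary: f)
  case (Cons y s)
  then obtain x s' where s: "s = x # s'" by (cases s) auto
  show ?case
  proof (cases "i = Suc (length s')")
    case True
    have "std (x # y # s') \<longleftrightarrow> addable y (set s')" using std_swap_iff[of y x s'] Cons.prems(1) s by simp
    with True show ?thesis by (simp add: s)
  next
    case False
    then have i: "i < length s" using Cons.prems s by simp
    have "std (y # swap_at i s) \<longleftrightarrow> std (swap_at i s)"
      using Cons.prems(1) swap_at_simps(2)[of i s] by auto
    then show ?thesis using Cons.IH[of "\<lambda>l. f (y # l)"] Cons.prems i False s
      by (simp add: Suc_diff_le Suc_diff_Suc)
  qed
qed simp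

lemma swap_at_swap_at: "swap_at i (swap_at i l) = l"
proof (induction i l rule: swap_at.induct)
  case (1 i y x s)
  show ?case
  proof (cases "i = Suc (length s)")
    case False
    obtain z u where zu: "swap_at i (x # s) = z # u" using swap_at_simps(1)[of i "x # s"] by (cases "swap_at i (x # s)") auto
    have "length u = length s" using swap_at_simps(1)[of i "x # s"] zu by simp
    then show ?thesis using 1[OF False] False zu by simp
  qed simp
qed auto

lemma tab_swap_at:
  assumes "distinct l" "1 \<le> i" "i < length l"
  shows "tab (swap_at i l) = switch i (tab l)"
  using assms
proof (induction i l rule: swap_at.induct)
  case (1 i y x s)
  show ?case
  proof (cases "i = Suc (length s)")
    case True
    show ?thesis
    proof
      fix b
      show "tab (swap_at i (y # x # s)) b = switch i (tab (y # x # s)) b"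
        using 1(2) True tab_le[of s b] by (auto simp: switch_def)
    qed
  next
    case False
    have IH: "tab (swap_at i (x # s)) = switch i (tab (x # s))"
      by (rule "1.IH"[OF False]) (use 1 False in auto)
    show ?thesis
    proof
      fix b
      show "tab (swap_at i (y # x # s)) b = switch i (tab (y # x # s)) b"
        using False 1(4) fun_cong[OF IH, of b] swap_at_simps(1)[of i "x # s"]
        by (cases "b = y") (auto simp: switch_def simp del: tab.simps(2)
          simp add: tab.simps(2)[of y])
    qed
  qed
qed auto

lemma box_of_tab:
  assumes "distinct l" "set l = boxes \<mu>" "1 \<le> i" "i \<le> length l"
  shows "box_of \<mu> (tab l) i = l ! (length l - i)"
  unfolding box_of_def
proof (rule the_equality)
  have lt: "length l - i < length l" using assms(3,4) by simp
  show "l ! (length l - i) \<in> boxes \<mu> \<and> tab l (l ! (length l - i)) = i"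
  proof
    show "l ! (length l - i) \<in> boxes \<mu>" using nth_mem[OF lt] by (simp only: assms(2))
    show "tab l (l ! (length l - i)) = i"
      using tab_nth[OF assms(1) lt] assms(3,4) by simp
  qed
  fix b assume b: "b \<in> boxes \<mu> \<and> tab l b = i"
  then have "b \<in> set l" using assms(2) by simp
  then obtain m where m: "m < length l" "l ! m = b" by (auto simp: in_set_conv_nth)
  then have "i = length l - m" using tab_nth[OF assms(1) m(1)] b by simp
  then have "length l - i = m" using m(1) by simp
  then show "b = l ! (length l - i)" using m(2) by simp
qed


section \<open>Pairs of partitions and shapes\<close>

lemma diagram_Sigma: "diagram p = Sigma {1..length p} (\<lambda>r. {1..p ! (r - 1)})"
  by (auto simp: diagram_def)

lemma finite_diagram: "finite (diagram p)"
  by (simp add: diagram_Sigma)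

lemma card_diagram: "card (diagram p) = sum_list p"
proof -
  have "card (diagram p) = (\<Sum>r\<in>{1..length p}. p ! (r - 1))"
    by (simp add: diagram_Sigma)
  also have "\<dots> = (\<Sum>i\<in>{0..<length p}. p ! i)"
    by (rule sum.reindex_bij_witness[of _ Suc "\<lambda>r. r - 1"]) auto
  finally show ?thesis by (simp add: sum_list_sum_nth)
qed

text \<open>The row lengths are read off the diagram. They are positive, so the first column determines the
  number of rows.\<close>

lemma diagram_inj:
  assumes "is_partition p" "is_partition p'" "diagram p = diagram p'"
  shows "p = p'"
proof -
  have pos: "1 \<le> u ! i" if "is_partition u" "i < length u" for u i
    using that by (metis One_nat_def is_partition_def nth_mem not_less_eq_eq not_one_le_zero le_zero_eq)
  have len: "r \<le> length u \<longleftrightarrow> (r, 1) \<in> diagram u" if "is_partition u" "1 \<le> r" for u r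
    using pos[OF that(1), of "r - 1"] that(2) by (auto simp: diagram_def)
  have "r \<le> length p \<longleftrightarrow> r \<le> length p'" if "1 \<le> r" for r using len[of p r] len[of p' r] assms that by simp
  from this[of "length p"] this[of "length p'"] this[of 1]
  have l: "length p = length p'" by (cases "length p"; cases "length p'") auto
  show ?thesis
  proof (rule nth_equalityI[OF l])
    fix i assume i: "i < length p"
    have "c \<le> u ! i \<longleftrightarrow> (Suc i, c) \<in> diagram u" if "1 \<le> c" "i < length u" for u c
      using that by (auto simp: diagram_def)
    then have "c \<le> p ! i \<longleftrightarrow> c \<le> p' ! i" if "1 \<le> c" for c using i l assms(3) that by simp
    from this[of "p ! i"] this[of "p' ! i"] show "p ! i = p' ! i"
      using pos[OF assms(1), of i] pos[OF assms(2), of i] i l by auto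
  qed
qed

lemma diagram_down:
  assumes "is_partition p" "(r, c) \<in> diagram p" "1 \<le> r'" "r' \<le> r" "1 \<le> c'" "c' \<le> c"
  shows "(r', c') \<in> diagram p"
proof -
  have "p ! (r' - 1) \<ge> p ! (r - 1)"
    using assms by (cases "r' = r") (auto simp: is_partition_def diagram_def sorted_wrt_iff_nth_less)
  then show ?thesis using assms by (auto simp: diagram_def)
qed

lemma boxes_shape:
  assumes "\<mu> \<in> A_hat k"
  shows "shape (boxes \<mu>)" "card (boxes \<mu>) = k"
proof -
  obtain p1 p2 where \<mu>: "\<mu> = (p1, p2)" "is_partition p1" "is_partition p2" "sum_list p1 + sum_list p2 = k"
    "length p1 \<le> 1" using assms by (auto simp: A_hat_def)
  show "shape (boxes \<mu>)"
    unfolding shape_def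
  proof (intro conjI allI impI)
    show "finite (boxes \<mu>)" by (simp add: boxes_def finite_diagram)
    fix j r c assume b: "(j, r, c) \<in> boxes \<mu>"
    then show "j = 1 \<and> r = 1 \<or> j = 2 \<and> 1 \<le> r" "1 \<le> c" using \<mu> by (auto simp: boxes_def diagram_def)
    fix r' c' assume "1 \<le> r' \<and> r' \<le> r \<and> 1 \<le> c' \<and> c' \<le> c"
    then show "(j, r', c') \<in> boxes \<mu>"
      using b \<mu> diagram_down[of p1 r c r' c'] diagram_down[of p2 r c r' c'] by (auto simp: boxes_def)
  qed
  have "card (boxes \<mu>) = card ({1::nat} \<times> diagram p1) + card ({2::nat} \<times> diagram p2)"
    unfolding boxes_def \<mu>(1) fst_conv snd_conv by (rule card_Un_disjoint) (auto simp: finite_diagram)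
  then show "card (boxes \<mu>) = k" using \<mu>(4) by (simp add: card_cartesian_product card_diagram)
qed

lemma boxes_inj:
  assumes "\<mu> \<in> A_hat k" "\<nu> \<in> A_hat k" "boxes \<mu> = boxes \<nu>"
  shows "\<mu> = \<nu>"
proof -
  have part: "is_partition (fst \<kappa>)" "is_partition (snd \<kappa>)" if "\<kappa> \<in> A_hat k" for \<kappa>
    using that by (cases \<kappa>; simp add: A_hat_def)+
  have "diagram (fst \<kappa>) = Pair 1 -` boxes \<kappa>" "diagram (snd \<kappa>) = Pair 2 -` boxes \<kappa>" for \<kappa>
    by (auto simp: boxes_def)
  then have "diagram (fst \<mu>) = diagram (fst \<nu>)" "diagram (snd \<mu>) = diagram (snd \<nu>)"
    by (simp_all only: assms(3))
  then show ?thesis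
    using part[OF assms(1)] part[OF assms(2)] by (intro prod_eqI) (rule diagram_inj; assumption)+
qed

text \<open>The row lengths are those of the shape, taken as long as the rows are not empty.\<close>

lemma shape_boxes:
  assumes N: "shape N" "card N = k"
  shows "\<exists>\<mu>\<in>A_hat k. boxes \<mu> = N"
proof -
  note nc = next_col[OF shape_finite[OF N(1)]]
  define row where "row j r = next_col N j r - 1" for j r
  have row: "(j, r, c) \<in> N \<longleftrightarrow> c \<le> row j r" if "1 \<le> r" "1 \<le> c" for j r c
  proof
    assume "(j, r, c) \<in> N"
    then show "c \<le> row j r"
      using shape_down[OF N(1), of j r c r "next_col N j r"] nc(1,2)[of j r] that unfolding row_def by fastforce
  next
    assume "c \<le> row j r"
    then show "(j, r, c) \<in> N" using nc(1)[of j r] nc(3)[of c j r] that by (simp add: row_def)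
  qed
  obtain m where m: "\<And>r c. (2, r, c) \<in> N \<Longrightarrow> r < m"
  proof -
    have "finite ((\<lambda>x. fst (snd x)) ` N)" using shape_finite[OF N(1)] by simp
    then obtain m where "\<forall>r\<in>(\<lambda>x. fst (snd x)) ` N. r < m" using finite_nat_set_iff_bounded by blast
    then have "r < m" if "(2, r, c) \<in> N" for r c using that by force
    with that show ?thesis by blast
  qed
  define t where "t = (LEAST r. 1 \<le> r \<and> (2, r, 1) \<notin> N)"
  have "1 \<le> Suc m \<and> (2, Suc m, 1) \<notin> N" using m[of "Suc m" 1] by auto
  from LeastI[of "\<lambda>r. 1 \<le> r \<and> (2, r, 1) \<notin> N", OF this] have t: "1 \<le> t" "(2, t, 1) \<notin> N" by (auto simp: t_def)
  have t_less: "(2, r, 1) \<in> N" if "1 \<le> r" "r < t" for r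
    using not_less_Least[of r "\<lambda>r. 1 \<le> r \<and> (2, r, 1) \<notin> N"] that by (auto simp: t_def)
  define p2 where "p2 = map (row 2) [1..<t]"
  define p1 where "p1 = (if (1, 1, 1) \<in> N then [row 1 1] else [])"
  have p2: "is_partition p2"
    unfolding is_partition_def sorted_wrt_iff_nth_less
  proof (intro conjI allI impI)
    fix i j assume ij: "i < j" "j < length p2"
    have pos: "1 \<le> row 2 (Suc j)" using row[of "Suc j" 1 2] t_less[of "Suc j"] ij by (auto simp: p2_def)
    then have "(2, Suc j, row 2 (Suc j)) \<in> N" using row[of "Suc j" "row 2 (Suc j)" 2] by simp
    from shape_down[OF N(1) this, of "Suc i" "row 2 (Suc j)"] have "(2, Suc i, row 2 (Suc j)) \<in> N" using ij pos by simp
    then show "p2 ! j \<le> p2 ! i" using row[of "Suc i" "row 2 (Suc j)" 2] pos ij by (simp add: p2_def)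
  next
    have "1 \<le> row 2 r" if "1 \<le> r" "r < t" for r using row[of r 1 2] t_less that by auto
    then show "0 \<notin> set p2" by (force simp: p2_def)
  qed
  have p1: "is_partition p1" using row[of 1 1 1] by (auto simp: p1_def is_partition_def)
  have "boxes (p1, p2) = N"
  proof (rule Set.set_eqI)
    fix b :: box
    obtain j r c where b: "b = (j, r, c)" by (cases b)
    show "b \<in> boxes (p1, p2) \<longleftrightarrow> b \<in> N"
    proof (cases "j = 2 \<and> 1 \<le> r \<and> 1 \<le> c")
      case True
      have "r < t" if "(2, r, c) \<in> N"
      proof (rule ccontr)
        assume "\<not> r < t"
        with shape_down[OF N(1) that, of t 1] t True show False by auto
      qed
      then show ?thesis using row[of r c 2] True t by (auto simp: b boxes_def diagram_def p2_def)
    next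
      case False
      show ?thesis
      proof (cases "j = 1 \<and> r = 1 \<and> 1 \<le> c")
        case True
        have "(1, 1, 1) \<in> N" if "(1, 1, c) \<in> N" using shape_down[OF N(1) that, of 1 1] True by simp
        then show ?thesis using row[of 1 c 1] True by (auto simp: b boxes_def diagram_def p1_def)
      next
        case not1: False
        have "b \<notin> N" using shape_valid[OF N(1), of j r c] False not1 by (auto simp: b)
        moreover have "b \<notin> boxes (p1, p2)" using False not1
          by (auto simp: b boxes_def diagram_def p1_def split: if_splits)
        ultimately show ?thesis by simp
      qed
    qed
  qed
  moreover have "(p1, p2) \<in> A_hat (card (boxes (p1, p2)))"
  proof -
    have "card (boxes (p1, p2)) = card ({1::nat} \<times> diagram p1) + card ({2::nat} \<times> diagram p2)"
      unfolding boxes_def fst_conv snd_conv by (rule card_Un_disjoint) (auto simp: finite_diagram)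
    then show ?thesis using p1 p2 by (simp add: A_hat_def card_cartesian_product card_diagram) (simp add: p1_def)
  qed
  ultimately show ?thesis using N(2) by auto
qed


section \<open>The diagonal entries after cancellation\<close>

lemma q_int_square_one: "q\<^sup>2 = 1 \<Longrightarrow> q_int q n = of_nat n"
  by (simp add: q_int_def power_mult)

text \<open>For \<open>z\<^sup>2 \<noteq> 1\<close> the quotient \<^const>\<open>T_quot\<close> is the rational function \<open>g\<close>, whose denominator \<open>z [n]\<close> does
  not vanish at \<open>q\<close>.\<close>

lemma T_quot_limit:
  assumes q2: "q\<^sup>2 = 1" and d: "d = content y - content x" "d \<noteq> 0" and j: "fst x = 2" "fst y = 2"
  shows "(T_quot x y \<longlongrightarrow> inverse (qnum q d)) (at q)"
proof -
  define n where "n = nat \<bar>d\<bar>"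
  define g where "g z = (if d > 0 then z ^ (2 * n) else - 1) / (z * q_int z n)" for z :: complex
  have q0: "q \<noteq> 0" using q2 by auto
  have n: "n \<noteq> 0" using d by (simp add: n_def)
  have CT: "CT z b = z powi (2 * content b)" if "fst b = 2" for z b
    using that by (cases b) (auto simp: content_def)
  have eq: "T_quot x y z = g z" if z: "z \<noteq> 0" "z\<^sup>2 \<noteq> 1" for z
  proof -
    define Q where "Q = q_int z n"
    have geo: "z ^ (2 * n) = 1 + Q * (z\<^sup>2 - 1)" using q_int_geometric[of z n] by (simp add: Q_def)
    have "CT z x = CT z y * z powi (- 2 * d)"
      using z(1) by (simp add: CT j d flip: power_int_add)
    then have "T_quot x y z = CT z y * (z - inverse z) / (CT z y * (1 - z powi (- 2 * d)))"
      by (simp add: T_quot_def right_diff_distrib)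
    also have "\<dots> = (z - inverse z) / (1 - z powi (- 2 * d))"
      using z(1) by (simp add: CT j)
    also have "\<dots> = g z"
    proof (cases "d > 0")
      case True
      have "z powi (- 2 * d) = inverse (z ^ (2 * n))"
        using True nat_mult_distrib[of 2 d] by (simp add: power_int_def n_def power_inverse)
      moreover have "(z - inverse z) / (1 - inverse w) = w / (z * Q)" if "w = 1 + Q * (z\<^sup>2 - 1)" "w \<noteq> 0" for w
      proof (cases "Q = 0")
        case False
        have "w - 1 \<noteq> 0" using that False z by simp
        have "z - inverse z = (z\<^sup>2 - 1) / z" using z by (simp add: field_simps power2_eq_square)
        moreover have "1 - inverse w = Q * (z\<^sup>2 - 1) / w" using that by (simp add: field_simps)
        ultimately show ?thesis using z by simp
      qed (use that in simp)
      from this[OF geo] z have "(z - inverse z) / (1 - inverse (z ^ (2 * n))) = z ^ (2 * n) / (z * Q)" by simp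
      ultimately show ?thesis using True by (simp add: g_def Q_def)
    next
      case False
      have "z powi (- 2 * d) = z ^ (2 * n)"
        using False d nat_mult_distrib[of 2 "- d"] by (simp add: power_int_def n_def)
      moreover have "z - inverse z = (z\<^sup>2 - 1) / z" using z by (simp add: field_simps power2_eq_square)
      ultimately show ?thesis using z False geo by (simp add: g_def Q_def[symmetric])
    qed
    finally show ?thesis .
  qed
  have "eventually (\<lambda>z. T_quot x y z = g z) (at q)"
  proof -
    have "eventually (\<lambda>z. z \<noteq> 0 \<and> z \<noteq> q \<and> z \<noteq> - q) (at q)"
      by (intro eventually_conj eventually_neq_at_within)
    then show ?thesis
    proof (rule eventually_mono)
      fix z assume "z \<noteq> 0 \<and> z \<noteq> q \<and> z \<noteq> - q"
      then have "z \<noteq> 0" "z\<^sup>2 \<noteq> 1" using q2 by (metis power2_eq_iff)+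
      then show "T_quot x y z = g z" by (rule eq)
    qed
  qed
  moreover have "(g \<longlongrightarrow> g q) (at q)"
  proof -
    have nz: "q * q_int q n \<noteq> 0" using q0 n q_int_square_one[OF q2] by simp
    have "((\<lambda>z. q_int z n) \<longlongrightarrow> q_int q n) (at q)"
      unfolding q_int_def by (intro tendsto_intros)
    then show ?thesis unfolding g_def using nz by (cases "d > 0") (auto intro!: tendsto_intros)
  qed
  moreover have "g q = inverse (qnum q d)"
  proof -
    have "q ^ (2 * n) = 1" using q2 by (simp add: power_mult)
    moreover have "of_int d = (if d > 0 then of_nat n else - of_nat n :: complex)"
      by (simp add: n_def) 
    ultimately show ?thesis using q2 by (simp add: g_def qnum_def q_int_square_one field_simps)
  qed
  ultimately show ?thesis using tendsto_cong by fastforce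
qed

context seminormal
begin

text \<open>Boxes in the same row or column are neighbours here, so that the content difference is \<open>1\<close> or
  \<open>-1\<close>; in the remaining cases the quotient or its limit is evaluated.\<close>

lemma T_entry_eq_diag_entry:
  assumes st: "std (y # x # s)" "length (y # x # s) \<le> k"
  shows "T_entry q x y = diag_entry q x y"
proof -
  obtain j r c where x: "x = (j, r, c)" by (cases x)
  obtain j' r' c' where y: "y = (j', r', c')" by (cases y)
  have comp: "j \<in> {1, 2}" "j' \<in> {1, 2}"
    using std_comp[OF st(1), of x] std_comp[OF st(1), of y] by (auto simp: x y)
  have sh: "shape (insert x (set s))" "shape (insert y (insert x (set s)))" "x \<notin> set s" "y \<notin> insert x (set s)"
    using st(1) by (auto simp: addable_def)
  have vx: "1 \<le> r" "1 \<le> c" using shape_valid[OF sh(1), of j r c] by (auto simp: x)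
  have vy: "1 \<le> r'" "1 \<le> c'" using shape_valid[OF sh(2), of j' r' c'] by (auto simp: y)
  have not_below: "\<not> (j = j' \<and> r' \<le> r \<and> c' \<le> c)"
    using shape_down[OF sh(1), of j r c r' c'] sh(4) vy by (auto simp: x y)
  have adj: "content y - content x = 1 \<or> content y - content x = - 1" if "j = j'" "r \<le> r'" "c \<le> c'"
  proof -
    have "\<not> addable y (set s)"
    proof
      assume "addable y (set s)"
      then have "x \<in> insert y (set s)"
        using shape_down[of "insert y (set s)" j' r' c' r c] that vx by (auto simp: addable_def x y)
      with sh show False by auto
    qed
    then show ?thesis using not_addable_adjacent[of "set s" x y] st std_shape[of s] by auto
  qed
  show ?thesis
  proof (cases "j = j' \<and> r = r'")
    case True
    then have "content y - content x = 1" using adj not_below by (auto simp: content_def x y)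
    then show ?thesis using True qnum_1[OF q_nonzero] by (simp add: x y diag_entry_def)
  next
    case nrow: False
    show ?thesis
    proof (cases "j = j' \<and> c = c'")
      case True
      then have "content y - content x = - 1" using adj not_below nrow by (auto simp: content_def x y)
      then show ?thesis using True nrow qnum_minus_1[OF q_nonzero]
        by (simp add: x y diag_entry_def)
    next
      case ncol: False
      show ?thesis
      proof (cases "q\<^sup>2 = 1 \<and> j = 2 \<and> j' = 2")
        case True
        have "content y - content x \<noteq> 0" using std_pair_content[OF st(1)] True by (simp add: x y)
        then have "(T_quot x y \<longlongrightarrow> inverse (qnum q (content y - content x))) (at q)"
          using T_quot_limit[of q _ y x] True by (simp add: x y)
        then have "Lim (at q) (T_quot x y) = inverse (qnum q (content y - content x))"
          by (rule tendsto_Lim[rotated]) simp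
        then show ?thesis using True nrow ncol by (simp add: x y diag_entry_def)
      next
        case False
        have "T_entry q x y = CT q y * h / (CT q y - CT q x)"
          using False nrow ncol unfolding x y T_entry.simps T_quot_def by auto
        moreover have "CT q y - CT q x \<noteq> 0"
        proof
          assume eq: "CT q y - CT q x = 0"
          then have "h * CT q y = 0" using diag_entry_CT[OF st] by simp
          moreover have "j' = 2 \<Longrightarrow> CT q y \<noteq> 0" "j = 2 \<Longrightarrow> CT q x \<noteq> 0" using q_nonzero by (auto simp: x y)
          moreover have "j = 1 \<Longrightarrow> r = 1" "j' = 1 \<Longrightarrow> r' = 1"
            using shape_valid[OF sh(1), of j r c] shape_valid[OF sh(2), of j' r' c'] by (auto simp: x y)
          ultimately show False
            using comp nrow False eq hecke_param_eq_0_iff[OF q_nonzero] by (auto simp: x y)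
        qed
        moreover have "CT q y * h = diag_entry q x y * (CT q y - CT q x)"
          using diag_entry_CT[OF st] by (simp only: mult.commute)
        ultimately show ?thesis by simp
      qed
    qed
  qed
qed

end


section \<open>The seminormal modules\<close>

lemma tableau_module_simps [simp]:
  "carrier (tableau_module \<mu> act) = {f. \<forall>L. L \<notin> standard_tableaux \<mu> \<longrightarrow> f L = 0}"
  "\<zero>\<^bsub>tableau_module \<mu> act\<^esub> = (\<lambda>_. 0)"
  "f \<oplus>\<^bsub>tableau_module \<mu> act\<^esub> g = (\<lambda>L. f L + g L)"
  "x \<odot>\<^bsub>tableau_module \<mu> act\<^esub> f = act x f"
  by (simp_all add: tableau_module_def)

text \<open>The lists that encode the standard tableaux of shape \<open>\<mu>\<close>.\<close>

definition orders :: "bipartition \<Rightarrow> box list set" where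
  "orders \<mu> = {l. std l \<and> set l = boxes \<mu>}"

lemma orders_St: "\<mu> \<in> A_hat k \<Longrightarrow> l \<in> orders \<mu> \<Longrightarrow> l \<in> St k"
  using std_card[of l] boxes_shape(2)[of \<mu> k] by (simp add: orders_def St_def)

lemma tab_orders_inj: "l \<in> orders \<mu> \<Longrightarrow> l' \<in> orders \<mu> \<Longrightarrow> tab l = tab l' \<Longrightarrow> l = l'"
  by (rule tab_inj) (auto simp: orders_def intro: std_distinct)

lemma swap_at_nth:
  assumes "1 \<le> i" "i < length l"
  shows "swap_at i l ! (length l - i) = l ! (length l - Suc i)"
    "swap_at i l ! (length l - Suc i) = l ! (length l - i)"
  using assms
  by (induction i l rule: swap_at.induct) (auto simp: nth_Cons Suc_diff_le split: nat.splits)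

lemma std_drop: "std l \<Longrightarrow> std (drop n l)"
proof (induction n)
  case (Suc n)
  then show ?case by (cases "drop n l") (auto simp: drop_Suc drop_tl)
qed simp

lemma standard_tableaux_tab:
  assumes "\<mu> \<in> A_hat k"
  shows "standard_tableaux \<mu> = tab ` orders \<mu>"
proof
  show "tab ` orders \<mu> \<subseteq> standard_tableaux \<mu>"
  proof
    fix L assume "L \<in> tab ` orders \<mu>"
    then obtain l where "std l" "set l = boxes \<mu>" "L = tab l" by (auto simp: orders_def)
    then show "L \<in> standard_tableaux \<mu>" using tab_standard[of l] by (simp add: standard_tableaux_filling)
  qed
  show "standard_tableaux \<mu> \<subseteq> tab ` orders \<mu>"
    using standard_tab[OF boxes_shape(1)[OF assms]]
    by (fastforce simp: standard_tableaux_filling orders_def)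
qed

lemma tableau_fun_eqI:
  assumes "\<mu> \<in> A_hat k" "F \<in> carrier (tableau_module \<mu> act)" "G \<in> carrier (tableau_module \<mu> act)"
    and "\<And>l. l \<in> orders \<mu> \<Longrightarrow> F (tab l) = G (tab l)"
  shows "F = G"
proof
  fix L show "F L = G L"
    using assms by (cases "L \<in> standard_tableaux \<mu>") (auto simp: standard_tableaux_tab[OF assms(1)])
qed

context seminormal
begin

text \<open>The action of the free algebra on functions of box lists induces one of the quotient on
  functions of tableaux, because the operators of elements of the ideal vanish.\<close>

definition tab_act :: "bipartition \<Rightarrow> free_elt set \<Rightarrow> (tableau \<Rightarrow> complex) \<Rightarrow> tableau \<Rightarrow> complex" where
  "tab_act \<mu> x F = (\<lambda>L. if L \<in> standard_tableaux \<mu>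
     then op (SOME f. f \<in> carrier (free_algebra k) \<and> x = rook_class k q f) (\<lambda>m. F (tab m))
       (SOME l. l \<in> orders \<mu> \<and> tab l = L)
     else 0)"

abbreviation "H \<mu> \<equiv> tableau_module \<mu> (tab_act \<mu>)"
abbreviation "A \<equiv> rook_algebra k q"
abbreviation "cls \<equiv> rook_class k q"

lemma tab_act_closed: "tab_act \<mu> x F \<in> carrier (H \<mu>)"
  by (simp add: tab_act_def)

lemma tab_act_tab:
  assumes \<mu>: "\<mu> \<in> A_hat k" and l: "l \<in> orders \<mu>" and f: "f \<in> carrier (free_algebra k)"
  shows "tab_act \<mu> (cls f) F (tab l) = op f (\<lambda>m. F (tab m)) l"
proof -
  define f' where "f' = (SOME f'. f' \<in> carrier (free_algebra k) \<and> cls f = cls f')"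
  have f': "f' \<in> carrier (free_algebra k) \<and> cls f = cls f'"
    unfolding f'_def using f by (rule_tac someI) auto
  define l' where "l' = (SOME l'. l' \<in> orders \<mu> \<and> tab l' = tab l)"
  have "l' \<in> orders \<mu> \<and> tab l' = tab l"
    unfolding l'_def using l by (rule_tac someI) auto
  then have l': "l' = l" using l tab_orders_inj by blast
  have "tab l \<in> standard_tableaux \<mu>" using l standard_tableaux_tab[OF \<mu>] by blast
  then have "tab_act \<mu> (cls f) F (tab l) = op f' (\<lambda>m. F (tab m)) l"
    unfolding tab_act_def f'_def[symmetric] l'_def[symmetric] l' by simp
  moreover have "op (f - f') (\<lambda>m. F (tab m)) l = 0"
    using rook_class_eq_iff[OF f, of f' q] f' orders_St[OF \<mu> l] by (intro rook_ideal_op[of k]) auto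
  ultimately show ?thesis by (simp add: op_apply_simps)
qed

lemma tab_act_eqI:
  assumes "\<mu> \<in> A_hat k" "G \<in> carrier (H \<mu>)" "f \<in> carrier (free_algebra k)"
    and "\<And>l. l \<in> orders \<mu> \<Longrightarrow> op f (\<lambda>m. F (tab m)) l = G (tab l)"
  shows "tab_act \<mu> (cls f) F = G"
  by (rule tableau_fun_eqI[OF assms(1) tab_act_closed[of \<mu>] assms(2)])
    (simp add: tab_act_tab assms)

lemma op_orders_cong:
  assumes "l \<in> orders \<mu>" "\<And>m. m \<in> orders \<mu> \<Longrightarrow> g m = g' m"
  shows "op f g l = op f g' l"
  using assms by (intro op_cong) (auto simp: orders_def)

lemma left_module_H:
  assumes \<mu>: "\<mu> \<in> A_hat k"
  shows "left_module A (H \<mu>)"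
proof (intro left_module.intro left_module_axioms.intro)
  show "ring A" by (rule ring_rook_algebra)
  show "abelian_group (H \<mu>)"
  proof (rule abelian_groupI)
    fix F assume "F \<in> carrier (H \<mu>)"
    then show "\<exists>G\<in>carrier (H \<mu>). G \<oplus>\<^bsub>H \<mu>\<^esub> F = \<zero>\<^bsub>H \<mu>\<^esub>" by (intro bexI[of _ "\<lambda>L. - F L"]) auto
  qed (auto simp: add_ac)
  fix x F assume x: "x \<in> carrier A" and F: "F \<in> carrier (H \<mu>)"
  obtain f where f: "f \<in> carrier (free_algebra k)" "x = cls f" using rook_class_surj[OF x] by blast
  show "x \<odot>\<^bsub>H \<mu>\<^esub> F \<in> carrier (H \<mu>)" using tab_act_closed by simp
  {
    fix G assume G: "G \<in> carrier (H \<mu>)"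
    have "op f (\<lambda>m. F (tab m) + G (tab m)) l = op f (\<lambda>m. F (tab m)) l + op f (\<lambda>m. G (tab m)) l" for l
      using op.act_add_right[of f "\<lambda>m. F (tab m)" "\<lambda>m. G (tab m)"] by (simp add: plus_fun_def)
    then have "tab_act \<mu> (cls f) (\<lambda>L. F L + G L) = (\<lambda>L. tab_act \<mu> (cls f) F L + tab_act \<mu> (cls f) G L)"
      by (intro tab_act_eqI[OF \<mu>]) (simp_all add: f tab_act_tab \<mu>, simp add: tab_act_def)
    then show "x \<odot>\<^bsub>H \<mu>\<^esub> (F \<oplus>\<^bsub>H \<mu>\<^esub> G) = x \<odot>\<^bsub>H \<mu>\<^esub> F \<oplus>\<^bsub>H \<mu>\<^esub> x \<odot>\<^bsub>H \<mu>\<^esub> G" by (simp add: f(2))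
  }
  fix y assume y: "y \<in> carrier A"
  obtain g where g: "g \<in> carrier (free_algebra k)" "y = cls g" using rook_class_surj[OF y] by blast
  have "tab_act \<mu> (cls (f + g)) F = (\<lambda>L. tab_act \<mu> (cls f) F L + tab_act \<mu> (cls g) F L)"
    by (intro tab_act_eqI[OF \<mu>]) (simp_all add: f g tab_act_tab \<mu> op_apply_simps free_algebra_closed, simp add: tab_act_def)
  then show "(x \<oplus>\<^bsub>A\<^esub> y) \<odot>\<^bsub>H \<mu>\<^esub> F = x \<odot>\<^bsub>H \<mu>\<^esub> F \<oplus>\<^bsub>H \<mu>\<^esub> y \<odot>\<^bsub>H \<mu>\<^esub> F"
    by (simp add: f(2) g(2) rook_class_hom[OF f(1) g(1)])
  have "tab_act \<mu> (cls (f * g)) F = tab_act \<mu> (cls f) (tab_act \<mu> (cls g) F)"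
  proof (rule tab_act_eqI[OF \<mu> tab_act_closed])
    show "f * g \<in> carrier (free_algebra k)" using f g by (intro free_algebra_closed)
    fix l assume l: "l \<in> orders \<mu>"
    show "op (f * g) (\<lambda>m. F (tab m)) l = tab_act \<mu> (cls f) (tab_act \<mu> (cls g) F) (tab l)"
      unfolding tab_act_tab[OF \<mu> l f(1)] op_apply_simps
      by (rule op_orders_cong[OF l]) (simp add: tab_act_tab \<mu> g)
  qed
  then show "(x \<otimes>\<^bsub>A\<^esub> y) \<odot>\<^bsub>H \<mu>\<^esub> F = x \<odot>\<^bsub>H \<mu>\<^esub> (y \<odot>\<^bsub>H \<mu>\<^esub> F)"
    by (simp add: f(2) g(2) rook_class_hom[OF f(1) g(1)])
next
  fix F assume F: "F \<in> carrier (H \<mu>)"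
  show "\<one>\<^bsub>A\<^esub> \<odot>\<^bsub>H \<mu>\<^esub> F = F"
    unfolding rook_class_one tableau_module_simps
    by (rule tab_act_eqI[OF \<mu> F one_closed]) simp
qed

lemma op_tvec:
  assumes "\<mu> \<in> A_hat k" "l \<in> orders \<mu>" "m \<in> orders \<mu>"
  shows "op f (\<lambda>m. tvec \<mu> (tab l) (tab m)) m = mat f m l"
  unfolding mat_def using assms
  by (intro op_orders_cong[OF assms(3)])
    (auto simp: tvec_def unit_fun_def standard_tableaux_tab dest: tab_orders_inj)

lemma consecutive:
  assumes "std l" "length l = k" "1 \<le> i" "i + 1 \<le> k"
  shows "\<exists>s. std (l ! (k - Suc i) # l ! (k - i) # s) \<and> length (l ! (k - Suc i) # l ! (k - i) # s) \<le> k"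
proof -
  have "drop (k - Suc i) l = l ! (k - Suc i) # l ! (k - i) # drop (Suc (k - i)) l"
    using Cons_nth_drop_Suc[of "k - Suc i" l] Cons_nth_drop_Suc[of "k - i" l] assms by (simp add: Suc_diff_Suc)
  moreover have "length (drop (k - Suc i) l) \<le> k" using assms by simp
  ultimately show ?thesis using std_drop[OF assms(1), of "k - Suc i"] by metis
qed

text \<open>The operators act on coordinate functions. So the coefficient of \<open>v\<^sub>m\<close> in \<open>T\<^sub>i v\<^sub>L\<close> for \<open>m = s\<^sub>i L\<close> is
  \<open>q - (T\<^sub>i)\<^sub>m\<^sub>m\<close>, which is \<open>q\<^sup>-\<^sup>1 + (T\<^sub>i)\<^sub>L\<^sub>L\<close> by the trace identity \<open>diag_entry_swap\<close>.\<close>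

lemma seminormal_action_tab_act:
  assumes \<mu>: "\<mu> \<in> A_hat k"
  shows "seminormal_action k q \<mu> (tab_act \<mu>)"
  unfolding seminormal_action_def
proof (intro conjI allI ballI impI; (elim conjE)?)
  show "left_module A (H \<mu>)" by (rule left_module_H[OF \<mu>])
next
  fix c F assume F: "F \<in> carrier (H \<mu>)"
  show "tab_act \<mu> (c \<odot>\<^bsub>A\<^esub> \<one>\<^bsub>A\<^esub>) F = (\<lambda>L. c * F L)"
    unfolding rook_class_one rook_algebra_smult[OF one_closed] mult_1_right
    by (rule tab_act_eqI[OF \<mu> _ scal_closed]) (use F in \<open>simp_all add: op_apply_simps del: op.act_scal\<close>)
next
  fix L i assume "L \<in> standard_tableaux \<mu>" and i: "1 \<le> i" "i \<le> k"
  then obtain l where l: "l \<in> orders \<mu>" "L = tab l" using standard_tableaux_tab[OF \<mu>] by blast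
  have lk: "std l" "length l = k" "set l = boxes \<mu>" using l(1) orders_St[OF \<mu> l(1)] by (auto simp: orders_def St_def)
  obtain i' where i': "i = Suc i'" using i by (cases i) auto
  have X: "rook_X k q i = cls (X_elt i')"
    unfolding rook_X_def i' by (simp only: X_elt_prod_list)
  show "tab_act \<mu> (rook_X k q i) (tvec \<mu> L) = (\<lambda>L'. CT q (box_of \<mu> L i) * tvec \<mu> L L')"
    unfolding X
  proof (rule tab_act_eqI[OF \<mu>])
    show "(\<lambda>L'. CT q (box_of \<mu> L i) * tvec \<mu> L L') \<in> carrier (H \<mu>)" by (auto simp: tvec_def)
    show "X_elt i' \<in> carrier (free_algebra k)" using X_elt_closed i i' by simp
    fix m assume m: "m \<in> orders \<mu>"
    have mk: "std m" "length m = k" using m orders_St[OF \<mu> m] by (auto simp: orders_def St_def)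
    have "op (X_elt i') (\<lambda>m. tvec \<mu> L (tab m)) m = CT q (m ! (k - i)) * tvec \<mu> L (tab m)"
      using op_X_elt[of m i' "\<lambda>m. tvec \<mu> L (tab m)"] mk i i' by simp
    also have "\<dots> = CT q (box_of \<mu> L i) * tvec \<mu> L (tab m)"
    proof (cases "tab m = L")
      case True
      then have "m = l" using tab_orders_inj[OF m l(1)] l(2) by simp
      then show ?thesis
        using box_of_tab[of l \<mu> i] lk i std_distinct[OF lk(1)] by (simp add: l(2))
    qed (simp add: tvec_def)
    finally show "op (X_elt i') (\<lambda>m. tvec \<mu> L (tab m)) m = CT q (box_of \<mu> L i) * tvec \<mu> L (tab m)" .
  qed
next
  fix L i assume "L \<in> standard_tableaux \<mu>" and i: "1 \<le> i" "i + 1 \<le> k"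
  then obtain l where l: "l \<in> orders \<mu>" "L = tab l" using standard_tableaux_tab[OF \<mu>] by blast
  have lk: "std l" "length l = k" "set l = boxes \<mu>" using l(1) orders_St[OF \<mu> l(1)] by (auto simp: orders_def St_def)
  define a where "a m = diag_entry q (m ! (k - i)) (m ! (k - Suc i))" for m
  have a: "T_diag q \<mu> L i = a l"
  proof -
    have bo: "box_of \<mu> L i = l ! (k - i)" "box_of \<mu> L (i + 1) = l ! (k - Suc i)"
      using box_of_tab[of l \<mu>] lk i std_distinct[OF lk(1)] by (simp_all add: l(2))
    show ?thesis
      unfolding T_diag_def bo a_def using consecutive[OF lk(1,2) i]
      by (metis T_entry_eq_diag_entry)
  qed
  show "tab_act \<mu> (rook_T k q i) (tvec \<mu> L) =
    (\<lambda>L'. T_diag q \<mu> L i * tvec \<mu> L L' + (inverse q + T_diag q \<mu> L i) * tvec \<mu> (switch i L) L')"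
    unfolding rook_T_def
  proof (rule tab_act_eqI[OF \<mu>])
    show "genT i \<in> carrier (free_algebra k)" using i by (intro genT_closed) auto
    show "(\<lambda>L'. T_diag q \<mu> L i * tvec \<mu> L L' + (inverse q + T_diag q \<mu> L i) * tvec \<mu> (switch i L) L')
      \<in> carrier (H \<mu>)" by (auto simp: tvec_def)
    fix m assume m: "m \<in> orders \<mu>"
    have mk: "std m" "length m = k" using m orders_St[OF \<mu> m] by (auto simp: orders_def St_def)
    have "op (genT i) (\<lambda>m. tvec \<mu> L (tab m)) m = a m * tvec \<mu> L (tab m) +
      (if std (swap_at i m) then (q - a m) * tvec \<mu> L (tab (swap_at i m)) else 0)"
      using T_op_formula[of m i q "\<lambda>m. tvec \<mu> L (tab m)"] mk i by (simp add: a_def)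
    also have "a m * tvec \<mu> L (tab m) = a l * tvec \<mu> L (tab m)"
      using tab_orders_inj[OF m l(1)] l(2) by (cases "tab m = L") (auto simp: tvec_def)
    also have "(if std (swap_at i m) then (q - a m) * tvec \<mu> L (tab (swap_at i m)) else 0) =
      (inverse q + a l) * tvec \<mu> (switch i L) (tab m)"
    proof (cases "tab m = switch i L")
      case False
      have "tab (swap_at i m) \<noteq> L" if "std (swap_at i m)"
      proof
        assume e: "tab (swap_at i m) = L"
        have "swap_at i m \<in> orders \<mu>" using that m by (auto simp: orders_def swap_at_simps)
        then have "swap_at i m = l" using tab_orders_inj l e by blast
        then have "m = swap_at i l" using swap_at_swap_at by metis
        with False tab_swap_at[of l i] std_distinct[OF lk(1)] lk i l(2) show False by simp
      qed
      with False show ?thesis by (auto simp: tvec_def)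
    next
      case True
      then have sw: "tab m = tab (swap_at i l)" using tab_swap_at[of l i] std_distinct[OF lk(1)] lk i l(2) by simp
      have d: "distinct (swap_at i l)"
        using std_distinct[OF lk(1)] swap_at_simps[of i l] by (metis card_distinct distinct_card)
      have ml: "m = swap_at i l" by (rule tab_inj[OF std_distinct[OF mk(1)] d sw])
      then have lm: "swap_at i m = l" by (simp add: swap_at_swap_at)
      have sm: "switch i L \<in> standard_tableaux \<mu>" using True m standard_tableaux_tab[OF \<mu>] by (metis imageI)
      have tv: "tvec \<mu> L (tab (swap_at i m)) = 1" "tvec \<mu> (switch i L) (tab m) = 1"
        using sm True l lm standard_tableaux_tab[OF \<mu>] by (auto simp: tvec_def)
      have "a m = diag_entry q (l ! (k - Suc i)) (l ! (k - i))"
        unfolding a_def ml using swap_at_nth[of i l] lk i by simp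
      also have "\<dots> = h - a l"
        unfolding a_def using consecutive[OF lk(1,2) i] diag_entry_swap by blast
      finally have "q - a m = inverse q + a l" by simp
      with tv lm lk show ?thesis by simp
    qed
    finally show "op (genT i) (\<lambda>m. tvec \<mu> L (tab m)) m =
      T_diag q \<mu> L i * tvec \<mu> L (tab m) + (inverse q + T_diag q \<mu> L i) * tvec \<mu> (switch i L) (tab m)"
      by (simp only: a)
  qed
qed

lemma cls_mu_closed: "l \<in> St k \<Longrightarrow> l' \<in> St k \<Longrightarrow> cls (mu k l l') \<in> carrier A"
  by (intro rook_class_closed mu_closed) auto

lemma cls_eqI:
  assumes "f \<in> carrier (free_algebra k)" "g \<in> carrier (free_algebra k)"
    and "\<And>l m. l \<in> St k \<Longrightarrow> m \<in> St k \<Longrightarrow> mat f l m = mat g l m"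
  shows "cls f = cls g"
  using assms rook_ideal_iff_mat[of "f - g"]
  by (simp add: rook_class_eq_iff free_algebra_closed mat_simps)

lemma sum_matrix_units:
  "(\<Sum>l\<in>St k. mu k l l) \<in> carrier (free_algebra k)" "cls (\<Sum>l\<in>St k. mu k l l) = \<one>\<^bsub>A\<^esub>"
proof -
  show c: "(\<Sum>l\<in>St k. mu k l l) \<in> carrier (free_algebra k)"
    by (intro free_algebra_sum mu_closed) auto
  show "cls (\<Sum>l\<in>St k. mu k l l) = \<one>\<^bsub>A\<^esub>"
    unfolding rook_class_one
    by (rule cls_eqI[OF c one_closed]) (auto simp: mat_sum mat_mu mat_simps finite_St intro!: sum.neutral)
qed

lemma op_mu:
  assumes "n \<le> k" "s \<in> St n" "s' \<in> St n" "set s = set s'" "l \<in> St n"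
  shows "op (mu n s s') g l = (if l = s then g s' else 0)"
  using assms by (simp add: op_eq_mat[OF assms(5)] mat_mu finite_St if_distrib if_distribR cong: if_cong)

text \<open>Given a nonzero coordinate of \<open>F\<close>, a combination of matrix units maps \<open>F\<close> to any other function.\<close>

lemma simple_module_H:
  assumes \<mu>: "\<mu> \<in> A_hat k"
  shows "simple_module A (H \<mu>)"
  unfolding simple_module_def
proof (intro conjI allI impI)
  show "left_module A (H \<mu>)" by (rule left_module_H[OF \<mu>])
  obtain l where "std l" "set l = boxes \<mu>" using std_exists[OF boxes_shape(1)[OF \<mu>]] by blast
  then have l: "l \<in> orders \<mu>" by (simp add: orders_def)
  then have "tvec \<mu> (tab l) \<in> carrier (H \<mu>)" "tvec \<mu> (tab l) (tab l) = 1"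
    using standard_tableaux_tab[OF \<mu>] by (auto simp: tvec_def)
  then show "carrier (H \<mu>) \<noteq> {\<zero>\<^bsub>H \<mu>\<^esub>}" by (metis singletonD tableau_module_simps(2) zero_neq_one)
next
  fix N assume N: "submodule N A (H \<mu>)"
  show "N = {\<zero>\<^bsub>H \<mu>\<^esub>} \<or> N = carrier (H \<mu>)"
  proof (rule disjCI)
    assume ne: "N \<noteq> carrier (H \<mu>)"
    have "F = \<zero>\<^bsub>H \<mu>\<^esub>" if F: "F \<in> N" for F
    proof (rule ccontr)
      assume "F \<noteq> \<zero>\<^bsub>H \<mu>\<^esub>"
      then obtain l where l: "l \<in> orders \<mu>" "F (tab l) \<noteq> 0"
        using submoduleD(1)[OF N] F tableau_fun_eqI[OF \<mu>, of F _ "\<lambda>_. 0"] by auto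
      have "G \<in> N" if G: "G \<in> carrier (H \<mu>)" for G
      proof -
        define f where "f = (\<Sum>l'\<in>orders \<mu>. scal (G (tab l') / F (tab l)) * mu k l' l)"
        have lS: "l \<in> St k" using orders_St[OF \<mu> l(1)] .
        have sub: "orders \<mu> \<subseteq> St k" using orders_St[OF \<mu>] by blast
        have f: "f \<in> carrier (free_algebra k)" unfolding f_def using sub lS
          by (intro free_algebra_sum free_algebra_closed scal_closed mu_closed) auto
        have "tab_act \<mu> (cls f) F = G"
        proof (rule tab_act_eqI[OF \<mu> G f])
          fix m assume m: "m \<in> orders \<mu>"
          have "op f (\<lambda>m. F (tab m)) m =
            (\<Sum>l'\<in>orders \<mu>. G (tab l') / F (tab l) * (if m = l' then F (tab l) else 0))"
            unfolding f_def op_sum op_apply_simps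
            using m l lS sub by (intro sum.cong) (auto simp: op_mu orders_def subset_eq)
          also have "\<dots> = G (tab m)"
            using m l finite_subset[OF sub finite_St] by (simp add: if_distrib cong: if_cong)
          finally show "op f (\<lambda>m. F (tab m)) m = G (tab m)" .
        qed
        with submoduleD(4)[OF N rook_class_closed[OF f] F] show ?thesis by simp
      qed
      with ne submoduleD(1)[OF N] show False by blast
    qed
    with submoduleD(2)[OF N] show "N = {\<zero>\<^bsub>H \<mu>\<^esub>}" by blast
  qed
qed

text \<open>A diagonal matrix unit of shape \<open>\<mu>\<close> fixes a basis vector of \<open>H \<mu>\<close> and annihilates \<open>H \<nu>\<close> if
  \<open>\<nu> \<noteq> \<mu>\<close>.\<close>

lemma H_isomorphic_eq:
  assumes \<mu>: "\<mu> \<in> A_hat k" and \<nu>: "\<nu> \<in> A_hat k" and iso: "module_isomorphic A (H \<mu>) (H \<nu>)"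
  shows "\<mu> = \<nu>"
proof (rule ccontr)
  assume ne: "\<mu> \<noteq> \<nu>"
  obtain l where "std l" "set l = boxes \<mu>" using std_exists[OF boxes_shape(1)[OF \<mu>]] by blast
  then have l: "l \<in> orders \<mu>" by (simp add: orders_def)
  note lS = orders_St[OF \<mu> l]
  obtain \<phi> where \<phi>: "\<phi> \<in> iso (add_monoid (H \<mu>)) (add_monoid (H \<nu>))"
    "\<And>a x. a \<in> carrier A \<Longrightarrow> x \<in> carrier (H \<mu>) \<Longrightarrow> \<phi> (a \<odot>\<^bsub>H \<mu>\<^esub> x) = a \<odot>\<^bsub>H \<nu>\<^esub> \<phi> x"
    using iso unfolding module_isomorphic_def by blast
  have bij: "bij_betw \<phi> (carrier (H \<mu>)) (carrier (H \<nu>))" and hom: "\<phi> \<in> hom (add_monoid (H \<mu>)) (add_monoid (H \<nu>))"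
    using \<phi>(1) by (auto simp: iso_def)
  define v where "v = tvec \<mu> (tab l)"
  define z where "z = (\<lambda>_::tableau. 0::complex)"
  have v: "v \<in> carrier (H \<mu>)" "v (tab l) = 1"
    using l standard_tableaux_tab[OF \<mu>] by (auto simp: tvec_def v_def)
  have c: "mu k l l \<in> carrier (free_algebra k)" using lS by (intro mu_closed) auto
  have fix_v: "tab_act \<mu> (cls (mu k l l)) v = v"
  proof (rule tab_act_eqI[OF \<mu> v(1) c])
    fix m assume m: "m \<in> orders \<mu>"
    show "op (mu k l l) (\<lambda>m. v (tab m)) m = v (tab m)"
      using orders_St[OF \<mu> m] lS tab_orders_inj[OF m l] by (auto simp: op_mu v_def tvec_def)
  qed
  have kill: "tab_act \<nu> (cls (mu k l l)) F = z" for F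
  proof (rule tab_act_eqI[OF \<nu> _ c])
    fix m assume m: "m \<in> orders \<nu>"
    have "m \<noteq> l" using m l boxes_inj[OF \<mu> \<nu>] ne by (auto simp: orders_def)
    then show "op (mu k l l) (\<lambda>m. F (tab m)) m = z (tab m)"
      using orders_St[OF \<nu> m] lS by (simp add: op_mu z_def)
  qed (simp add: z_def)
  have "\<phi> v = z" using \<phi>(2)[OF cls_mu_closed[OF lS lS] v(1)] fix_v kill by simp
  moreover have "\<phi> z = z"
  proof -
    have "\<phi> (z \<oplus>\<^bsub>H \<mu>\<^esub> z) = \<phi> z \<oplus>\<^bsub>H \<nu>\<^esub> \<phi> z" using hom_mult[OF hom, of z z] by (simp add: z_def)
    then have "\<phi> z = (\<lambda>L. \<phi> z L + \<phi> z L)" by (simp add: z_def)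
    then show ?thesis by (metis (no_types) add_cancel_right_right ext z_def)
  qed
  ultimately have "v = z" using inj_onD[OF bij_betw_imp_inj_on[OF bij], of v z] v(1) by (simp add: z_def)
  then show False using v(2) by (simp add: z_def)
qed

end


section \<open>Classification of the simple modules and semisimplicity\<close>

context seminormal
begin

abbreviation "U l \<equiv> cls (mu k l l)"

lemma U_closed: "l \<in> St k \<Longrightarrow> U l \<in> carrier A"
  by (rule cls_mu_closed)

lemma cls_mult_U:
  assumes "f \<in> carrier (free_algebra k)" "l \<in> St k"
  shows "cls f \<otimes>\<^bsub>A\<^esub> U l = cls (f * mu k l l)"
  using assms by (intro rook_class_hom mu_closed) auto

lemma U_mult_U:
  assumes "l \<in> St k" "l' \<in> St k"
  shows "U l \<otimes>\<^bsub>A\<^esub> U l' = (if l = l' then U l else \<zero>\<^bsub>A\<^esub>)"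
proof -
  have c: "mu k l l \<in> carrier (free_algebra k)" "mu k l' l' \<in> carrier (free_algebra k)"
    using assms by (auto intro: mu_closed)
  have "cls (mu k l l * mu k l' l') = cls (if l = l' then mu k l l else 0)"
    using assms c
    by (intro cls_eqI) (auto simp: mat_mu_right mat_mu mat_simps free_algebra_zero intro: free_algebra_closed)
  then show ?thesis using cls_mult_U[OF c(1) assms(2)] by (auto simp: rook_class_zero)
qed

lemma partial_sum_closed:
  assumes add: "\<And>x y. x \<in> S \<Longrightarrow> y \<in> S \<Longrightarrow> x \<oplus>\<^bsub>A\<^esub> y \<in> S" and zero: "\<zero>\<^bsub>A\<^esub> \<in> S"
    and U: "\<And>l. l \<in> St k \<Longrightarrow> U l \<in> S"
  shows "\<one>\<^bsub>A\<^esub> \<in> S"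
proof -
  have "cls (\<Sum>l\<in>B. mu k l l) \<in> S" if "finite B" "B \<subseteq> St k" for B
    using that
  proof (induction B)
    case empty
    then show ?case using zero by (simp add: rook_class_zero)
  next
    case (insert l B)
    have c: "mu k l l \<in> carrier (free_algebra k)" "(\<Sum>l\<in>B. mu k l l) \<in> carrier (free_algebra k)"
      using insert.prems by (auto intro!: mu_closed free_algebra_sum)
    show ?case
      using add[of "U l" "cls (\<Sum>l\<in>B. mu k l l)"] insert U rook_class_hom(2)[OF c, of q] by simp
  qed
  from this[OF finite_St order.refl] show ?thesis by (simp only: sum_matrix_units)
qed

text \<open>The elements \<open>U l\<close> add up to \<open>1\<close>.\<close>

lemma U_acts_nonzero:
  assumes M: "left_module A M" and m: "m \<in> carrier M" "m \<noteq> \<zero>\<^bsub>M\<^esub>"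
  shows "\<exists>l\<in>St k. U l \<odot>\<^bsub>M\<^esub> m \<noteq> \<zero>\<^bsub>M\<^esub>"
proof (rule ccontr)
  interpret left_module A M by (rule M)
  assume "\<not> ?thesis"
  then have "\<one>\<^bsub>A\<^esub> \<in> {a \<in> carrier A. a \<odot>\<^bsub>M\<^esub> m = \<zero>\<^bsub>M\<^esub>}"
    by (intro partial_sum_closed) (auto simp: smult_l_distr zero_smult m intro: U_closed)
  then show False using m by (simp add: smult_one)
qed

text \<open>Some \<open>U l\<close> does not annihilate \<open>M\<close>; let \<open>m\<close> be a nonzero vector in its image. An element that
  annihilates the basis vector of the tableau of \<open>l\<close> has column \<open>l\<close> equal to zero, so its product with \<open>U l\<close> is
  zero and it annihilates \<open>m = U l m\<close>. Hence the simple modules are isomorphic.\<close>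

lemma simple_module_isomorphic_H:
  assumes M: "simple_module A M"
  shows "\<exists>\<mu>\<in>A_hat k. module_isomorphic A M (H \<mu>)"
proof -
  interpret M: left_module A M using M by (simp add: simple_module_def)
  obtain m1 where m1: "m1 \<in> carrier M" "m1 \<noteq> \<zero>\<^bsub>M\<^esub>"
    using M M.M.zero_closed unfolding simple_module_def by blast
  from U_acts_nonzero[OF M.left_module_axioms this] obtain l where l: "l \<in> St k" "U l \<odot>\<^bsub>M\<^esub> m1 \<noteq> \<zero>\<^bsub>M\<^esub>" by blast
  define m where "m = U l \<odot>\<^bsub>M\<^esub> m1"
  have m: "m \<in> carrier M" "m \<noteq> \<zero>\<^bsub>M\<^esub>" using l m1 by (auto simp: m_def intro: M.smult_closed U_closed)
  have Um: "U l \<odot>\<^bsub>M\<^esub> m = m"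
    using M.smult_assoc1[OF U_closed[OF l(1)] U_closed[OF l(1)] m1(1)] l(1)
    by (simp add: m_def U_mult_U)
  have "shape (set l)" "card (set l) = k" using l(1) std_shape std_card by (auto simp: St_def)
  then obtain \<mu> where \<mu>: "\<mu> \<in> A_hat k" "boxes \<mu> = set l" using shape_boxes by blast
  then have lo: "l \<in> orders \<mu>" using l(1) by (simp add: orders_def St_def)
  have "module_isomorphic A M (H \<mu>)"
  proof (rule simple_modules_isomorphic[OF M simple_module_H[OF \<mu>(1)] m])
    show "tvec \<mu> (tab l) \<in> carrier (H \<mu>)" by (auto simp: tvec_def)
    have "tvec \<mu> (tab l) (tab l) = 1" using lo standard_tableaux_tab[OF \<mu>(1)] by (auto simp: tvec_def)
    then show "tvec \<mu> (tab l) \<noteq> \<zero>\<^bsub>H \<mu>\<^esub>" by (metis tableau_module_simps(2) zero_neq_one)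
    fix a assume a: "a \<in> carrier A" "a \<odot>\<^bsub>H \<mu>\<^esub> tvec \<mu> (tab l) = \<zero>\<^bsub>H \<mu>\<^esub>"
    obtain f where f: "f \<in> carrier (free_algebra k)" "a = cls f" using rook_class_surj[OF a(1)] by blast
    have col: "mat f s l = 0" if "s \<in> St k" for s
    proof (cases "s \<in> orders \<mu>")
      case True
      then show ?thesis
        using tab_act_tab[OF \<mu>(1) True f(1), of "tvec \<mu> (tab l)"] a(2) op_tvec[OF \<mu>(1) lo True] f(2) by simp
    next
      case False
      then have "set l \<noteq> set s" using that \<mu>(2) by (simp add: orders_def St_def)
      then show ?thesis using that mat_eq_0 by (simp add: St_def)
    qed
    have c: "mu k l l \<in> carrier (free_algebra k)" using l(1) by (intro mu_closed) auto
    have "cls (f * mu k l l) = cls 0"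
      using l(1) f(1) c col
      by (intro cls_eqI) (auto simp: mat_mu_right mat_simps free_algebra_zero intro: free_algebra_closed)
    then have "a \<otimes>\<^bsub>A\<^esub> U l = \<zero>\<^bsub>A\<^esub>" using cls_mult_U[OF f(1) l(1)] f(2) by (simp add: rook_class_zero)
    then have "\<zero>\<^bsub>A\<^esub> \<odot>\<^bsub>M\<^esub> m = a \<odot>\<^bsub>M\<^esub> m"
      using M.smult_assoc1[OF a(1) U_closed[OF l(1)] m(1)] Um by simp
    then show "a \<odot>\<^bsub>M\<^esub> m = \<zero>\<^bsub>M\<^esub>" using M.zero_smult[OF m(1)] by simp
  qed
  with \<mu>(1) show ?thesis by blast
qed

text \<open>The columns of the matrix blocks.\<close>

definition column :: "box list \<Rightarrow> free_elt set set" where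
  "column l = {x \<odot>\<^bsub>regular_module A\<^esub> U l | x. x \<in> carrier A}"

lemma column_submodule: "l \<in> St k \<Longrightarrow> submodule (column l) A (regular_module A)"
  unfolding column_def
  by (rule left_module.cyclic_submodule[OF left_module_regular[OF ring_rook_algebra]])
    (simp add: U_closed)

lemma U_column: "l \<in> St k \<Longrightarrow> U l \<in> column l"
proof -
  interpret ring A by (rule ring_rook_algebra)
  assume "l \<in> St k"
  then have "U l = \<one>\<^bsub>A\<^esub> \<odot>\<^bsub>regular_module A\<^esub> U l" by (simp add: U_closed)
  then show ?thesis unfolding column_def by blast
qed

lemma U_nonzero: "l \<in> St k \<Longrightarrow> U l \<noteq> \<zero>\<^bsub>A\<^esub>"
  using rook_ideal_iff_mat[OF mu_closed[OF order.refl], of l l] rook_class_eq_zero_iff[OF mu_closed[OF order.refl], of l l q]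
  by (auto simp: mat_mu)

lemma column_mult_U:
  assumes "l \<in> St k" "l' \<in> St k" "x \<in> column l"
  shows "x \<otimes>\<^bsub>A\<^esub> U l' = (if l = l' then x else \<zero>\<^bsub>A\<^esub>)"
proof -
  interpret ring A by (rule ring_rook_algebra)
  obtain y where y: "y \<in> carrier A" "x = y \<otimes>\<^bsub>A\<^esub> U l" using assms(3) by (auto simp: column_def)
  then have "x \<otimes>\<^bsub>A\<^esub> U l' = y \<otimes>\<^bsub>A\<^esub> (U l \<otimes>\<^bsub>A\<^esub> U l')" using assms by (simp add: m_assoc U_closed)
  then show ?thesis using y assms by (simp add: U_mult_U)
qed

text \<open>A nonzero element of a column has a nonzero entry, and a matrix unit moves this entry to the
  diagonal.\<close>

lemma column_simple:
  assumes l: "l \<in> St k"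
  shows "simple_module A (regular_module A\<lparr>carrier := column l\<rparr>)"
  unfolding simple_module_def
proof (intro conjI allI impI)
  show "left_module A (regular_module A\<lparr>carrier := column l\<rparr>)"
    by (rule left_module_restrict[OF left_module_regular[OF ring_rook_algebra] column_submodule[OF l]])
  show "carrier (regular_module A\<lparr>carrier := column l\<rparr>) \<noteq> {\<zero>\<^bsub>regular_module A\<lparr>carrier := column l\<rparr>\<^esub>}"
    using U_column[OF l] U_nonzero[OF l] by auto
  fix K assume "submodule K A (regular_module A\<lparr>carrier := column l\<rparr>)"
  note K = submoduleD[OF this]
  have smult: "a \<otimes>\<^bsub>A\<^esub> x \<in> K" if "a \<in> carrier A" "x \<in> K" for a x using K(4)[OF that] by simp
  have "column l \<subseteq> K" if "x \<in> K" "x \<noteq> \<zero>\<^bsub>A\<^esub>" for x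
  proof -
    have "x \<in> column l" using K(1) \<open>x \<in> K\<close> by auto
    then obtain y where "y \<in> carrier A" "x = y \<otimes>\<^bsub>A\<^esub> U l" by (auto simp: column_def)
    then obtain f where f: "f \<in> carrier (free_algebra k)" "x = cls f \<otimes>\<^bsub>A\<^esub> U l" using rook_class_surj by blast
    have x: "x = cls (f * mu k l l)" using f(2) cls_mult_U[OF f(1) l] by simp
    have c: "mu k l l \<in> carrier (free_algebra k)" using l by (intro mu_closed) auto
    have "\<exists>s\<in>St k. mat f s l \<noteq> 0"
    proof (rule ccontr)
      assume "\<not> ?thesis"
      then have "cls (f * mu k l l) = cls 0" using l f(1) c
        by (intro cls_eqI) (auto simp: mat_mu_right mat_simps free_algebra_zero intro: free_algebra_closed)
      with x that(2) show False by (simp add: rook_class_zero)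
    qed
    then obtain s where s: "s \<in> St k" "mat f s l \<noteq> 0" by blast
    have ls: "set l = set s"
    proof (rule ccontr)
      assume "set l \<noteq> set s"
      then show False using s mat_eq_0[of s l f] by (simp add: St_def)
    qed
    have c': "mu k l s \<in> carrier (free_algebra k)" using l s(1) by (intro mu_closed) auto
    define g where "g = scal (inverse (mat f s l)) * mu k l s"
    have g: "g \<in> carrier (free_algebra k)" using c' by (simp add: g_def free_algebra_closed scal_closed)
    have "cls (g * (f * mu k l l)) = U l"
    proof (rule cls_eqI[OF _ c])
      show "g * (f * mu k l l) \<in> carrier (free_algebra k)" using g f c by (intro free_algebra_closed)
      fix a b assume ab: "a \<in> St k" "b \<in> St k"
      show "mat (g * (f * mu k l l)) a b = mat (mu k l l) a b"
        unfolding g_def mult.assoc mat_simps mat_mu_left[OF order.refl l s(1) ls ab(1)]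
          mat_mu_right[OF order.refl l l refl s(1) ab(2)] mat_mu[OF order.refl l l refl ab] using s(2) by simp
    qed
    then have "U l = cls g \<otimes>\<^bsub>A\<^esub> x" using rook_class_hom(1)[OF g free_algebra_closed(2)[OF f(1) c]] x by simp
    then have "U l \<in> K" using smult[OF rook_class_closed[OF g] that(1)] by simp
    then show ?thesis using smult by (auto simp: column_def)
  qed
  then show "K = {\<zero>\<^bsub>regular_module A\<lparr>carrier := column l\<rparr>\<^esub>} \<or> K = carrier (regular_module A\<lparr>carrier := column l\<rparr>)"
    using K(1,2) by auto
qed

text \<open>The columns generate the algebra since the elements \<open>U l\<close> add up to \<open>1\<close>. Their sum is direct since
  right multiplication by \<open>U l\<close> is the identity on column \<open>l\<close> and zero on all others.\<close>

theorem semisimple_rook_algebra: "semisimple_ring A"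
  unfolding semisimple_ring_def semisimple_module_def
proof (intro conjI exI[of _ "column ` St k"] ballI)
  interpret R: ring A by (rule ring_rook_algebra)
  interpret L: left_module A "regular_module A" by (rule left_module_regular[OF ring_rook_algebra])
  let ?R = "regular_module A"
  show "left_module A ?R" by (rule L.left_module_axioms)
  fix N assume "N \<in> column ` St k"
  then obtain l where l: "l \<in> St k" "N = column l" by blast
  show "submodule N A ?R" "simple_module A (?R\<lparr>carrier := N\<rparr>)"
    using column_submodule column_simple l by auto
  let ?S = "submodule_sum A ?R (column ` St k - {N})"
  define Z where "Z = {x \<in> carrier A. x \<otimes>\<^bsub>A\<^esub> U l = \<zero>\<^bsub>A\<^esub>}"
  have "submodule Z A ?R"
    by (rule L.submoduleI) (auto simp: Z_def R.l_distr R.m_assoc U_closed l)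
  moreover have "\<Union>(column ` St k - {N}) \<subseteq> Z"
  proof
    fix x assume "x \<in> \<Union>(column ` St k - {N})"
    then obtain l' where l': "l' \<in> St k" "x \<in> column l'" "l' \<noteq> l" using l(2) by blast
    then show "x \<in> Z" using column_mult_U[OF l'(1) l(1) l'(2)] submoduleD(1)[OF column_submodule[OF l'(1)]]
      by (auto simp: Z_def)
  qed
  ultimately have "?S \<subseteq> Z" unfolding submodule_sum_def by blast
  moreover have "x = \<zero>\<^bsub>A\<^esub>" if "x \<in> N" "x \<in> Z" for x
    using column_mult_U[OF l(1) l(1), of x] that l(2) by (simp add: Z_def)
  moreover have "\<zero>\<^bsub>A\<^esub> \<in> ?S" 
  proof -
    have "\<zero>\<^bsub>A\<^esub> \<in> N'" if "submodule N' A ?R" for N' using submoduleD(2)[OF that] by simp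
    then show ?thesis unfolding submodule_sum_def by blast
  qed
  moreover have "\<zero>\<^bsub>A\<^esub> \<in> N" using submoduleD(2)[OF column_submodule[OF l(1)]] l(2) by simp
  ultimately show "N \<inter> ?S = {\<zero>\<^bsub>?R\<^esub>}" by auto
next
  interpret R: ring A by (rule ring_rook_algebra)
  interpret L: left_module A "regular_module A" by (rule left_module_regular[OF ring_rook_algebra])
  let ?R = "regular_module A"
  have "submodule (carrier A) A ?R" by (rule L.submoduleI) auto
  moreover have "\<Union>(column ` St k) \<subseteq> carrier A"
    using submoduleD(1)[OF column_submodule] by auto
  moreover have "carrier A \<subseteq> N" if N: "submodule N A ?R" "\<Union>(column ` St k) \<subseteq> N" for N
  proof
    fix x assume x: "x \<in> carrier A"
    have "U l \<in> N" if "l \<in> St k" for l using U_column[OF that] that N(2) by blast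
    then have "\<one>\<^bsub>A\<^esub> \<in> N"
      using submoduleD(2,3)[OF N(1)] by (intro partial_sum_closed) auto
    then have "x \<odot>\<^bsub>?R\<^esub> \<one>\<^bsub>A\<^esub> \<in> N" by (rule submoduleD(4)[OF N(1) x])
    then show "x \<in> N" using x by simp
  qed
  ultimately show "submodule_sum A ?R (column ` St k) = carrier ?R"
    unfolding submodule_sum_def by auto
qed

end


section \<open>Failure of semisimplicity when the q-factorial vanishes\<close>

text \<open>The generator \<open>T\<^sub>i\<^sub>+\<^sub>1\<close> of the Hecke algebra on functions of words, acting on the letters at the
  positions \<open>i\<close> and \<open>i + 1\<close> counted from \<open>0\<close>. On words without these positions the default
  value is \<open>q * f w\<close>.\<close>

fun hecke_op :: "complex \<Rightarrow> nat \<Rightarrow> (nat list \<Rightarrow> complex) \<Rightarrow> nat list \<Rightarrow> complex" where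
  "hecke_op q 0 f (a # b # w) =
     (if a < b then f (b # a # w)
      else if b < a then f (b # a # w) + (q - inverse q) * f (a # b # w)
      else q * f (a # b # w))"
| "hecke_op q (Suc i) f (a # w) = hecke_op q i (\<lambda>u. f (a # u)) w"
| "hecke_op q i f w = q * f w"

lemma hecke_op_add: "hecke_op q i (\<lambda>u. f u + g u) w = hecke_op q i f w + hecke_op q i g w"
proof (induction i arbitrary: f g w)
  case 0
  show ?case by (cases "(q, 0::nat, f, w)" rule: hecke_op.cases) (auto simp: algebra_simps)
next
  case (Suc i)
  then show ?case by (cases w) (auto simp: algebra_simps)
qed

lemma hecke_op_scale: "hecke_op q i (\<lambda>u. c * f u) w = c * hecke_op q i f w"
proof (induction i arbitrary: f w)
  case 0
  show ?case by (cases "(q, 0::nat, f, w)" rule: hecke_op.cases) (auto simp: algebra_simps)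
next
  case (Suc i)
  then show ?case by (cases w) (auto simp: algebra_simps)
qed

lemma hecke_op_cong:
  assumes "\<And>u. length u = length w \<Longrightarrow> f u = g u"
  shows "hecke_op q i f w = hecke_op q i g w"
  using assms
proof (induction i arbitrary: f g w)
  case 0
  show ?case
  proof (cases "(q, 0::nat, f, w)" rule: hecke_op.cases)
    case (1 q' f' a b u)
    then show ?thesis using 0[of "a # b # u"] 0[of "b # a # u"] by (cases a b rule: linorder_cases) auto
  qed (use 0[of w] in auto)
next
  case (Suc i)
  show ?case
  proof (cases w)
    case (Cons a u)
    then show ?thesis using Suc.IH[of u "\<lambda>u. f (a # u)" "\<lambda>u. g (a # u)"] Suc.prems by simp
  qed (use Suc.prems[of w] in simp)
qed

lemma hecke_op_Cons: "(\<lambda>w. hecke_op q (Suc i) f (a # w)) = hecke_op q i (\<lambda>u. f (a # u))"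
  by (rule ext) simp

lemma hecke_q: "q \<noteq> 0 \<Longrightarrow> q * (q * x) = (q - inverse q) * (q * x) + x" for q x :: complex
  by (simp add: field_simps)

lemma hecke_op_quadratic:
  assumes "q \<noteq> 0"
  shows "hecke_op q i (hecke_op q i f) w = (q - inverse q) * hecke_op q i f w + f w"
proof (induction i arbitrary: f w)
  case 0
  note qp = hecke_q[OF assms]
  define h where "h = q - inverse q"
  show ?case
  proof (cases "(q, 0::nat, f, w)" rule: hecke_op.cases)
    case (1 q' f' a b u)
    then show ?thesis using qp[of "f (a # b # u)"]
      by (cases a b rule: linorder_cases) (auto simp: h_def[symmetric])
  qed (use qp in auto)
next
  case (Suc i)
  then show ?case using hecke_q[OF assms] by (cases w) (auto simp: hecke_op_Cons)
qed

lemma hecke_op_braid: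
  assumes "q \<noteq> 0" "i + 2 < length w"
  shows "hecke_op q i (hecke_op q (Suc i) (hecke_op q i f)) w = hecke_op q (Suc i) (hecke_op q i (hecke_op q (Suc i) f)) w"
  using assms(2)
proof (induction i arbitrary: f w)
  case 0
  then obtain a b c u where w: "w = a # b # c # u"
    by (auto simp: Suc_le_length_iff less_eq_Suc_le)
  define h where "h = q - inverse q"
  have qp: "q * (q * x) = h * (q * x) + x" for x unfolding h_def by (rule hecke_q[OF assms(1)])
  have qp': "q * (h * x) + x = q * (q * x)" for x using qp[of x] by (simp add: mult.left_commute)
  show ?case unfolding w
  proof (cases "a < b \<or> b < a"; cases "b < c \<or> c < b"; cases "a < c \<or> c < a")
  qed (auto simp: h_def[symmetric] qp distrib_left mult.left_commute[of q h])
next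
  case (Suc i)
  then show ?case by (cases w) (simp_all add: hecke_op_Cons)
qed

lemma hecke_op_far:
  assumes "i + 1 < j"
  shows "hecke_op q i (hecke_op q j f) w = hecke_op q j (hecke_op q i f) w"
  using assms
proof (induction i arbitrary: f w j)
  case 0
  define m where "m = j - 2"
  have j: "j = Suc (Suc m)" using 0 by (simp add: m_def)
  show ?case
  proof (cases "(q, 0::nat, f, w)" rule: hecke_op.cases)
    case (1 q' f' a b u)
    then show ?thesis by (cases a b rule: linorder_cases) (auto simp: j hecke_op_add hecke_op_scale)
  qed (auto simp: j)
next
  case (Suc i)
  then show ?case by (cases w; cases j) (simp_all add: hecke_op_Cons)
qed

definition hecke_gen :: "complex \<Rightarrow> rook_gen \<Rightarrow> (nat list \<Rightarrow> complex) \<Rightarrow> nat list \<Rightarrow> complex" where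
  "hecke_gen q g f = (case g of GenP i \<Rightarrow> 0 | GenT i \<Rightarrow> hecke_op q (i - 1) f)"

text \<open>The q-analogue of the trivial representation, extended by zero to the \<open>P\<^sub>i\<close>.\<close>

definition index_gen :: "complex \<Rightarrow> rook_gen \<Rightarrow> complex \<Rightarrow> complex" where
  "index_gen q g c = (case g of GenP i \<Rightarrow> 0 | GenT i \<Rightarrow> q * c)"

interpretation hecke: free_action fscale "hecke_gen q" for q
proof (intro free_action.intro free_action_axioms.intro)
  show "Modules.module fscale" by (rule module_fscale)
  show "hecke_gen q g (v + w) = hecke_gen q g v + hecke_gen q g w" for g v w
    by (cases g) (auto simp: hecke_gen_def plus_fun_def hecke_op_add)
  show "hecke_gen q g (fscale c v) = fscale c (hecke_gen q g v)" for g c v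
    by (cases g) (auto simp: hecke_gen_def fscale_def hecke_op_scale)
qed

interpretation index: free_action "(*)" "index_gen q" for q
proof (intro free_action.intro free_action_axioms.intro)
  show "Modules.module ((*) :: complex \<Rightarrow> complex \<Rightarrow> complex)"
    by unfold_locales (auto simp: algebra_simps)
qed (auto simp: index_gen_def algebra_simps split: rook_gen.splits)

abbreviation hecke_act where "hecke_act q \<equiv> hecke.act q"

definition index_char :: "complex \<Rightarrow> free_elt \<Rightarrow> complex" where
  "index_char q f = index.act q f 1"

lemma index_char_simps:
  "index_char q (f + g) = index_char q f + index_char q g"
  "index_char q (f - g) = index_char q f - index_char q g"
  "index_char q (f * g) = index_char q f * index_char q g"
  "index_char q (scal c) = c" "index_char q 1 = 1" "index_char q 0 = 0" "index_char q (genT i) = q"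
  "index_char q (genP i) = 0"
proof -
  have "index.act q f c = c * index.act q f 1" for c using index.act_scale[of q f c 1] by simp
  from this[of "index.act q g 1"] show "index_char q (f * g) = index_char q f * index_char q g"
    by (simp only: index_char_def index.act_mult mult.commute)
qed (auto simp: index_char_def index.act_add_left index.act_diff_left index_gen_def)

lemma index_char_rook_ideal:
  assumes "q \<noteq> 0" "f \<in> rook_ideal k q"
  shows "index_char q f = 0"
proof -
  have h: "q * q - ((q - inverse q) * q + 1) = 0" using assms(1) by (simp add: left_diff_distrib)
  have "index.act q f 1 \<in> {0}"
  proof (rule index.rook_ideal_act[OF _ _ _ assms(2)])
    show "index.subspace {0}" by (rule index.subspaceI) auto
    show "index_gen q g v \<in> {0}" if "v \<in> {0}" for g v using that by (simp add: index_gen_def split: rook_gen.splits)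
    show "index.act q r v \<in> {0}" if "r \<in> rook_relations k q" for r v
    proof -
      have "index_char q r = 0"
        using that unfolding rook_relations_def
        by (elim UnE CollectE exE conjE) (simp_all add: index_char_simps h)
      then show ?thesis using index.act_scale[of q r v 1] by (simp add: index_char_def)
    qed
  qed
  then show ?thesis by (simp add: index_char_def)
qed

text \<open>The relations hold at the words of length \<open>k\<close>, which have all the positions concerned.\<close>

lemma hecke_act_rook_ideal:
  assumes "q \<noteq> 0" "f \<in> rook_ideal k q" "length w = k"
  shows "hecke_act q f v w = 0"
proof -
  let ?Z = "{v. \<forall>w. length w = k \<longrightarrow> v w = (0::complex)}"
  have "hecke_act q f v \<in> ?Z"
  proof (rule hecke.rook_ideal_act[OF _ _ _ assms(2)])
    show "hecke.subspace ?Z" by (rule hecke.subspaceI) (auto simp: fscale_apply)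
    show "hecke_gen q g v \<in> ?Z" if "v \<in> ?Z" for g v
    proof (intro CollectI allI impI)
      fix w :: "nat list" assume w: "length w = k"
      have "hecke_op q i v w = hecke_op q i (\<lambda>u. 0 * v u) w" for i
        using that w by (intro hecke_op_cong) auto
      then have "hecke_op q i v w = 0 * hecke_op q i v w" for i by (rule trans[OF _ hecke_op_scale])
      then have z: "hecke_op q i v w = 0" for i by (metis mult_zero_left)
      show "hecke_gen q g v w = 0" using z by (simp add: hecke_gen_def split: rook_gen.splits)
    qed
    show "hecke_act q r v \<in> ?Z" if "r \<in> rook_relations k q" for r v
    proof (intro CollectI allI impI)
      fix w :: "nat list" assume w: "length w = k"
      note simps = hecke.act_add_left hecke.act_diff_left hecke.act_mult hecke_gen_def
      show "hecke_act q r v w = 0"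
        using that unfolding rook_relations_def
      proof (elim UnE CollectE exE conjE)
        fix i assume "r = genT i * genT i - (scal (q - inverse q) * genT i + 1)"
        then have "hecke_act q r v w = hecke_op q (i - 1) (hecke_op q (i - 1) v) w - (fscale (q - inverse q) (hecke_op q (i - 1) v) w + v w)"
          by (simp add: simps)
        then show ?thesis using hecke_op_quadratic[OF assms(1), of "i - 1" v w] by (simp only: fscale_apply) simp
      next
        fix i assume r: "r = genT i * genT (i+1) * genT i - genT (i+1) * genT i * genT (i+1)"
          "1 \<le> i" "i + 2 \<le> k"
        then obtain m where "i = Suc m" by (cases i) auto
        then show ?thesis using hecke_op_braid[OF assms(1), of m w v] r w by (simp add: simps)
      next
        fix i j assume r: "r = genT i * genT j - genT j * genT i" "1 \<le> i" "1 \<le> j" "1 < \<bar>int i - int j\<bar>"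
        then have "i - 1 + 1 < j - 1 \<or> j - 1 + 1 < i - 1" by linarith
        then show ?thesis using hecke_op_far[of "i - 1" "j - 1" q v w] hecke_op_far[of "j - 1" "i - 1" q v w] r(1)
          by (auto simp: simps)
      next
        have z: "hecke_op q j 0 w = 0" for j using hecke_op_scale[of q j 0 0 w] by (simp add: zero_fun_def)
        note simps' = simps z
        {
          fix i j assume "r = genP i * genT j - genT j * genP i"
          then show ?thesis by (simp add: simps')
        next
          fix i j assume "r = genT j * genP i - scal q * genP i"
          then show ?thesis by (simp add: simps') 
        next
          fix i assume "r = genP (i+1) - scal q * (genP i * genT i * genP i - scal (q - inverse q) * genP i)"
          then show ?thesis by (simp add: simps')
        }
      qed (simp_all add: simps)
    qed
  qed
  with assms(3) show ?thesis by blast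
qed

text \<open>The sum of \<open>q\<close> to the number of inversions of \<open>w\<close> times \<open>f w\<close>, over all
  arrangements \<open>w\<close> of the set \<open>B\<close> of \<open>n\<close> letters.\<close>

primrec inv_sum :: "complex \<Rightarrow> nat \<Rightarrow> nat set \<Rightarrow> (nat list \<Rightarrow> complex) \<Rightarrow> complex" where
  "inv_sum q 0 B f = f []"
| "inv_sum q (Suc n) B f = (\<Sum>a\<in>B. q ^ card {b\<in>B. b < a} * inv_sum q n (B - {a}) (\<lambda>w. f (a # w)))"

lemma inv_sum_add: "inv_sum q n B (\<lambda>w. f w + g w) = inv_sum q n B f + inv_sum q n B g"
  by (induction n arbitrary: B f g) (auto simp: distrib_left sum.distrib)

lemma inv_sum_scale: "inv_sum q n B (\<lambda>w. c * f w) = c * inv_sum q n B f"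
proof (induction n arbitrary: B f)
  case (Suc n)
  show ?case
    unfolding inv_sum.simps sum_distrib_left by (rule sum.cong) (simp_all add: Suc mult.left_commute[of _ c])
qed simp

text \<open>For \<open>i = 0\<close> the words \<open>a b u\<close> and \<open>b a u\<close> with \<open>a < b\<close> are paired: the number of inversions
  of the second one exceeds that of the first by one.\<close>

lemma inv_sum_hecke_op:
  assumes "q \<noteq> 0" "i + 1 < n" "finite B"
  shows "inv_sum q n B (hecke_op q i f) = q * inv_sum q n B f"
  using assms(2,3)
proof (induction i arbitrary: n B f)
  case (Suc i)
  then obtain m where "n = Suc m" by (cases n) auto
  with Suc show ?case
    by (auto simp: hecke_op_Cons sum_distrib_left mult.left_commute[of _ q] intro!: sum.cong)
next
  case 0
  then obtain m where n: "n = Suc (Suc m)" by (cases n; cases "n - 1") auto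
  \<comment> \<open>\<open>e a b g\<close> is the sum over the words that begin with \<open>a\<close> and \<open>b\<close>, without the inversions of these two letters.\<close>
  define S where "S = {(a, b). a \<in> B \<and> b \<in> B \<and> a < b}"
  define c where "c a = card {b\<in>B. b < a}" for a
  define e where "e a b g = inv_sum q m (B - {a} - {b}) (\<lambda>w. g (a # b # w))" for a b g
  have fS: "finite S" unfolding S_def by (rule finite_subset[of _ "B \<times> B"]) (use 0 in auto)
  have c2: "card {x\<in>B - {a}. x < b} = (if a < b then c b - 1 else c b)" if "a \<in> B" for a b
  proof -
    have "{x\<in>B - {a}. x < b} = (if a < b then {x\<in>B. x < b} - {a} else {x\<in>B. x < b})" by auto
    then show ?thesis using that 0(2) by (simp add: c_def)
  qed
  have pairs: "inv_sum q n B g =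
    (\<Sum>(a, b)\<in>S. q ^ (c a + c b - 1) * e a b g + q ^ (c a + c b) * e b a g)" for g
  proof -
    have "inv_sum q n B g =
      (\<Sum>a\<in>B. \<Sum>b\<in>B - {a}. q ^ (c a + card {x\<in>B - {a}. x < b}) * e a b g)"
      unfolding n inv_sum.simps sum_distrib_left e_def c_def power_add mult.assoc ..
    also have "\<dots> = (\<Sum>(a, b)\<in>Sigma B (\<lambda>a. B - {a}). q ^ (c a + card {x\<in>B - {a}. x < b}) * e a b g)"
      by (rule sum.Sigma) (use 0 in auto)
    also have "Sigma B (\<lambda>a. B - {a}) = S \<union> prod.swap ` S"
      by (auto simp: S_def image_iff)
    also have "(\<Sum>(a, b)\<in>S \<union> prod.swap ` S. q ^ (c a + card {x\<in>B - {a}. x < b}) * e a b g) =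
      (\<Sum>(a, b)\<in>S. q ^ (c a + card {x\<in>B - {a}. x < b}) * e a b g) +
      (\<Sum>(a, b)\<in>prod.swap ` S. q ^ (c a + card {x\<in>B - {a}. x < b}) * e a b g)"
      by (rule sum.union_disjoint) (use fS in \<open>auto simp: S_def\<close>)
    also have "(\<Sum>(a, b)\<in>prod.swap ` S. q ^ (c a + card {x\<in>B - {a}. x < b}) * e a b g) =
      (\<Sum>(a, b)\<in>S. q ^ (c b + card {x\<in>B - {b}. x < a}) * e b a g)"
      by (subst sum.reindex) (auto simp: case_prod_unfold)
    finally show ?thesis
      unfolding sum.distrib[symmetric]
    proof (elim trans, intro sum.cong)
      fix p assume "p \<in> S"
      then obtain a b where p: "p = (a, b)" "a \<in> B" "b \<in> B" "a < b" by (auto simp: S_def)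
      have "c b > 0" using p 0(2) by (auto simp: c_def card_gt_0_iff)
      then show "(case p of (a, b) \<Rightarrow> q ^ (c a + card {x\<in>B - {a}. x < b}) * e a b g) +
        (case p of (a, b) \<Rightarrow> q ^ (c b + card {x\<in>B - {b}. x < a}) * e b a g) =
        (case p of (a, b) \<Rightarrow> q ^ (c a + c b - 1) * e a b g + q ^ (c a + c b) * e b a g)"
        using p c2[of a b] c2[of b a] by (simp add: add.commute)
    qed simp
  qed
  show ?case
    unfolding pairs sum_distrib_left
  proof (intro sum.cong refl)
    fix p assume "p \<in> S"
    then obtain a b where p: "p = (a, b)" "a \<in> B" "b \<in> B" "a < b" by (auto simp: S_def)
    have "c b > 0" using p 0(2) by (auto simp: c_def card_gt_0_iff)
    then obtain d where d: "c a + c b = Suc d" by (cases "c a + c b") auto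
    have ab: "e a b (hecke_op q 0 f) = e b a f" "e b a (hecke_op q 0 f) = e a b f + (q - inverse q) * e b a f"
    proof -
      have comm: "B - {b} - {a} = B - {a} - {b}" by blast
      show "e a b (hecke_op q 0 f) = e b a f" unfolding e_def comm using p(4) by simp
      have "(\<lambda>w. hecke_op q 0 f (b # a # w)) = (\<lambda>w. f (a # b # w) + (q - inverse q) * f (b # a # w))"
        using p(4) by auto
      then show "e b a (hecke_op q 0 f) = e a b f + (q - inverse q) * e b a f"
        unfolding e_def comm by (simp only: inv_sum_add inv_sum_scale)
    qed
    show "(case p of (a, b) \<Rightarrow> q ^ (c a + c b - 1) * e a b (hecke_op q 0 f) + q ^ (c a + c b) * e b a (hecke_op q 0 f)) =
      q * (case p of (a, b) \<Rightarrow> q ^ (c a + c b - 1) * e a b f + q ^ (c a + c b) * e b a f)"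
    proof -
      have "r * x + q * r * (z + (q - inverse q) * x) = q * (r * z + q * r * x)" for r x z
      proof -
        have qr: "q * r * (inverse q * x) = r * x" using assms(1) by simp
        have "q * r * (z + (q - inverse q) * x) = q * r * z + q * r * q * x - q * r * (inverse q * x)"
          by (simp only: distrib_left left_diff_distrib right_diff_distrib mult.assoc add_diff_eq)
        then show ?thesis unfolding qr by (simp only: distrib_left mult.assoc mult.left_commute) simp
      qed
      then show ?thesis unfolding p(1) prod.case ab d by (simp only: power_Suc diff_Suc_1)
    qed
  qed
qed

text \<open>Moving a letter to the left past a smaller one multiplies an invariant function by \<open>q\<close>.\<close>

lemma hecke_op_invariant_front:
  assumes y: "\<And>i w. i + 1 < n \<Longrightarrow> length w = n \<Longrightarrow> hecke_op q i y w = q * y w"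
    and "length (xs @ a # ys) = n" "\<forall>x\<in>set xs. x < a"
  shows "y (a # xs @ ys) = q ^ length xs * y (xs @ a # ys)"
  using assms
proof (induction xs arbitrary: n y)
  case (Cons x xs)
  obtain m where m: "n = Suc m" "m = length xs + Suc (length ys)" using Cons.prems(2) by simp
  have "y (a # x # xs @ ys) = q * y (x # a # xs @ ys)"
    using Cons.prems(1)[of 0 "x # a # xs @ ys"] Cons.prems(2,3) m by simp
  also have "y (x # a # xs @ ys) = q ^ length xs * y (x # xs @ a # ys)"
  proof (rule Cons.IH[of m "\<lambda>w. y (x # w)"])
    fix i and w :: "nat list" assume "i + 1 < m" "length w = m"
    then show "hecke_op q i (\<lambda>w. y (x # w)) w = q * y (x # w)" using Cons.prems(1)[of "Suc i" "x # w"] m by simp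
  qed (use Cons.prems m in auto)
  finally show ?case by simp
qed simp

text \<open>Choosing \<open>a\<close> as the first letter contributes \<open>q\<^sup>c\<close> to the weight and another \<open>q\<^sup>c\<close> to the value of
  an invariant function, where \<open>c\<close> is the number of smaller letters. Summing \<open>q\<^sup>2\<^sup>c\<close> over the \<open>n\<close>
  letters gives \<open>[n]\<close>.\<close>

lemma inv_sum_invariant:
  assumes "\<And>i w. i + 1 < n \<Longrightarrow> length w = n \<Longrightarrow> hecke_op q i y w = q * y w" "finite B" "card B = n"
  shows "inv_sum q n B y = q_fact q n * y (sorted_list_of_set B)"
  using assms
proof (induction n arbitrary: B y)
  case 0
  then show ?case by (simp add: q_fact_def)
next
  case (Suc n)
  let ?l = "sorted_list_of_set B"
  have head: "inv_sum q n (B - {a}) (\<lambda>w. y (a # w)) = q_fact q n * q ^ card {b\<in>B. b < a} * y ?l"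
    if a: "a \<in> B" for a
  proof -
    have "a \<in> set ?l" using a Suc.prems by simp
    then obtain xs ys where l: "?l = xs @ a # ys" by (meson split_list)
    have s: "sorted_wrt (<) (xs @ a # ys)" using strict_sorted_list_of_set[of B] l by simp
    have B: "B = set (xs @ a # ys)" using Suc.prems(2) l by (metis set_sorted_list_of_set)
    have "distinct (xs @ a # ys)" using s by (simp add: strict_sorted_iff)
    then have "B - {a} = set (xs @ ys)" by (auto simp: B)
    moreover have "sorted_wrt (<) (xs @ ys)" using s by (auto simp: sorted_wrt_append)
    ultimately have "sorted_list_of_set (B - {a}) = xs @ ys"
      by (simp only: strict_sorted_iff sorted_list_of_set.idem_if_sorted_distinct)
    moreover have "{b\<in>B. b < a} = set xs" using s by (auto simp: B sorted_wrt_append)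
    moreover have "card (set xs) = length xs" using s
      by (intro distinct_card) (auto simp: sorted_wrt_append strict_sorted_iff)
    moreover have len: "length (xs @ a # ys) = Suc n" using Suc.prems l by (metis length_sorted_list_of_set)
    moreover have "y (a # xs @ ys) = q ^ length xs * y (xs @ a # ys)"
      using s by (intro hecke_op_invariant_front[OF Suc.prems(1) len]) (auto simp: sorted_wrt_append)
    moreover have "inv_sum q n (B - {a}) (\<lambda>w. y (a # w)) = q_fact q n * y (a # sorted_list_of_set (B - {a}))"
    proof (rule Suc.IH[of "\<lambda>w. y (a # w)"])
      fix i and w :: "nat list" assume "i + 1 < n" "length w = n"
      then show "hecke_op q i (\<lambda>w. y (a # w)) w = q * y (a # w)" using Suc.prems(1)[of "Suc i" "a # w"] by simp
    qed (use Suc.prems a in auto)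
    ultimately show ?thesis using l by simp
  qed
  have bij: "bij_betw (\<lambda>a. card {b\<in>B. b < a}) B {..<Suc n}"
  proof -
    have less: "card {b\<in>B. b < a} < card {b\<in>B. b < a'}" if "a \<in> B" "a < a'" for a a'
      using that Suc.prems(2) by (intro psubset_card_mono) auto
    have inj: "inj_on (\<lambda>a. card {b\<in>B. b < a}) B"
      by (rule linorder_inj_onI') (use less in fastforce)
    have "card {b\<in>B. b < a} < card B" if "a \<in> B" for a
      using that Suc.prems(2) by (intro psubset_card_mono) auto
    then have "(\<lambda>a. card {b\<in>B. b < a}) ` B \<subseteq> {..<Suc n}" using Suc.prems(3) by auto
    then have "(\<lambda>a. card {b\<in>B. b < a}) ` B = {..<Suc n}"
      by (rule card_subset_eq[rotated]) (simp_all add: card_image[OF inj] Suc.prems(3))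
    with inj show ?thesis by (simp add: bij_betw_def)
  qed
  have "inv_sum q (Suc n) B y = (\<Sum>a\<in>B. (q ^ 2) ^ card {b\<in>B. b < a}) * q_fact q n * y ?l"
    unfolding inv_sum.simps sum_distrib_right
    by (rule sum.cong) (simp_all add: head power_mult_distrib power2_eq_square)
  also have "(\<Sum>a\<in>B. (q ^ 2) ^ card {b\<in>B. b < a}) = (\<Sum>j<Suc n. (q ^ 2) ^ j)"
    by (rule sum.reindex_bij_betw[OF bij])
  also have "\<dots> = q_int q (Suc n)" by (simp only: q_int_def power_mult)
  finally show ?case by (simp add: q_fact_def)
qed

text \<open>A single summand, a power of \<open>q\<close>, remains.\<close>

lemma inv_sum_point:
  assumes "q \<noteq> 0" "distinct l"
  shows "inv_sum q (length l) (set l) (\<lambda>w. if w = l then 1 else 0) \<noteq> 0"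
  using assms(2)
proof (induction l)
  case (Cons a l)
  define e where "e b = inv_sum q (length l) (set (a # l) - {b}) (\<lambda>w. if b # w = a # l then 1 else 0)" for b
  have "e b = 0" if "b \<noteq> a" for b
    using that inv_sum_scale[of q "length l" "set (a # l) - {b}" 0 "\<lambda>_. 0"] by (simp add: e_def)
  moreover have "e a \<noteq> 0"
  proof -
    have "set (a # l) - {a} = set l" using Cons.prems by auto
    then show ?thesis using Cons by (simp add: e_def)
  qed
  moreover have "inv_sum q (length (a # l)) (set (a # l)) (\<lambda>w. if w = a # l then 1 else 0) =
    (\<Sum>b\<in>set (a # l). if b = a then q ^ card {c\<in>set (a # l). c < a} * e a else 0)"
    unfolding list.size add_Suc_right add_0_right inv_sum.simps e_def[symmetric]
    by (intro sum.cong) (simp_all add: calculation(1))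
  ultimately show ?case using assms(1) by simp
qed simp

lemma inv_sum_act:
  assumes q: "q \<noteq> 0" and f: "f \<in> carrier (free_algebra k)"
  shows "inv_sum q k {..<k} (hecke_act q f v) = index_char q f * inv_sum q k {..<k} v"
  using f
proof (induction rule: free_algebra_induct)
  case (single w c)
  have word: "inv_sum q k {..<k} (word_act (hecke_gen q) u v) = word_act (index_gen q) u 1 * inv_sum q k {..<k} v"
    if "set u \<subseteq> rook_gens k" for u
    using that
  proof (induction u)
    case (Cons g u)
    show ?case
    proof (cases g)
      case (GenP i)
      have "inv_sum q k {..<k} (\<lambda>_. 0) = 0" using inv_sum_scale[of q k "{..<k}" 0 "\<lambda>_. 0"] by simp
      then show ?thesis by (simp add: GenP hecke_gen_def index_gen_def zero_fun_def)
    next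
      case (GenT i)
      then have "i - 1 + 1 < k" using Cons.prems by (auto simp: rook_gens_def)
      then show ?thesis using Cons by (simp add: GenT hecke_gen_def index_gen_def inv_sum_hecke_op[OF q])
    qed
  qed simp
  show ?case
    by (simp add: hecke.act_single index_char_def index.act_single word[OF single])
      (simp add: fscale_def inv_sum_scale word[OF single])
next
  case (add f g)
  have "inv_sum q k {..<k} (hecke_act q (f + g) v) = inv_sum q k {..<k} (hecke_act q f v) + inv_sum q k {..<k} (hecke_act q g v)"
    by (simp add: hecke.act_add_left plus_fun_def inv_sum_add)
  with add show ?case by (simp add: index_char_simps distrib_right)
qed

text \<open>The kernel \<open>K\<close> of the index character is a maximal left ideal. One of the simple summands is not contained
  in it, hence meets it in zero, and so contains an element \<open>n\<close> on which the algebra acts by the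
  character. Its action on functions of words is then evaluated by \<open>inv_sum\<close> in two ways.\<close>

lemma semisimple_imp_q_fact:
  assumes q: "q \<noteq> 0" and semi: "semisimple_ring (rook_algebra k q)"
  shows "q_fact q k \<noteq> 0"
proof
  assume zero: "q_fact q k = 0"
  let ?A = "rook_algebra k q"
  let ?R = "regular_module ?A"
  interpret A: ring ?A by (rule ring_rook_algebra)
  interpret L: left_module ?A ?R by (rule left_module_regular[OF ring_rook_algebra])
  obtain F where F: "\<And>N. N \<in> F \<Longrightarrow> submodule N ?A ?R" "\<And>N. N \<in> F \<Longrightarrow> simple_module ?A (?R\<lparr>carrier := N\<rparr>)"
    "submodule_sum ?A ?R F = carrier ?A"
    using semi unfolding semisimple_ring_def semisimple_module_def by auto
  define K where "K = {rook_class k q f | f. f \<in> carrier (free_algebra k) \<and> index_char q f = 0}"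
  have K_iff: "rook_class k q f \<in> K \<longleftrightarrow> index_char q f = 0" if f: "f \<in> carrier (free_algebra k)" for f
  proof
    assume "rook_class k q f \<in> K"
    then obtain g where g: "g \<in> carrier (free_algebra k)" "index_char q g = 0" "rook_class k q f = rook_class k q g"
      by (auto simp: K_def)
    then have "index_char q (f - g) = 0" using rook_class_eq_iff[OF f g(1)] index_char_rook_ideal[OF q] by blast
    then show "index_char q f = 0" using g(2) by (simp add: index_char_simps)
  qed (use f in \<open>auto simp: K_def\<close>)
  have K: "submodule K ?A ?R"
  proof (rule L.submoduleI)
    show "K \<subseteq> carrier ?R" by (auto simp: K_def intro: rook_class_closed)
    show "\<zero>\<^bsub>?R\<^esub> \<in> K" using K_iff[OF free_algebra_zero] by (simp add: rook_class_zero index_char_simps)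
    fix x assume "x \<in> K"
    then obtain f where f: "f \<in> carrier (free_algebra k)" "index_char q f = 0" "x = rook_class k q f" by (auto simp: K_def)
    {
      fix y assume "y \<in> K"
      then obtain g where g: "g \<in> carrier (free_algebra k)" "index_char q g = 0" "y = rook_class k q g" by (auto simp: K_def)
      show "x \<oplus>\<^bsub>?R\<^esub> y \<in> K"
        using f g K_iff[of "f + g"] by (simp add: rook_class_hom index_char_simps free_algebra_closed)
    }
    fix a assume "a \<in> carrier ?A"
    then obtain g where g: "g \<in> carrier (free_algebra k)" "a = rook_class k q g" using rook_class_surj by blast
    show "a \<odot>\<^bsub>?R\<^esub> x \<in> K"
      using f g K_iff[of "g * f"] by (simp add: rook_class_hom index_char_simps free_algebra_closed)
  qed
  have "\<one>\<^bsub>?A\<^esub> \<notin> K" using K_iff[OF one_closed] by (simp add: rook_class_one index_char_simps)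
  obtain N where N: "N \<in> F" "\<not> N \<subseteq> K"
  proof (rule ccontr)
    assume "\<not> thesis"
    then have "\<Union>F \<subseteq> K" using that by blast
    then have "submodule_sum ?A ?R F \<subseteq> K" using K unfolding submodule_sum_def by blast
    with F(3) \<open>\<one>\<^bsub>?A\<^esub> \<notin> K\<close> show False by auto
  qed
  note sN = submoduleD[OF F(1)[OF N(1)]]
  have smult: "a \<otimes>\<^bsub>?A\<^esub> x \<in> N" if "a \<in> carrier ?A" "x \<in> N" for a x using sN(4)[OF that] by simp
  have NK: "N \<inter> K = {\<zero>\<^bsub>?A\<^esub>}"
  proof -
    interpret N: left_module ?A "?R\<lparr>carrier := N\<rparr>"
      by (rule left_module_restrict[OF L.left_module_axioms F(1)[OF N(1)]])
    have "submodule (N \<inter> K) ?A (?R\<lparr>carrier := N\<rparr>)"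
      by (rule N.submoduleI) (use sN submoduleD[OF K] in auto)
    then have "N \<inter> K = {\<zero>\<^bsub>?A\<^esub>} \<or> N \<inter> K = N"
      using F(2)[OF N(1)] unfolding simple_module_def by auto
    with N(2) show ?thesis by blast
  qed
  obtain x where x: "x \<in> N" "x \<notin> K" using N(2) by blast
  have "x \<in> carrier ?A" using sN(1) x(1) by auto
  then obtain g where g: "g \<in> carrier (free_algebra k)" "x = rook_class k q g" using rook_class_surj by blast
  have g0: "index_char q g \<noteq> 0" using K_iff[OF g(1)] x g(2) by simp
  define n where "n = scal (inverse (index_char q g)) * g"
  have n: "n \<in> carrier (free_algebra k)" "index_char q n = 1"
    unfolding n_def index_char_simps using g0 by (auto intro: free_algebra_closed scal_closed g(1))
  have nN: "rook_class k q n \<in> N"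
    using smult[OF rook_class_closed[OF scal_closed] x(1)] g by (simp add: n_def rook_class_hom scal_closed)
  have inv: "genT i * n - scal q * n \<in> rook_ideal k q" if i: "1 \<le> i" "i < k" for i
  proof -
    have c: "genT i - scal q \<in> carrier (free_algebra k)" using i by (intro free_algebra_closed genT_closed scal_closed)
    have "rook_class k q ((genT i - scal q) * n) \<in> N"
      using smult[OF rook_class_closed[OF c] nN] n(1) c by (simp add: rook_class_hom)
    moreover have "rook_class k q ((genT i - scal q) * n) \<in> K"
      using K_iff[OF free_algebra_closed(2)[OF c n(1)]] by (simp add: index_char_simps)
    ultimately have "rook_class k q ((genT i - scal q) * n) = \<zero>\<^bsub>?A\<^esub>" using NK by blast
    then show ?thesis
      using rook_class_eq_zero_iff[OF free_algebra_closed(2)[OF c n(1)]] by (simp add: left_diff_distrib)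
  qed
  define v :: "nat list \<Rightarrow> complex" where "v = (\<lambda>w. if w = [0..<k] then 1 else 0)"
  have "inv_sum q k {..<k} v \<noteq> 0"
    using inv_sum_point[OF q, of "[0..<k]"] by (simp add: v_def lessThan_atLeast0)
  moreover have "inv_sum q k {..<k} (hecke_act q n v) = 0"
  proof -
    have "hecke_op q i (hecke_act q n v) w = q * hecke_act q n v w" if "i + 1 < k" "length w = k" for i w
      using hecke_act_rook_ideal[OF q inv[of "Suc i"] that(2), of v] that(1)
      by (simp add: hecke.act_diff_left hecke.act_mult hecke_gen_def) (simp add: fscale_apply)
    then have "inv_sum q k {..<k} (hecke_act q n v) = q_fact q k * hecke_act q n v (sorted_list_of_set {..<k})"
      by (rule inv_sum_invariant) auto
    then show ?thesis by (simp only: zero mult_zero_left)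
  qed
  ultimately show False using inv_sum_act[OF q n(1), of v] n(2) by simp
qed

theorem corollary2p21:
  fixes k :: nat and q :: complex
  assumes "q \<noteq> 0" and "1 \<le> k"
  shows "(semisimple_ring (rook_algebra k q) \<longleftrightarrow> q_fact q k \<noteq> 0) \<and>
    (semisimple_ring (rook_algebra k q) \<longrightarrow>
      (\<exists>act. (\<forall>\<mu>\<in>A_hat k. seminormal_action k q \<mu> (act \<mu>) \<and>
                 simple_module (rook_algebra k q) (tableau_module \<mu> (act \<mu>))) \<and>
             (\<forall>\<mu>\<in>A_hat k. \<forall>\<nu>\<in>A_hat k.
                 module_isomorphic (rook_algebra k q)
                   (tableau_module \<mu> (act \<mu>)) (tableau_module \<nu> (act \<nu>)) \<longrightarrow> \<mu> = \<nu>) \<and>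
             (\<forall>M :: (free_elt set, 'v) module. simple_module (rook_algebra k q) M \<longrightarrow>
                 (\<exists>\<mu>\<in>A_hat k. module_isomorphic (rook_algebra k q) M (tableau_module \<mu> (act \<mu>))))))"
proof (intro conjI impI iffI)
  have sn: "seminormal k q" if "q_fact q k \<noteq> 0"
    using assms(1) that by (rule seminormal.intro)
  show "q_fact q k \<noteq> 0" if "semisimple_ring (rook_algebra k q)"
    using semisimple_imp_q_fact[OF assms(1) that] .
  show "semisimple_ring (rook_algebra k q)" if "q_fact q k \<noteq> 0"
    using seminormal.semisimple_rook_algebra[OF sn[OF that]] .
  assume "semisimple_ring (rook_algebra k q)"
  then interpret seminormal k q using sn semisimple_imp_q_fact[OF assms(1)] by blast
  show "\<exists>act. (\<forall>\<mu>\<in>A_hat k. seminormal_action k q \<mu> (act \<mu>) \<and>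
                 simple_module (rook_algebra k q) (tableau_module \<mu> (act \<mu>))) \<and>
             (\<forall>\<mu>\<in>A_hat k. \<forall>\<nu>\<in>A_hat k.
                 module_isomorphic (rook_algebra k q)
                   (tableau_module \<mu> (act \<mu>)) (tableau_module \<nu> (act \<nu>)) \<longrightarrow> \<mu> = \<nu>) \<and>
             (\<forall>M :: (free_elt set, 'v) module. simple_module (rook_algebra k q) M \<longrightarrow>
                 (\<exists>\<mu>\<in>A_hat k. module_isomorphic (rook_algebra k q) M (tableau_module \<mu> (act \<mu>))))"
    using seminormal_action_tab_act simple_module_H H_isomorphic_eq simple_module_isomorphic_H
    by (intro exI[of _ tab_act] conjI ballI allI impI) blast+
qed

end
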